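(* Let $G$ be a finite group and $A$ a separable infinite dimensional simple unital finite $C^*$-algebra. Suppose that the action $\alpha:G\curvearrowright A$ has the tracial Rokhlin property. Then the map $(1_{C(G)}\otimes\mathrm{id}_A)\rtimes G$ from $A\rtimes_\alpha G$ to $(C(G)\otimes A)\rtimes_{\sigma\otimes\alpha}G$ is a tracially sequentially-split $*$-homomorphism.
   Context: For a $C^*$-algebra $A$, let $A^+$ be its cone of positive elements (including $0$), $c_0(\mathbb{N},A)=\{(a_n)_n: \lim_n\|a_n\|=0\}$, $l^\infty(\mathbb{N},A)=\{(a_n)_n: (\|a_n\|)_n \text{ bounded}\}$, and $A_\infty=l^\infty(\mathbb{N},A)/c_0(\mathbb{N},A)$. $A$ is embedded in $A_\infty$ as constant sequences, and $A_\infty\cap A'$ is the central sequence algebra. Let $A_\infty^{++}$ be the set of $x\in A_\infty^+$, $x=[(x_n)_n]$, for which there is no strictly increasing sequence $(k_n)$ of natural numbers with $\lim_n x_{k_n}=0$. Definition. Let $A,B$ be separable $C^*$-algebras with $A$ unital. A $*$-homomorphism $\phi:A\to B$ is tracially sequentially-split if for every nonzero $z\in A_\infty^{++}$ there exist a $*$-homomorphism $\psi:B\to A_\infty$ and a nonzero projection $g\in A_\infty\cap A'$ such that (1) $\psi(\phi(a))=ag$ for each $a\in A$, and (2) $1_{A_\infty}-g$ is Murray-von Neumann equivalent in $A_\infty$ to a projection in the hereditary $C^*$-subalgebra $\overline{zA_\infty z}$. Definition. Let $G$ be a finite group and $A$ an infinite dimensional simple separable unital finite $C^*$-algebra. An action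 $\alpha:G\curvearrowright A$ has the tracial Rokhlin property if for every finite set $F\subset A$, every $\epsilon>0$ and every nonzero positive $x\in A$ there exist mutually orthogonal projections $\{e_g\}_{g\in G}$ in $A$ such that (1) $\|\alpha_g(e_h)-e_{gh}\|\le\epsilon$ for all $g,h\in G$; (2) $\|e_ga-ae_g\|\le\epsilon$ for all $g\in G$, $a\in F$; (3) with $e=\sum_ge_g$, $1-e$ is Murray-von Neumann equivalent to a projection in $\overline{xAx}$. $\sigma:G\curvearrowright C(G)$ is the canonical translation action. $1_{C(G)}\otimes\mathrm{id}_A:(A,\alpha)\to(C(G)\otimes A,\sigma\otimes\alpha)$ is the equivariant map $a\mapsto 1_{C(G)}\otimes a$. For an equivariant $*$-homomorphism $\phi:(A,\alpha)\to(B,\beta)$, $\phi\rtimes G:A\rtimes_\alpha G\to B\rtimes_\beta G$ is the natural extension $\sum_g a_gu_g\mapsto\sum_g\phi(a_g)u_g$, where $u_g$ denote the implementing unitaries. *)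

theory Defs
  imports "HOL-Analysis.Analysis" "HOL-Algebra.Algebra"
begin

section \<open>C*-algebras\<close>

text \<open>
  C*-algebras are carrier-based, because crossed products and sequence algebras depend on terms.
  The field \<open>one\<close> inherited from rings is meaningful only under the additional
  assumption \<^prop>\<open>Group.monoid A\<close>, which says that \<open>A\<close> is unital.
\<close>

record 'a cstar = "(complex, 'a) module" +
  star :: "'a \<Rightarrow> 'a"
  nrm :: "'a \<Rightarrow> real"

definition complex_ring :: "complex ring" where
  "complex_ring = \<lparr>carrier = UNIV, mult = (*), one = 1, ring.zero = 0, add = (+)\<rparr>"

text \<open>The value 0 off the carrier is needed since \<^locale>\<open>Metric_space\<close> asks for
  a symmetric and nonnegative function on the whole type.\<close>

definition cstar_dist :: "('a, 'm) cstar_scheme \<Rightarrow> 'a \<Rightarrow> 'a \<Rightarrow> real" where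
  "cstar_dist A x y = (if x \<in> carrier A \<and> y \<in> carrier A then nrm A (x \<ominus>\<^bsub>A\<^esub> y) else 0)"

definition cstar_topology :: "('a, 'm) cstar_scheme \<Rightarrow> 'a topology" where
  "cstar_topology A = Metric_space.mtopology (carrier A) (cstar_dist A)"

locale pre_cstar_algebra = module complex_ring A for A :: "('a, 'm) cstar_scheme" (structure) +
  assumes mult_closed: "\<lbrakk>x \<in> carrier A; y \<in> carrier A\<rbrakk> \<Longrightarrow> x \<otimes> y \<in> carrier A"
    and mult_assoc: "\<lbrakk>x \<in> carrier A; y \<in> carrier A; z \<in> carrier A\<rbrakk>
      \<Longrightarrow> (x \<otimes> y) \<otimes> z = x \<otimes> (y \<otimes> z)"
    and distr_right: "\<lbrakk>x \<in> carrier A; y \<in> carrier A; z \<in> carrier A\<rbrakk>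
      \<Longrightarrow> (x \<oplus> y) \<otimes> z = x \<otimes> z \<oplus> y \<otimes> z"
    and distr_left: "\<lbrakk>x \<in> carrier A; y \<in> carrier A; z \<in> carrier A\<rbrakk>
      \<Longrightarrow> z \<otimes> (x \<oplus> y) = z \<otimes> x \<oplus> z \<otimes> y"
    and smult_mult_left: "\<lbrakk>x \<in> carrier A; y \<in> carrier A\<rbrakk>
      \<Longrightarrow> (c \<odot> x) \<otimes> y = c \<odot> (x \<otimes> y)"
    and smult_mult_right: "\<lbrakk>x \<in> carrier A; y \<in> carrier A\<rbrakk>
      \<Longrightarrow> x \<otimes> (c \<odot> y) = c \<odot> (x \<otimes> y)"
    and star_closed: "x \<in> carrier A \<Longrightarrow> star A x \<in> carrier A"
    and star_star: "x \<in> carrier A \<Longrightarrow> star A (star A x) = x"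
    and star_add: "\<lbrakk>x \<in> carrier A; y \<in> carrier A\<rbrakk>
      \<Longrightarrow> star A (x \<oplus> y) = star A x \<oplus> star A y"
    and star_smult: "x \<in> carrier A \<Longrightarrow> star A (c \<odot> x) = cnj c \<odot> star A x"
    and star_mult: "\<lbrakk>x \<in> carrier A; y \<in> carrier A\<rbrakk>
      \<Longrightarrow> star A (x \<otimes> y) = star A y \<otimes> star A x"
    and nrm_nonneg: "x \<in> carrier A \<Longrightarrow> 0 \<le> nrm A x"
    and nrm_eq_0: "x \<in> carrier A \<Longrightarrow> nrm A x = 0 \<longleftrightarrow> x = \<zero>"
    and nrm_triangle: "\<lbrakk>x \<in> carrier A; y \<in> carrier A\<rbrakk>
      \<Longrightarrow> nrm A (x \<oplus> y) \<le> nrm A x + nrm A y"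
    and nrm_smult: "x \<in> carrier A \<Longrightarrow> nrm A (c \<odot> x) = cmod c * nrm A x"
    and nrm_mult: "\<lbrakk>x \<in> carrier A; y \<in> carrier A\<rbrakk>
      \<Longrightarrow> nrm A (x \<otimes> y) \<le> nrm A x * nrm A y"
    and nrm_star_mult: "x \<in> carrier A \<Longrightarrow> nrm A (star A x \<otimes> x) = (nrm A x)\<^sup>2"

locale cstar_algebra = pre_cstar_algebra +
  assumes complete: "Metric_space.mcomplete (carrier A) (cstar_dist A)"

definition separable_cstar :: "('a, 'm) cstar_scheme \<Rightarrow> bool" where
  "separable_cstar A \<longleftrightarrow> separable_space (cstar_topology A)"

definition infinite_dimensional_cstar :: "('a, 'm) cstar_scheme \<Rightarrow> bool" where
  "infinite_dimensional_cstar A \<longleftrightarrow>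
     \<not> (\<exists>F. finite F \<and> F \<subseteq> carrier A \<and>
          (\<forall>x\<in>carrier A. \<exists>c. x = (\<Oplus>\<^bsub>A\<^esub>f\<in>F. c f \<odot>\<^bsub>A\<^esub> f)))"

definition closed_two_sided_ideal :: "'a set \<Rightarrow> ('a, 'm) cstar_scheme \<Rightarrow> bool" where
  "closed_two_sided_ideal I A \<longleftrightarrow>
     submodule I complex_ring A \<and>
     (\<forall>x\<in>I. \<forall>a\<in>carrier A. a \<otimes>\<^bsub>A\<^esub> x \<in> I \<and> x \<otimes>\<^bsub>A\<^esub> a \<in> I) \<and>
     closedin (cstar_topology A) I"

definition simple_cstar :: "('a, 'm) cstar_scheme \<Rightarrow> bool" where
  "simple_cstar A \<longleftrightarrow>
     carrier A \<noteq> {\<zero>\<^bsub>A\<^esub>} \<and>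
     (\<forall>I. closed_two_sided_ideal I A \<longrightarrow> I = {\<zero>\<^bsub>A\<^esub>} \<or> I = carrier A)"

definition positive_cone :: "('a, 'm) cstar_scheme \<Rightarrow> 'a set" where
  "positive_cone A = {star A b \<otimes>\<^bsub>A\<^esub> b | b. b \<in> carrier A}"

definition projections :: "('a, 'm) cstar_scheme \<Rightarrow> 'a set" where
  "projections A = {p \<in> carrier A. p \<otimes>\<^bsub>A\<^esub> p = p \<and> star A p = p}"

definition mvn_equivalent :: "('a, 'm) cstar_scheme \<Rightarrow> 'a \<Rightarrow> 'a \<Rightarrow> bool" where
  "mvn_equivalent A p q \<longleftrightarrow>
     (\<exists>v\<in>carrier A. star A v \<otimes>\<^bsub>A\<^esub> v = p \<and> v \<otimes>\<^bsub>A\<^esub> star A v = q)"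

text \<open>A unital C*-algebra is finite if its unit is a finite projection, that is, not
  equivalent to a proper subprojection (every projection is below the unit).\<close>

definition finite_cstar :: "('a, 'm) cstar_scheme \<Rightarrow> bool" where
  "finite_cstar A \<longleftrightarrow>
     (\<forall>p\<in>projections A. mvn_equivalent A \<one>\<^bsub>A\<^esub> p \<longrightarrow> p = \<one>\<^bsub>A\<^esub>)"

definition hereditary_subalgebra :: "('a, 'm) cstar_scheme \<Rightarrow> 'a \<Rightarrow> 'a set" where
  "hereditary_subalgebra A z =
     Abstract_Topology.closure_of (cstar_topology A) {z \<otimes>\<^bsub>A\<^esub> a \<otimes>\<^bsub>A\<^esub> z | a. a \<in> carrier A}"

definition star_hom :: "('a, 'm) cstar_scheme \<Rightarrow> ('b, 'n) cstar_scheme \<Rightarrow> ('a \<Rightarrow> 'b) set" where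
  "star_hom A B = {\<phi>. \<phi> \<in> hom A B \<and> \<phi> \<in> hom (add_monoid A) (add_monoid B) \<and>
     (\<forall>c. \<forall>x\<in>carrier A. \<phi> (c \<odot>\<^bsub>A\<^esub> x) = c \<odot>\<^bsub>B\<^esub> \<phi> x) \<and>
     (\<forall>x\<in>carrier A. \<phi> (star A x) = star B (\<phi> x))}"


section \<open>The sequence algebra\<close>

definition linf :: "('a, 'm) cstar_scheme \<Rightarrow> (nat \<Rightarrow> 'a) cstar" where
  "linf A = \<lparr>carrier = {x. (\<forall>n. x n \<in> carrier A) \<and> bdd_above (range (\<lambda>n. nrm A (x n)))},
     mult = (\<lambda>x y n. x n \<otimes>\<^bsub>A\<^esub> y n), one = (\<lambda>n. \<one>\<^bsub>A\<^esub>),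
     ring.zero = (\<lambda>n. \<zero>\<^bsub>A\<^esub>), add = (\<lambda>x y n. x n \<oplus>\<^bsub>A\<^esub> y n),
     smult = (\<lambda>c x n. c \<odot>\<^bsub>A\<^esub> x n),
     star = (\<lambda>x n. star A (x n)), nrm = (\<lambda>x. SUP n. nrm A (x n))\<rparr>"

definition c0 :: "('a, 'm) cstar_scheme \<Rightarrow> (nat \<Rightarrow> 'a) set" where
  "c0 A = {x. (\<forall>n. x n \<in> carrier A) \<and> (\<lambda>n. nrm A (x n)) \<longlonglongrightarrow> 0}"

text \<open>The quotient by a closed two-sided ideal. The ring operations are those of
  \<^const>\<open>FactRing\<close>; the remaining operations follow the same pattern, and the
  norm is the quotient norm.\<close>

definition cstar_quotient :: "('a, 'm) cstar_scheme \<Rightarrow> 'a set \<Rightarrow> 'a set cstar" where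
  "cstar_quotient A I = module.extend
     (ring.extend (A Quot I) (module.fields (\<lambda>c S. \<Union>x\<in>S. I +>\<^bsub>A\<^esub> (c \<odot>\<^bsub>A\<^esub> x))))
     (cstar.fields (\<lambda>S. \<Union>x\<in>S. I +>\<^bsub>A\<^esub> star A x) (\<lambda>S. INF x\<in>S. nrm A x))"

definition seq_alg :: "('a, 'm) cstar_scheme \<Rightarrow> (nat \<Rightarrow> 'a) set cstar" where
  "seq_alg A = cstar_quotient (linf A) (c0 A)"

definition seq_class :: "('a, 'm) cstar_scheme \<Rightarrow> (nat \<Rightarrow> 'a) \<Rightarrow> (nat \<Rightarrow> 'a) set" where
  "seq_class A x = c0 A +>\<^bsub>linf A\<^esub> x"

definition const_embed :: "('a, 'm) cstar_scheme \<Rightarrow> 'a \<Rightarrow> (nat \<Rightarrow> 'a) set" where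
  "const_embed A a = seq_class A (\<lambda>n. a)"

definition central_seq_alg :: "('a, 'm) cstar_scheme \<Rightarrow> (nat \<Rightarrow> 'a) set set" where
  "central_seq_alg A = {g \<in> carrier (seq_alg A). \<forall>a\<in>carrier A.
     const_embed A a \<otimes>\<^bsub>seq_alg A\<^esub> g = g \<otimes>\<^bsub>seq_alg A\<^esub> const_embed A a}"

definition seq_alg_pp :: "('a, 'm) cstar_scheme \<Rightarrow> (nat \<Rightarrow> 'a) set set" where
  "seq_alg_pp A = {S \<in> positive_cone (seq_alg A).
     \<exists>x\<in>carrier (linf A). S = seq_class A x \<and>
       \<not> (\<exists>k. strict_mono k \<and> (\<lambda>n. nrm A (x (k n))) \<longlonglongrightarrow> 0)}"


section \<open>Tracially sequentially-split homomorphisms\<close>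

definition tracially_sequentially_split ::
    "('a, 'm) cstar_scheme \<Rightarrow> ('b, 'n) cstar_scheme \<Rightarrow> ('a \<Rightarrow> 'b) \<Rightarrow> bool" where
  "tracially_sequentially_split A B \<phi> \<longleftrightarrow>
     cstar_algebra A \<and> separable_cstar A \<and> Group.monoid A \<and>
     cstar_algebra B \<and> separable_cstar B \<and>
     \<phi> \<in> star_hom A B \<and>
     (\<forall>z\<in>seq_alg_pp A. z \<noteq> \<zero>\<^bsub>seq_alg A\<^esub> \<longrightarrow>
        (\<exists>\<psi>\<in>star_hom B (seq_alg A).
         \<exists>g\<in>projections (seq_alg A) \<inter> central_seq_alg A.
           g \<noteq> \<zero>\<^bsub>seq_alg A\<^esub> \<and>
           (\<forall>a\<in>carrier A. \<psi> (\<phi> a) = const_embed A a \<otimes>\<^bsub>seq_alg A\<^esub> g) \<and>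
           (\<exists>q\<in>projections (seq_alg A) \<inter> hereditary_subalgebra (seq_alg A) z.
              mvn_equivalent (seq_alg A) (\<one>\<^bsub>seq_alg A\<^esub> \<ominus>\<^bsub>seq_alg A\<^esub> g) q)))"


section \<open>Group actions and the tracial Rokhlin property\<close>

text \<open>As in \<^locale>\<open>group_action\<close>, the maps \<open>\<alpha> g\<close> are extensional on the carrier.
  They are bijective star-homomorphisms, i.e. automorphisms.\<close>

definition cstar_action ::
    "('g, 'k) monoid_scheme \<Rightarrow> ('a, 'm) cstar_scheme \<Rightarrow> ('g \<Rightarrow> 'a \<Rightarrow> 'a) \<Rightarrow> bool" where
  "cstar_action G A \<alpha> \<longleftrightarrow>
     group_action G (carrier A) \<alpha> \<and> (\<forall>g\<in>carrier G. \<alpha> g \<in> star_hom A A)"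

definition tracial_rokhlin_property ::
    "('g, 'k) monoid_scheme \<Rightarrow> ('a, 'm) cstar_scheme \<Rightarrow> ('g \<Rightarrow> 'a \<Rightarrow> 'a) \<Rightarrow> bool" where
  "tracial_rokhlin_property G A \<alpha> \<longleftrightarrow>
     (\<forall>F \<epsilon> x. finite F \<and> F \<subseteq> carrier A \<and> \<epsilon> > 0 \<and>
        x \<in> positive_cone A \<and> x \<noteq> \<zero>\<^bsub>A\<^esub> \<longrightarrow>
        (\<exists>e. (\<forall>g\<in>carrier G. e g \<in> projections A) \<and>
           (\<forall>g\<in>carrier G. \<forall>h\<in>carrier G. g \<noteq> h \<longrightarrow> e g \<otimes>\<^bsub>A\<^esub> e h = \<zero>\<^bsub>A\<^esub>) \<and>
           (\<forall>g\<in>carrier G. \<forall>h\<in>carrier G.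
              nrm A (\<alpha> g (e h) \<ominus>\<^bsub>A\<^esub> e (g \<otimes>\<^bsub>G\<^esub> h)) \<le> \<epsilon>) \<and>
           (\<forall>g\<in>carrier G. \<forall>a\<in>F.
              nrm A (e g \<otimes>\<^bsub>A\<^esub> a \<ominus>\<^bsub>A\<^esub> a \<otimes>\<^bsub>A\<^esub> e g) \<le> \<epsilon>) \<and>
           (\<exists>q\<in>projections A \<inter> hereditary_subalgebra A x.
              mvn_equivalent A (\<one>\<^bsub>A\<^esub> \<ominus>\<^bsub>A\<^esub> (\<Oplus>\<^bsub>A\<^esub>g\<in>carrier G. e g)) q)))"


section \<open>Functions on a finite set and translation\<close>

definition fun_cstar :: "'x set \<Rightarrow> ('a, 'm) cstar_scheme \<Rightarrow> ('x \<Rightarrow> 'a) cstar" where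
  "fun_cstar S A = \<lparr>carrier = S \<rightarrow>\<^sub>E carrier A,
     mult = (\<lambda>f h. \<lambda>x\<in>S. f x \<otimes>\<^bsub>A\<^esub> h x), one = (\<lambda>x\<in>S. \<one>\<^bsub>A\<^esub>),
     ring.zero = (\<lambda>x\<in>S. \<zero>\<^bsub>A\<^esub>), add = (\<lambda>f h. \<lambda>x\<in>S. f x \<oplus>\<^bsub>A\<^esub> h x),
     smult = (\<lambda>c f. \<lambda>x\<in>S. c \<odot>\<^bsub>A\<^esub> f x),
     star = (\<lambda>f. \<lambda>x\<in>S. star A (f x)), nrm = (\<lambda>f. SUP x\<in>S. nrm A (f x))\<rparr>"

definition complex_cstar :: "complex cstar" where
  "complex_cstar = \<lparr>carrier = UNIV, mult = (*), one = 1, ring.zero = 0, add = (+),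
     smult = (*), star = cnj, nrm = cmod\<rparr>"

definition CG :: "('g, 'k) monoid_scheme \<Rightarrow> ('g \<Rightarrow> complex) cstar" where
  "CG G = fun_cstar (carrier G) complex_cstar"

definition translation :: "('g, 'k) monoid_scheme \<Rightarrow> 'g \<Rightarrow> ('g \<Rightarrow> complex) \<Rightarrow> ('g \<Rightarrow> complex)" where
  "translation G g = (\<lambda>f\<in>carrier (CG G). \<lambda>h\<in>carrier G. f (inv\<^bsub>G\<^esub> g \<otimes>\<^bsub>G\<^esub> h))"

text \<open>For a finite group, the tensor product of \<^term>\<open>CG G\<close> with \<open>A\<close> is the algebra
  of functions from the group to \<open>A\<close>, with the elementary tensors below. That this is
  a tensor product and that the diagonal action acts as it should on elementary tensors is
  checked at the end of the theory.\<close>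

definition CG_tensor :: "('g, 'k) monoid_scheme \<Rightarrow> ('a, 'm) cstar_scheme \<Rightarrow> ('g \<Rightarrow> 'a) cstar" where
  "CG_tensor G A = fun_cstar (carrier G) A"

definition elem_tensor ::
    "('g, 'k) monoid_scheme \<Rightarrow> ('a, 'm) cstar_scheme \<Rightarrow> ('g \<Rightarrow> complex) \<Rightarrow> 'a \<Rightarrow> ('g \<Rightarrow> 'a)" where
  "elem_tensor G A f a = (\<lambda>h\<in>carrier G. f h \<odot>\<^bsub>A\<^esub> a)"

definition tensor_action ::
    "('g, 'k) monoid_scheme \<Rightarrow> ('a, 'm) cstar_scheme \<Rightarrow> ('g \<Rightarrow> 'a \<Rightarrow> 'a) \<Rightarrow>
     'g \<Rightarrow> ('g \<Rightarrow> 'a) \<Rightarrow> ('g \<Rightarrow> 'a)" where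
  "tensor_action G A \<alpha> g =
     (\<lambda>F\<in>carrier (CG_tensor G A). \<lambda>h\<in>carrier G. \<alpha> g (F (inv\<^bsub>G\<^esub> g \<otimes>\<^bsub>G\<^esub> h)))"

definition unit_tensor ::
    "('g, 'k) monoid_scheme \<Rightarrow> ('a, 'm) cstar_scheme \<Rightarrow> 'a \<Rightarrow> ('g \<Rightarrow> 'a)" where
  "unit_tensor G A a = elem_tensor G A \<one>\<^bsub>CG G\<^esub> a"


section \<open>Crossed products by finite groups\<close>

text \<open>
  A function \<open>x\<close> from the group to \<open>A\<close> stands for the sum of all \<open>x g u\<^sub>g\<close>. The
  operations are determined by the rules \<open>u\<^sub>g a = \<alpha>\<^sub>g(a) u\<^sub>g\<close>,
  \<open>u\<^sub>g u\<^sub>h = u\<^sub>g\<^sub>h\<close> and by \<open>u\<^sub>g\<close> being unitary. The convolution algebra carries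
  the l1-norm, and the crossed product is its enveloping C*-algebra: the norm is the largest
  C*-seminorm dominated by the l1-norm. As the group is finite, no completion is needed
  and the full and the reduced crossed product coincide.
\<close>

definition l1_crossed_product ::
    "('g, 'k) monoid_scheme \<Rightarrow> ('a, 'm) cstar_scheme \<Rightarrow> ('g \<Rightarrow> 'a \<Rightarrow> 'a) \<Rightarrow> ('g \<Rightarrow> 'a) cstar" where
  "l1_crossed_product G A \<alpha> = \<lparr>carrier = carrier G \<rightarrow>\<^sub>E carrier A,
     mult = (\<lambda>x y. \<lambda>s\<in>carrier G.
       \<Oplus>\<^bsub>A\<^esub>t\<in>carrier G. x t \<otimes>\<^bsub>A\<^esub> \<alpha> t (y (inv\<^bsub>G\<^esub> t \<otimes>\<^bsub>G\<^esub> s))),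
     one = (\<lambda>s\<in>carrier G. if s = \<one>\<^bsub>G\<^esub> then \<one>\<^bsub>A\<^esub> else \<zero>\<^bsub>A\<^esub>),
     ring.zero = (\<lambda>s\<in>carrier G. \<zero>\<^bsub>A\<^esub>), add = (\<lambda>x y. \<lambda>s\<in>carrier G. x s \<oplus>\<^bsub>A\<^esub> y s),
     smult = (\<lambda>c x. \<lambda>s\<in>carrier G. c \<odot>\<^bsub>A\<^esub> x s),
     star = (\<lambda>x. \<lambda>s\<in>carrier G. \<alpha> s (star A (x (inv\<^bsub>G\<^esub> s)))),
     nrm = (\<lambda>x. \<Sum>s\<in>carrier G. nrm A (x s))\<rparr>"

definition cstar_seminorm :: "('a, 'm) cstar_scheme \<Rightarrow> ('a \<Rightarrow> real) \<Rightarrow> bool" where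
  "cstar_seminorm A p \<longleftrightarrow>
     (\<forall>x\<in>carrier A. 0 \<le> p x \<and> p (star A x \<otimes>\<^bsub>A\<^esub> x) = (p x)\<^sup>2) \<and>
     (\<forall>c. \<forall>x\<in>carrier A. p (c \<odot>\<^bsub>A\<^esub> x) = cmod c * p x) \<and>
     (\<forall>x\<in>carrier A. \<forall>y\<in>carrier A.
        p (x \<oplus>\<^bsub>A\<^esub> y) \<le> p x + p y \<and> p (x \<otimes>\<^bsub>A\<^esub> y) \<le> p x * p y)"

definition enveloping_norm :: "('a, 'm) cstar_scheme \<Rightarrow> 'a \<Rightarrow> real" where
  "enveloping_norm A x =
     (SUP p\<in>{p. cstar_seminorm A p \<and> (\<forall>y\<in>carrier A. p y \<le> nrm A y)}. p x)"

definition crossed_product ::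
    "('g, 'k) monoid_scheme \<Rightarrow> ('a, 'm) cstar_scheme \<Rightarrow> ('g \<Rightarrow> 'a \<Rightarrow> 'a) \<Rightarrow> ('g \<Rightarrow> 'a) cstar" where
  "crossed_product G A \<alpha> =
     (l1_crossed_product G A \<alpha>)\<lparr>nrm := enveloping_norm (l1_crossed_product G A \<alpha>)\<rparr>"

definition crossed_hom :: "('g, 'k) monoid_scheme \<Rightarrow> ('a \<Rightarrow> 'b) \<Rightarrow> ('g \<Rightarrow> 'a) \<Rightarrow> ('g \<Rightarrow> 'b)" where
  "crossed_hom G \<phi> x = (\<lambda>g\<in>carrier G. \<phi> (x g))"


section \<open>Consistency of the constructions\<close>

lemma complex_ring_simps [simp]:
  "carrier complex_ring = UNIV" "mult complex_ring = (*)" "one complex_ring = 1"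
  "ring.zero complex_ring = 0" "add complex_ring = (+)"
  by (simp_all add: complex_ring_def)

lemma cring_complex_ring: "cring complex_ring"
proof (rule cringI)
  show "abelian_group complex_ring"
    by (rule abelian_groupI) (auto intro: exI[of _ "- x" for x] simp: algebra_simps add_eq_0_iff)
  show "Group.comm_monoid complex_ring"
    by (rule comm_monoidI) (auto simp: algebra_simps)
qed (auto simp: algebra_simps)

lemma a_inv_complex_ring [simp]: "\<ominus>\<^bsub>complex_ring\<^esub> c = - c"
proof -
  interpret cring complex_ring by (rule cring_complex_ring)
  have "(- c) \<oplus>\<^bsub>complex_ring\<^esub> c = \<zero>\<^bsub>complex_ring\<^esub>" by simp
  then show ?thesis by (intro minus_equality) auto
qed

context pre_cstar_algebra
begin

lemma uminus_eq_smult: "x \<in> carrier A \<Longrightarrow> \<ominus> x = (-1) \<odot> x"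
  using smult_l_minus[of "1" x] smult_one[of x] by simp

lemma nrm_uminus: "x \<in> carrier A \<Longrightarrow> nrm A (\<ominus> x) = nrm A x"
  by (simp add: uminus_eq_smult nrm_smult)

lemma nrm_minus_commute:
  assumes "x \<in> carrier A" "y \<in> carrier A"
  shows "nrm A (x \<ominus> y) = nrm A (y \<ominus> x)"
proof -
  have "\<ominus> (x \<ominus> y) = y \<ominus> x"
    using assms by (simp add: a_minus_def minus_add a_comm)
  then show ?thesis using nrm_uminus[of "x \<ominus> y"] assms by simp
qed

lemma metric_space: "Metric_space (carrier A) (cstar_dist A)"
proof
  fix x y z assume xyz: "x \<in> carrier A" "y \<in> carrier A" "z \<in> carrier A"
  have "x \<ominus> z = (x \<ominus> y) \<oplus> (y \<ominus> z)"
    using xyz by (simp add: a_minus_def a_assoc r_neg1)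
  then show "cstar_dist A x z \<le> cstar_dist A x y + cstar_dist A y z"
    using xyz nrm_triangle[of "x \<ominus> y" "y \<ominus> z"] by (simp add: cstar_dist_def)
next
  fix x y assume "x \<in> carrier A" "y \<in> carrier A"
  then show "cstar_dist A x y = 0 \<longleftrightarrow> x = y"
    by (simp add: cstar_dist_def nrm_eq_0 a_minus_def)
      (metis M.add.inv_closed M.add.inv_inv M.minus_equality M.r_neg)
qed (auto simp: cstar_dist_def nrm_nonneg nrm_minus_commute)

lemma mcomplete_iff:
  "Metric_space.mcomplete (carrier A) (cstar_dist A) \<longleftrightarrow>
     (\<forall>\<sigma>::nat \<Rightarrow> 'a. (\<forall>n. \<sigma> n \<in> carrier A) \<and>
        (\<forall>\<epsilon>>0. \<exists>N. \<forall>n\<ge>N. \<forall>m\<ge>N. nrm A (\<sigma> n \<ominus> \<sigma> m) < \<epsilon>) \<longrightarrow>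
        (\<exists>x\<in>carrier A. \<forall>\<epsilon>>0. \<exists>N. \<forall>n\<ge>N. nrm A (\<sigma> n \<ominus> x) < \<epsilon>))"
proof -
  interpret M: Metric_space "carrier A" "cstar_dist A" by (rule metric_space)
  have C: "M.MCauchy \<sigma> \<longleftrightarrow> (\<forall>n. \<sigma> n \<in> carrier A) \<and>
        (\<forall>\<epsilon>>0. \<exists>N. \<forall>n\<ge>N. \<forall>m\<ge>N. nrm A (\<sigma> n \<ominus> \<sigma> m) < \<epsilon>)" for \<sigma>
    unfolding M.MCauchy_def cstar_dist_def by (auto simp: image_subset_iff)
  have L: "limitin M.mtopology \<sigma> x sequentially \<longleftrightarrow>
      x \<in> carrier A \<and> (\<forall>\<epsilon>>0. \<exists>N. \<forall>n\<ge>N. nrm A (\<sigma> n \<ominus> x) < \<epsilon>)"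
    if "\<forall>n. \<sigma> n \<in> carrier A" for \<sigma> x
    using that unfolding M.limit_metric_sequentially cstar_dist_def by auto
  have K: "(M.MCauchy \<sigma> \<longrightarrow> (\<exists>x. limitin M.mtopology \<sigma> x sequentially)) \<longleftrightarrow>
     ((\<forall>n. \<sigma> n \<in> carrier A) \<and>
        (\<forall>\<epsilon>>0. \<exists>N. \<forall>n\<ge>N. \<forall>m\<ge>N. nrm A (\<sigma> n \<ominus> \<sigma> m) < \<epsilon>) \<longrightarrow>
        (\<exists>x\<in>carrier A. \<forall>\<epsilon>>0. \<exists>N. \<forall>n\<ge>N. nrm A (\<sigma> n \<ominus> x) < \<epsilon>))" for \<sigma>
  proof (cases "\<forall>n. \<sigma> n \<in> carrier A")
    case True
    show ?thesis unfolding C L[OF True] Bex_def using True by simp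
  qed (simp only: C; simp)
  show ?thesis unfolding M.mcomplete_def by (rule iff_allI, rule K)
qed

end

lemma cstar_algebra_complex: "cstar_algebra complex_cstar"
proof -
  have "pre_cstar_algebra complex_cstar"
  proof (intro pre_cstar_algebra.intro moduleI cring_complex_ring pre_cstar_algebra_axioms.intro)
    show "abelian_group complex_cstar"
      by (rule abelian_groupI)
        (auto simp: complex_cstar_def algebra_simps add_eq_0_iff intro: exI[of _ "- x" for x])
  qed (auto simp: complex_cstar_def algebra_simps norm_mult power2_eq_square
         intro: norm_triangle_ineq)
  then interpret pre_cstar_algebra complex_cstar .
  have m: "x \<ominus>\<^bsub>complex_cstar\<^esub> y = x - y" for x y
  proof -
    have "\<ominus>\<^bsub>complex_cstar\<^esub> y = - y"
      by (subst uminus_eq_smult) (simp_all add: complex_cstar_def)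
    then show ?thesis by (simp add: a_minus_def) (simp add: complex_cstar_def)
  qed
  show ?thesis
  proof
    show "Metric_space.mcomplete (carrier complex_cstar) (cstar_dist complex_cstar)"
      unfolding mcomplete_iff m
    proof (intro allI impI, elim conjE)
      fix \<sigma> :: "nat \<Rightarrow> complex"
      assume "\<forall>\<epsilon>>0. \<exists>N. \<forall>n\<ge>N. \<forall>m\<ge>N. nrm complex_cstar (\<sigma> n - \<sigma> m) < \<epsilon>"
      then have "Cauchy \<sigma>"
        by (intro CauchyI) (auto simp: complex_cstar_def)
      then obtain x where "\<sigma> \<longlonglongrightarrow> x"
        by (auto simp: Cauchy_convergent_iff convergent_def)
      then show "\<exists>x\<in>carrier complex_cstar.
          \<forall>\<epsilon>>0. \<exists>N. \<forall>n\<ge>N. nrm complex_cstar (\<sigma> n - x) < \<epsilon>"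
        by (intro bexI[of _ x]) (auto simp: LIMSEQ_iff complex_cstar_def)
    qed
  qed
qed

lemma fun_cstar_simps [simp]:
  "carrier (fun_cstar S A) = S \<rightarrow>\<^sub>E carrier A"
  "f \<otimes>\<^bsub>fun_cstar S A\<^esub> h = (\<lambda>x\<in>S. f x \<otimes>\<^bsub>A\<^esub> h x)"
  "\<one>\<^bsub>fun_cstar S A\<^esub> = (\<lambda>x\<in>S. \<one>\<^bsub>A\<^esub>)"
  "\<zero>\<^bsub>fun_cstar S A\<^esub> = (\<lambda>x\<in>S. \<zero>\<^bsub>A\<^esub>)"
  "f \<oplus>\<^bsub>fun_cstar S A\<^esub> h = (\<lambda>x\<in>S. f x \<oplus>\<^bsub>A\<^esub> h x)"
  "c \<odot>\<^bsub>fun_cstar S A\<^esub> f = (\<lambda>x\<in>S. c \<odot>\<^bsub>A\<^esub> f x)"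
  "star (fun_cstar S A) f = (\<lambda>x\<in>S. star A (f x))"
  "nrm (fun_cstar S A) f = (SUP x\<in>S. nrm A (f x))"
  by (simp_all add: fun_cstar_def)

lemma funcset_extensional_app:
  "f \<in> S \<rightarrow>\<^sub>E T \<Longrightarrow> x \<in> S \<Longrightarrow> f x \<in> T"
  "f \<in> S \<rightarrow>\<^sub>E T \<Longrightarrow> x \<notin> S \<Longrightarrow> f x = undefined"
  by auto

lemma SUP_finite_less_iff:
  fixes f :: "'a \<Rightarrow> real"
  assumes "finite S" "S \<noteq> {}"
  shows "(SUP x\<in>S. f x) < c \<longleftrightarrow> (\<forall>x\<in>S. f x < c)"
  using assms by (simp add: cSup_eq_Max)

lemma SUP_finite_upper:
  fixes f :: "'a \<Rightarrow> real"
  assumes "finite S" "x \<in> S"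
  shows "f x \<le> (SUP x\<in>S. f x)"
  using assms by (intro cSUP_upper) auto

lemma SUP_finite_attained:
  fixes f :: "'a \<Rightarrow> real"
  assumes "finite S" "S \<noteq> {}"
  obtains x where "x \<in> S" "(SUP x\<in>S. f x) = f x"
proof -
  have "(SUP x\<in>S. f x) \<in> f ` S"
    using assms by (simp add: cSup_eq_Max)
  then show ?thesis using that by blast
qed

lemma (in cstar_algebra) cstar_algebra_fun:
  fixes S :: "'x set"
  assumes S: "finite S" "S \<noteq> {}"
  shows "cstar_algebra (fun_cstar S A)"
proof -
  have "pre_cstar_algebra (fun_cstar S A)"
  proof (intro pre_cstar_algebra.intro moduleI cring_complex_ring pre_cstar_algebra_axioms.intro)
    show "abelian_group (fun_cstar S A)"
    proof (rule abelian_groupI)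
      fix f assume f: "f \<in> carrier (fun_cstar S A)"
      show "\<exists>h\<in>carrier (fun_cstar S A). h \<oplus>\<^bsub>fun_cstar S A\<^esub> f = \<zero>\<^bsub>fun_cstar S A\<^esub>"
        using f PiE_mem[OF f[simplified]]
        by (intro bexI[of _ "\<lambda>x\<in>S. \<ominus> f x"]) (auto simp: M.l_neg intro!: restrict_ext)
    qed (auto simp: fun_eq_iff restrict_def funcset_extensional_app[where T = "carrier A"] M.a_ac)
  next
    fix f :: "'x \<Rightarrow> 'a" assume f: "f \<in> carrier (fun_cstar S A)"
    obtain x where x: "x \<in> S" "(SUP x\<in>S. nrm A (f x)) = nrm A (f x)"
      using SUP_finite_attained[OF S] .
    have fS: "f x \<in> carrier A" if "x \<in> S" for x using f that by auto
    show "0 \<le> nrm (fun_cstar S A) f" using x fS nrm_nonneg by simp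
    show "nrm (fun_cstar S A) f = 0 \<longleftrightarrow> f = \<zero>\<^bsub>fun_cstar S A\<^esub>"
    proof
      assume 0: "nrm (fun_cstar S A) f = 0"
      have "f y = \<zero>" if "y \<in> S" for y
        using SUP_finite_upper[OF S(1) that, of "\<lambda>x. nrm A (f x)"] 0 fS[OF that]
          nrm_nonneg nrm_eq_0 by fastforce
      then show "f = \<zero>\<^bsub>fun_cstar S A\<^esub>"
        using f by (auto intro!: extensionalityI[of _ S] simp: PiE_def)
    next
      assume "f = \<zero>\<^bsub>fun_cstar S A\<^esub>"
      then have "f x = \<zero>" using x by simp
      then show "nrm (fun_cstar S A) f = 0" using x nrm_eq_0[of "f x"] by simp
    qed
    show "nrm (fun_cstar S A) (c \<odot>\<^bsub>fun_cstar S A\<^esub> f) = cmod c * nrm (fun_cstar S A) f" for c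
    proof -
      have "(SUP x\<in>S. nrm A (c \<odot> f x)) = cmod c * nrm A (f x)"
        using x(1) SUP_finite_upper[OF S(1), of _ "\<lambda>x. nrm A (f x)"] fS
        by (intro cSup_eq_maximum) (auto simp: nrm_smult x(2) intro!: mult_left_mono)
      then show ?thesis using x by (simp cong: SUP_cong_simp)
    qed
    show "nrm (fun_cstar S A) (star (fun_cstar S A) f \<otimes>\<^bsub>fun_cstar S A\<^esub> f)
        = (nrm (fun_cstar S A) f)\<^sup>2"
    proof -
      have "(SUP x\<in>S. nrm A (star A (f x) \<otimes> f x)) = (nrm A (f x))\<^sup>2"
        using x(1) SUP_finite_upper[OF S(1), of _ "\<lambda>x. nrm A (f x)"] fS nrm_nonneg
        by (intro cSup_eq_maximum) (auto simp: nrm_star_mult x(2) intro!: power_mono)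
      then show ?thesis using x by (simp cong: SUP_cong_simp)
    qed
  next
    fix f h :: "'x \<Rightarrow> 'a"
    assume fh: "f \<in> carrier (fun_cstar S A)" "h \<in> carrier (fun_cstar S A)"
    have c: "f x \<in> carrier A" "h x \<in> carrier A" if "x \<in> S" for x using fh that by auto
    have le: "nrm A (f x) \<le> (SUP x\<in>S. nrm A (f x))" "nrm A (h x) \<le> (SUP x\<in>S. nrm A (h x))"
      if "x \<in> S" for x
      using that S by (auto intro!: SUP_finite_upper)
    show "nrm (fun_cstar S A) (f \<oplus>\<^bsub>fun_cstar S A\<^esub> h)
        \<le> nrm (fun_cstar S A) f + nrm (fun_cstar S A) h"
      using S(2) by (auto intro!: cSUP_least order.trans[OF nrm_triangle] add_mono le c)
    show "nrm (fun_cstar S A) (f \<otimes>\<^bsub>fun_cstar S A\<^esub> h)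
        \<le> nrm (fun_cstar S A) f * nrm (fun_cstar S A) h"
      using S(2) by (auto intro!: cSUP_least order.trans[OF nrm_mult] mult_mono le c
          nrm_nonneg order.trans[OF nrm_nonneg le(1)])
  qed (auto simp: fun_eq_iff restrict_def funcset_extensional_app[where T = "carrier A"]
        smult_l_distr[simplified] smult_r_distr smult_assoc1[simplified] smult_one[simplified] mult_closed mult_assoc distr_left distr_right
        smult_mult_left smult_mult_right star_closed star_star star_add star_smult star_mult)
  then interpret F: pre_cstar_algebra "fun_cstar S A" .
  have m: "f \<ominus>\<^bsub>fun_cstar S A\<^esub> h = (\<lambda>x\<in>S. f x \<ominus> h x)"
    if "f \<in> carrier (fun_cstar S A)" "h \<in> carrier (fun_cstar S A)" for f h
  proof -
    have "f \<ominus>\<^bsub>fun_cstar S A\<^esub> h = f \<oplus>\<^bsub>fun_cstar S A\<^esub> ((-1) \<odot>\<^bsub>fun_cstar S A\<^esub> h)"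
      by (simp only: a_minus_def F.uminus_eq_smult[OF that(2)])
    also have "\<dots> = (\<lambda>x\<in>S. f x \<oplus> (-1) \<odot> h x)"
      by (auto intro!: restrict_ext)
    also have "\<dots> = (\<lambda>x\<in>S. f x \<ominus> h x)"
      using that by (auto simp: a_minus_def uminus_eq_smult
          funcset_extensional_app[where T = "carrier A"] intro!: restrict_ext)
    finally show ?thesis .
  qed
  show ?thesis
  proof
    show "Metric_space.mcomplete (carrier (fun_cstar S A)) (cstar_dist (fun_cstar S A))"
      unfolding F.mcomplete_iff
    proof (intro allI impI, elim conjE)
      fix \<sigma> :: "nat \<Rightarrow> 'x \<Rightarrow> 'a"
      assume \<sigma>: "\<forall>n. \<sigma> n \<in> carrier (fun_cstar S A)"
        and cau: "\<forall>\<epsilon>>0. \<exists>N. \<forall>n\<ge>N. \<forall>m\<ge>N.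
          nrm (fun_cstar S A) (\<sigma> n \<ominus>\<^bsub>fun_cstar S A\<^esub> \<sigma> m) < \<epsilon>"
      have \<sigma>S: "\<sigma> n x \<in> carrier A" if "x \<in> S" for n x using \<sigma> that by auto
      have lt: "nrm (fun_cstar S A) (f \<ominus>\<^bsub>fun_cstar S A\<^esub> h) < \<epsilon>
          \<longleftrightarrow> (\<forall>x\<in>S. nrm A (f x \<ominus> h x) < \<epsilon>)"
        if "f \<in> carrier (fun_cstar S A)" "h \<in> carrier (fun_cstar S A)" for f h \<epsilon>
        using SUP_finite_less_iff[OF S] by (simp add: m[OF that])
      have "\<exists>y\<in>carrier A. \<forall>\<epsilon>>0. \<exists>N. \<forall>n\<ge>N. nrm A (\<sigma> n x \<ominus> y) < \<epsilon>" if x: "x \<in> S" for x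
      proof -
        have "\<exists>N. \<forall>n\<ge>N. \<forall>m\<ge>N. nrm A (\<sigma> n x \<ominus> \<sigma> m x) < \<epsilon>" if \<epsilon>: "\<epsilon> > 0" for \<epsilon>
        proof -
          obtain N where N: "\<And>n m. n \<ge> N \<Longrightarrow> m \<ge> N \<Longrightarrow>
              nrm (fun_cstar S A) (\<sigma> n \<ominus>\<^bsub>fun_cstar S A\<^esub> \<sigma> m) < \<epsilon>"
            using cau \<epsilon> by blast
          have "nrm A (\<sigma> n x \<ominus> \<sigma> m x) < \<epsilon>" if "n \<ge> N" "m \<ge> N" for n m
            using N[OF that] lt[OF \<sigma>[rule_format] \<sigma>[rule_format]] x by blast
          then show ?thesis by blast
        qed
        then show ?thesis
          using complete[unfolded mcomplete_iff, THEN spec, of "\<lambda>n. \<sigma> n x"] \<sigma>S[OF x] by blast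
      qed
      then obtain y where y: "\<And>x. x \<in> S \<Longrightarrow> y x \<in> carrier A"
        and lim: "\<And>x \<epsilon>. x \<in> S \<Longrightarrow> \<epsilon> > 0 \<Longrightarrow> \<exists>N. \<forall>n\<ge>N. nrm A (\<sigma> n x \<ominus> y x) < \<epsilon>"
        by metis
      have yc: "restrict y S \<in> carrier (fun_cstar S A)" using y by auto
      have "\<exists>N. \<forall>n\<ge>N. nrm (fun_cstar S A) (\<sigma> n \<ominus>\<^bsub>fun_cstar S A\<^esub> restrict y S) < \<epsilon>"
        if "\<epsilon> > 0" for \<epsilon>
      proof -
        have "\<forall>x\<in>S. \<forall>\<^sub>F n in sequentially. nrm A (\<sigma> n x \<ominus> y x) < \<epsilon>"
          using lim that by (auto simp: eventually_sequentially)
        then have "\<forall>\<^sub>F n in sequentially. \<forall>x\<in>S. nrm A (\<sigma> n x \<ominus> y x) < \<epsilon>"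
          using S(1) by (simp add: eventually_ball_finite)
        then obtain N where "\<And>n x. n \<ge> N \<Longrightarrow> x \<in> S \<Longrightarrow> nrm A (\<sigma> n x \<ominus> restrict y S x) < \<epsilon>"
          by (auto simp: eventually_sequentially)
        then show ?thesis
          using lt[OF \<sigma>[rule_format] yc] by blast
      qed
      then show "\<exists>f\<in>carrier (fun_cstar S A). \<forall>\<epsilon>>0. \<exists>N. \<forall>n\<ge>N.
          nrm (fun_cstar S A) (\<sigma> n \<ominus>\<^bsub>fun_cstar S A\<^esub> f) < \<epsilon>"
        using yc by blast
    qed
  qed
qed


context cstar_algebra
begin

lemma finsum_fun_cstar_app:
  fixes S :: "'x set"
  assumes "finite S" "x \<in> S" "F \<in> T \<rightarrow> carrier (fun_cstar S A)"
  shows "(\<Oplus>\<^bsub>fun_cstar S A\<^esub>t\<in>T. F t) x = (\<Oplus>t\<in>T. F t x)"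
proof -
  interpret F: cstar_algebra "fun_cstar S A"
    using assms by (intro cstar_algebra_fun) auto
  from assms(3) show ?thesis
  proof (induction T rule: infinite_finite_induct)
    case (insert t T)
    then have "F t x \<in> carrier A" "\<forall>t\<in>T. F t x \<in> carrier A"
      using assms(2) by (auto simp: Pi_iff)
    then show ?case
      using insert assms(2)
      by (simp add: F.M.finsum_insert M.finsum_insert Pi_iff del: fun_cstar_simps(1))
  qed (use assms(2) in \<open>auto simp: F.M.finsum_infinite M.finsum_infinite\<close>)
qed

context
  fixes G :: "('g, 'k) monoid_scheme"
  assumes G: "group G" "finite (carrier G)"
begin

lemma CG_simps: 
  "carrier (CG G) = carrier G \<rightarrow>\<^sub>E UNIV"
  "f \<oplus>\<^bsub>CG G\<^esub> f' = (\<lambda>h\<in>carrier G. f h + f' h)"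
  "f \<otimes>\<^bsub>CG G\<^esub> f' = (\<lambda>h\<in>carrier G. f h * f' h)"
  "\<one>\<^bsub>CG G\<^esub> = (\<lambda>h\<in>carrier G. 1)"
  "c \<odot>\<^bsub>CG G\<^esub> f = (\<lambda>h\<in>carrier G. c * f h)"
  "star (CG G) f = (\<lambda>h\<in>carrier G. cnj (f h))"
  "nrm (CG G) f = (SUP h\<in>carrier G. cmod (f h))"
  by (simp_all add: CG_def complex_cstar_def cong: restrict_cong)

lemma elem_tensor:
  assumes "a \<in> carrier A" "b \<in> carrier A"
  shows "elem_tensor G A f a \<in> carrier (CG_tensor G A)"
    and "elem_tensor G A (f \<oplus>\<^bsub>CG G\<^esub> f') a =
      elem_tensor G A f a \<oplus>\<^bsub>CG_tensor G A\<^esub> elem_tensor G A f' a"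
    and "elem_tensor G A f (a \<oplus> b) =
      elem_tensor G A f a \<oplus>\<^bsub>CG_tensor G A\<^esub> elem_tensor G A f b"
    and "elem_tensor G A (c \<odot>\<^bsub>CG G\<^esub> f) a = c \<odot>\<^bsub>CG_tensor G A\<^esub> elem_tensor G A f a"
    and "elem_tensor G A f (c \<odot> a) = c \<odot>\<^bsub>CG_tensor G A\<^esub> elem_tensor G A f a"
    and "elem_tensor G A f a \<otimes>\<^bsub>CG_tensor G A\<^esub> elem_tensor G A f' b =
      elem_tensor G A (f \<otimes>\<^bsub>CG G\<^esub> f') (a \<otimes> b)"
    and "star (CG_tensor G A) (elem_tensor G A f a) =
      elem_tensor G A (star (CG G) f) (star A a)"
proof -
  have comm: "c \<odot> (d \<odot> x) = d \<odot> (c \<odot> x)" if "x \<in> carrier A" for c d x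
    using that smult_assoc1[simplified] by (metis mult.commute)
  show "elem_tensor G A f a \<otimes>\<^bsub>CG_tensor G A\<^esub> elem_tensor G A f' b =
      elem_tensor G A (f \<otimes>\<^bsub>CG G\<^esub> f') (a \<otimes> b)"
    using assms by (auto simp: elem_tensor_def CG_tensor_def CG_simps smult_assoc1[simplified]
        smult_mult_left smult_mult_right mult_closed comm intro!: restrict_ext)
  from assms show "elem_tensor G A f (c \<odot> a) = c \<odot>\<^bsub>CG_tensor G A\<^esub> elem_tensor G A f a"
    by (auto simp: elem_tensor_def CG_tensor_def comm intro!: restrict_ext)
qed (use assms in \<open>auto simp: elem_tensor_def CG_tensor_def CG_simps smult_l_distr[simplified]
      smult_r_distr smult_assoc1[simplified] smult_mult_left smult_mult_right mult_closed
      star_smult star_closed intro!: restrict_ext\<close>)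

lemma nrm_elem_tensor:
  assumes "a \<in> carrier A"
  shows "nrm (CG_tensor G A) (elem_tensor G A f a) = nrm (CG G) f * nrm A a"
proof -
  have ne: "carrier G \<noteq> {}" using G by (auto dest: group.is_monoid monoid.one_closed)
  obtain h where h: "h \<in> carrier G" "(SUP h\<in>carrier G. cmod (f h)) = cmod (f h)"
    using SUP_finite_attained[OF G(2) ne] .
  have "(SUP h\<in>carrier G. nrm A (f h \<odot> a)) = cmod (f h) * nrm A a"
    using h(1) SUP_finite_upper[OF G(2), of _ "\<lambda>h. cmod (f h)"] assms
    by (intro cSup_eq_maximum) (auto simp: nrm_smult h(2) nrm_nonneg intro!: mult_right_mono)
  then show ?thesis
    by (simp add: CG_tensor_def elem_tensor_def CG_simps h cong: SUP_cong_simp)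
qed

text \<open>Together with the previous lemmas: the algebraic tensor product of \<^term>\<open>CG G\<close>
  and \<^term>\<open>A\<close> is all of \<^term>\<open>CG_tensor G A\<close>.\<close>

lemma elem_tensor_expansion:
  assumes "c \<in> carrier G \<rightarrow> carrier A"
  shows "(\<Oplus>\<^bsub>CG_tensor G A\<^esub>g\<in>carrier G.
      elem_tensor G A (\<lambda>h\<in>carrier G. if h = g then 1 else 0) (c g)) = restrict c (carrier G)"
    (is "?s = _")
proof -
  interpret T: cstar_algebra "fun_cstar (carrier G) A"
    using G by (intro cstar_algebra_fun) (auto dest: group.is_monoid monoid.one_closed)
  have cl: "(\<lambda>g. elem_tensor G A (\<lambda>h\<in>carrier G. if h = g then 1 else 0) (c g))
      \<in> carrier G \<rightarrow> carrier (fun_cstar (carrier G) A)"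
    using assms by (auto simp: CG_tensor_def elem_tensor_def Pi_iff)
  have "?s h = c h" if h: "h \<in> carrier G" for h
  proof -
    have "?s h = (\<Oplus>g\<in>carrier G. (if h = g then 1 else 0) \<odot> c g)"
      using finsum_fun_cstar_app[OF G(2) h cl] h by (simp add: CG_tensor_def elem_tensor_def)
    also have "\<dots> = (\<Oplus>g\<in>carrier G. if h = g then c g else \<zero>)"
      using assms smult_one[simplified] smult_l_null[simplified]
      by (intro M.finsum_cong') (auto simp: Pi_iff)
    also have "\<dots> = c h"
      using h assms G(2) by (intro M.add.finprod_singleton) auto
    finally show ?thesis .
  qed
  moreover have "?s \<in> carrier (fun_cstar (carrier G) A)"
    using T.M.finsum_closed[OF cl] by (simp only: CG_tensor_def)
  ultimately show ?thesis by (auto intro!: extensionalityI[of _ "carrier G"] simp: PiE_def)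
qed

end

end

lemma (in group) tensor_action_elem_tensor:
  assumes "cstar_algebra A" "cstar_action G A \<alpha>"
    and "g \<in> carrier G" "f \<in> carrier (CG G)" "a \<in> carrier A"
  shows "tensor_action G A \<alpha> g (elem_tensor G A f a) =
    elem_tensor G A (translation G g f) (\<alpha> g a)"
proof -
  interpret A: cstar_algebra A by fact
  have "\<alpha> g (c \<odot>\<^bsub>A\<^esub> a) = c \<odot>\<^bsub>A\<^esub> \<alpha> g a" for c
    using assms by (auto simp: cstar_action_def star_hom_def)
  then show ?thesis
    using assms by (auto simp: tensor_action_def CG_tensor_def elem_tensor_def translation_def
        intro!: restrict_ext)
qed


lemma group_actionI:
  assumes "group G"
    and closed: "\<And>g x. g \<in> carrier G \<Longrightarrow> x \<in> E \<Longrightarrow> \<phi> g x \<in> E"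
    and ext: "\<And>g. g \<in> carrier G \<Longrightarrow> \<phi> g \<in> extensional E"
    and one: "\<And>x. x \<in> E \<Longrightarrow> \<phi> \<one>\<^bsub>G\<^esub> x = x"
    and mult: "\<And>g h x. g \<in> carrier G \<Longrightarrow> h \<in> carrier G \<Longrightarrow> x \<in> E \<Longrightarrow>
      \<phi> (g \<otimes>\<^bsub>G\<^esub> h) x = \<phi> g (\<phi> h x)"
  shows "group_action G E \<phi>"
proof -
  interpret group G by fact
  have bij: "\<phi> g \<in> Bij E" if g: "g \<in> carrier G" for g
  proof -
    have "bij_betw (\<phi> g) E E"
      using g closed mult[of "inv\<^bsub>G\<^esub> g" g, symmetric] mult[of g "inv\<^bsub>G\<^esub> g", symmetric] one
      by (intro bij_betw_byWitness[where f' = "\<phi> (inv\<^bsub>G\<^esub> g)"]) auto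
    then show ?thesis using ext[OF g] by (simp add: Bij_def)
  qed
  have "\<phi> (g \<otimes>\<^bsub>G\<^esub> h) = compose E (\<phi> g) (\<phi> h)"
    if "g \<in> carrier G" "h \<in> carrier G" for g h
    using that by (intro extensionalityI[of _ E]) (auto simp: ext mult compose_eq)
  then show ?thesis
    using bij group_BijGroup
    by (intro group_action.intro group_hom.intro group_hom_axioms.intro is_group homI)
      (auto simp: BijGroup_def)
qed

lemma cstar_actionD:
  assumes "cstar_action G A \<alpha>" "g \<in> carrier G" "a \<in> carrier A"
  shows "\<alpha> g a \<in> carrier A" "\<alpha> \<one>\<^bsub>G\<^esub> a = a"
    and "h \<in> carrier G \<Longrightarrow> \<alpha> (g \<otimes>\<^bsub>G\<^esub> h) a = \<alpha> g (\<alpha> h a)"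
    and "\<alpha> g (c \<odot>\<^bsub>A\<^esub> a) = c \<odot>\<^bsub>A\<^esub> \<alpha> g a" "\<alpha> g (star A a) = star A (\<alpha> g a)"
    and "b \<in> carrier A \<Longrightarrow> \<alpha> g (a \<otimes>\<^bsub>A\<^esub> b) = \<alpha> g a \<otimes>\<^bsub>A\<^esub> \<alpha> g b"
    and "b \<in> carrier A \<Longrightarrow> \<alpha> g (a \<oplus>\<^bsub>A\<^esub> b) = \<alpha> g a \<oplus>\<^bsub>A\<^esub> \<alpha> g b"
proof -
  interpret group_action G "carrier A" \<alpha> using assms(1) by (simp add: cstar_action_def)
  show "\<alpha> \<one>\<^bsub>G\<^esub> a = a"
    using id_eq_one assms(3) by (metis restrict_apply')
  show "h \<in> carrier G \<Longrightarrow> \<alpha> (g \<otimes>\<^bsub>G\<^esub> h) a = \<alpha> g (\<alpha> h a)"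
    using composition_rule assms(2,3) by blast
qed (use assms in \<open>auto simp: cstar_action_def star_hom_def hom_def Pi_iff\<close>)

lemma (in group) cstar_action_tensor_action:
  assumes A: "cstar_algebra A" and \<alpha>: "cstar_action G A \<alpha>"
  shows "cstar_action G (CG_tensor G A) (tensor_action G A \<alpha>)"
proof -
  interpret A: cstar_algebra A by fact
  note D = cstar_actionD[OF \<alpha>]
  note [simp] = tensor_action_def CG_tensor_def
  have "group_action G (carrier (CG_tensor G A)) (tensor_action G A \<alpha>)"
  proof (rule group_actionI)
    fix F assume F: "F \<in> carrier (CG_tensor G A)"
    then have FG: "F h \<in> carrier A" if "h \<in> carrier G" for h using that by auto
    show "tensor_action G A \<alpha> \<one> F = F"
      using F by (intro extensionalityI[of _ "carrier G"]) (auto simp: D(2)[OF one_closed FG] PiE_def)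
    fix g assume g: "g \<in> carrier G"
    show "tensor_action G A \<alpha> g F \<in> carrier (CG_tensor G A)"
      using F g by (auto intro!: D(1) FG)
    fix h assume h: "h \<in> carrier G"
    have cl: "tensor_action G A \<alpha> h F \<in> carrier G \<rightarrow>\<^sub>E carrier A"
      using F h by (auto intro!: D(1) FG)
    show "tensor_action G A \<alpha> (g \<otimes> h) F = tensor_action G A \<alpha> g (tensor_action G A \<alpha> h F)"
      using F g h cl by (auto intro!: restrict_ext simp: D(3) FG inv_mult_group m_assoc)
  qed (auto simp: is_group)
  moreover have "tensor_action G A \<alpha> g \<in> star_hom (CG_tensor G A) (CG_tensor G A)"
    if g: "g \<in> carrier G" for g
    using g by (auto simp: star_hom_def hom_def Pi_iff funcset_extensional_app[where T = "carrier A"]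
        D A.mult_closed A.star_closed intro!: restrict_ext)
  ultimately show ?thesis by (simp add: cstar_action_def)
qed

lemma (in group) cstar_action_translation: "cstar_action G (CG G) (translation G)"
proof -
  have "cstar_action G complex_cstar (\<lambda>_. \<lambda>c\<in>UNIV. c)"
    by (auto simp: cstar_action_def star_hom_def hom_def complex_cstar_def is_group
        intro!: group_actionI)
  moreover have "tensor_action G complex_cstar (\<lambda>_. \<lambda>c\<in>UNIV. c) = translation G"
    by (auto simp: tensor_action_def translation_def CG_def CG_tensor_def fun_eq_iff)
  ultimately show ?thesis
    using cstar_action_tensor_action[OF cstar_algebra_complex]
    by (metis CG_def CG_tensor_def)
qed

text \<open>The element \<open>a u\<^sub>g\<close> of a crossed product.\<close>

definition crossed_monomial ::
    "('g, 'k) monoid_scheme \<Rightarrow> ('a, 'm) cstar_scheme \<Rightarrow> 'g \<Rightarrow> 'a \<Rightarrow> ('g \<Rightarrow> 'a)" where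
  "crossed_monomial G A g a = (\<lambda>s\<in>carrier G. if s = g then a else \<zero>\<^bsub>A\<^esub>)"

lemma crossed_product_simps:
  "carrier (crossed_product G A \<alpha>) = carrier G \<rightarrow>\<^sub>E carrier A"
  "x \<otimes>\<^bsub>crossed_product G A \<alpha>\<^esub> y = (\<lambda>s\<in>carrier G.
       \<Oplus>\<^bsub>A\<^esub>t\<in>carrier G. x t \<otimes>\<^bsub>A\<^esub> \<alpha> t (y (inv\<^bsub>G\<^esub> t \<otimes>\<^bsub>G\<^esub> s)))"
  "star (crossed_product G A \<alpha>) x = (\<lambda>s\<in>carrier G. \<alpha> s (star A (x (inv\<^bsub>G\<^esub> s))))"
  "add_monoid (crossed_product G A \<alpha>) = add_monoid (fun_cstar (carrier G) A)"
  by (simp_all add: crossed_product_def l1_crossed_product_def fun_cstar_def)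

context group
begin

context
  fixes A :: "('b, 'm) cstar_scheme" and \<alpha> :: "'a \<Rightarrow> 'b \<Rightarrow> 'b"
  assumes fin: "finite (carrier G)" and A: "cstar_algebra A" and \<alpha>: "cstar_action G A \<alpha>"
begin

interpretation A: cstar_algebra A by (rule A)

lemma action_zero: "g \<in> carrier G \<Longrightarrow> \<alpha> g \<zero>\<^bsub>A\<^esub> = \<zero>\<^bsub>A\<^esub>"
  using cstar_actionD(1,7)[OF \<alpha>, of g "\<zero>\<^bsub>A\<^esub>"]
  by (metis A.M.add.l_cancel_one' A.M.l_zero A.M.zero_closed)

lemma mult_zero:
  assumes "a \<in> carrier A"
  shows "a \<otimes>\<^bsub>A\<^esub> \<zero>\<^bsub>A\<^esub> = \<zero>\<^bsub>A\<^esub>" "\<zero>\<^bsub>A\<^esub> \<otimes>\<^bsub>A\<^esub> a = \<zero>\<^bsub>A\<^esub>"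
  using assms A.distr_left[of "\<zero>\<^bsub>A\<^esub>" "\<zero>\<^bsub>A\<^esub>" a] A.distr_right[of "\<zero>\<^bsub>A\<^esub>" "\<zero>\<^bsub>A\<^esub>" a] A.mult_closed
  by (metis A.M.add.l_cancel_one' A.M.l_zero A.M.zero_closed)+

lemma star_zero: "star A \<zero>\<^bsub>A\<^esub> = \<zero>\<^bsub>A\<^esub>"
  using A.star_add[of "\<zero>\<^bsub>A\<^esub>" "\<zero>\<^bsub>A\<^esub>"] A.star_closed
  by (metis A.M.add.l_cancel_one' A.M.l_zero A.M.zero_closed)

lemma crossed_monomial_mult:
  assumes "g \<in> carrier G" "h \<in> carrier G" "a \<in> carrier A" "b \<in> carrier A"
  shows "crossed_monomial G A g a \<otimes>\<^bsub>crossed_product G A \<alpha>\<^esub> crossed_monomial G A h b =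
    crossed_monomial G A (g \<otimes> h) (a \<otimes>\<^bsub>A\<^esub> \<alpha> g b)"
proof -
  have "(\<Oplus>\<^bsub>A\<^esub>t\<in>carrier G. crossed_monomial G A g a t \<otimes>\<^bsub>A\<^esub>
      \<alpha> t (crossed_monomial G A h b (inv t \<otimes> s))) =
      (if s = g \<otimes> h then a \<otimes>\<^bsub>A\<^esub> \<alpha> g b else \<zero>\<^bsub>A\<^esub>)" if s: "s \<in> carrier G" for s
  proof -
    have [simp]: "inv g \<otimes> s = h \<longleftrightarrow> s = g \<otimes> h"
      using assms s by (metis inv_solve_left)
    have [simp]: "g \<otimes> (inv g \<otimes> s) = s" "inv g \<otimes> (g \<otimes> h) = h"
      using assms s by (simp_all add: m_assoc[symmetric])
    have "(\<Oplus>\<^bsub>A\<^esub>t\<in>carrier G. crossed_monomial G A g a t \<otimes>\<^bsub>A\<^esub>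
        \<alpha> t (crossed_monomial G A h b (inv t \<otimes> s))) =
        (\<Oplus>\<^bsub>A\<^esub>t\<in>carrier G. if g = t then (if s = g \<otimes> h then a \<otimes>\<^bsub>A\<^esub> \<alpha> t b else \<zero>\<^bsub>A\<^esub>) else \<zero>\<^bsub>A\<^esub>)"
      using assms s
      by (intro A.M.finsum_cong')
        (auto simp: crossed_monomial_def action_zero mult_zero A.mult_closed cstar_actionD[OF \<alpha>])
    also have "\<dots> = (if s = g \<otimes> h then a \<otimes>\<^bsub>A\<^esub> \<alpha> g b else \<zero>\<^bsub>A\<^esub>)"
      using assms fin
      by (intro A.M.add.finprod_singleton) (auto simp: A.mult_closed cstar_actionD[OF \<alpha>])
    finally show ?thesis .
  qed
  then show ?thesis
    by (auto simp: crossed_product_simps crossed_monomial_def[of G A "g \<otimes> h"] intro!: restrict_ext)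
qed

lemma crossed_monomial_star:
  assumes "g \<in> carrier G" "a \<in> carrier A"
  shows "star (crossed_product G A \<alpha>) (crossed_monomial G A g a) =
    crossed_monomial G A (inv g) (\<alpha> (inv g) (star A a))"
  using assms
  by (auto simp: crossed_product_simps crossed_monomial_def star_zero action_zero intro!: restrict_ext)

lemma crossed_monomial_expansion:
  assumes x: "x \<in> carrier (crossed_product G A \<alpha>)"
  shows "x = (\<Oplus>\<^bsub>crossed_product G A \<alpha>\<^esub>g\<in>carrier G. crossed_monomial G A g (x g))"
proof -
  have xG: "x g \<in> carrier A" if "g \<in> carrier G" for g
    using x that by (auto simp: crossed_product_simps)
  have "(\<Oplus>\<^bsub>crossed_product G A \<alpha>\<^esub>g\<in>carrier G. crossed_monomial G A g (x g)) =
      (\<Oplus>\<^bsub>CG_tensor G A\<^esub>g\<in>carrier G. crossed_monomial G A g (x g))"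
    by (simp only: finsum_def crossed_product_simps(4) CG_tensor_def)
  also have "\<dots> = (\<Oplus>\<^bsub>CG_tensor G A\<^esub>g\<in>carrier G.
      elem_tensor G A (\<lambda>h\<in>carrier G. if h = g then 1 else 0) (x g))"
  proof -
    interpret T: cstar_algebra "CG_tensor G A"
      unfolding CG_tensor_def using fin by (intro A.cstar_algebra_fun) auto
    have "crossed_monomial G A g (x g) =
        elem_tensor G A (\<lambda>h\<in>carrier G. if h = g then 1 else 0) (x g)" if "g \<in> carrier G" for g
      using xG[OF that] A.smult_one[simplified] A.smult_l_null[simplified]
      by (auto simp: crossed_monomial_def elem_tensor_def intro!: restrict_ext)
    then show ?thesis
      using xG by (intro T.M.finsum_cong') (auto simp: elem_tensor_def CG_tensor_def)
  qed
  also have "\<dots> = x"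
    using A.elem_tensor_expansion[OF is_group fin, of x] xG x
    by (auto simp: crossed_product_simps PiE_def extensional_restrict)
  finally show ?thesis ..
qed

lemma crossed_hom_monomial:
  assumes "\<phi> \<zero>\<^bsub>A\<^esub> = \<zero>\<^bsub>B\<^esub>"
  shows "crossed_hom G \<phi> (crossed_monomial G A g a) = crossed_monomial G B g (\<phi> a)"
  using assms by (auto simp: crossed_hom_def crossed_monomial_def intro!: restrict_ext)

end

end

end

theory Submission
  imports Defs
begin

text \<open>
  Write \<open>C\<close> for the crossed product of \<open>A\<close>. Let \<open>e\<^sub>n\<close> be Rokhlin towers that are asymptotically
  equivariant and asymptotically central. The map sending \<open>(F\<^sub>s)\<^sub>s\<close>, where each \<open>F\<^sub>s\<close> is a function on
  the group, to the class of the sequence of \<open>\<Sum>\<^sub>s \<Sum>\<^sub>h e\<^sub>n(h) F\<^sub>s(h) u\<^sub>s\<close> is a *-homomorphism into the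
  sequence algebra of \<open>C\<close>, and on constant functions it is multiplication by the class \<open>g\<close> of the
  sequence \<open>\<Sum>\<^sub>h e\<^sub>n(h)\<close>.

  The point is smallness of \<open>1 - g\<close> relative to positive \<open>z = (z\<^sub>n)\<close> in the sequence algebra of \<open>C\<close>,
  whereas the tracial Rokhlin property only provides smallness relative to elements of \<open>A\<close>. As \<open>z\<^sub>n\<close> is
  bounded away from 0, it may be replaced by a cut-down \<open>y\<^sub>n\<close>. If there are towers with sum 1, nothing
  is left to prove. Otherwise the tracial Rokhlin property gives nonzero projections in all hereditary
  subalgebras of \<open>A\<close>. Take a projection \<open>p\<close> under the coefficient of \<open>y\<^sub>n\<^sup>2\<close> at the unit. For a fine tower,
  compression by \<open>e(h)\<close> kills the other coefficients, so that, unless all \<open>e(h) p e(h)\<close> are small (which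
  contradicts finiteness), a nonzero projection of \<open>A\<close> is equivalent in \<open>C\<close> to one in \<open>y\<^sub>n C y\<^sub>n\<close>. A
  further tower whose complement is small relative to this projection does the job.
\<close>

section \<open>C*-algebras as types\<close>

text \<open>Four constraints shape the construction. (a) That the range projection lies in the
  hereditary subalgebra of \<open>z\<close> needs witnesses bounded in \<open>n\<close>. The
  cut-down provides them: it satisfies \<open>z * (g * y) = y\<close> with
  \<open>norm g \<le> 2 / \<delta>\<close>, and the absence of null subsequences makes
  \<open>\<delta>\<close> eventually independent of \<open>n\<close>. (b) The class of the tower
  sums must be nonzero. Hence complements are compared with a proper nonzero subprojection: a tower
  with sum 0 would make the unit equivalent to a projection below it. Proper subprojections exist
  because a simple algebra with a scalar corner \<open>p A p\<close> is finite dimensional. (c) The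
  projection \<open>p\<close> found under the unit coefficient may be nearly orthogonal to the
  tower. Then it is equivalent to a projection under the complement, which embeds into a proper
  subprojection of \<open>p\<close>, against finiteness. (d) The norm of the crossed product is a
  supremum of C*-seminorms. One concrete representation is needed to see that it separates points
  and controls coefficients.\<close>

text \<open>The scalars of the library class are real; the central element \<open>iu\<close> plays the role of \<open>\<i>\<close>.\<close>

class cstar_alg = real_normed_algebra_1 + banach +
  fixes adj :: "'a \<Rightarrow> 'a" and iu :: 'a
  assumes adj_adj [simp]: "adj (adj x) = x"
    and adj_add: "adj (x + y) = adj x + adj y"
    and adj_scaleR: "adj (r *\<^sub>R x) = r *\<^sub>R adj x"
    and adj_mult: "adj (x * y) = adj y * adj x"
    and norm_adj_mult: "norm (adj x * x) = (norm x)\<^sup>2"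
    and iu_commute: "iu * x = x * iu"
    and iu_square: "iu * iu = - 1"
    and adj_iu: "adj iu = - iu"

section \<open>Involution, C*-identity and complex scalars\<close>

lemma adj_minus_right [simp]: "adj (- x) = - adj (x::'a::cstar_alg)"
  using adj_scaleR[of "-1" x] by simp

lemma adj_diff: "adj (x - y) = adj x - adj (y::'a::cstar_alg)"
  using adj_add[of x "- y"] by simp

lemma adj_zero [simp]: "adj (0::'a::cstar_alg) = 0"
  using adj_scaleR[of 0 0] by simp

lemma adj_one [simp]: "adj (1::'a::cstar_alg) = 1"
proof -
  have "adj (1::'a) = adj (adj 1 * 1)" by (metis adj_adj adj_mult mult.right_neutral mult_1)
  then show ?thesis by simp
qed

lemma norm_adj [simp]: "norm (adj x) = norm (x::'a::cstar_alg)"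
proof -
  have le: "norm x \<le> norm (adj x)" for x :: 'a
  proof (cases "x = 0")
    case False
    have "norm x * norm x \<le> norm (adj x) * norm x"
      using norm_mult_ineq[of "adj x" x] by (simp add: norm_adj_mult power2_eq_square)
    then show ?thesis using False by simp
  qed simp
  show ?thesis using le[of x] le[of "adj x"] by simp
qed

lemma norm_mult_adj: "norm (x * adj x) = (norm (x::'a::cstar_alg))\<^sup>2"
  using norm_adj_mult[of "adj x"] by simp

lemma norm_square_sa: "adj (h::'a::cstar_alg) = h \<Longrightarrow> norm (h * h) = (norm h)\<^sup>2"
  using norm_adj_mult[of h] by simp

lemma bounded_linear_adj: "bounded_linear (adj :: 'a::cstar_alg \<Rightarrow> 'a)"
  by (rule bounded_linear_intro[where K = 1]) (auto simp: adj_add adj_scaleR)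

definition sc :: "complex \<Rightarrow> 'a::cstar_alg" where
  "sc c = Re c *\<^sub>R 1 + Im c *\<^sub>R iu"

lemma sc_commute: "sc c * x = x * sc c"
  by (simp add: sc_def algebra_simps iu_commute)

lemma sc_mult: "sc (a * b) = sc a * sc b"
  by (simp add: sc_def algebra_simps iu_square)

lemma sc_of_real [simp]: "sc (of_real r) = r *\<^sub>R 1"
  by (simp add: sc_def)

lemma sc_one [simp]: "sc 1 = 1" and sc_minus: "sc (- c) = - sc c"
  by (simp_all add: sc_def)

lemma adj_sc: "adj (sc c) = sc (cnj c)"
  by (simp add: sc_def adj_add adj_scaleR adj_iu)

lemma norm_sc_mult: "norm (sc c * x) = cmod c * norm x"
proof -
  have "adj (sc c * x) * (sc c * x) = adj x * (sc (cnj c) * sc c * x)"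
    by (simp add: adj_mult adj_sc mult.assoc)
  also have "\<dots> = (cmod c)\<^sup>2 *\<^sub>R (adj x * x)"
    by (simp only: sc_mult[symmetric] mult.commute[of "cnj c"] complex_norm_square[symmetric])
      (simp add: sc_of_real flip: of_real_power)
  finally have "(norm (sc c * x))\<^sup>2 = (cmod c * norm x)\<^sup>2"
    by (metis norm_adj_mult norm_scaleR power_mult_distrib abs_power2)
  then show ?thesis by simp
qed

text \<open>The logarithmic norm of \<open>x\<close> is at most \<open>m\<close>. For self-adjoint \<open>x\<close> this means that the
  spectrum lies below \<open>m\<close>; it replaces the functional calculus in the treatment of positivity.\<close>

definition dissipative :: "real \<Rightarrow> 'a::real_normed_algebra_1 \<Rightarrow> bool" where
  "dissipative m x \<longleftrightarrow> (\<forall>e>0. \<exists>d>0. norm (1 + d *\<^sub>R x) \<le> 1 + d * (m + e))"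

text \<open>Convexity of the norm along the segment from 1 to \<open>1 + d *\<^sub>R x\<close>. It
  allows several step sizes to be replaced by their minimum.\<close>

lemma dissipative_step_mono:
  fixes x :: "'a::real_normed_algebra_1"
  assumes "norm (1 + d *\<^sub>R x) \<le> 1 + d * k" "0 \<le> d'" "d' \<le> d" "0 < d"
  shows "norm (1 + d' *\<^sub>R x) \<le> 1 + d' * k"
proof -
  define s where "s = d' / d"
  have s: "0 \<le> s" "s \<le> 1" "d' = s * d" using assms by (auto simp: s_def)
  have "1 + d' *\<^sub>R x = (1 - s) *\<^sub>R 1 + s *\<^sub>R (1 + d *\<^sub>R x)"
    by (simp add: s algebra_simps)
  then have "norm (1 + d' *\<^sub>R x) \<le> (1 - s) + s * norm (1 + d *\<^sub>R x)"
    using norm_triangle_ineq[of "(1 - s) *\<^sub>R 1" "s *\<^sub>R (1 + d *\<^sub>R x)"] s by simp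
  also have "\<dots> \<le> (1 - s) + s * (1 + d * k)"
    using assms(1) s by (intro add_left_mono mult_left_mono) auto
  finally show ?thesis by (simp add: s algebra_simps)
qed

text \<open>At a common step \<open>d\<close>, the midpoint of \<open>1 + d *\<^sub>R x\<close> and
  \<open>1 + d *\<^sub>R y\<close> is \<open>1 + (d/2) *\<^sub>R (x + y)\<close>. This makes sums of
  positive elements positive without a spectral argument.\<close>

lemma dissipative_add:
  fixes x y :: "'a::real_normed_algebra_1"
  assumes "dissipative m x" "dissipative n y"
  shows "dissipative (m + n) (x + y)"
  unfolding dissipative_def
proof (intro allI impI)
  fix e :: real assume "e > 0"
  then obtain d1 d2 where d: "d1 > 0" "norm (1 + d1 *\<^sub>R x) \<le> 1 + d1 * (m + e/2)"
      "d2 > 0" "norm (1 + d2 *\<^sub>R y) \<le> 1 + d2 * (n + e/2)"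
    using assms unfolding dissipative_def by (meson half_gt_zero)
  define d where "d = min d1 d2"
  have x: "norm (1 + d *\<^sub>R x) \<le> 1 + d * (m + e/2)"
    using d by (intro dissipative_step_mono[OF d(2)]) (auto simp: d_def)
  have y: "norm (1 + d *\<^sub>R y) \<le> 1 + d * (n + e/2)"
    using d by (intro dissipative_step_mono[OF d(4)]) (auto simp: d_def)
  have "1 + (d/2) *\<^sub>R (x + y) = (1/2) *\<^sub>R ((1 + d *\<^sub>R x) + (1 + d *\<^sub>R y))"
    by (simp add: algebra_simps flip: scaleR_add_left)
  then have "norm (1 + (d/2) *\<^sub>R (x + y)) \<le> (norm (1 + d *\<^sub>R x) + norm (1 + d *\<^sub>R y)) / 2"
    using norm_triangle_ineq[of "1 + d *\<^sub>R x" "1 + d *\<^sub>R y"] by simp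
  also have "\<dots> \<le> 1 + (d/2) * (m + n + e)" using x y by (simp add: field_simps)
  finally show "\<exists>d>0. norm (1 + d *\<^sub>R (x + y)) \<le> 1 + d * (m + n + e)"
    using d by (intro exI[of _ "d/2"]) (auto simp: d_def)
qed

lemma dissipative_mono: "dissipative m x \<Longrightarrow> m \<le> n \<Longrightarrow> dissipative n x"
  unfolding dissipative_def
  by (meson add_left_mono add_right_mono less_imp_le mult_left_mono order_trans)

lemma dissipative_scale:
  assumes "dissipative m x" "0 \<le> r"
  shows "dissipative (r * m) (r *\<^sub>R x)"
proof (cases "r = 0")
  case True
  then show ?thesis by (auto simp: dissipative_def intro!: exI[of _ 1])
next
  case False
  then have r: "r > 0" using assms by simp
  show ?thesis unfolding dissipative_def
  proof (intro allI impI)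
    fix e :: real assume "e > 0"
    then obtain d where "d > 0" "norm (1 + d *\<^sub>R x) \<le> 1 + d * (m + e / r)"
      using assms(1) r unfolding dissipative_def by (meson divide_pos_pos)
    then show "\<exists>d>0. norm (1 + d *\<^sub>R r *\<^sub>R x) \<le> 1 + d * (r * m + e)"
      using r by (intro exI[of _ "d / r"]) (auto simp: field_simps)
  qed
qed

lemma dissipative_norm: "dissipative (norm x) (x::'a::real_normed_algebra_1)"
  unfolding dissipative_def
proof (intro allI impI)
  fix e :: real assume "e > 0"
  then show "\<exists>d>0. norm (1 + d *\<^sub>R x) \<le> 1 + d * (norm x + e)"
    using norm_triangle_ineq[of 1 x] by (intro exI[of _ 1]) auto
qed

lemma dissipative_const: "dissipative r (r *\<^sub>R (1::'a::real_normed_algebra_1))"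
  unfolding dissipative_def
proof (intro allI impI)
  fix e :: real assume e: "e > 0"
  have n: "norm (1 + d *\<^sub>R r *\<^sub>R (1::'a)) = \<bar>1 + d * r\<bar>" for d
    by (metis norm_of_real of_real_1 of_real_add of_real_def of_real_mult scaleR_scaleR)
  have "- 1 \<le> r / (1 + \<bar>r\<bar>)"
    by (subst pos_le_divide_eq) auto
  then have "\<bar>1 + (1 / (1 + \<bar>r\<bar>)) * r\<bar> = 1 + (1 / (1 + \<bar>r\<bar>)) * r" by simp
  then have "norm (1 + (1 / (1 + \<bar>r\<bar>)) *\<^sub>R r *\<^sub>R (1::'a)) \<le> 1 + (1 / (1 + \<bar>r\<bar>)) * (r + e)"
    unfolding n using e by (simp add: add_divide_distrib)
  then show "\<exists>d>0. norm (1 + d *\<^sub>R r *\<^sub>R (1::'a)) \<le> 1 + d * (r + e)"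
    by (intro exI[of _ "1 / (1 + \<bar>r\<bar>)"]) (auto simp: add_pos_nonneg)
qed

text \<open>Neumann series. The commutation clause is carried along because such inverses are later
  multiplied with square roots and absolute values of the same element.\<close>

lemma one_minus_inverse:
  fixes t :: "'a::{real_normed_algebra_1,banach}"
  assumes "norm t < 1"
  shows "\<exists>y. (1 - t) * y = 1 \<and> y * (1 - t) = 1 \<and> norm y \<le> 1 / (1 - norm t)
    \<and> (\<forall>c. c * t = t * c \<longrightarrow> c * y = y * c)"
proof -
  have s: "summable (\<lambda>n. norm (t ^ n))"
    by (rule summable_comparison_test[of _ "\<lambda>n. norm t ^ n"])
      (use assms in \<open>auto simp: norm_power_ineq intro!: exI[of _ 0] summable_geometric\<close>)
  note s' = summable_norm_cancel[OF s]
  define y where "y = suminf (\<lambda>n. t ^ n)"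
  have y: "(\<lambda>n. t ^ n) sums y" using s' by (simp add: y_def summable_sums)
  have y1: "(\<lambda>n. t ^ Suc n) sums (y - 1)"
    using y sums_Suc_iff[of "\<lambda>n. t ^ n" "y - 1"] by simp
  have "(\<lambda>n. t ^ Suc n) sums (t * y)" using sums_mult[OF y, of t] by simp
  then have 1: "t * y = y - 1" using y1 sums_unique2 by blast
  have "(\<lambda>n. t ^ Suc n) sums (y * t)" using sums_mult2[OF y, of t] by (simp add: power_commutes)
  then have 2: "y * t = y - 1" using y1 sums_unique2 by blast
  have "norm y \<le> suminf (\<lambda>n. norm (t ^ n))" unfolding y_def by (rule summable_norm[OF s])
  also have "\<dots> \<le> suminf (\<lambda>n. norm t ^ n)"
    using assms s by (intro suminf_le) (auto simp: norm_power_ineq intro!: summable_geometric)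
  finally have 3: "norm y \<le> 1 / (1 - norm t)" using assms by (simp add: suminf_geometric)
  have "c * y = y * c" if c: "c * t = t * c" for c
  proof -
    have "c * t ^ n = t ^ n * c" for n
      by (induction n) (auto simp: c mult.assoc[symmetric], simp add: mult.assoc c)
    then have "(\<lambda>n. c * t ^ n) sums (y * c)" using sums_mult2[OF y, of c] by simp
    then show ?thesis using sums_mult[OF y, of c] sums_unique2 by blast
  qed
  then show ?thesis using 1 2 3 by (intro exI[of _ y]) (auto simp: algebra_simps)
qed

text \<open>Some \<open>1 + d *\<^sub>R x\<close> has norm at most \<open>1 - d * m / 2\<close>, and
  \<open>(- d) *\<^sub>R x\<close> is 1 minus that element, so the Neumann series inverts it. The
  factor 2 in the bound comes from spending half of \<open>m\<close> on the error term.\<close>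

lemma dissipative_inverse:
  fixes x :: "'a::{real_normed_algebra_1,banach}"
  assumes "dissipative (- m) x" "0 < m"
  shows "\<exists>y. x * y = 1 \<and> y * x = 1 \<and> norm y \<le> 2 / m \<and> (\<forall>c. c * x = x * c \<longrightarrow> c * y = y * c)"
proof -
  obtain d where d: "d > 0" "norm (1 + d *\<^sub>R x) \<le> 1 + d * (- m + m / 2)"
    using assms unfolding dissipative_def by (meson half_gt_zero)
  then have lt: "norm (1 + d *\<^sub>R x) < 1" "d * m / 2 \<le> 1 - norm (1 + d *\<^sub>R x)"
    using mult_pos_pos[OF d(1) assms(2)] by (simp_all add: algebra_simps)
  obtain y where y: "(1 - (1 + d *\<^sub>R x)) * y = 1" "y * (1 - (1 + d *\<^sub>R x)) = 1"
      "norm y \<le> 1 / (1 - norm (1 + d *\<^sub>R x))"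
      "\<And>c. c * (1 + d *\<^sub>R x) = (1 + d *\<^sub>R x) * c \<Longrightarrow> c * y = y * c"
    using one_minus_inverse[OF lt(1)] by blast
  have "norm y \<le> 1 / (d * m / 2)"
    using d lt assms(2) by (intro order_trans[OF y(3)] divide_left_mono) auto
  then have "norm ((- d) *\<^sub>R y) \<le> 2 / m" using d assms(2) by (simp add: field_simps)
  then show ?thesis using y
    by (intro exI[of _ "(- d) *\<^sub>R y"]) (auto simp: algebra_simps)
qed

text \<open>A skew-adjoint direction changes the norm of 1 only to second order: the squared norm is
  at most \<open>1 + d\<^sup>2 * (norm h)\<^sup>2\<close>. The step \<open>d\<close> is so small
  that this extra term is at most \<open>d * e\<close>.\<close>

lemma dissipative_iu:
  fixes h :: "'a::cstar_alg"
  assumes "adj h = h"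
  shows "dissipative 0 (iu * h)"
  unfolding dissipative_def
proof (intro allI impI)
  fix e :: real assume e: "e > 0"
  define d where "d = e / ((norm h)\<^sup>2 + 1)"
  have d: "d > 0" using e by (simp add: d_def add_nonneg_pos)
  have "adj (1 + d *\<^sub>R (iu * h)) * (1 + d *\<^sub>R (iu * h)) = 1 + (d\<^sup>2) *\<^sub>R (h * h)"
  proof -
    have "h * (iu * (iu * h)) = - (h * h)"
      by (simp add: iu_square flip: mult.assoc[of iu])
    then show ?thesis
      by (simp add: adj_add adj_scaleR adj_mult adj_iu assms algebra_simps iu_commute[of h] power2_eq_square)
  qed
  then have "(norm (1 + d *\<^sub>R (iu * h)))\<^sup>2 \<le> 1 + d\<^sup>2 * (norm h)\<^sup>2"
    using norm_adj_mult[of "1 + d *\<^sub>R (iu * h)"] norm_triangle_ineq[of 1 "(d\<^sup>2) *\<^sub>R (h * h)"]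
    by (simp add: norm_square_sa[OF assms])
  also have "d\<^sup>2 * (norm h)\<^sup>2 \<le> d * e"
  proof -
    have "d * (norm h)\<^sup>2 \<le> e" using e by (simp add: d_def field_simps add_pos_nonneg)
    then show ?thesis using d by (simp add: power2_eq_square mult.assoc)
  qed
  also have "1 + d * e \<le> (1 + d * (0 + e))\<^sup>2" using d e by (simp add: power2_eq_square algebra_simps)
  finally have "norm (1 + d *\<^sub>R (iu * h)) \<le> 1 + d * (0 + e)"
    using d e by (intro power2_le_imp_le[of "norm _"]) auto
  then show "\<exists>d>0. norm (1 + d *\<^sub>R (iu * h)) \<le> 1 + d * (0 + e)" using d by blast
qed

text \<open>If \<open>u = 1 + i \<delta> h - \<delta>\<^sup>2 h\<^sup>2 / 2\<close>, then \<open>u\<close> is unitary up to an error of fourth order and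
  its real part is \<open>1 - \<delta>\<^sup>2 h\<^sup>2 / 2\<close>.\<close>

lemma dissipative_square:
  fixes h :: "'a::cstar_alg"
  assumes h: "adj h = h"
  shows "dissipative 0 (- (h * h))"
  unfolding dissipative_def
proof (intro allI impI)
  fix e :: real assume e: "e > 0"
  define N where "N = (norm h) ^ 4"
  define d where "d = sqrt (e / (N + 1))"
  have N: "N \<ge> 0" by (simp add: N_def)
  have d: "d > 0" "d\<^sup>2 = e / (N + 1)" using e N by (auto simp: d_def add_nonneg_pos)
  define u where "u = 1 + d *\<^sub>R (iu * h) - (d\<^sup>2/2) *\<^sub>R (h * h)"
  have "(iu * h) * (iu * h) = - (h * h)" "(iu * h) * (h * h) = (h * h) * (iu * h)"
    by (metis iu_commute iu_square mult.assoc mult_minus_left mult_1) (metis iu_commute mult.assoc)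
  moreover have "adj (iu * h) = - (iu * h)" by (simp add: adj_mult adj_iu h iu_commute)
  moreover have "h * h * (h * h) = h * (h * (h * h))" by (simp add: mult.assoc)
  ultimately have "adj u * u = 1 + (d ^ 4 / 4) *\<^sub>R (h * h * (h * h))"
    by (simp add: u_def adj_add adj_diff adj_scaleR adj_mult h algebra_simps power2_eq_square power4_eq_xxxx)
      (simp flip: scaleR_add_left)
  then have "(norm u)\<^sup>2 = norm (1 + (d ^ 4 / 4) *\<^sub>R (h * h * (h * h)))"
    by (metis norm_adj_mult)
  also have "\<dots> \<le> 1 + d ^ 4 / 4 * N"
    using norm_triangle_ineq[of 1 "(d ^ 4 / 4) *\<^sub>R (h * h * (h * h))"] norm_square_sa[of "h * h"]
    by (simp add: norm_square_sa[OF h] adj_mult h N_def flip: power_mult)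
  also have "d ^ 4 / 4 * N \<le> d\<^sup>2 / 4 * e"
  proof -
    have "d\<^sup>2 * N \<le> e" using e N by (simp add: d(2) field_simps)
    then have "d\<^sup>2 * (d\<^sup>2 * N) \<le> d\<^sup>2 * e" by (intro mult_left_mono) auto
    then show ?thesis by (simp add: power2_eq_square power4_eq_xxxx mult.assoc)
  qed
  also have "1 + d\<^sup>2 / 4 * e \<le> (1 + d\<^sup>2 / 2 * e)\<^sup>2"
    using e by (simp add: power2_sum)
  finally have u: "norm u \<le> 1 + d\<^sup>2 / 2 * e"
    using e by (intro power2_le_imp_le[of "norm _"]) auto
  have "u + adj u = 2 *\<^sub>R (1 + (d\<^sup>2/2) *\<^sub>R (- (h * h)))"
    by (simp add: u_def adj_add adj_diff adj_scaleR adj_mult h adj_iu iu_commute scaleR_2)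
  then have "2 * norm (1 + (d\<^sup>2/2) *\<^sub>R (- (h * h))) \<le> norm u + norm (adj u)"
    using norm_triangle_ineq[of u "adj u"] by (metis abs_numeral norm_scaleR)
  then have "norm (1 + (d\<^sup>2/2) *\<^sub>R (- (h * h))) \<le> 1 + (d\<^sup>2/2) * (0 + e)"
    using u by simp
  then show "\<exists>d>0. norm (1 + d *\<^sub>R (- (h * h))) \<le> 1 + d * (0 + e)"
    using d(1) by (intro exI[of _ "d\<^sup>2/2"]) auto
qed

section \<open>Resolvents and the spectral radius of self-adjoint elements\<close>

lemma inverse_average:
  fixes x :: "'a::real_algebra_1"
  assumes "(1 - x) * q = 1" "q * (1 - x) = 1" "(1 + x) * r = 1" "r * (1 + x) = 1"
  shows "(1 - x * x) * ((1/2) *\<^sub>R (q + r)) = 1" "((1/2) *\<^sub>R (q + r)) * (1 - x * x) = 1"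
proof -
  have f: "1 - x * x = (1 + x) * (1 - x)" "1 - x * x = (1 - x) * (1 + x)"
    by (simp_all add: algebra_simps)
  have "(1 - x * x) * q = 1 + x" "(1 - x * x) * r = 1 - x"
    using assms f by (metis mult.assoc mult.right_neutral)+
  then show "(1 - x * x) * ((1/2) *\<^sub>R (q + r)) = 1"
    by (simp add: distrib_left flip: scaleR_2)
  have "q * (1 - x * x) = 1 + x" "r * (1 - x * x) = 1 - x"
    using assms f by (metis mult.assoc mult_1)+
  then show "((1/2) *\<^sub>R (q + r)) * (1 - x * x) = 1"
    by (simp add: distrib_right flip: scaleR_2)
qed

text \<open>Averaging the resolvents at \<open>c\<close> and \<open>- c\<close> gives the resolvent of the square, and the
  distance of the resolvents on two circles does not grow (Rickart).\<close>

definition resolvents_close :: "'a::cstar_alg \<Rightarrow> real \<Rightarrow> real \<Rightarrow> bool" where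
  "resolvents_close y s d \<longleftrightarrow> (\<forall>c. cmod c = 1 \<longrightarrow>
     (\<exists>q r. (1 - sc c * y) * q = 1 \<and> q * (1 - sc c * y) = 1 \<and>
       (1 - s *\<^sub>R (sc c * y)) * r = 1 \<and> r * (1 - s *\<^sub>R (sc c * y)) = 1 \<and> norm (q - r) \<le> d))"

lemma resolvents_close_square:
  assumes "resolvents_close y s d"
  shows "resolvents_close (y * y) (s * s) d"
  unfolding resolvents_close_def
proof (intro allI impI)
  fix c :: complex assume c: "cmod c = 1"
  define b where "b = csqrt c"
  have b: "b * b = c" by (simp add: b_def flip: power2_eq_square)
  have b1: "cmod b = 1" using c by (simp add: b_def norm_csqrt)
  then have "cmod (- b) = 1" by simp
  define x where "x = sc b * y"
  have xx: "x * x = sc c * (y * y)"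
  proof -
    have "x * x = sc b * (y * sc b) * y" by (simp only: x_def mult.assoc)
    also have "\<dots> = sc (b * b) * (y * y)" by (simp only: sc_commute[of b y, symmetric] sc_mult mult.assoc)
    finally show ?thesis by (simp only: b)
  qed
  have m: "sc (- b) * y = - x" by (simp add: x_def sc_minus)
  obtain q r where q: "(1 - x) * q = 1" "q * (1 - x) = 1"
       "(1 - s *\<^sub>R x) * r = 1" "r * (1 - s *\<^sub>R x) = 1" "norm (q - r) \<le> d"
    using assms b1 unfolding resolvents_close_def x_def by blast
  obtain q' r' where q': "(1 + x) * q' = 1" "q' * (1 + x) = 1"
       "(1 + s *\<^sub>R x) * r' = 1" "r' * (1 + s *\<^sub>R x) = 1" "norm (q' - r') \<le> d"
    using assms[unfolded resolvents_close_def, rule_format, of "- b"] b1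
    unfolding m scaleR_minus_right diff_minus_eq_add by (metis norm_minus_cancel)
  have "(1/2) *\<^sub>R (q + q') - (1/2) *\<^sub>R (r + r') = (1/2) *\<^sub>R ((q - r) + (q' - r'))"
    by (simp add: algebra_simps)
  then have "norm ((1/2) *\<^sub>R (q + q') - (1/2) *\<^sub>R (r + r')) \<le> d"
    using norm_triangle_ineq[of "q - r" "q' - r'"] q q' by simp
  then show "\<exists>q r. (1 - sc c * (y * y)) * q = 1 \<and> q * (1 - sc c * (y * y)) = 1 \<and>
       (1 - (s * s) *\<^sub>R (sc c * (y * y))) * r = 1 \<and> r * (1 - (s * s) *\<^sub>R (sc c * (y * y))) = 1 \<and>
       norm (q - r) \<le> d"
    using inverse_average[OF q(1,2) q'(1,2)] inverse_average[OF q(3,4) q'(3,4)]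
    unfolding xx[symmetric] by (intro exI[of _ "(1/2) *\<^sub>R (q + q')"] exI[of _ "(1/2) *\<^sub>R (r + r')"]) simp
qed

lemma resolvents_close_power:
  "resolvents_close y s d \<Longrightarrow> resolvents_close (y ^ (2 ^ n)) (s ^ (2 ^ n)) d"
proof (induction n)
  case (Suc n)
  then show ?case
    using resolvents_close_square[of "y ^ (2 ^ n)"] by (simp add: mult_2 power_add)
qed simp

text \<open>Iterated C*-identity. The exponents \<open>2 ^ n\<close> are exactly those reached by
  repeated squaring of resolvents.\<close>

lemma norm_power_two_sa:
  fixes h :: "'a::cstar_alg"
  assumes "adj h = h"
  shows "adj (h ^ (2 ^ n)) = h ^ (2 ^ n) \<and> norm (h ^ (2 ^ n)) = norm h ^ (2 ^ n)"
proof (induction n)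
  case (Suc n)
  have e: "x ^ (2 ^ Suc n) = x ^ (2 ^ n) * x ^ (2 ^ n)" for x :: "'b::monoid_mult"
    by (simp add: mult_2 power_add)
  then show ?case
    using Suc norm_square_sa[of "h ^ (2 ^ n)"] by (simp only: e adj_mult power2_eq_square simp_thms)
qed (simp add: assms)

text \<open>By the bound \<open>K\<close>, the resolvents on the unit circle and on the circle of
  radius \<open>s\<close> are within 1/8 of each other for \<open>s\<close> near 1. Squaring
  \<open>n\<close> times preserves this distance, keeps the norm of the power equal to 1 and sends
  the radius to 0. There the resolvent is close to 1, hence so is the one on the unit circle, and
  this forces the power to have norm below 1.\<close>

lemma norm_neq_1_if_resolvent_bounded:
  fixes h :: "'a::cstar_alg"
  assumes h: "adj h = h"
    and K: "\<And>c. cmod c \<le> 1 \<Longrightarrow>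
      \<exists>q. (1 - sc c * h) * q = 1 \<and> q * (1 - sc c * h) = 1 \<and> norm q \<le> K"
  shows "norm h \<noteq> 1"
proof
  assume h1: "norm h = 1"
  \<comment> \<open>By the resolvent identity the two resolvents differ by at most
    \<open>(1 - s) * K\<^sup>2\<close>, which this choice makes at most 1/8. The summand 1 covers
    \<open>K = 0\<close>.\<close>
  define s where "s = 1 - 1 / (8 * (K\<^sup>2 + 1))"
  have s: "0 \<le> s" "s < 1" by (auto simp: s_def add_nonneg_pos)
  have K2: "(1 - s) * K\<^sup>2 \<le> 1/8"
    using zero_le_power2[of K] by (simp add: s_def divide_le_eq add_nonneg_pos)
  have "resolvents_close h s (1/8)"
    unfolding resolvents_close_def
  proof (intro allI impI)
    fix c :: complex assume c: "cmod c = 1"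
    obtain q where q: "(1 - sc c * h) * q = 1" "q * (1 - sc c * h) = 1" "norm q \<le> K"
      using K[of c] c by auto
    have sc_s: "sc (of_real s * c) * h = s *\<^sub>R (sc c * h)" by (simp add: sc_mult)
    obtain r where r: "(1 - s *\<^sub>R (sc c * h)) * r = 1" "r * (1 - s *\<^sub>R (sc c * h)) = 1" "norm r \<le> K"
      using K[of "of_real s * c"] c s unfolding sc_s by (auto simp: norm_mult)
    have "q - r = q * ((1 - s *\<^sub>R (sc c * h)) - (1 - sc c * h)) * r"
    proof -
      have "q * ((1 - s *\<^sub>R (sc c * h)) - (1 - sc c * h)) * r =
          q * ((1 - s *\<^sub>R (sc c * h)) * r) - (q * (1 - sc c * h)) * r"
        by (simp only: left_diff_distrib right_diff_distrib mult.assoc)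
      then show ?thesis by (simp only: q r mult_1_left mult_1_right)
    qed
    also have "\<dots> = (1 - s) *\<^sub>R (q * (sc c * h) * r)"
      by (simp add: algebra_simps)
    finally have "norm (q - r) \<le> (1 - s) * (norm q * norm (sc c * h) * norm r)"
      using s order_trans[OF norm_mult_ineq[of "q * (sc c * h)" r]
          mult_right_mono[OF norm_mult_ineq[of q "sc c * h"] norm_ge_zero]]
      by (simp add: mult_left_mono)
    also have "\<dots> \<le> (1 - s) * (K * 1 * K)"
      using q(3) r(3) s h1 c order_trans[OF norm_ge_zero q(3)]
      by (intro mult_left_mono mult_mono) (simp_all add: norm_sc_mult)
    finally have "norm (q - r) \<le> 1/8" using K2 by (simp add: power2_eq_square)
    then show "\<exists>q r. (1 - sc c * h) * q = 1 \<and> q * (1 - sc c * h) = 1 \<and>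
       (1 - s *\<^sub>R (sc c * h)) * r = 1 \<and> r * (1 - s *\<^sub>R (sc c * h)) = 1 \<and> norm (q - r) \<le> 1/8"
      using q r by blast
  qed
  note RC = resolvents_close_power[OF this]
  obtain n where n: "s ^ n < 1/10"
    using real_arch_pow_inv[of "1/10" s] s by auto
  have "s ^ (2 ^ n) \<le> s ^ n" using s by (intro power_decreasing) auto
  with n have sn: "s ^ (2 ^ n) \<le> 1/10" "0 \<le> s ^ (2 ^ n)" using s by auto
  define y where "y = h ^ (2 ^ n)"
  have y: "norm y = 1" using norm_power_two_sa[OF h, of n] h1 by (simp add: y_def)
  obtain q r where q: "(1 - y) * q = 1"
      and r: "(1 - s ^ (2 ^ n) *\<^sub>R y) * r = 1" and qr: "norm (q - r) \<le> 1/8"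
    using RC[of n, unfolded resolvents_close_def, rule_format, of 1] by (auto simp: y_def)
  have r1: "r - 1 = s ^ (2 ^ n) *\<^sub>R (y * r)" using r by (simp add: algebra_simps)
  have yr: "norm (r - 1) \<le> 1/10 * norm r"
    unfolding r1 using mult_mono[OF sn(1), of "norm (y * r)" "norm r"] sn y norm_mult_ineq[of y r] by simp
  then have "norm r \<le> 10/9" using norm_triangle_ineq[of "r - 1" 1] by simp
  with yr have "norm (r - 1) \<le> 1/9" by simp
  then have q1: "norm (q - 1) \<le> 1/8 + 1/9" using qr norm_triangle_ineq[of "q - r" "r - 1"] by simp
  \<comment> \<open>A rewriting of \<open>(1 - y) * q = 1\<close>. With \<open>norm y = 1\<close> it
    bounds \<open>norm y\<close> by \<open>2 * (1/8 + 1/9)\<close>, which is less than 1.\<close>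
  have "y = (q - 1) - y * (q - 1)" using q by (simp add: algebra_simps)
  then have "norm y \<le> norm (q - 1) + norm y * norm (q - 1)"
    using norm_triangle_ineq4[of "q - 1" "y * (q - 1)"] norm_mult_ineq[of y "q - 1"] by simp
  then show False using q1 y by simp
qed

text \<open>Scale to norm 1 and split \<open>sc c * k\<close> into its real part, controlled by the
  two hypotheses, and its imaginary part, which is dissipative with bound 0. Then
  \<open>sc c * k - 1\<close> is dissipative with the same negative bound for all
  \<open>cmod c \<le> 1\<close>, so the resolvents are uniformly bounded and norm 1 is
  impossible.\<close>

lemma norm_le_if_dissipative:
  fixes h :: "'a::cstar_alg"
  assumes h: "adj h = h" and d: "dissipative m h" "dissipative m (- h)" and m: "0 \<le> m"
  shows "norm h \<le> m"
proof (rule ccontr)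
  assume "\<not> norm h \<le> m"
  then have lt: "m < norm h" "0 < norm h" using m by auto
  define k where "k = (1 / norm h) *\<^sub>R h"
  define n where "n = m / norm h"
  have n: "0 \<le> n" "n < 1" using lt m by (auto simp: n_def)
  have k: "adj k = k" "norm k = 1" using h lt by (auto simp: k_def adj_scaleR)
  have dk: "dissipative n k" "dissipative n (- k)"
    using dissipative_scale[OF d(1), of "1 / norm h"] dissipative_scale[OF d(2), of "1 / norm h"]
    by (auto simp: k_def n_def)
  have "norm k \<noteq> 1"
  proof (rule norm_neq_1_if_resolvent_bounded[OF k(1), of "2 / (1 - n)"])
    fix c :: complex assume c: "cmod c \<le> 1"
    have 1: "dissipative n (Re c *\<^sub>R k)"
    proof -
      have "dissipative (\<bar>Re c\<bar> * n) (Re c *\<^sub>R k)"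
        using dissipative_scale[OF dk(1), of "\<bar>Re c\<bar>"] dissipative_scale[OF dk(2), of "\<bar>Re c\<bar>"]
        by (cases "0 \<le> Re c") auto
      moreover have "\<bar>Re c\<bar> * n \<le> 1 * n"
        using n c abs_Re_le_cmod[of c] by (intro mult_right_mono) auto
      ultimately show ?thesis using dissipative_mono by auto
    qed
    have 2: "dissipative 0 (Im c *\<^sub>R (iu * k))"
      using dissipative_iu[of "Im c *\<^sub>R k"] k by (simp add: adj_scaleR)
    have 3: "dissipative (- 1) (- 1 :: 'a)" using dissipative_const[of "-1", where 'a='a] by simp
    have "dissipative (- (1 - n)) (sc c * k - 1)"
      using dissipative_add[OF dissipative_add[OF 1 2] 3] by (simp add: sc_def algebra_simps)
    then obtain y where "(sc c * k - 1) * y = 1" "y * (sc c * k - 1) = 1" "norm y \<le> 2 / (1 - n)"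
      using dissipative_inverse[of "1 - n" "sc c * k - 1"] n by auto
    then show "\<exists>q. (1 - sc c * k) * q = 1 \<and> q * (1 - sc c * k) = 1 \<and> norm q \<le> 2 / (1 - n)"
      by (intro exI[of _ "- y"]) (auto simp: algebra_simps)
  qed
  then show False using k by simp
qed

section \<open>Positive elements and square roots\<close>

definition psd :: "'a::cstar_alg \<Rightarrow> bool" where
  "psd h \<longleftrightarrow> adj h = h \<and> dissipative 0 (- h)"

lemma psd_sa: "psd h \<Longrightarrow> adj h = h"
  by (simp add: psd_def)

lemma psd_add: "psd a \<Longrightarrow> psd b \<Longrightarrow> psd (a + b)"
  using dissipative_add[of 0 "- a" 0 "- b"] by (simp add: psd_def adj_add)

lemma psd_scale: "psd a \<Longrightarrow> 0 \<le> r \<Longrightarrow> psd (r *\<^sub>R a)"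
  using dissipative_scale[of 0 "- a" r] by (simp add: psd_def adj_scaleR)

lemma psd_square: "adj h = h \<Longrightarrow> psd (h * h)"
  by (simp add: psd_def adj_mult dissipative_square)

lemma psd_if_close:
  assumes "adj h = h" "norm (M *\<^sub>R 1 - h) \<le> M"
  shows "psd h"
proof -
  have "dissipative M (M *\<^sub>R 1 - h)" using dissipative_norm assms(2) by (rule dissipative_mono)
  then have "dissipative (M + - M) ((M *\<^sub>R 1 - h) + (- M) *\<^sub>R 1)" using dissipative_const by (rule dissipative_add)
  then show ?thesis using assms(1) by (simp add: psd_def)
qed

lemma psd_bound:
  assumes "adj h = h" "norm h \<le> M"
  shows "psd (M *\<^sub>R 1 - h)"
proof -
  have "dissipative (norm h + - M) (h + (- M) *\<^sub>R 1)" by (intro dissipative_add dissipative_norm dissipative_const)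
  then have "dissipative 0 (h + (- M) *\<^sub>R 1)" by (rule dissipative_mono) (use assms in simp)
  then show ?thesis using assms(1) by (simp add: psd_def adj_diff adj_scaleR)
qed

lemma psd_norm_le:
  assumes "psd a" "psd (M *\<^sub>R 1 - a)" "0 \<le> M"
  shows "norm a \<le> M"
proof (rule norm_le_if_dissipative)
  show "dissipative M a"
    using dissipative_add[OF dissipative_const[of M, where 'a='a]] assms(2) by (fastforce simp: psd_def)
  show "dissipative M (- a)" using assms by (auto simp: psd_def intro: dissipative_mono)
qed (use assms in \<open>auto simp: psd_sa\<close>)

lemma psd_norm_mono:
  assumes "psd a" "psd b"
  shows "norm a \<le> norm (a + b)"
proof (rule psd_norm_le)
  have "psd (norm (a + b) *\<^sub>R 1 - (a + b))"
    using assms by (intro psd_bound) (auto simp: psd_sa adj_add)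
  from psd_add[OF this assms(2)] show "psd (norm (a + b) *\<^sub>R 1 - a)" by simp
qed (use assms in auto)

lemma psd_antisym: "psd a \<Longrightarrow> psd (- a) \<Longrightarrow> a = 0"
  using psd_norm_le[of a 0] by simp

lemma psd_norm_diff:
  assumes "psd h" "norm h \<le> M"
  shows "norm (M *\<^sub>R 1 - h) \<le> M"
proof (rule psd_norm_le)
  show "psd (M *\<^sub>R 1 - h)" using assms by (intro psd_bound) (auto simp: psd_sa)
  show "0 \<le> M" using assms norm_ge_zero order_trans by blast
qed (use assms in simp)

lemma psd_inverse:
  fixes h :: "'a::cstar_alg"
  assumes "psd h" "0 < m"
  shows "\<exists>y. (h + m *\<^sub>R 1) * y = 1 \<and> y * (h + m *\<^sub>R 1) = 1 \<and> norm y \<le> 2 / m \<and>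
    (\<forall>c. c * h = h * c \<longrightarrow> c * y = y * c)"
proof -
  have "dissipative (0 + - m) (- h + (- m) *\<^sub>R 1)"
    using assms(1) by (intro dissipative_add dissipative_const) (simp add: psd_def)
  then have "dissipative (- m) (- (h + m *\<^sub>R 1))" by simp
  from dissipative_inverse[OF this assms(2)] obtain y where
    "- (h + m *\<^sub>R 1) * y = 1" "y * - (h + m *\<^sub>R 1) = 1" "norm y \<le> 2 / m"
    "\<And>c. c * - (h + m *\<^sub>R 1) = - (h + m *\<^sub>R 1) * c \<Longrightarrow> c * y = y * c" by blast
  then show ?thesis by (intro exI[of _ "- y"]) (auto simp: algebra_simps)
qed

text \<open>The perturbation is by multiples of a contraction \<open>p\<close> instead of 1 because
  a supremum argument inside a corner moves along the unit \<open>p\<close> of that corner.\<close>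

lemma psd_closed:
  fixes x :: "'a::cstar_alg"
  assumes "\<And>e. e > 0 \<Longrightarrow> psd (x + e *\<^sub>R p)" "norm p \<le> 1" "adj x = x"
  shows "psd x"
  unfolding psd_def
proof
  show "dissipative 0 (- x)" unfolding dissipative_def
  proof (intro allI impI)
    fix e :: real assume e: "e > 0"
    have "dissipative (0 + e/2) (- (x + (e/2) *\<^sub>R p) + (e/2) *\<^sub>R p)"
    proof (rule dissipative_add)
      show "dissipative 0 (- (x + (e/2) *\<^sub>R p))" using assms(1)[of "e/2"] e by (simp add: psd_def)
      show "dissipative (e/2) ((e/2) *\<^sub>R p)"
        using e assms(2) by (intro dissipative_mono[OF dissipative_norm]) (simp add: mult_left_le)
    qed
    then have "dissipative (e/2) (- x)" by simp
    then obtain d where "d > 0" "norm (1 + d *\<^sub>R (- x)) \<le> 1 + d * (e/2 + e/2)"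
      using e unfolding dissipative_def by (meson half_gt_zero)
    then show "\<exists>d>0. norm (1 + d *\<^sub>R (- x)) \<le> 1 + d * (0 + e)" by (intro exI[of _ d]) simp
  qed
qed (rule assms(3))

section \<open>Square roots from the Taylor series of sqrt (1 - t)\<close>

definition sqrt_coeff :: "nat \<Rightarrow> real" where
  "sqrt_coeff n = pochhammer (- 1/2) n / fact n"

lemma sqrt_coeff_gbinomial: "sqrt_coeff n = (1/2 gchoose n) * (- 1) ^ n"
  by (simp add: sqrt_coeff_def gbinomial_pochhammer)

text \<open>Vandermonde convolution: the square of the series is 1 - t.\<close>

lemma sqrt_coeff_convolution:
  "(\<Sum>i\<le>n. sqrt_coeff i * sqrt_coeff (n - i)) = (if n = 0 then 1 else if n = 1 then - 1 else 0)"
proof -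
  have "(\<Sum>i\<le>n. sqrt_coeff i * sqrt_coeff (n - i)) =
      (\<Sum>i=0..n. ((1/2 gchoose i) * (1/2 gchoose (n - i))) * (- 1) ^ n)"
    by (intro sum.cong) (auto simp: sqrt_coeff_gbinomial mult_ac simp flip: power_add)
  also have "\<dots> = ((1/2 + 1/2) gchoose n) * (- 1) ^ n"
    by (simp only: gbinomial_Vandermonde flip: sum_distrib_right)
  also have "(1/2 + 1/2 :: real) gchoose n = of_nat (1 choose n)"
    by (simp add: binomial_gbinomial)
  finally show ?thesis
    by (cases n; cases "n - 1") auto
qed

lemma sqrt_coeff_nonpos: "sqrt_coeff (Suc n) \<le> 0"
proof -
  have "pochhammer (1/2 :: real) n > 0" by (intro pochhammer_pos) simp
  then show ?thesis by (simp add: sqrt_coeff_def pochhammer_rec divide_le_0_iff mult_le_0_iff)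
qed

lemma sum_sqrt_coeff: "(\<Sum>k\<le>n. sqrt_coeff k) = pochhammer (1/2) n / fact n"
proof -
  have "(\<Sum>k\<le>n. sqrt_coeff k) = (- 1) ^ n * ((1/2 - 1 :: real) gchoose n)"
    unfolding sqrt_coeff_gbinomial by (rule gbinomial_sum_lower_neg)
  also have "\<dots> = pochhammer (1/2) n / fact n"
    by (simp add: gbinomial_pochhammer)
  finally show ?thesis .
qed

text \<open>All coefficients after the first are nonpositive and the partial sums have a positive
  closed form. The series thus converges absolutely up to and including radius 1, which is needed
  for elements that are not invertible.\<close>

lemma sqrt_coeff_bound: "(\<Sum>k<n. \<bar>sqrt_coeff (Suc k)\<bar>) \<le> 1"
proof -
  have "(\<Sum>k<n. \<bar>sqrt_coeff (Suc k)\<bar>) = - (\<Sum>k<n. sqrt_coeff (Suc k))"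
    using sqrt_coeff_nonpos by (simp add: abs_of_nonpos sum_negf)
  also have "\<dots> = 1 - (\<Sum>k\<le>n. sqrt_coeff k)"
    by (simp add: sum.atMost_shift sqrt_coeff_def)
  also have "\<dots> \<le> 1"
    unfolding sum_sqrt_coeff using pochhammer_pos[of "1/2::real" n] by simp
  finally show ?thesis .
qed

text \<open>The Cauchy product squares the series to \<open>1 - k\<close>. The bound on
  \<open>1 - s\<close> is recorded because \<open>psd_if_close\<close> turns it into positivity of a
  self-adjoint root.\<close>

lemma sqrt_series:
  fixes k :: "'a::cstar_alg"
  assumes k: "norm k \<le> 1"
  shows "\<exists>s. s * s = 1 - k \<and> norm (1 - s) \<le> 1 \<and> (adj k = k \<longrightarrow> adj s = s) \<and>
    (\<forall>c. c * k = k * c \<longrightarrow> c * s = s * c)"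
proof -
  define f where "f n = sqrt_coeff n *\<^sub>R k ^ n" for n
  have kn: "norm (k ^ n) \<le> 1" for n
    using norm_power_ineq[of k n] power_le_one[OF norm_ge_zero k, of n] by simp
  have fb: "norm (f n) \<le> \<bar>sqrt_coeff n\<bar>" for n
    using kn[of n] by (simp add: f_def mult_left_le)
  have sS: "summable (\<lambda>n. \<bar>sqrt_coeff (Suc n)\<bar>)"
    by (rule summableI_nonneg_bounded[OF _ sqrt_coeff_bound]) simp
  then have "summable (\<lambda>n. \<bar>sqrt_coeff n\<bar>)"
    using summable_Suc_iff[of "\<lambda>n. \<bar>sqrt_coeff n\<bar>"] by simp
  then have sf: "summable (\<lambda>n. norm (f n))"
    by (rule summable_comparison_test[rotated]) (use fb in auto)
  define s where "s = suminf f"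
  have s: "f sums s" using summable_norm_cancel[OF sf] by (simp add: s_def summable_sums)
  have "(\<lambda>n. \<Sum>i\<le>n. f i * f (n - i)) sums (s * s)"
    using Cauchy_product_sums[OF sf sf] by (simp add: s_def)
  moreover have "(\<Sum>i\<le>n. f i * f (n - i)) = (if n = 0 then 1 else if n = 1 then - 1 else 0) *\<^sub>R k ^ n" for n
  proof -
    have "(\<Sum>i\<le>n. f i * f (n - i)) = (\<Sum>i\<le>n. (sqrt_coeff i * sqrt_coeff (n - i)) *\<^sub>R k ^ n)"
      by (intro sum.cong) (auto simp: f_def simp flip: power_add)
    then show ?thesis by (simp only: sqrt_coeff_convolution flip: scaleR_sum_left)
  qed
  moreover have "(\<lambda>n. (if n = 0 then 1 else if n = 1 then - 1 else 0) *\<^sub>R k ^ n) sums (1 - k)"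
    using sums_finite[of "{0, 1}" "\<lambda>n. (if n = 0 then 1 else if n = 1 then - 1 else 0) *\<^sub>R k ^ n"] by simp
  ultimately have 1: "s * s = 1 - k" using sums_unique2 by (metis (no_types, lifting) ext)
  have f0: "f 0 = 1" by (simp add: f_def sqrt_coeff_def)
  have "(\<lambda>n. f (Suc n)) sums (s - 1)" using s sums_Suc_iff[of f "s - 1"] by (simp add: f0)
  then have s1: "s - 1 = suminf (\<lambda>n. f (Suc n))" by (rule sums_unique)
  have sf1: "summable (\<lambda>n. norm (f (Suc n)))" using sf summable_Suc_iff[of "\<lambda>n. norm (f n)"] by simp
  have "norm (s - 1) \<le> suminf (\<lambda>n. norm (f (Suc n)))" unfolding s1 by (rule summable_norm[OF sf1])
  also have "\<dots> \<le> suminf (\<lambda>n. \<bar>sqrt_coeff (Suc n)\<bar>)" by (rule suminf_le[OF fb sf1 sS])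
  also have "\<dots> \<le> 1" by (rule suminf_le_const[OF sS sqrt_coeff_bound])
  finally have 2: "norm (1 - s) \<le> 1" by (simp add: norm_minus_commute)
  have 3: "adj s = s" if "adj k = k"
  proof -
    have "adj (k ^ n) = k ^ n" for n
      by (induction n) (auto simp: adj_mult that power_commutes)
    then have "(\<lambda>n. adj (f n)) = f" by (simp add: f_def adj_scaleR fun_eq_iff)
    then show ?thesis using bounded_linear.sums[OF bounded_linear_adj s] s sums_unique2 by metis
  qed
  have 4: "c * s = s * c" if c: "c * k = k * c" for c
  proof -
    have "c * k ^ n = k ^ n * c" for n
      by (induction n) (auto simp: c mult.assoc[symmetric], simp add: mult.assoc c)
    then have "(\<lambda>n. c * f n) sums (s * c)" using sums_mult2[OF s, of c] by (simp add: f_def)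
    then show ?thesis using sums_mult[OF s, of c] sums_unique2 by blast
  qed
  show ?thesis using 1 2 3 4 by blast
qed

lemma psd_sqrt:
  fixes h :: "'a::cstar_alg"
  assumes "psd h"
  shows "\<exists>s. psd s \<and> s * s = h \<and> (\<forall>c. c * h = h * c \<longrightarrow> c * s = s * c)"
proof (cases "h = 0")
  case True
  then show ?thesis using assms by (intro exI[of _ 0]) simp
next
  case False
  define N where "N = norm h"
  define k where "k = 1 - (1/N) *\<^sub>R h"
  have N: "N > 0" using False by (simp add: N_def)
  have "N *\<^sub>R k = N *\<^sub>R 1 - h" using N by (simp add: k_def scaleR_diff_right)
  then have "N * norm k \<le> N" using psd_norm_diff[OF assms, of N] N
    by (metis N_def abs_norm_cancel norm_scaleR order_refl)
  then have k: "norm k \<le> 1" "adj k = k"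
    using N assms by (simp_all add: k_def adj_diff adj_scaleR psd_sa)
  then obtain s where s: "s * s = 1 - k" "norm (1 - s) \<le> 1" "adj s = s"
      "\<And>c. c * k = k * c \<Longrightarrow> c * s = s * c"
    using sqrt_series[OF k(1)] by blast
  have "psd s" using s(2,3) psd_if_close[of s 1] by simp
  moreover have "(sqrt N *\<^sub>R s) * (sqrt N *\<^sub>R s) = h" using N s(1) by (simp add: k_def)
  moreover have "c * (sqrt N *\<^sub>R s) = (sqrt N *\<^sub>R s) * c" if "c * h = h * c" for c
  proof -
    have "c * s = s * c" using that by (intro s(4)) (simp add: k_def algebra_simps)
    then show ?thesis by simp
  qed
  moreover have "psd s \<Longrightarrow> psd (sqrt N *\<^sub>R s)" using N by (intro psd_scale) simp_all
  ultimately show ?thesis by blast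
qed

text \<open>The absolute value of \<open>s\<close>. Half of \<open>m + s\<close> and half of
  \<open>m - s\<close> then act as positive and negative parts, in place of a functional
  calculus.\<close>

lemma sa_abs:
  fixes s :: "'a::cstar_alg"
  assumes "adj s = s"
  shows "\<exists>m. psd m \<and> m * m = s * s \<and> (\<forall>c. c * s = s * c \<longrightarrow> c * m = m * c)"
proof -
  obtain m where "psd m" "m * m = s * s" "\<And>c. c * (s * s) = s * s * c \<Longrightarrow> c * m = m * c"
    using psd_sqrt[OF psd_square[OF assms]] by blast
  then show ?thesis by (metis mult.assoc)
qed

text \<open>Apart from 0, the elements \<open>y\<^sup>* y\<close> and \<open>y y\<^sup>*\<close> have the same spectrum, so both are
  nonnegative if the first one is nonpositive.\<close>

lemma adj_mult_nonpos:
  fixes y :: "'a::cstar_alg"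
  assumes yy: "adj y * y = - (w * w)" and w: "adj w = w"
  shows "y = 0"
proof (rule ccontr)
  assume "y \<noteq> 0"
  define M where "M = (norm y)\<^sup>2"
  have M: "M > 0" using \<open>y \<noteq> 0\<close> by (simp add: M_def)
  define h where "h = (1/M) *\<^sub>R (adj y * y)"
  define g where "g = (1/M) *\<^sub>R (y * adj y)"
  have h: "adj h = h" "norm h = 1" using M
    by (simp_all add: h_def adj_scaleR adj_mult norm_adj_mult flip: M_def)
  have dh: "dissipative 0 h"
    using psd_scale[OF psd_square[OF w], of "1/M"] M by (simp add: h_def yy psd_def)
  \<comment> \<open>Twice the real part of \<open>y\<close>, followed by twice its imaginary part.
    Half the sum of their squares is \<open>y * adj y + adj y * y\<close>, so adding
    \<open>w * w\<close> leaves \<open>y * adj y\<close>.\<close>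
  define p where "p = y + adj y"
  define q where "q = iu * (adj y - y)"
  have "adj p = p" "adj q = q"
    by (simp_all add: p_def q_def adj_add adj_mult adj_diff adj_iu algebra_simps iu_commute)
  then have "psd ((1/2) *\<^sub>R (p * p + q * q) + w * w)"
    by (intro psd_add psd_scale psd_square w) auto
  moreover have "(1/2) *\<^sub>R (p * p + q * q) + w * w = y * adj y"
  proof -
    have "q * q = (iu * iu) * ((adj y - y) * (adj y - y))"
      unfolding q_def by (metis iu_commute mult.assoc)
    then have "p * p + q * q = 2 *\<^sub>R (y * adj y + adj y * y)"
      by (simp add: iu_square p_def algebra_simps scaleR_2)
    then show ?thesis by (simp add: yy)
  qed
  ultimately have g: "adj g = g" "dissipative 0 (- g)"
    using psd_scale[of "y * adj y" "1/M"] M by (auto simp: g_def psd_def)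
  have inv: "\<exists>q. (1 - sc c * k) * q = 1 \<and> q * (1 - sc c * k) = 1 \<and> norm q \<le> 2"
    if k: "adj k = k" "dissipative 0 (Re c *\<^sub>R k)" for c and k :: 'a
  proof -
    have "dissipative 0 (Im c *\<^sub>R (iu * k))"
      using dissipative_iu[of "Im c *\<^sub>R k"] k by (simp add: adj_scaleR)
    from dissipative_add[OF dissipative_add[OF k(2) this] dissipative_const[of "-1"]]
    have "dissipative (- 1) (sc c * k - 1)" by (simp add: sc_def algebra_simps)
    then obtain y where "(sc c * k - 1) * y = 1" "y * (sc c * k - 1) = 1" "norm y \<le> 2"
      using dissipative_inverse[of 1 "sc c * k - 1"] by auto
    then show ?thesis by (intro exI[of _ "- y"]) (auto simp: algebra_simps)
  qed
  have "norm h \<noteq> 1"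
  proof (rule norm_neq_1_if_resolvent_bounded[OF h(1), of 3])
    fix c :: complex assume c: "cmod c \<le> 1"
    show "\<exists>q. (1 - sc c * h) * q = 1 \<and> q * (1 - sc c * h) = 1 \<and> norm q \<le> 3"
    proof (cases "0 \<le> Re c")
      case True
      then have "dissipative 0 (Re c *\<^sub>R h)" using dissipative_scale[OF dh, of "Re c"] by simp
      then show ?thesis using inv[OF h(1), of c] by fastforce
    next
      case False
      then have "dissipative 0 (Re c *\<^sub>R g)" using dissipative_scale[OF g(2), of "- Re c"] by simp
      then obtain q where q: "(1 - sc c * g) * q = 1" "q * (1 - sc c * g) = 1" "norm q \<le> 2"
        using inv[OF g(1)] by blast
      define z :: 'a where "z = sc (c / of_real M)"
      have z: "z * x = x * z" for x unfolding z_def by (rule sc_commute)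
      have z': "x * (z * t) = z * (x * t)" for x t by (metis mult.assoc z)
      have zM: "z * x = (1/M) *\<^sub>R (sc c * x)" for x
        by (simp add: z_def divide_inverse mult.commute[of c] sc_mult flip: of_real_inverse)
      have zg: "sc c * g = z * (y * adj y)" "sc c * h = z * (adj y * y)"
        by (simp_all add: zM g_def h_def)
      have e: "z * (y * (adj y * q)) = q - 1" "q * (z * (y * adj y)) = q - 1"
        using q(1,2) by (simp_all add: zg algebra_simps)
      \<comment> \<open>Jacobson's formula: the inverse \<open>q\<close> of
        \<open>1 - z * (y * adj y)\<close> yields the inverse
        \<open>1 + z * (adj y * (q * y))\<close> of \<open>1 - z * (adj y * y)\<close>. It transfers
        the resolvent bound from \<open>g\<close> to \<open>h\<close> on the half disc where
        \<open>g\<close> is controlled; the bound 3 is 1 + 2.\<close>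
      define r where "r = 1 + z * (adj y * (q * y))"
      have "(z * (adj y * y)) * (z * (adj y * (q * y))) = z * (adj y * ((z * (y * (adj y * q))) * y))"
        by (simp only: mult.assoc z'[of y "adj y * (q * y)"])
      also have "\<dots> = z * (adj y * (q * y)) - z * (adj y * y)"
        by (simp add: e algebra_simps)
      finally have r1: "(1 - sc c * h) * r = 1" by (simp add: zg r_def algebra_simps)
      have "(z * (adj y * (q * y))) * (z * (adj y * y)) = z * (adj y * ((q * (z * (y * adj y))) * y))"
        by (simp only: mult.assoc z'[of y "adj y * y"])
      also have "\<dots> = z * (adj y * (q * y)) - z * (adj y * y)"
        by (simp add: e algebra_simps)
      finally have r2: "r * (1 - sc c * h) = 1" by (simp add: zg r_def algebra_simps)
      have "norm (adj y * (q * y)) \<le> norm y * (2 * norm y)"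
        using norm_mult_ineq[of "adj y" "q * y"] norm_mult_ineq[of q y] mult_right_mono[OF q(3), of "norm y"]
        by (smt (verit) mult_left_mono norm_adj norm_ge_zero)
      then have "norm (z * (adj y * (q * y))) \<le> (1/M) * (1 * (norm y * (2 * norm y)))"
        unfolding zM norm_scaleR norm_sc_mult using M c
        by (intro mult_mono) auto
      also have "\<dots> = 2" using \<open>y \<noteq> 0\<close> by (simp add: M_def power2_eq_square)
      finally have "norm r \<le> 3" using norm_triangle_ineq[of 1 "z * (adj y * (q * y))"] by (simp add: r_def)
      then show ?thesis using r1 r2 by blast
    qed
  qed
  then show False using h by simp
qed

text \<open>Let \<open>n\<close> be the negative part of \<open>adj x * x\<close>. Then
  \<open>adj (x * n) * (x * n)\<close> is minus the cube of \<open>n\<close>, hence minus a square,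
  so \<open>x * n = 0\<close> by the preceding lemma and \<open>n\<close> vanishes.\<close>

lemma psd_adj_mult:
  fixes x :: "'a::cstar_alg"
  shows "psd (adj x * x)"
proof -
  define s where "s = adj x * x"
  have s: "adj s = s" by (simp add: s_def adj_mult)
  obtain m where m: "psd m" "m * m = s * s" "\<And>c. c * s = s * c \<Longrightarrow> c * m = m * c"
    using sa_abs[OF s] by blast
  obtain t where t: "psd t" "t * t = m" "\<And>c. c * m = m * c \<Longrightarrow> c * t = t * c"
    using psd_sqrt[OF m(1)] by blast
  have sm: "s * m = m * s" using m(3)[of s] by simp
  define n where "n = (1/2) *\<^sub>R (m - s)"
  have n: "adj n = n" using s m(1) by (simp add: n_def adj_scaleR adj_diff psd_sa)
  have sn: "s * n = - (n * n)" and mn: "n * m = n * n"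
    by (simp_all add: n_def algebra_simps m(2) sm flip: scaleR_add_left)
  have "n * m = m * n" by (simp add: n_def algebra_simps sm)
  then have nt: "n * t = t * n" by (rule t(3))
  have ntsa: "adj (n * t) = n * t" using n t(1) nt by (simp add: adj_mult psd_sa)
  \<comment> \<open>The cube of \<open>n\<close> is the square of \<open>n * t\<close>, since
    \<open>t\<close> is a root of \<open>m\<close> and \<open>n * m = n * n\<close>.\<close>
  have w: "(n * t) * (n * t) = n * (n * n)"
  proof -
    have "(n * t) * (n * t) = n * ((t * n) * t)" by (simp only: mult.assoc)
    also have "\<dots> = n * (n * (t * t))" by (simp only: nt[symmetric] mult.assoc)
    finally show ?thesis by (simp add: t(2) mn)
  qed
  have "adj (x * n) * (x * n) = n * (s * n)" by (simp add: adj_mult n s_def mult.assoc)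
  also have "\<dots> = - ((n * t) * (n * t))" by (simp add: sn w)
  finally have "x * n = 0" using ntsa by (rule adj_mult_nonpos)
  then have "s * n = 0" by (simp add: s_def mult.assoc)
  then have "n = 0" using sn norm_square_sa[OF n] by simp
  then have "s = m" by (simp add: n_def)
  then show ?thesis using m(1) by (simp add: s_def)
qed

section \<open>Projections and spectral cut-downs\<close>

text \<open>A norm bound becomes an algebraic identity between squares and a multiple of 1, a form
  that unital star-homomorphisms preserve.\<close>

lemma norm_square_adj_mult_complement:
  fixes x :: "'a::cstar_alg"
  assumes "norm x \<le> M"
  shows "\<exists>b. M\<^sup>2 *\<^sub>R 1 - adj x * x = adj b * b"
proof -
  have "psd (M\<^sup>2 *\<^sub>R 1 - adj x * x)"
    using assms by (intro psd_bound) (auto simp: adj_mult norm_adj_mult intro: power_mono)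
  then show ?thesis using psd_sqrt psd_sa by metis
qed

lemma add_adj_mult:
  fixes x y :: "'a::cstar_alg"
  shows "\<exists>b. adj x * x + adj y * y = adj b * b \<and> norm x \<le> norm b"
proof -
  obtain b where b: "psd b" "b * b = adj x * x + adj y * y"
    using psd_sqrt[OF psd_add[OF psd_adj_mult psd_adj_mult]] by metis
  then have e: "adj x * x + adj y * y = adj b * b" by (simp add: psd_sa)
  have "(norm x)\<^sup>2 \<le> (norm b)\<^sup>2"
    using psd_norm_mono[OF psd_adj_mult psd_adj_mult, of x y] by (simp only: e norm_adj_mult)
  then have "norm x \<le> norm b" by (rule power2_le_imp_le) simp
  then show ?thesis using e by blast
qed

lemma adj_mult_sqrt:
  fixes x :: "'a::cstar_alg"
  shows "\<exists>s. adj s = s \<and> adj x * x = s * s"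
  using psd_sqrt[OF psd_adj_mult, of x] psd_sa by metis

text \<open>\<open>y\<close> is the positive part of \<open>z - \<delta>\<close>, and
  \<open>g\<close> inverts the absolute value of \<open>z - \<delta>\<close> plus
  \<open>\<delta>\<close>. Where \<open>y\<close> is supported, this absolute value is
  \<open>z - \<delta>\<close> itself, so \<open>g\<close> acts there as an inverse of
  \<open>z\<close>, with a bound depending on \<open>\<delta>\<close> alone.\<close>

lemma spectral_cutdown:
  fixes w :: "'a::cstar_alg"
  defines "z \<equiv> adj w * w"
  assumes \<delta>: "0 < \<delta>" "\<delta> < norm z"
  shows "\<exists>y g. adj y = y \<and> y \<noteq> 0 \<and> y * (g * z) = y \<and> z * (g * y) = y \<and> norm g \<le> 2 / \<delta>"
proof -
  have z: "psd z" unfolding z_def by (rule psd_adj_mult)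
  define s where "s = z - \<delta> *\<^sub>R 1"
  have s: "adj s = s" using z by (simp add: s_def adj_diff adj_scaleR psd_sa)
  obtain m where m: "psd m" "m * m = s * s" "\<And>c. c * s = s * c \<Longrightarrow> c * m = m * c"
    using sa_abs[OF s] by blast
  have sm: "s * m = m * s" using m(3)[of s] by simp
  obtain g where g: "(m + \<delta> *\<^sub>R 1) * g = 1" "g * (m + \<delta> *\<^sub>R 1) = 1" "norm g \<le> 2 / \<delta>"
      "\<And>c. c * m = m * c \<Longrightarrow> c * g = g * c"
    using psd_inverse[OF m(1) \<delta>(1)] by blast
  define y where "y = (1/2) *\<^sub>R (m + s)"
  have y: "adj y = y" using s m(1) by (simp add: y_def adj_scaleR adj_add psd_sa)
  have zs: "z = s + \<delta> *\<^sub>R 1" by (simp add: s_def)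
  have "y * s = y * m" "s * y = m * y" by (simp_all add: y_def algebra_simps m(2) sm)
  then have yz: "y * z = y * (m + \<delta> *\<^sub>R 1)" "z * y = (m + \<delta> *\<^sub>R 1) * y"
    by (simp_all add: zs algebra_simps)
  have "z * m = m * z" using sm by (simp add: zs algebra_simps)
  then have zg: "z * g = g * z" by (rule g(4))
  have "y * (g * z) = y" using yz(1) g(1) zg by (metis mult.assoc mult.right_neutral)
  moreover have "z * (g * y) = y" using yz(2) g(2) zg by (metis mult.assoc mult_1)
  \<comment> \<open>If the positive part vanished, \<open>\<delta> - z\<close> would be positive and
    \<open>norm z\<close> at most \<open>\<delta>\<close>.\<close>
  moreover have "y \<noteq> 0"
  proof
    assume "y = 0"
    then have "m + s = 0" by (simp add: y_def)
    then have "m = \<delta> *\<^sub>R 1 - z" by (simp add: s_def eq_neg_iff_add_eq_0[symmetric])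
    then have "norm z \<le> \<delta>" using psd_norm_le[OF z, of \<delta>] m(1) \<delta> by simp
    then show False using \<delta> by simp
  qed
  ultimately show ?thesis using y g(3) by blast
qed

text \<open>The witness is the square root of \<open>T\<close> times the inverse of
  \<open>T\<close>; the two commute.\<close>

lemma psd_inverse_sqrt:
  fixes T :: "'a::cstar_alg"
  assumes T: "adj T = T" "norm (1 - T) < 1"
  shows "\<exists>w. adj w = w \<and> w * T * w = 1 \<and> (\<forall>c. c * T = T * c \<longrightarrow> c * w = w * c)"
proof -
  have "psd T" using T psd_if_close[of T 1] by simp
  then obtain q where q: "psd q" "q * q = T" "\<And>c. c * T = T * c \<Longrightarrow> c * q = q * c"
    using psd_sqrt by blast
  obtain i where i: "T * i = 1" "i * T = 1" "\<And>c. c * (1 - T) = (1 - T) * c \<Longrightarrow> c * i = i * c"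
    using one_minus_inverse[OF T(2)] by auto
  have ci: "c * i = i * c" if "c * T = T * c" for c
    by (rule i(3)) (simp add: algebra_simps that)
  have "adj i = adj i * (T * i)" by (simp add: i)
  also have "\<dots> = adj (T * i) * i" by (simp add: adj_mult T(1) mult.assoc)
  finally have "adj i = i" by (simp add: i)
  moreover have qT: "q * T = T * q" by (simp add: mult.assoc flip: q(2))
  ultimately have "adj (q * i) = q * i" using ci[OF qT] q(1) by (simp add: adj_mult psd_sa)
  moreover have "(q * i) * T * (q * i) = 1"
    using i q(2) qT ci[OF qT] by (metis mult.assoc mult.right_neutral)
  moreover have "c * (q * i) = (q * i) * c" if "c * T = T * c" for c
    using ci[OF that] q(3)[OF that] by (metis mult.assoc)
  ultimately show ?thesis by blast
qed

text \<open>Adding \<open>1 - r\<close> makes \<open>k * y * y * adj k\<close>, which is close to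
  \<open>r\<close>, invertible in the whole algebra. The inverse square root \<open>w\<close> of the
  sum commutes with \<open>r\<close>, and normalising \<open>y * adj k\<close> by \<open>w\<close>
  gives a partial isometry with source \<open>r\<close> whose range projection has \<open>y\<close>
  on both sides.\<close>

lemma projection_near_conjugate:
  fixes r k y :: "'a::cstar_alg"
  assumes r: "r * r = r" "adj r = r" and y: "adj y = y"
    and rk: "r * k = k" and near: "norm (r - k * y * y * adj k) < 1"
  shows "\<exists>v c. adj v * v = r \<and> v * adj v = y * c * y"
proof -
  define c where "c = k * y * y * adj k"
  define T where "T = c + (1 - r)"
  have kr: "adj k * r = adj k" using rk r(2) by (metis adj_mult)
  have rc: "r * c = c" using rk by (simp add: c_def flip: mult.assoc)
  have cr: "c * r = c" using kr by (simp add: c_def mult.assoc)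
  have "adj T = T" by (simp add: T_def c_def adj_add adj_diff adj_mult r y mult.assoc)
  moreover have "norm (1 - T) < 1" using near by (simp add: T_def c_def)
  ultimately obtain w where w: "adj w = w" "w * T * w = 1" "\<And>c. c * T = T * c \<Longrightarrow> c * w = w * c"
    using psd_inverse_sqrt by blast
  have rT: "r * T = c" "T * r = c" by (simp_all add: T_def algebra_simps rc cr r)
  then have rw: "r * w = w * r" by (intro w(3)) simp
  define v where "v = y * adj k * w * r"
  have "adj v * v = r * (w * (k * y * y * adj k) * w) * r"
    by (simp add: v_def adj_mult r w y mult.assoc)
  also have "\<dots> = r * (w * (T * r) * w) * r" by (simp add: rT flip: c_def)
  also have "\<dots> = r * ((w * T * w) * r) * r" using rw by (simp add: mult.assoc)
  also have "\<dots> = r" by (simp add: w r)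
  finally have 1: "adj v * v = r" .
  have "v * adj v = y * (adj k * w * r * r * w * k) * y"
    by (simp only: v_def adj_mult adj_adj r(2) w(1) y mult.assoc)
  with 1 show ?thesis by blast
qed

text \<open>\<open>r\<close> is the spectral projection of \<open>c\<close> above 1/2, obtained as
  half of \<open>1 + u\<close> from the sign \<open>u\<close> of
  \<open>s = 2 *\<^sub>R c - 1\<close>. The bound \<open>e \<le> 1/8\<close> makes
  \<open>s * s\<close> invertible, and the distance to \<open>c\<close> is at most half of
  \<open>norm (1 - m)\<close>, which is at most \<open>8 * e\<close>.\<close>

lemma projection_near_almost_projection:
  fixes c :: "'a::cstar_alg"
  assumes c: "adj c = c" "norm (c * c - c) \<le> e" "e \<le> 1/8"
  shows "\<exists>r. r * r = r \<and> adj r = r \<and> norm (r - c) \<le> 4 * e"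
proof -
  define s where "s = 2 *\<^sub>R c - 1"
  have s: "adj s = s" using c by (simp add: s_def adj_diff adj_scaleR)
  have "s * s - 1 = 4 *\<^sub>R (c * c - c)"
    by (simp add: s_def algebra_simps) (simp flip: scaleR_add_left)
  then have ss: "norm (s * s - 1) \<le> 4 * e" using c(2) by simp
  obtain m where m: "psd m" "m * m = s * s" "\<And>c. c * s = s * c \<Longrightarrow> c * m = m * c"
    using sa_abs[OF s] by blast
  have sm: "s * m = m * s" using m(3)[of s] by simp
  obtain q where q: "(m + 1) * q = 1" "q * (m + 1) = 1" "norm q \<le> 2"
    using psd_inverse[OF m(1), of 1] by auto
  have "m - 1 = (m - 1) * ((m + 1) * q)" by (simp add: q)
  also have "\<dots> = (s * s - 1) * q" by (simp add: algebra_simps flip: m(2))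
  finally have "norm (m - 1) \<le> (4 * e) * 2"
    using norm_mult_ineq[of "s * s - 1" q]
      mult_mono[OF ss q(3) order_trans[OF norm_ge_zero ss] norm_ge_zero] by simp
  then have m1: "norm (1 - m) \<le> 8 * e" by (simp add: norm_minus_commute)
  have "norm (1 - s * s) < 1" using ss c(3) by (simp add: norm_minus_commute)
  from one_minus_inverse[OF this] obtain i where i: "(s * s) * i = 1" "i * (s * s) = 1"
      and ic: "\<And>c. c * (1 - s * s) = (1 - s * s) * c \<Longrightarrow> c * i = i * c" by auto
  have si: "s * i = i * s" and mi: "m * i = i * m"
    by (rule ic, simp add: algebra_simps, rule ic, simp add: algebra_simps flip: m(2))
  define u where "u = s * (m * i)"
  have uu: "u * u = 1"
  proof -
    have "u * u = (s * s) * ((m * m) * i) * i"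
      unfolding u_def by (metis si mi sm mult.assoc)
    then show ?thesis using i by (simp add: m(2))
  qed
  have "adj i = adj i * ((s * s) * i)" by (simp add: i)
  also have "\<dots> = adj ((s * s) * i) * i" by (simp add: adj_mult s mult.assoc)
  finally have "adj i = i" by (simp add: i)
  then have ua: "adj u = u" using s psd_sa[OF m(1)] si mi sm
    by (simp add: u_def adj_mult) (metis mult.assoc)
  have "norm u = 1" using norm_adj_mult[of u] norm_ge_zero[of u]
    by (simp add: ua uu) (metis norm_ge_zero power2_eq_1_iff power_eq_iff_eq_base power_one zero_less_numeral zero_le_one)
  have "u * m = s * ((m * m) * i)" unfolding u_def by (metis mi mult.assoc)
  then have um: "u * m = s" using i by (simp add: m(2))
  define r where "r = (1/2) *\<^sub>R (1 + u)"
  have "r * r = r" by (simp add: r_def algebra_simps uu flip: scaleR_add_left)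
  moreover have "adj r = r" by (simp add: r_def adj_scaleR adj_add ua)
  moreover have "norm (r - c) \<le> 4 * e"
  proof -
    have "r - c = (1/2) *\<^sub>R (u * (1 - m))" by (simp add: r_def right_diff_distrib um) (simp add: s_def algebra_simps)
    then have "norm (r - c) \<le> (1/2) * (norm u * norm (1 - m))" using norm_mult_ineq[of u "1 - m"] by simp
    then show ?thesis using m1 \<open>norm u = 1\<close> by simp
  qed
  ultimately show ?thesis by blast
qed

lemma psd_conjugate:
  fixes a k :: "'a::cstar_alg"
  assumes "psd a"
  shows "psd (adj k * a * k)"
proof -
  obtain t where t: "psd t" "t * t = a" using psd_sqrt[OF assms] by blast
  have "adj k * a * k = adj (t * k) * (t * k)"
    using t by (simp add: adj_mult psd_sa mult.assoc flip: t(2))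
  then show ?thesis using psd_adj_mult by metis
qed

lemma norm_projection_le: "p * p = p \<Longrightarrow> adj p = p \<Longrightarrow> norm (p::'a::cstar_alg) \<le> 1"
  using norm_adj_mult[of p] by (auto simp: power2_eq_square)

text \<open>For every real \<open>l\<close> the positive and negative parts of
  \<open>h - l *\<^sub>R p\<close> in the corner have product 0. Without a splitting one of them
  always vanishes, so \<open>h\<close> is comparable with every multiple of \<open>p\<close>, and
  the largest multiple below \<open>h\<close> must equal \<open>h\<close>.\<close>

lemma corner_scalar_or_split:
  fixes p h :: "'a::cstar_alg"
  assumes p: "p * p = p" "adj p = p" and h: "adj h = h" "p * h = h" "h * p = h"
    and ns: "\<And>l. h \<noteq> l *\<^sub>R p"
  shows "\<exists>x y. adj x = x \<and> x \<noteq> 0 \<and> x * p = x \<and> y \<noteq> 0 \<and> p * y = y \<and> x * y = 0"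
proof (rule ccontr)
  assume neg: "\<not> ?thesis"
  have p0: "p \<noteq> 0" using ns[of 0] h by auto
  have pp: "psd p" using psd_square[OF p(2)] p(1) by simp
  have dich: "psd (l *\<^sub>R p - h) \<or> psd (h - l *\<^sub>R p)" for l
  proof -
    define s where "s = h - l *\<^sub>R p"
    have s: "adj s = s" "p * s = s" "s * p = s"
      using p h by (simp_all add: s_def adj_diff adj_scaleR algebra_simps)
    obtain m where m: "psd m" "m * m = s * s" "\<And>c. c * s = s * c \<Longrightarrow> c * m = m * c"
      using sa_abs[OF s(1)] by blast
    have pm: "p * m = m * p" using s by (intro m(3)) simp
    have sm: "s * m = m * s" using m(3)[of s] by simp
    have "p * m * p = p * m" using pm p(1) by (simp add: mult.assoc)
    then have psdpm: "psd (p * m)" using psd_conjugate[OF m(1), of p] p(2) by simp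
    define x where "x = p * (m + s)"
    define y where "y = p * (m - s)"
    have pp': "p * (p * t) = p * t" for t by (simp add: p(1) flip: mult.assoc)
    have "adj x = x" using s m(1) p pm by (simp add: x_def adj_mult adj_add psd_sa algebra_simps)
    moreover have "x * p = x" using s pm by (simp add: x_def algebra_simps pp' p(1))
    moreover have "p * y = y" by (simp add: y_def pp')
    moreover have "x * y = 0"
    proof -
      have "x * y = p * ((m + s) * p) * (m - s)" by (simp add: x_def y_def mult.assoc)
      also have "(m + s) * p = p * (m + s)" using s pm by (simp add: algebra_simps)
      also have "p * (p * (m + s)) * (m - s) = p * ((m + s) * (m - s))" by (simp add: pp' mult.assoc)
      also have "(m + s) * (m - s) = 0" by (simp add: algebra_simps m(2) sm)
      finally show ?thesis by simp
    qed
    ultimately have "x = 0 \<or> y = 0" using neg by blast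
    then have "p * m = - s \<or> p * m = s" using s(2) by (auto simp: x_def y_def algebra_simps add_eq_0_iff)
    then show ?thesis using psdpm by (auto simp: s_def)
  qed
  have lower: "psd (h + norm h *\<^sub>R p)" and upper: "psd (norm h *\<^sub>R p - h)"
  proof -
    have "adj p * (norm h *\<^sub>R 1 - h) * p = norm h *\<^sub>R p - h"
      "adj p * (norm h *\<^sub>R 1 - (- h)) * p = h + norm h *\<^sub>R p"
      using p h by (simp_all add: algebra_simps)
    then show "psd (h + norm h *\<^sub>R p)" "psd (norm h *\<^sub>R p - h)"
      using psd_conjugate[OF psd_bound, of h "norm h" p] psd_conjugate[OF psd_bound, of "- h" "norm h" p] h
      by auto
  qed
  define S where "S = {l. psd (h - l *\<^sub>R p)}"
  have "- norm h \<in> S" using lower by (simp add: S_def)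
  have ub: "l \<le> norm h" if "l \<in> S" for l
  proof (rule ccontr)
    assume l: "\<not> l \<le> norm h"
    have "psd ((h - l *\<^sub>R p) + (norm h *\<^sub>R p - h))" using that upper by (intro psd_add) (auto simp: S_def)
    then have "psd ((1 / (l - norm h)) *\<^sub>R ((h - l *\<^sub>R p) + (norm h *\<^sub>R p - h)))"
      using l by (intro psd_scale) auto
    also have "(h - l *\<^sub>R p) + (norm h *\<^sub>R p - h) = (l - norm h) *\<^sub>R (- p)" by (simp add: algebra_simps)
    finally have "psd (- p)" using l by simp
    then show False using psd_antisym[OF pp] p0 by simp
  qed
  then have bdd: "bdd_above S" by (auto simp: bdd_above_def)
  define l0 where "l0 = Sup S"
  have np: "norm p \<le> 1" using p by (rule norm_projection_le)
  have "psd (h - l0 *\<^sub>R p)"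
  proof (rule psd_closed[OF _ np])
    fix e :: real assume e: "e > 0"
    then obtain l where l: "l \<in> S" "l0 - e < l"
      using less_cSup_iff[of S "l0 - e"] bdd \<open>- norm h \<in> S\<close> by (auto simp: l0_def)
    have "psd ((h - l *\<^sub>R p) + (l - l0 + e) *\<^sub>R p)"
      using l pp by (intro psd_add psd_scale) (auto simp: S_def)
    then show "psd (h - l0 *\<^sub>R p + e *\<^sub>R p)" by (simp add: algebra_simps)
  qed (use p h in \<open>simp add: adj_diff adj_scaleR\<close>)
  moreover have "psd (l0 *\<^sub>R p - h)"
  proof (rule psd_closed[OF _ np])
    fix e :: real assume e: "e > 0"
    then have "l0 + e \<notin> S" using cSup_upper[OF _ bdd, of "l0 + e"] by (auto simp: l0_def)
    then have "psd ((l0 + e) *\<^sub>R p - h)" using dich[of "l0 + e"] by (auto simp: S_def)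
    then show "psd (l0 *\<^sub>R p - h + e *\<^sub>R p)" by (simp add: algebra_simps)
  qed (use p h in \<open>simp add: adj_diff adj_scaleR\<close>)
  ultimately have "h - l0 *\<^sub>R p = 0" using psd_antisym[of "h - l0 *\<^sub>R p"] by simp
  then show False using ns[of l0] by simp
qed

section \<open>The product of all unital C*-algebras\<close>

definition unital_cstar :: "('a, 'm) cstar_scheme \<Rightarrow> bool" where
  "unital_cstar A \<longleftrightarrow> cstar_algebra A \<and> Group.monoid A"

lemma unital_pre: "unital_cstar A \<Longrightarrow> pre_cstar_algebra A"
  by (simp add: unital_cstar_def cstar_algebra_def)

lemma unital_module: "unital_cstar A \<Longrightarrow> module complex_ring A"
  by (simp add: unital_pre pre_cstar_algebra.axioms(1))

lemma unital_abelian: "unital_cstar A \<Longrightarrow> abelian_group A"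
  using unital_module unfolding module_def by blast

lemma unital_ring: "unital_cstar A \<Longrightarrow> ring A"
  by (rule ringI)
    (auto simp: unital_abelian pre_cstar_algebra.distr_left[OF unital_pre]
      pre_cstar_algebra.distr_right[OF unital_pre] unital_cstar_def)

lemmas unital_simps =
  monoid.r_one[OF ring.is_monoid[OF unital_ring]]
  ring.ring_simprules[OF unital_ring]
  module.smult_closed[OF unital_module, simplified]
  module.smult_l_distr[OF unital_module, simplified]
  module.smult_r_distr[OF unital_module, simplified]
  module.smult_assoc1[OF unital_module, simplified]
  module.smult_one[OF unital_module, simplified]
  pre_cstar_algebra.smult_mult_left[OF unital_pre]
  pre_cstar_algebra.smult_mult_right[OF unital_pre]
  pre_cstar_algebra.star_closed[OF unital_pre]
  pre_cstar_algebra.star_star[OF unital_pre]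
  pre_cstar_algebra.star_add[OF unital_pre]
  pre_cstar_algebra.star_smult[OF unital_pre]
  pre_cstar_algebra.star_mult[OF unital_pre]
  pre_cstar_algebra.nrm_nonneg[OF unital_pre]

lemmas unital_nrm =
  pre_cstar_algebra.nrm_eq_0[OF unital_pre]
  pre_cstar_algebra.nrm_triangle[OF unital_pre]
  pre_cstar_algebra.nrm_smult[OF unital_pre]
  pre_cstar_algebra.nrm_mult[OF unital_pre]
  pre_cstar_algebra.nrm_star_mult[OF unital_pre]
  pre_cstar_algebra.nrm_uminus[OF unital_pre]

lemma unital_star_one:
  assumes "unital_cstar A"
  shows "star A \<one>\<^bsub>A\<^esub> = \<one>\<^bsub>A\<^esub>"
proof -
  note u = unital_simps[OF assms]
  have "star A (\<one>\<^bsub>A\<^esub> \<otimes>\<^bsub>A\<^esub> star A \<one>\<^bsub>A\<^esub>) = star A (star A \<one>\<^bsub>A\<^esub>) \<otimes>\<^bsub>A\<^esub> star A \<one>\<^bsub>A\<^esub>"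
    by (rule pre_cstar_algebra.star_mult[OF unital_pre[OF assms]]) (simp_all add: u)
  then show ?thesis by (simp add: u)
qed

lemma unital_minus_split:
  assumes "unital_cstar A" "x \<in> carrier A" "y \<in> carrier A" "z \<in> carrier A"
  shows "x \<ominus>\<^bsub>A\<^esub> z = (x \<ominus>\<^bsub>A\<^esub> y) \<oplus>\<^bsub>A\<^esub> (y \<ominus>\<^bsub>A\<^esub> z)"
proof -
  interpret ring A using assms(1) by (rule unital_ring)
  show ?thesis using assms(2-) by (simp add: a_minus_def a_assoc r_neg1)
qed

lemma unital_nrm_triangle_minus:
  assumes "unital_cstar A" "x \<in> carrier A" "y \<in> carrier A" "z \<in> carrier A"
  shows "nrm A (x \<ominus>\<^bsub>A\<^esub> z) \<le> nrm A (x \<ominus>\<^bsub>A\<^esub> y) + nrm A (y \<ominus>\<^bsub>A\<^esub> z)"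
  unfolding unital_minus_split[OF assms] using assms
  by (intro unital_nrm(2)) (auto intro: ring.ring_simprules(4)[OF unital_ring])

lemma unital_nrm_one:
  assumes "unital_cstar A"
  shows "nrm A \<one>\<^bsub>A\<^esub> \<le> 1"
proof -
  have "nrm A \<one>\<^bsub>A\<^esub> = (nrm A \<one>\<^bsub>A\<^esub>)\<^sup>2"
    using unital_nrm(5)[OF assms, of "\<one>\<^bsub>A\<^esub>"] by (simp add: unital_star_one assms unital_simps)
  then show ?thesis by (auto simp: power2_eq_square)
qed

lemma unital_smult_zero: "unital_cstar A \<Longrightarrow> c \<odot>\<^bsub>A\<^esub> \<zero>\<^bsub>A\<^esub> = \<zero>\<^bsub>A\<^esub>"
  by (rule module.smult_r_null[OF unital_module]) auto

lemma unital_zero_smult: "unital_cstar A \<Longrightarrow> x \<in> carrier A \<Longrightarrow> 0 \<odot>\<^bsub>A\<^esub> x = \<zero>\<^bsub>A\<^esub>"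
  using module.smult_l_null[OF unital_module] by simp

lemma unital_star_zero:
  assumes "unital_cstar A"
  shows "star A \<zero>\<^bsub>A\<^esub> = \<zero>\<^bsub>A\<^esub>"
proof -
  have "star A (0 \<odot>\<^bsub>A\<^esub> \<zero>\<^bsub>A\<^esub>) = cnj 0 \<odot>\<^bsub>A\<^esub> star A \<zero>\<^bsub>A\<^esub>"
    using assms by (intro pre_cstar_algebra.star_smult unital_pre) (simp_all add: unital_simps)
  then show ?thesis using assms by (simp add: unital_smult_zero unital_zero_smult unital_simps)
qed

lemma unital_nrm_zero: "unital_cstar A \<Longrightarrow> nrm A \<zero>\<^bsub>A\<^esub> = 0"
  by (simp add: unital_nrm(1) unital_simps)

text \<open>HOL has no types depending on terms, so a carrier-based algebra is not a type. The
  bounded product of all unital C*-algebras on subsets of one type is a type, however, and it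
  contains each factor. The factor \<open>complex\<close> ensures that it is nonzero.\<close>

typedef 'a cprod = "{(f :: 'a cstar \<Rightarrow> 'a, c :: complex).
    (\<forall>A. if unital_cstar A then f A \<in> carrier A else f A = undefined) \<and>
    (\<exists>K. \<forall>A. unital_cstar A \<longrightarrow> nrm A (f A) \<le> K)}"
proof
  show "(\<lambda>A. if unital_cstar A then \<zero>\<^bsub>A\<^esub> else undefined, 0) \<in> {(f :: 'a cstar \<Rightarrow> 'a, c :: complex).
    (\<forall>A. if unital_cstar A then f A \<in> carrier A else f A = undefined) \<and>
    (\<exists>K. \<forall>A. unital_cstar A \<longrightarrow> nrm A (f A) \<le> K)}"
    by (auto simp: unital_simps unital_nrm_zero intro!: exI[of _ 0])
qed

definition pcomp :: "'a cprod \<Rightarrow> 'a cstar \<Rightarrow> 'a" where "pcomp x = fst (Rep_cprod x)"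
definition pscal :: "'a cprod \<Rightarrow> complex" where "pscal x = snd (Rep_cprod x)"
definition mkprod :: "('a cstar \<Rightarrow> 'a) \<Rightarrow> complex \<Rightarrow> 'a cprod" where
  "mkprod f c = Abs_cprod (\<lambda>A. if unital_cstar A then f A else undefined, c)"

lemma pcomp_closed: "unital_cstar A \<Longrightarrow> pcomp x A \<in> carrier A"
  and pcomp_bounded: "\<exists>K. \<forall>A. unital_cstar A \<longrightarrow> nrm A (pcomp x A) \<le> K"
  and pcomp_undefined: "\<not> unital_cstar A \<Longrightarrow> pcomp x A = undefined"
  using Rep_cprod[of x] by (auto simp: pcomp_def split: prod.splits if_splits)

lemma cprod_eqI:
  assumes "\<And>A. unital_cstar A \<Longrightarrow> pcomp x A = pcomp y A" "pscal x = pscal y"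
  shows "x = y"
proof -
  have "pcomp x A = pcomp y A" for A using assms(1) pcomp_undefined by metis
  then have "Rep_cprod x = Rep_cprod y"
    using assms(2) by (auto simp: pcomp_def pscal_def prod_eq_iff fun_eq_iff)
  then show ?thesis by (simp add: Rep_cprod_inject)
qed

lemma mkprod:
  assumes "\<And>A. unital_cstar A \<Longrightarrow> f A \<in> carrier A" "\<And>A. unital_cstar A \<Longrightarrow> nrm A (f A) \<le> K"
  shows "unital_cstar A \<Longrightarrow> pcomp (mkprod f c) A = f A" "pscal (mkprod f c) = c"
proof -
  have "Rep_cprod (mkprod f c) = (\<lambda>A. if unital_cstar A then f A else undefined, c)"
    unfolding mkprod_def by (rule Abs_cprod_inverse) (use assms in auto)
  then show "unital_cstar A \<Longrightarrow> pcomp (mkprod f c) A = f A" "pscal (mkprod f c) = c"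
    by (simp_all add: pcomp_def pscal_def)
qed

section \<open>Pointwise operations and the supremum norm on the product\<close>

instantiation cprod :: (type) "{real_normed_vector, one, times}"
begin

definition "0 = mkprod (\<lambda>A. \<zero>\<^bsub>A\<^esub>) 0"
definition "1 = mkprod (\<lambda>A. \<one>\<^bsub>A\<^esub>) 1"
definition "x + y = mkprod (\<lambda>A. pcomp x A \<oplus>\<^bsub>A\<^esub> pcomp y A) (pscal x + pscal y)"
definition "- x = mkprod (\<lambda>A. \<ominus>\<^bsub>A\<^esub> pcomp x A) (- pscal x)"
definition "x - (y :: 'a cprod) = x + - y"
definition "x * y = mkprod (\<lambda>A. pcomp x A \<otimes>\<^bsub>A\<^esub> pcomp y A) (pscal x * pscal y)"
definition "r *\<^sub>R x = mkprod (\<lambda>A. of_real r \<odot>\<^bsub>A\<^esub> pcomp x A) (r *\<^sub>R pscal x)"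
definition "norm x = Sup (insert (cmod (pscal x)) {nrm A (pcomp x A) | A. unital_cstar A})"
definition "sgn x = inverse (norm x) *\<^sub>R (x :: 'a cprod)"
definition "dist x y = norm (x - (y :: 'a cprod))"
definition "(uniformity :: ('a cprod \<times> 'a cprod) filter) = (INF e\<in>{0 <..}. principal {(x, y). dist x y < e})"
definition "open (U :: 'a cprod set) \<longleftrightarrow> (\<forall>x\<in>U. eventually (\<lambda>(x', y). x' = x \<longrightarrow> y \<in> U) uniformity)"

lemma pcomp_zero: "unital_cstar A \<Longrightarrow> pcomp 0 A = \<zero>\<^bsub>A\<^esub>" and pscal_zero: "pscal 0 = 0"
  unfolding zero_cprod_def
  by (rule mkprod[where K = 0]; simp add: unital_simps unital_nrm_zero)+

lemma pcomp_one: "unital_cstar A \<Longrightarrow> pcomp 1 A = \<one>\<^bsub>A\<^esub>" and pscal_one: "pscal 1 = 1"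
  unfolding one_cprod_def
  by (rule mkprod[where K = 1]; simp add: unital_simps unital_nrm_one)+

lemma pcomp_add: "unital_cstar A \<Longrightarrow> pcomp (x + y) A = pcomp x A \<oplus>\<^bsub>A\<^esub> pcomp y A"
  and pscal_add: "pscal (x + y) = pscal x + pscal y"
proof -
  obtain K L where "\<And>A. unital_cstar A \<Longrightarrow> nrm A (pcomp x A) \<le> K"
    "\<And>A. unital_cstar A \<Longrightarrow> nrm A (pcomp y A) \<le> L"
    using pcomp_bounded[of x] pcomp_bounded[of y] by auto
  then have "unital_cstar A \<Longrightarrow> nrm A (pcomp x A \<oplus>\<^bsub>A\<^esub> pcomp y A) \<le> K + L" for A
    by (meson add_mono pcomp_closed order_trans unital_nrm(2))
  from mkprod[OF _ this, where c = "pscal x + pscal y"]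
  show "unital_cstar A \<Longrightarrow> pcomp (x + y) A = pcomp x A \<oplus>\<^bsub>A\<^esub> pcomp y A"
    "pscal (x + y) = pscal x + pscal y"
    unfolding plus_cprod_def by (auto simp: unital_simps pcomp_closed)
qed

lemma pcomp_uminus: "unital_cstar A \<Longrightarrow> pcomp (- x) A = \<ominus>\<^bsub>A\<^esub> pcomp x A"
  and pscal_uminus: "pscal (- x) = - pscal x"
proof -
  obtain K where "\<And>A. unital_cstar A \<Longrightarrow> nrm A (pcomp x A) \<le> K"
    using pcomp_bounded[of x] by auto
  then have "unital_cstar A \<Longrightarrow> nrm A (\<ominus>\<^bsub>A\<^esub> pcomp x A) \<le> K" for A
    by (simp add: pcomp_closed unital_nrm)
  from mkprod[OF _ this, where c = "- pscal x"]
  show "unital_cstar A \<Longrightarrow> pcomp (- x) A = \<ominus>\<^bsub>A\<^esub> pcomp x A" "pscal (- x) = - pscal x"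
    unfolding uminus_cprod_def by (auto simp: unital_simps pcomp_closed)
qed

lemma pcomp_times: "unital_cstar A \<Longrightarrow> pcomp (x * y) A = pcomp x A \<otimes>\<^bsub>A\<^esub> pcomp y A"
  and pscal_times: "pscal (x * y) = pscal x * pscal y"
proof -
  obtain K L where KL: "\<And>A. unital_cstar A \<Longrightarrow> nrm A (pcomp x A) \<le> K"
    "\<And>A. unital_cstar A \<Longrightarrow> nrm A (pcomp y A) \<le> L"
    using pcomp_bounded[of x] pcomp_bounded[of y] by auto
  have "nrm A (pcomp x A \<otimes>\<^bsub>A\<^esub> pcomp y A) \<le> \<bar>K\<bar> * \<bar>L\<bar>" if A: "unital_cstar A" for A
  proof -
    have "nrm A (pcomp x A \<otimes>\<^bsub>A\<^esub> pcomp y A) \<le> nrm A (pcomp x A) * nrm A (pcomp y A)"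
      using A by (simp add: pcomp_closed unital_nrm)
    also have "\<dots> \<le> \<bar>K\<bar> * \<bar>L\<bar>"
      using KL[OF A] A by (intro mult_mono) (auto simp: pcomp_closed unital_simps)
    finally show ?thesis .
  qed
  from mkprod[OF _ this, where c = "pscal x * pscal y"]
  show "unital_cstar A \<Longrightarrow> pcomp (x * y) A = pcomp x A \<otimes>\<^bsub>A\<^esub> pcomp y A"
    "pscal (x * y) = pscal x * pscal y"
    unfolding times_cprod_def by (auto simp: unital_simps pcomp_closed)
qed

lemma pcomp_scaleR: "unital_cstar A \<Longrightarrow> pcomp (r *\<^sub>R x) A = of_real r \<odot>\<^bsub>A\<^esub> pcomp x A"
  and pscal_scaleR: "pscal (r *\<^sub>R x) = r *\<^sub>R pscal x"
proof -
  obtain K where "\<And>A. unital_cstar A \<Longrightarrow> nrm A (pcomp x A) \<le> K"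
    using pcomp_bounded[of x] by auto
  then have "unital_cstar A \<Longrightarrow> nrm A (of_real r \<odot>\<^bsub>A\<^esub> pcomp x A) \<le> \<bar>r\<bar> * K" for A
    by (simp add: pcomp_closed unital_nrm mult_left_mono)
  from mkprod[OF _ this, where c = "r *\<^sub>R pscal x"]
  show "unital_cstar A \<Longrightarrow> pcomp (r *\<^sub>R x) A = of_real r \<odot>\<^bsub>A\<^esub> pcomp x A"
    "pscal (r *\<^sub>R x) = r *\<^sub>R pscal x"
    unfolding scaleR_cprod_def by (auto simp: unital_simps pcomp_closed)
qed

lemmas pcomp_vec = pcomp_zero pscal_zero pcomp_add pscal_add pcomp_uminus pscal_uminus
  pcomp_scaleR pscal_scaleR

lemma norm_cprod_bdd: "bdd_above (insert (cmod (pscal x)) {nrm A (pcomp x A) | A. unital_cstar A})"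
proof -
  obtain K where "\<And>A. unital_cstar A \<Longrightarrow> nrm A (pcomp x A) \<le> K" using pcomp_bounded[of x] by auto
  then show ?thesis by (intro bdd_aboveI[of _ "max K (cmod (pscal x))"]) (auto simp: max.coboundedI1)
qed

lemma nrm_pcomp_le: "unital_cstar A \<Longrightarrow> nrm A (pcomp x A) \<le> norm x"
  unfolding norm_cprod_def by (intro cSup_upper norm_cprod_bdd) auto

lemma pscal_le: "cmod (pscal x) \<le> norm x"
  unfolding norm_cprod_def by (intro cSup_upper norm_cprod_bdd) auto

lemma norm_cprod_leI:
  "(\<And>A. unital_cstar A \<Longrightarrow> nrm A (pcomp x A) \<le> K) \<Longrightarrow> cmod (pscal x) \<le> K \<Longrightarrow> norm x \<le> K"
  unfolding norm_cprod_def by (intro cSup_least) auto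

instance
proof
  fix x y z :: "'a cprod" and a b :: real
  show "x + y + z = x + (y + z)" "x + y = y + x" "0 + x = x" "- x + x = 0"
    "a *\<^sub>R (x + y) = a *\<^sub>R x + a *\<^sub>R y" "(a + b) *\<^sub>R x = a *\<^sub>R x + b *\<^sub>R x"
    "a *\<^sub>R b *\<^sub>R x = (a * b) *\<^sub>R x" "1 *\<^sub>R x = x"
    by (rule cprod_eqI;
      simp add: pcomp_vec pcomp_closed unital_simps algebra_simps scaleR_conv_of_real)+
  show "x - y = x + - y" "sgn x = inverse (norm x) *\<^sub>R x" "dist x y = norm (x - y)"
    "(uniformity :: ('a cprod \<times> 'a cprod) filter) = (INF e\<in>{0 <..}. principal {(x, y). dist x y < e})"
    "open U \<longleftrightarrow> (\<forall>x\<in>U. eventually (\<lambda>(x', y). x' = x \<longrightarrow> y \<in> U) uniformity)" for U :: "'a cprod set"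
    by (fact minus_cprod_def sgn_cprod_def dist_cprod_def uniformity_cprod_def open_cprod_def)+
  show "norm x = 0 \<longleftrightarrow> x = 0"
  proof
    assume 0: "norm x = 0"
    show "x = 0"
    proof (rule cprod_eqI)
      fix A :: "'a cstar" assume A: "unital_cstar A"
      then have "nrm A (pcomp x A) = 0"
        using nrm_pcomp_le[OF A, of x] pre_cstar_algebra.nrm_nonneg[OF unital_pre[OF A] pcomp_closed[OF A], of x] 0
        by simp
      then show "pcomp x A = pcomp 0 A" using A by (simp add: unital_nrm pcomp_closed pcomp_zero)
    next
      show "pscal x = pscal 0" using pscal_le[of x] 0 by (simp add: pscal_zero)
    qed
  next
    assume "x = 0"
    then have "norm x \<le> 0" by (intro norm_cprod_leI) (auto simp: pcomp_zero pscal_zero unital_nrm_zero)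
    then show "norm x = 0" using pscal_le[of x] norm_ge_zero[of "pscal x"] by linarith
  qed
  show "norm (x + y) \<le> norm x + norm y"
  proof (rule norm_cprod_leI)
    fix A :: "'a cstar" assume A: "unital_cstar A"
    then show "nrm A (pcomp (x + y) A) \<le> norm x + norm y"
      using unital_nrm(2)[OF A pcomp_closed pcomp_closed, of x y] nrm_pcomp_le[OF A, of x] nrm_pcomp_le[OF A, of y]
      by (simp add: pcomp_add)
  next
    show "cmod (pscal (x + y)) \<le> norm x + norm y"
      using norm_triangle_ineq[of "pscal x" "pscal y"] pscal_le[of x] pscal_le[of y] by (simp add: pscal_add)
  qed
  have le: "norm (a *\<^sub>R x) \<le> \<bar>a\<bar> * norm x" for a and x :: "'a cprod"
    by (rule norm_cprod_leI)
      (auto simp: pcomp_vec unital_nrm pcomp_closed intro!: mult_left_mono nrm_pcomp_le pscal_le)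
  show "norm (a *\<^sub>R x) = \<bar>a\<bar> * norm x"
  proof (cases "a = 0")
    case True
    then show ?thesis
      using le[of 0 x] order_trans[OF norm_ge_zero pscal_le[of "0 *\<^sub>R x"]] by simp
  next
    case False
    have "inverse a *\<^sub>R a *\<^sub>R x = x" using False
      by (intro cprod_eqI) (simp_all add: pcomp_vec pcomp_closed unital_simps(29) unital_simps(1)
        module.smult_assoc1[OF unital_module, simplified, symmetric] module.smult_one[OF unital_module, simplified])
    then have "norm x \<le> \<bar>inverse a\<bar> * norm (a *\<^sub>R x)" using le[of "inverse a" "a *\<^sub>R x"] by simp
    then show ?thesis using le[of a x] False by (simp add: abs_inverse field_simps)
  qed
qed

end

instance cprod :: (type) real_normed_algebra_1
proof
  fix x y z :: "'a cprod" and a :: real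
  show "x * y * z = x * (y * z)" "(x + y) * z = x * z + y * z" "x * (y + z) = x * y + x * z"
    "1 * x = x" "x * 1 = x" "a *\<^sub>R x * y = a *\<^sub>R (x * y)" "x * a *\<^sub>R y = a *\<^sub>R (x * y)"
    by (rule cprod_eqI;
      simp add: pcomp_vec pcomp_times pscal_times pcomp_one pscal_one pcomp_closed unital_simps algebra_simps)+
  show "(0 :: 'a cprod) \<noteq> 1" using pscal_zero pscal_one by (metis zero_neq_one)
  show "norm (x * y) \<le> norm x * norm y"
  proof (rule norm_cprod_leI)
    fix A :: "'a cstar" assume A: "unital_cstar A"
    have "nrm A (pcomp (x * y) A) \<le> nrm A (pcomp x A) * nrm A (pcomp y A)"
      using A by (simp add: pcomp_times unital_nrm pcomp_closed)
    also have "\<dots> \<le> norm x * norm y"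
      using A by (intro mult_mono nrm_pcomp_le) (auto simp: unital_simps pcomp_closed)
    finally show "nrm A (pcomp (x * y) A) \<le> norm x * norm y" .
  next
    show "cmod (pscal (x * y)) \<le> norm x * norm y"
      by (auto simp: pscal_times norm_mult intro!: mult_mono pscal_le)
  qed
  show "norm (1 :: 'a cprod) = 1"
  proof (rule antisym)
    show "norm (1 :: 'a cprod) \<le> 1"
      by (rule norm_cprod_leI) (auto simp: pcomp_one pscal_one unital_nrm_one)
    show "1 \<le> norm (1 :: 'a cprod)" using pscal_le[of 1] by (simp add: pscal_one)
  qed
qed

lemma pcomp_diff: "unital_cstar A \<Longrightarrow> pcomp (x - y) A = pcomp x A \<ominus>\<^bsub>A\<^esub> pcomp y A"
  by (simp only: minus_cprod_def pcomp_add pcomp_uminus a_minus_def)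

lemma pscal_diff: "pscal (x - y) = pscal x - pscal y"
  by (simp only: minus_cprod_def pscal_add pscal_uminus diff_conv_add_uminus)

instance cprod :: (type) banach
proof
  fix S :: "nat \<Rightarrow> 'a cprod" assume S: "Cauchy S"
  have lim: "\<exists>l\<in>carrier A. \<forall>\<epsilon>>0. \<exists>N. \<forall>n\<ge>N. nrm A (pcomp (S n) A \<ominus>\<^bsub>A\<^esub> l) < \<epsilon>"
    if A: "unital_cstar A" for A :: "'a cstar"
  proof -
    interpret cstar_algebra A using A by (simp add: unital_cstar_def)
    have "\<exists>N. \<forall>n\<ge>N. \<forall>m\<ge>N. nrm A (pcomp (S n) A \<ominus>\<^bsub>A\<^esub> pcomp (S m) A) < \<epsilon>" if \<epsilon>: "\<epsilon> > 0" for \<epsilon>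
    proof -
      obtain N where "\<forall>m\<ge>N. \<forall>n\<ge>N. norm (S m - S n) < \<epsilon>" using CauchyD[OF S \<epsilon>] by blast
      then show ?thesis
        using nrm_pcomp_le[OF A] by (metis pcomp_diff[OF A] order_le_less_trans)
    qed
    then show ?thesis
      using complete[unfolded mcomplete_iff, THEN spec, of "\<lambda>n. pcomp (S n) A"] A by (simp add: pcomp_closed)
  qed
  define l where "l A = (SOME l. l \<in> carrier A \<and> (\<forall>\<epsilon>>0. \<exists>N. \<forall>n\<ge>N. nrm A (pcomp (S n) A \<ominus>\<^bsub>A\<^esub> l) < \<epsilon>))"
    for A :: "'a cstar"
  have l: "l A \<in> carrier A \<and> (\<forall>\<epsilon>>0. \<exists>N. \<forall>n\<ge>N. nrm A (pcomp (S n) A \<ominus>\<^bsub>A\<^esub> l A) < \<epsilon>)"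
    if "unital_cstar A" for A
    unfolding l_def by (rule someI_ex) (use lim[OF that] in blast)
  have "Cauchy (\<lambda>n. pscal (S n))"
  proof (rule CauchyI)
    fix e :: real assume "e > 0"
    then obtain N where "\<forall>m\<ge>N. \<forall>n\<ge>N. norm (S m - S n) < e" using CauchyD[OF S] by blast
    then show "\<exists>M. \<forall>m\<ge>M. \<forall>n\<ge>M. norm (pscal (S m) - pscal (S n)) < e"
      using pscal_le by (metis pscal_diff order_le_less_trans)
  qed
  then obtain c where c: "(\<lambda>n. pscal (S n)) \<longlonglongrightarrow> c" by (auto simp: Cauchy_convergent_iff convergent_def)
  \<comment> \<open>A Cauchy estimate for the supremum norm holds in all factors from the same index
    on, so the coordinatewise limits are approached uniformly.\<close>
  have close: "nrm A (pcomp (S n) A \<ominus>\<^bsub>A\<^esub> l A) \<le> e"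
    if N: "\<forall>m\<ge>N. \<forall>n\<ge>N. norm (S m - S n) < e" and n: "n \<ge> N" and A: "unital_cstar A" for A N n e
  proof (rule field_le_epsilon)
    fix d :: real assume "d > 0"
    then obtain M where M: "\<forall>m\<ge>M. nrm A (pcomp (S m) A \<ominus>\<^bsub>A\<^esub> l A) < d" using l[OF A] by blast
    define m where "m = max M N"
    have "nrm A (pcomp (S n) A \<ominus>\<^bsub>A\<^esub> l A) \<le>
        nrm A (pcomp (S n) A \<ominus>\<^bsub>A\<^esub> pcomp (S m) A) + nrm A (pcomp (S m) A \<ominus>\<^bsub>A\<^esub> l A)"
      using A l[OF A] by (intro unital_nrm_triangle_minus pcomp_closed) auto
    moreover have "nrm A (pcomp (S n) A \<ominus>\<^bsub>A\<^esub> pcomp (S m) A) \<le> norm (S n - S m)"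
      using nrm_pcomp_le[OF A, of "S n - S m"] by (simp add: pcomp_diff A)
    moreover have "norm (S n - S m) < e" using N n by (simp add: m_def)
    moreover have "nrm A (pcomp (S m) A \<ominus>\<^bsub>A\<^esub> l A) < d" using M by (simp add: m_def)
    ultimately show "nrm A (pcomp (S n) A \<ominus>\<^bsub>A\<^esub> l A) \<le> e + d" by linarith
  qed
  obtain N1 where N1: "\<forall>m\<ge>N1. \<forall>n\<ge>N1. norm (S m - S n) < 1" using CauchyD[OF S, of 1] by auto
  have "nrm A (l A) \<le> norm (S N1) + 1" if A: "unital_cstar A" for A
  proof -
    define u where "u = pcomp (S N1) A \<ominus>\<^bsub>A\<^esub> l A"
    have u: "u \<in> carrier A" unfolding u_def
      using A l[OF A] by (intro ring.ring_simprules(4)[OF unital_ring] pcomp_closed) auto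
    have "l A = pcomp (S N1) A \<oplus>\<^bsub>A\<^esub> \<ominus>\<^bsub>A\<^esub> u"
      using A l[OF A] unfolding u_def by (simp add: unital_simps pcomp_closed)
    then have "nrm A (l A) \<le> nrm A (pcomp (S N1) A) + nrm A (\<ominus>\<^bsub>A\<^esub> u)"
      using unital_nrm(2)[OF A, of "pcomp (S N1) A" "\<ominus>\<^bsub>A\<^esub> u"] u
      by (simp add: ring.ring_simprules(3)[OF unital_ring] A pcomp_closed)
    also have "nrm A (\<ominus>\<^bsub>A\<^esub> u) = nrm A u" using A u by (rule unital_nrm(6))
    finally have "nrm A (l A) \<le> nrm A (pcomp (S N1) A) + nrm A (pcomp (S N1) A \<ominus>\<^bsub>A\<^esub> l A)"
      by (simp only: u_def)
    then show ?thesis using close[OF N1 _ A, of N1] nrm_pcomp_le[OF A, of "S N1"] by simp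
  qed
  note L = mkprod[of l, OF _ this, where c = c]
  have "S \<longlonglongrightarrow> mkprod l c"
  proof (rule LIMSEQ_I)
    fix e :: real assume e: "e > 0"
    obtain N where N: "\<forall>m\<ge>N. \<forall>n\<ge>N. norm (S m - S n) < e/2" using CauchyD[OF S, of "e/2"] e by auto
    obtain M where M: "\<forall>n\<ge>M. cmod (pscal (S n) - c) < e/2" using LIMSEQ_D[OF c, of "e/2"] e by auto
    have "norm (S n - mkprod l c) < e" if n: "n \<ge> max M N" for n
    proof -
      have "norm (S n - mkprod l c) \<le> e/2"
      proof (rule norm_cprod_leI)
        fix A :: "'a cstar" assume A: "unital_cstar A"
        show "nrm A (pcomp (S n - mkprod l c) A) \<le> e/2"
          using close[OF N _ A, of n] n l by (simp add: pcomp_diff A L)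
      next
        show "cmod (pscal (S n - mkprod l c)) \<le> e/2"
          using M n l by (simp add: pscal_diff L less_imp_le)
      qed
      then show ?thesis using e by simp
    qed
    then show "\<exists>no. \<forall>n\<ge>no. norm (S n - mkprod l c) < e" by blast
  qed
  then show "convergent S" by (auto simp: convergent_def)
qed

instantiation cprod :: (type) cstar_alg
begin

definition "adj x = mkprod (\<lambda>A. star A (pcomp x A)) (cnj (pscal x))"
definition "iu = mkprod (\<lambda>A. \<i> \<odot>\<^bsub>A\<^esub> \<one>\<^bsub>A\<^esub>) \<i>"

lemma unital_nrm_star: "unital_cstar A \<Longrightarrow> x \<in> carrier A \<Longrightarrow> nrm A (star A x) = nrm A x"
proof -
  assume A: "unital_cstar A" and x: "x \<in> carrier A"
  have le: "nrm A x \<le> nrm A (star A x)" if x: "x \<in> carrier A" for x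
  proof (cases "nrm A x = 0")
    case False
    have "nrm A x * nrm A x \<le> nrm A (star A x) * nrm A x"
      using unital_nrm(4)[OF A, of "star A x" x] A x by (simp add: unital_simps unital_nrm power2_eq_square)
    then show ?thesis using False pre_cstar_algebra.nrm_nonneg[OF unital_pre[OF A] x] by simp
  qed (use A x in \<open>simp add: unital_simps\<close>)
  show ?thesis using le[OF x] le[of "star A x"] A x by (simp add: unital_simps)
qed

lemma pcomp_adj: "unital_cstar A \<Longrightarrow> pcomp (adj x) A = star A (pcomp x A)"
  and pscal_adj: "pscal (adj x) = cnj (pscal x)"
proof -
  have "unital_cstar A \<Longrightarrow> nrm A (star A (pcomp x A)) \<le> norm x" for A
    by (simp add: unital_nrm_star pcomp_closed nrm_pcomp_le)
  from mkprod[OF _ this, where c = "cnj (pscal x)"]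
  show "unital_cstar A \<Longrightarrow> pcomp (adj x) A = star A (pcomp x A)" "pscal (adj x) = cnj (pscal x)"
    unfolding adj_cprod_def by (auto simp: unital_simps pcomp_closed)
qed

lemma pcomp_iu: "unital_cstar A \<Longrightarrow> pcomp iu A = \<i> \<odot>\<^bsub>A\<^esub> \<one>\<^bsub>A\<^esub>" and pscal_iu: "pscal iu = \<i>"
  unfolding iu_cprod_def
  by (rule mkprod[where K = 1]; simp add: unital_simps unital_nrm unital_nrm_one)+

instance
proof
  fix x y :: "'a cprod" and r :: real
  show "adj (adj x) = x" "adj (x + y) = adj x + adj y" "adj (r *\<^sub>R x) = r *\<^sub>R adj x"
    "adj (x * y) = adj y * adj x" "iu * x = x * iu"
    by (rule cprod_eqI; simp add: pcomp_vec pcomp_times pscal_times pcomp_adj pscal_adj pcomp_iu pscal_iu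
        pcomp_closed unital_simps)+
  have ii: "c \<odot>\<^bsub>A\<^esub> (d \<odot>\<^bsub>A\<^esub> \<one>\<^bsub>A\<^esub>) = (c * d) \<odot>\<^bsub>A\<^esub> \<one>\<^bsub>A\<^esub>" if "unital_cstar A" for c d and A :: "'a cstar"
    using that by (simp add: unital_simps)
  note um = pre_cstar_algebra.uminus_eq_smult[OF unital_pre]
  show "iu * iu = (- 1 :: 'a cprod)"
  proof (rule cprod_eqI)
    fix A :: "'a cstar" assume A: "unital_cstar A"
    have "pcomp (iu * iu) A = \<i> \<odot>\<^bsub>A\<^esub> (\<i> \<odot>\<^bsub>A\<^esub> \<one>\<^bsub>A\<^esub>)" using A by (simp add: pcomp_times pcomp_iu unital_simps)
    then show "pcomp (iu * iu) A = pcomp (- 1) A" using A by (simp add: ii um pcomp_uminus pcomp_one unital_simps)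
  qed (simp add: pscal_times pscal_iu pscal_uminus pscal_one)
  show "adj iu = (- iu :: 'a cprod)"
  proof (rule cprod_eqI)
    fix A :: "'a cstar" assume A: "unital_cstar A"
    have "pcomp (- iu) A = (- 1) \<odot>\<^bsub>A\<^esub> (\<i> \<odot>\<^bsub>A\<^esub> \<one>\<^bsub>A\<^esub>)"
      using A by (simp add: pcomp_uminus pcomp_iu um unital_simps)
    then show "pcomp (adj iu) A = pcomp (- iu) A"
      using A by (simp add: ii pcomp_adj pcomp_iu unital_star_one pre_cstar_algebra.star_smult[OF unital_pre]
          ring.ring_simprules(6)[OF unital_ring])
  qed (simp add: pscal_adj pscal_iu pscal_uminus)
  show "norm (adj x * x) = (norm x)\<^sup>2"
  proof (rule antisym)
    show "norm (adj x * x) \<le> (norm x)\<^sup>2"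
    proof (rule norm_cprod_leI)
      fix A :: "'a cstar" assume A: "unital_cstar A"
      show "nrm A (pcomp (adj x * x) A) \<le> (norm x)\<^sup>2"
        using A by (simp add: pcomp_times pcomp_adj pcomp_closed unital_nrm unital_simps nrm_pcomp_le power_mono)
    next
      show "cmod (pscal (adj x * x)) \<le> (norm x)\<^sup>2"
        by (simp add: pscal_times pscal_adj norm_mult power_mono pscal_le flip: power2_eq_square)
    qed
    have "norm x \<le> sqrt (norm (adj x * x))"
    proof (rule norm_cprod_leI)
      fix A :: "'a cstar" assume A: "unital_cstar A"
      have "(nrm A (pcomp x A))\<^sup>2 \<le> norm (adj x * x)"
        using nrm_pcomp_le[OF A, of "adj x * x"] A by (simp add: pcomp_times pcomp_adj pcomp_closed unital_nrm)
      then show "nrm A (pcomp x A) \<le> sqrt (norm (adj x * x))" by (rule real_le_rsqrt)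
    next
      have "(cmod (pscal x))\<^sup>2 \<le> norm (adj x * x)"
        using pscal_le[of "adj x * x"] by (simp add: pscal_times pscal_adj norm_mult power2_eq_square)
      then show "cmod (pscal x) \<le> sqrt (norm (adj x * x))" by (rule real_le_rsqrt)
    qed
    then show "(norm x)\<^sup>2 \<le> norm (adj x * x)" by (simp add: real_le_rsqrt sqrt_ge_absD)
  qed
qed

end

text \<open>Not unital: all other coordinates, including the scalar one, are 0, so the unit of
  \<open>A\<close> becomes a projection different from 1. Identities involving 1 have to be read
  inside the factor.\<close>

definition emb :: "'a cstar \<Rightarrow> 'a \<Rightarrow> 'a cprod" where
  "emb A x = mkprod (\<lambda>B. if B = A then x else \<zero>\<^bsub>B\<^esub>) 0"

lemma pcomp_emb':
  assumes A: "unital_cstar A" and x: "x \<in> carrier A"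
  shows "unital_cstar B \<Longrightarrow> pcomp (emb A x) B = (if B = A then x else \<zero>\<^bsub>B\<^esub>)" "pscal (emb A x) = 0"
proof -
  have "nrm B (if B = A then x else \<zero>\<^bsub>B\<^esub>) \<le> nrm A x" if "unital_cstar B" for B
    using that A x by (auto simp: unital_nrm_zero unital_simps)
  from mkprod[OF _ this, where c = 0] show "unital_cstar B \<Longrightarrow> pcomp (emb A x) B = (if B = A then x else \<zero>\<^bsub>B\<^esub>)"
      "pscal (emb A x) = 0"
    using A x unfolding emb_def by (auto simp: unital_simps)
qed

context
  fixes A :: "'a cstar"
  assumes A: "unital_cstar A"
begin

lemma pcomp_emb: "x \<in> carrier A \<Longrightarrow> pcomp (emb A x) A = x"
  using pcomp_emb'(1)[OF A _ A] by simp

lemma emb_zero: "emb A \<zero>\<^bsub>A\<^esub> = 0"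
  using A by (intro cprod_eqI) (auto simp: pcomp_emb' pcomp_vec unital_simps)

lemma emb_add: "x \<in> carrier A \<Longrightarrow> y \<in> carrier A \<Longrightarrow> emb A (x \<oplus>\<^bsub>A\<^esub> y) = emb A x + emb A y"
  using A by (intro cprod_eqI) (auto simp: pcomp_emb' pcomp_vec unital_simps)

lemma emb_mult: "x \<in> carrier A \<Longrightarrow> y \<in> carrier A \<Longrightarrow> emb A (x \<otimes>\<^bsub>A\<^esub> y) = emb A x * emb A y"
  using A by (intro cprod_eqI) (auto simp: pcomp_emb' pcomp_times pscal_times unital_simps)

lemma emb_uminus: "x \<in> carrier A \<Longrightarrow> emb A (\<ominus>\<^bsub>A\<^esub> x) = - emb A x"
  using A by (intro cprod_eqI) (auto simp: pcomp_emb' pcomp_vec unital_simps)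

lemma emb_diff: "x \<in> carrier A \<Longrightarrow> y \<in> carrier A \<Longrightarrow> emb A (x \<ominus>\<^bsub>A\<^esub> y) = emb A x - emb A y"
  using A by (simp add: a_minus_def emb_add emb_uminus unital_simps)

lemma emb_scaleR: "x \<in> carrier A \<Longrightarrow> emb A (of_real r \<odot>\<^bsub>A\<^esub> x) = r *\<^sub>R emb A x"
  using A by (intro cprod_eqI) (auto simp: pcomp_emb' pcomp_vec unital_simps unital_smult_zero)

lemma emb_star: "x \<in> carrier A \<Longrightarrow> emb A (star A x) = adj (emb A x)"
  using A by (intro cprod_eqI) (auto simp: pcomp_emb' pcomp_adj pscal_adj unital_simps unital_star_zero)

lemma norm_emb: "x \<in> carrier A \<Longrightarrow> norm (emb A x) = nrm A x"
proof (rule antisym)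
  assume x: "x \<in> carrier A"
  show "norm (emb A x) \<le> nrm A x"
    using A x by (intro norm_cprod_leI) (auto simp: pcomp_emb' unital_simps unital_nrm_zero)
  show "nrm A x \<le> norm (emb A x)"
    using nrm_pcomp_le[OF A, of "emb A x"] x by (simp add: pcomp_emb)
qed

lemma emb_inject: "x \<in> carrier A \<Longrightarrow> y \<in> carrier A \<Longrightarrow> emb A x = emb A y \<longleftrightarrow> x = y"
  using pcomp_emb by metis

lemma emb_finsum: "f \<in> I \<rightarrow> carrier A \<Longrightarrow> emb A (\<Oplus>\<^bsub>A\<^esub>i\<in>I. f i) = (\<Sum>i\<in>I. emb A (f i))"
proof (induction I rule: infinite_finite_induct)
  interpret ring A using A by (rule unital_ring)
  case (infinite I) then show ?case by (simp add: finsum_infinite emb_zero)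
next
  interpret ring A using A by (rule unital_ring)
  case empty then show ?case by (simp add: emb_zero)
next
  interpret ring A using A by (rule unital_ring)
  case (insert i I)
  then show ?case by (simp add: Pi_iff emb_add)
qed

end

lemmas emb_simps = emb_zero emb_add emb_mult emb_uminus emb_diff emb_scaleR emb_star norm_emb

lemmas pcomp_simps = pcomp_zero pcomp_add pcomp_uminus pcomp_diff pcomp_times pcomp_scaleR pcomp_adj pcomp_one

lemmas unital_closed =
  ring.ring_simprules(1-6)[OF unital_ring]
  module.smult_closed[OF unital_module, simplified]
  pre_cstar_algebra.star_closed[OF unital_pre]

section \<open>Results carried back to the carrier of one algebra\<close>

context
  fixes A :: "'a cstar"
  assumes A: "unital_cstar A"
begin

lemmas em = emb_simps[OF A]
lemmas us = unital_simps[OF A]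

text \<open>Absorption of \<open>emb A a\<close> on one side kills every coordinate outside the
  factor \<open>A\<close>. This is how nonzero elements found in the product are seen to be nonzero
  in \<open>A\<close>.\<close>

lemma eq_zero_if_comp_zero:
  assumes "x * emb A a = x \<or> emb A a * x = x" "a \<in> carrier A" "pcomp x A = \<zero>\<^bsub>A\<^esub>"
  shows "x = 0"
proof (rule cprod_eqI)
  fix B :: "'a cstar" assume B: "unital_cstar B"
  have "pcomp x B = pcomp (x * emb A a) B \<or> pcomp x B = pcomp (emb A a * x) B" using assms(1) by auto
  then show "pcomp x B = pcomp 0 B"
    using assms(2,3) B A
    by (cases "B = A") (auto simp: pcomp_times pcomp_emb' pcomp_zero pcomp_closed unital_simps)
next
  have "pscal x = pscal (x * emb A a) \<or> pscal x = pscal (emb A a * x)" using assms(1) by auto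
  then show "pscal x = pscal 0"
    using assms(2) A by (auto simp: pscal_times pcomp_emb' pscal_zero)
qed

lemma carrier_square_complement:
  assumes x: "x \<in> carrier A" and M: "nrm A x \<le> M"
  shows "\<exists>b\<in>carrier A. (of_real (M\<^sup>2) \<odot>\<^bsub>A\<^esub> \<one>\<^bsub>A\<^esub>) \<ominus>\<^bsub>A\<^esub> star A x \<otimes>\<^bsub>A\<^esub> x = star A b \<otimes>\<^bsub>A\<^esub> b"
proof -
  obtain b where "M\<^sup>2 *\<^sub>R 1 - adj (emb A x) * emb A x = adj b * b"
    using norm_square_adj_mult_complement[of "emb A x" M] x M by (auto simp: norm_emb[OF A])
  then have "pcomp (M\<^sup>2 *\<^sub>R 1 - adj (emb A x) * emb A x) A = pcomp (adj b * b) A" by simp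
  then show ?thesis using x A
    by (intro bexI[of _ "pcomp b A"]) (simp_all only: pcomp_simps pcomp_emb pcomp_closed)
qed

lemma carrier_sum_squares:
  assumes x: "x \<in> carrier A" and y: "y \<in> carrier A"
  shows "\<exists>b\<in>carrier A. star A x \<otimes>\<^bsub>A\<^esub> x \<oplus>\<^bsub>A\<^esub> star A y \<otimes>\<^bsub>A\<^esub> y = star A b \<otimes>\<^bsub>A\<^esub> b"
    and "nrm A (star A x \<otimes>\<^bsub>A\<^esub> x) \<le> nrm A (star A x \<otimes>\<^bsub>A\<^esub> x \<oplus>\<^bsub>A\<^esub> star A y \<otimes>\<^bsub>A\<^esub> y)"
proof -
  obtain b where b: "adj (emb A x) * emb A x + adj (emb A y) * emb A y = adj b * b" "norm (emb A x) \<le> norm b"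
    using add_adj_mult by blast
  have "pcomp (adj (emb A x) * emb A x + adj (emb A y) * emb A y) A = pcomp (adj b * b) A" using b by simp
  then show "\<exists>b\<in>carrier A. star A x \<otimes>\<^bsub>A\<^esub> x \<oplus>\<^bsub>A\<^esub> star A y \<otimes>\<^bsub>A\<^esub> y = star A b \<otimes>\<^bsub>A\<^esub> b"
    using x y A by (intro bexI[of _ "pcomp b A"]) (simp_all only: pcomp_simps pcomp_emb pcomp_closed)
  have "norm (adj (emb A x) * emb A x) \<le> norm (adj (emb A x) * emb A x + adj (emb A y) * emb A y)"
    using b by (simp add: norm_adj_mult power_mono)
  also have "adj (emb A x) * emb A x = emb A (star A x \<otimes>\<^bsub>A\<^esub> x)" using x by (simp add: em us)
  also have "adj (emb A y) * emb A y = emb A (star A y \<otimes>\<^bsub>A\<^esub> y)" using y by (simp add: em us)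
  finally show "nrm A (star A x \<otimes>\<^bsub>A\<^esub> x) \<le> nrm A (star A x \<otimes>\<^bsub>A\<^esub> x \<oplus>\<^bsub>A\<^esub> star A y \<otimes>\<^bsub>A\<^esub> y)"
    using x y by (simp add: us norm_emb[OF A] flip: emb_add[OF A])
qed

lemma carrier_spectral_cutdown:
  assumes w: "w \<in> carrier A" and z: "z = star A w \<otimes>\<^bsub>A\<^esub> w" and d: "0 < \<delta>" "\<delta> < nrm A z"
  shows "\<exists>y\<in>carrier A. \<exists>g\<in>carrier A. star A y = y \<and> y \<noteq> \<zero>\<^bsub>A\<^esub> \<and>
    y \<otimes>\<^bsub>A\<^esub> (g \<otimes>\<^bsub>A\<^esub> z) = y \<and> z \<otimes>\<^bsub>A\<^esub> (g \<otimes>\<^bsub>A\<^esub> y) = y \<and> nrm A g \<le> 2 / \<delta>"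
proof -
  have zc: "z \<in> carrier A" using w z by (simp add: us)
  have ez: "adj (emb A w) * emb A w = emb A z" using w z by (simp add: em us)
  obtain y g where y: "adj y = y" "y \<noteq> 0" "y * (g * emb A z) = y" "emb A z * (g * y) = y" "norm g \<le> 2 / \<delta>"
    using spectral_cutdown[of \<delta> "emb A w"] d zc unfolding ez by (auto simp: norm_emb[OF A])
  have eqs: "pcomp (adj y) A = pcomp y A" "pcomp (y * (g * emb A z)) A = pcomp y A"
      "pcomp (emb A z * (g * y)) A = pcomp y A" using y by simp_all
  have "pcomp y A \<noteq> \<zero>\<^bsub>A\<^esub>"
  proof
    assume y0: "pcomp y A = \<zero>\<^bsub>A\<^esub>"
    define t where "t = y * g"
    have "y = t * emb A z" using y(3) by (simp add: t_def mult.assoc)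
    then have "pcomp y B = pcomp 0 B" if "unital_cstar B" for B
      using that zc A y0 by (cases "B = A") (simp_all add: pcomp_times pcomp_emb' pcomp_zero pcomp_closed unital_simps)
    moreover have "pscal y = pscal 0"
      using \<open>y = t * emb A z\<close> zc A by (simp add: pscal_times pcomp_emb' pscal_zero)
    ultimately have "y = 0" by (rule cprod_eqI)
    then show False using y by simp
  qed
  moreover have "nrm A (pcomp g A) \<le> 2 / \<delta>" using nrm_pcomp_le[OF A, of g] y by simp
  ultimately show ?thesis using eqs zc A
    by (intro bexI[of _ "pcomp y A"] bexI[of _ "pcomp g A"]) (simp_all only: pcomp_simps pcomp_emb pcomp_closed simp_thms)
qed

lemma carrier_projection_near_conjugate:
  assumes c: "r \<in> carrier A" "k \<in> carrier A" "y \<in> carrier A"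
    and r: "r \<otimes>\<^bsub>A\<^esub> r = r" "star A r = r" and y: "star A y = y" and rk: "r \<otimes>\<^bsub>A\<^esub> k = k"
    and near: "nrm A (r \<ominus>\<^bsub>A\<^esub> k \<otimes>\<^bsub>A\<^esub> y \<otimes>\<^bsub>A\<^esub> y \<otimes>\<^bsub>A\<^esub> star A k) < 1"
  shows "\<exists>v\<in>carrier A. \<exists>c\<in>carrier A. star A v \<otimes>\<^bsub>A\<^esub> v = r \<and> v \<otimes>\<^bsub>A\<^esub> star A v = y \<otimes>\<^bsub>A\<^esub> c \<otimes>\<^bsub>A\<^esub> y"
proof -
  have e: "emb A r * emb A r = emb A r" "adj (emb A r) = emb A r" "adj (emb A y) = emb A y"
      "emb A r * emb A k = emb A k"
    using c r y rk by (simp_all flip: emb_mult[OF A] emb_star[OF A])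
  have "emb A r - emb A k * emb A y * emb A y * adj (emb A k) =
      emb A (r \<ominus>\<^bsub>A\<^esub> k \<otimes>\<^bsub>A\<^esub> y \<otimes>\<^bsub>A\<^esub> y \<otimes>\<^bsub>A\<^esub> star A k)"
    using c by (simp only: em us) (simp add: mult.assoc)
  then have "norm (emb A r - emb A k * emb A y * emb A y * adj (emb A k)) < 1"
    using near c by (simp add: norm_emb[OF A] unital_closed A)
  then obtain v c' where v: "adj v * v = emb A r" "v * adj v = emb A y * c' * emb A y"
    using projection_near_conjugate[OF e] by blast
  then have "pcomp (adj v * v) A = pcomp (emb A r) A" "pcomp (v * adj v) A = pcomp (emb A y * c' * emb A y) A" by simp_all
  then show ?thesis using c A
    by (intro bexI[of _ "pcomp v A"] bexI[of _ "pcomp c' A"]) (simp_all only: pcomp_simps pcomp_emb pcomp_closed simp_thms)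
qed

lemma carrier_projection_near_almost_projection:
  assumes c: "c \<in> carrier A" "star A c = c" "nrm A (c \<otimes>\<^bsub>A\<^esub> c \<ominus>\<^bsub>A\<^esub> c) \<le> e" "e \<le> 1/8"
  shows "\<exists>r\<in>projections A. nrm A (r \<ominus>\<^bsub>A\<^esub> c) \<le> 4 * e"
proof -
  have "adj (emb A c) = emb A c" using c by (simp flip: emb_star[OF A])
  moreover have "emb A c * emb A c - emb A c = emb A (c \<otimes>\<^bsub>A\<^esub> c \<ominus>\<^bsub>A\<^esub> c)"
    using c by (simp only: em us) simp
  then have "norm (emb A c * emb A c - emb A c) \<le> e"
    using c by (simp add: norm_emb[OF A] unital_closed A)
  ultimately obtain r where r: "r * r = r" "adj r = r" "norm (r - emb A c) \<le> 4 * e"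
    using projection_near_almost_projection c(4) by blast
  have "pcomp (r * r) A = pcomp r A" "pcomp (adj r) A = pcomp r A" using r by simp_all
  then have "pcomp r A \<in> projections A" using A by (simp add: projections_def pcomp_times pcomp_adj pcomp_closed)
  moreover have "nrm A (pcomp r A \<ominus>\<^bsub>A\<^esub> c) \<le> 4 * e"
    using nrm_pcomp_le[OF A, of "r - emb A c"] r c A by (simp add: pcomp_diff pcomp_emb)
  ultimately show ?thesis by blast
qed

lemma carrier_corner_scalar_or_split:
  assumes p: "p \<in> projections A" and h: "h \<in> carrier A" "star A h = h" "p \<otimes>\<^bsub>A\<^esub> h = h" "h \<otimes>\<^bsub>A\<^esub> p = h"
    and ns: "\<And>l :: real. h \<noteq> of_real l \<odot>\<^bsub>A\<^esub> p"
  shows "\<exists>x\<in>carrier A. \<exists>y\<in>carrier A. star A x = x \<and> x \<noteq> \<zero>\<^bsub>A\<^esub> \<and> x \<otimes>\<^bsub>A\<^esub> p = x \<and>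
    y \<noteq> \<zero>\<^bsub>A\<^esub> \<and> p \<otimes>\<^bsub>A\<^esub> y = y \<and> x \<otimes>\<^bsub>A\<^esub> y = \<zero>\<^bsub>A\<^esub>"
proof -
  have pcomp_in_carrier: "p \<in> carrier A" using p by (simp add: projections_def)
  have "emb A p * emb A p = emb A p" "adj (emb A p) = emb A p" "adj (emb A h) = emb A h"
      "emb A p * emb A h = emb A h" "emb A h * emb A p = emb A h"
    using p h by (simp_all add: projections_def flip: emb_mult[OF A] emb_star[OF A])
  moreover have "emb A h \<noteq> l *\<^sub>R emb A p" for l
    using ns[of l] pcomp_in_carrier h A emb_inject[OF A h(1), of "of_real l \<odot>\<^bsub>A\<^esub> p"]
    by (simp add: emb_scaleR unital_simps)
  ultimately obtain x y where x: "adj x = x" "x \<noteq> 0" "x * emb A p = x" "y \<noteq> 0" "emb A p * y = y" "x * y = 0"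
    using corner_scalar_or_split[of "emb A p" "emb A h"] by blast
  have "pcomp x A \<noteq> \<zero>\<^bsub>A\<^esub>" "pcomp y A \<noteq> \<zero>\<^bsub>A\<^esub>"
    using eq_zero_if_comp_zero[OF _ pcomp_in_carrier] x by blast+
  moreover have "pcomp (adj x) A = pcomp x A" "pcomp (x * emb A p) A = pcomp x A"
      "pcomp (emb A p * y) A = pcomp y A" "pcomp (x * y) A = pcomp 0 A" using x by simp_all
  ultimately show ?thesis using pcomp_in_carrier A
    by (intro bexI[of _ "pcomp x A"] bexI[of _ "pcomp y A"]) (simp_all only: pcomp_simps pcomp_emb pcomp_closed simp_thms)
qed

end

section \<open>Enveloping norms\<close>

text \<open>The norm of a row in the free left Hilbert module with inner product
  \<open>(\<Sum>i\<in>I. f i * adj (g i))\<close>.\<close>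

definition family_norm :: "'i set \<Rightarrow> ('i \<Rightarrow> 'a::cstar_alg) \<Rightarrow> real" where
  "family_norm I f = sqrt (norm (\<Sum>i\<in>I. f i * adj (f i)))"

lemma adj_sum: "adj (\<Sum>i\<in>I. f i) = (\<Sum>i\<in>I. adj (f i :: 'a::cstar_alg))"
  by (induction I rule: infinite_finite_induct) (auto simp: adj_add)

lemma psd_mult_adj: "psd (x * adj (x::'a::cstar_alg))"
  using psd_adj_mult[of "adj x"] by simp

lemma psd_zero: "psd (0::'a::cstar_alg)"
  using psd_mult_adj[of 0] by simp

lemma psd_sum: "(\<And>i. i \<in> I \<Longrightarrow> psd (f i)) \<Longrightarrow> psd (\<Sum>i\<in>I. f i :: 'a::cstar_alg)"
  by (induction I rule: infinite_finite_induct) (auto simp: psd_zero psd_add)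

lemma psd_conjugate': "psd a \<Longrightarrow> psd (k * a * adj k)" for k :: "'a::cstar_alg"
  using psd_conjugate[of a "adj k"] by simp

lemma family_norm_nonneg: "0 \<le> family_norm I f"
  by (simp add: family_norm_def)

lemma family_norm_square: "(family_norm I f)\<^sup>2 = norm (\<Sum>i\<in>I. f i * adj (f i))"
  by (simp add: family_norm_def)

lemma norm_le_family_norm:
  assumes "finite I" "i \<in> I"
  shows "norm (f i) \<le> family_norm I f"
proof -
  have "norm (f i * adj (f i)) \<le> norm (f i * adj (f i) + (\<Sum>j\<in>I - {i}. f j * adj (f j)))"
    by (intro psd_norm_mono psd_sum psd_mult_adj)
  also have "f i * adj (f i) + (\<Sum>j\<in>I - {i}. f j * adj (f j)) = (\<Sum>j\<in>I. f j * adj (f j))"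
    using assms by (simp add: sum.remove)
  finally show ?thesis by (simp add: family_norm_def norm_mult_adj real_le_rsqrt)
qed

text \<open>With \<open>a\<close> the inner product of \<open>g\<close> and \<open>f\<close>,
  subtract the component \<open>a * f i\<close> from \<open>g i\<close>. The sum \<open>T\<close>
  then becomes \<open>a * adj a\<close> plus positive terms, where the bound on \<open>f\<close>
  enters through positivity of \<open>1 - S\<close>.\<close>

lemma family_Cauchy_Schwarz_aux:
  assumes "finite I" "family_norm I f \<le> 1"
  shows "norm (\<Sum>i\<in>I. f i * adj (g i)) \<le> family_norm I g"
proof -
  define S where "S = (\<Sum>i\<in>I. f i * adj (f i))"
  define T where "T = (\<Sum>i\<in>I. g i * adj (g i))"
  define a where "a = (\<Sum>i\<in>I. g i * adj (f i))"
  define w where "w i = g i - a * f i" for i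
  have aa: "(\<Sum>i\<in>I. f i * adj (g i)) = adj a" by (simp add: a_def adj_sum adj_mult)
  have "norm S \<le> 1" using assms(2) by (simp add: family_norm_def S_def)
  moreover have "adj S = S" by (simp add: S_def adj_sum adj_mult)
  ultimately have p: "psd (1 - S)" using psd_bound[of S 1] by simp
  have "w i * adj (w i) = g i * adj (g i) - g i * adj (f i) * adj a - a * (f i * adj (g i)) + a * (f i * adj (f i)) * adj a" for i
    by (simp add: w_def adj_diff adj_mult algebra_simps)
  then have "(\<Sum>i\<in>I. w i * adj (w i)) = T - a * adj a - a * adj a + a * S * adj a"
    by (simp add: sum.distrib sum_subtractf T_def S_def aa a_def[symmetric] flip: sum_distrib_left sum_distrib_right)
  then have Te: "T = a * adj a + ((\<Sum>i\<in>I. w i * adj (w i)) + a * (1 - S) * adj a)"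
    by (simp add: algebra_simps)
  have "norm (a * adj a) \<le> norm T"
    unfolding Te by (intro psd_norm_mono psd_add psd_sum psd_mult_adj psd_conjugate'[OF p])
  then show ?thesis by (simp add: aa norm_mult_adj family_norm_def T_def real_le_rsqrt)
qed

lemma family_norm_scale: "family_norm I (\<lambda>i. r *\<^sub>R f i) = \<bar>r\<bar> * family_norm I f"
  by (simp add: family_norm_def adj_scaleR real_sqrt_mult flip: scaleR_sum_right)

lemma family_Cauchy_Schwarz:
  assumes I: "finite I"
  shows "norm (\<Sum>i\<in>I. f i * adj (g i)) \<le> family_norm I f * family_norm I g"
proof (cases "family_norm I f = 0")
  case True
  then have "f i = 0" if "i \<in> I" for i using norm_le_family_norm[OF I that, of f] by simp
  then show ?thesis using True by simp
next
  case False
  define r where "r = 1 / family_norm I f"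
  have r: "r > 0" using False family_norm_nonneg[of I f] by (simp add: r_def)
  have "family_norm I (\<lambda>i. r *\<^sub>R f i) \<le> 1"
    unfolding family_norm_scale using r False by (simp add: r_def)
  from family_Cauchy_Schwarz_aux[OF I this, of g]
  have "r * norm (\<Sum>i\<in>I. f i * adj (g i)) \<le> family_norm I g"
    using r by (simp flip: scaleR_sum_right)
  then show ?thesis using False family_norm_nonneg[of I f] by (simp add: r_def field_simps)
qed

lemma family_norm_triangle:
  assumes I: "finite I"
  shows "family_norm I (\<lambda>i. f i + g i) \<le> family_norm I f + family_norm I g"
proof (rule power2_le_imp_le)
  have e: "(\<Sum>i\<in>I. (f i + g i) * adj (f i + g i)) =
      (\<Sum>i\<in>I. f i * adj (f i)) + (\<Sum>i\<in>I. f i * adj (g i)) + ((\<Sum>i\<in>I. g i * adj (f i)) + (\<Sum>i\<in>I. g i * adj (g i)))"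
    by (simp add: adj_add algebra_simps sum.distrib)
  have "norm (\<Sum>i\<in>I. (f i + g i) * adj (f i + g i)) \<le>
      norm (\<Sum>i\<in>I. f i * adj (f i)) + norm (\<Sum>i\<in>I. f i * adj (g i)) +
      (norm (\<Sum>i\<in>I. g i * adj (f i)) + norm (\<Sum>i\<in>I. g i * adj (g i)))"
    unfolding e by (rule order_trans[OF norm_triangle_ineq add_mono[OF norm_triangle_ineq norm_triangle_ineq]])
  also have "\<dots> \<le> (family_norm I f)\<^sup>2 + family_norm I f * family_norm I g +
      (family_norm I g * family_norm I f + (family_norm I g)\<^sup>2)"
    unfolding family_norm_square by (intro add_mono family_Cauchy_Schwarz I order_refl)
  also have "\<dots> = (family_norm I f + family_norm I g)\<^sup>2" by (simp add: power2_sum)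
  finally show "(family_norm I (\<lambda>i. f i + g i))\<^sup>2 \<le> (family_norm I f + family_norm I g)\<^sup>2"
    by (simp only: family_norm_square)
qed (simp add: family_norm_nonneg)

lemma family_norm_sum:
  assumes "finite I"
  shows "family_norm I (\<lambda>i. \<Sum>j\<in>J. f j i) \<le> (\<Sum>j\<in>J. family_norm I (f j))"
proof (induction J rule: infinite_finite_induct)
  case (insert j J)
  then show ?case using family_norm_triangle[OF assms, of "f j" "\<lambda>i. \<Sum>j\<in>J. f j i"] by simp
qed (simp_all add: family_norm_def)

text \<open>Each \<open>M\<^sup>2 *\<^sub>R 1 - c i * adj (c i)\<close> is positive, and so are its
  conjugates by \<open>f i\<close>. The factors may vary with \<open>i\<close> because different
  translates of one coefficient occur in a convolution.\<close>

lemma family_norm_mult_le: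
  assumes I: "finite I" and c: "\<And>i. i \<in> I \<Longrightarrow> norm (c i) \<le> M" and M: "0 \<le> M"
  shows "family_norm I (\<lambda>i. f i * c i) \<le> M * family_norm I f"
proof -
  have p: "psd (f i * (M\<^sup>2 *\<^sub>R 1 - c i * adj (c i)) * adj (f i))" if "i \<in> I" for i
    using c[OF that] by (intro psd_conjugate' psd_bound) (auto simp: adj_mult norm_mult_adj intro: power_mono)
  define u where "u = (\<Sum>i\<in>I. (f i * c i) * adj (f i * c i))"
  define v where "v = (\<Sum>i\<in>I. f i * (M\<^sup>2 *\<^sub>R 1 - c i * adj (c i)) * adj (f i))"
  have "u + v = (\<Sum>i\<in>I. M\<^sup>2 *\<^sub>R (f i * adj (f i)))"
    unfolding u_def v_def sum.distrib[symmetric]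
    by (rule sum.cong) (simp_all add: adj_mult algebra_simps)
  moreover have "psd u" unfolding u_def by (rule psd_sum) (rule psd_mult_adj)
  moreover have "psd v" unfolding v_def by (rule psd_sum) (rule p)
  ultimately have "norm (\<Sum>i\<in>I. (f i * c i) * adj (f i * c i)) \<le> norm (\<Sum>i\<in>I. M\<^sup>2 *\<^sub>R (f i * adj (f i)))"
    using psd_norm_mono[of u v] by (simp only: u_def)
  then have "(family_norm I (\<lambda>i. f i * c i))\<^sup>2 \<le> (M * family_norm I f)\<^sup>2"
    by (simp add: family_norm_square power_mult_distrib flip: scaleR_sum_right)
  then show ?thesis by (rule power2_le_imp_le) (simp add: M family_norm_nonneg)
qed

lemma family_norm_reindex:
  assumes "bij_betw h J I"
  shows "family_norm J (\<lambda>j. f (h j)) = family_norm I f"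
  using sum.reindex_bij_betw[OF assms, of "\<lambda>i. f i * adj (f i)"] by (simp add: family_norm_def)

section \<open>Suprema of dominated C*-seminorms\<close>

definition dominated_seminorms :: "('a, 'm) cstar_scheme \<Rightarrow> ('a \<Rightarrow> real) set" where
  "dominated_seminorms A = {p. cstar_seminorm A p \<and> (\<forall>y\<in>carrier A. p y \<le> nrm A y)}"

context
  fixes A :: "('a, 'm) cstar_scheme" and p
  assumes p: "p \<in> dominated_seminorms A"
begin

lemma enveloping_upper: "q \<in> dominated_seminorms A \<Longrightarrow> x \<in> carrier A \<Longrightarrow> q x \<le> enveloping_norm A x"
  unfolding enveloping_norm_def dominated_seminorms_def
  by (rule cSUP_upper) (auto intro!: bdd_aboveI[of _ "nrm A x"])

text \<open>A member \<open>p\<close> of the family is assumed because the supremum of an empty set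
  of reals says nothing. For crossed products the norm of right multiplication will serve as
  \<open>p\<close>.\<close>

lemma enveloping_least:
  "(\<And>q. q \<in> dominated_seminorms A \<Longrightarrow> q x \<le> K) \<Longrightarrow> enveloping_norm A x \<le> K"
  unfolding enveloping_norm_def
  by (rule cSUP_least) (use p in \<open>auto simp: dominated_seminorms_def\<close>)

lemma enveloping_norm_le: "x \<in> carrier A \<Longrightarrow> enveloping_norm A x \<le> nrm A x"
  by (rule enveloping_least) (auto simp: dominated_seminorms_def)

lemma enveloping_nonneg: "x \<in> carrier A \<Longrightarrow> 0 \<le> enveloping_norm A x"
  using enveloping_upper[OF p, of x] p
  by (auto simp: dominated_seminorms_def cstar_seminorm_def intro: order_trans)

lemma cstar_seminorm_enveloping:
  assumes closed: "\<And>c x. x \<in> carrier A \<Longrightarrow> c \<odot>\<^bsub>A\<^esub> x \<in> carrier A"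
    "\<And>x y. x \<in> carrier A \<Longrightarrow> y \<in> carrier A \<Longrightarrow> x \<otimes>\<^bsub>A\<^esub> y \<in> carrier A"
    "\<And>x. x \<in> carrier A \<Longrightarrow> star A x \<in> carrier A"
  shows "cstar_seminorm A (enveloping_norm A)"
  unfolding cstar_seminorm_def
proof (intro conjI ballI allI)
  note N0 = enveloping_nonneg and NU = enveloping_upper
  have q: "q x \<ge> 0" "q (star A x \<otimes>\<^bsub>A\<^esub> x) = (q x)\<^sup>2" "q (c \<odot>\<^bsub>A\<^esub> x) = cmod c * q x"
    "y \<in> carrier A \<Longrightarrow> q (x \<oplus>\<^bsub>A\<^esub> y) \<le> q x + q y" "y \<in> carrier A \<Longrightarrow> q (x \<otimes>\<^bsub>A\<^esub> y) \<le> q x * q y"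
    if "q \<in> dominated_seminorms A" "x \<in> carrier A" for q x y c
    using that by (auto simp: dominated_seminorms_def cstar_seminorm_def)
  fix x assume x: "x \<in> carrier A"
  show "0 \<le> enveloping_norm A x" using x by (rule N0)
  have sx: "star A x \<otimes>\<^bsub>A\<^esub> x \<in> carrier A" using closed x by auto
  show "enveloping_norm A (star A x \<otimes>\<^bsub>A\<^esub> x) = (enveloping_norm A x)\<^sup>2"
  proof (rule antisym)
    show "enveloping_norm A (star A x \<otimes>\<^bsub>A\<^esub> x) \<le> (enveloping_norm A x)\<^sup>2"
      by (rule enveloping_least) (simp add: q x NU power_mono)
    have "q x \<le> sqrt (enveloping_norm A (star A x \<otimes>\<^bsub>A\<^esub> x))" if "q \<in> dominated_seminorms A" for q
      using NU[OF that sx] q(2)[OF that x] by (simp add: real_le_rsqrt)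
    then have "enveloping_norm A x \<le> sqrt (enveloping_norm A (star A x \<otimes>\<^bsub>A\<^esub> x))" by (rule enveloping_least)
    then have "(enveloping_norm A x)\<^sup>2 \<le> (sqrt (enveloping_norm A (star A x \<otimes>\<^bsub>A\<^esub> x)))\<^sup>2"
      using N0[OF x] by (rule power_mono)
    then show "(enveloping_norm A x)\<^sup>2 \<le> enveloping_norm A (star A x \<otimes>\<^bsub>A\<^esub> x)" using N0[OF sx] by simp
  qed
  fix y assume y: "y \<in> carrier A"
  show "enveloping_norm A (x \<oplus>\<^bsub>A\<^esub> y) \<le> enveloping_norm A x + enveloping_norm A y"
    using NU[OF _ x] NU[OF _ y] q(4)[OF _ x y] by (intro enveloping_least) (meson add_mono order_trans)
  show "enveloping_norm A (x \<otimes>\<^bsub>A\<^esub> y) \<le> enveloping_norm A x * enveloping_norm A y"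
  proof (rule enveloping_least)
    fix r assume r: "r \<in> dominated_seminorms A"
    have "r (x \<otimes>\<^bsub>A\<^esub> y) \<le> r x * r y" using q(5)[OF r x y] .
    also have "\<dots> \<le> enveloping_norm A x * enveloping_norm A y"
      using NU[OF r x] NU[OF r y] q(1)[OF r x] q(1)[OF r y] N0[OF x] by (intro mult_mono) auto
    finally show "r (x \<otimes>\<^bsub>A\<^esub> y) \<le> enveloping_norm A x * enveloping_norm A y" .
  qed
next
  note N0 = enveloping_nonneg and NU = enveloping_upper
  fix c x assume x: "x \<in> carrier A"
  have q: "q (c \<odot>\<^bsub>A\<^esub> x) = cmod c * q x" if "q \<in> dominated_seminorms A" for q
    using that x by (auto simp: dominated_seminorms_def cstar_seminorm_def)
  show "enveloping_norm A (c \<odot>\<^bsub>A\<^esub> x) = cmod c * enveloping_norm A x"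
  proof (rule antisym)
    show "enveloping_norm A (c \<odot>\<^bsub>A\<^esub> x) \<le> cmod c * enveloping_norm A x"
      by (rule enveloping_least) (simp add: q NU x mult_left_mono)
    show "cmod c * enveloping_norm A x \<le> enveloping_norm A (c \<odot>\<^bsub>A\<^esub> x)"
    proof (cases "c = 0")
      case True
      then show ?thesis using N0 closed(1)[OF x] by simp
    next
      case False
      have "q x \<le> enveloping_norm A (c \<odot>\<^bsub>A\<^esub> x) / cmod c" if "q \<in> dominated_seminorms A" for q
        using NU[OF that closed(1)[OF x, of c]] q[OF that] False by (simp add: field_simps)
      then have "enveloping_norm A x \<le> enveloping_norm A (c \<odot>\<^bsub>A\<^esub> x) / cmod c" by (rule enveloping_least)
      then show ?thesis using False by (simp add: field_simps)
    qed
  qed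
qed

end

section \<open>Crossed products are C*-algebras\<close>

lemma crossed_product_ops:
  "carrier (crossed_product G A \<alpha>) = carrier G \<rightarrow>\<^sub>E carrier A"
  "\<one>\<^bsub>crossed_product G A \<alpha>\<^esub> = (\<lambda>s\<in>carrier G. if s = \<one>\<^bsub>G\<^esub> then \<one>\<^bsub>A\<^esub> else \<zero>\<^bsub>A\<^esub>)"
  "\<zero>\<^bsub>crossed_product G A \<alpha>\<^esub> = (\<lambda>s\<in>carrier G. \<zero>\<^bsub>A\<^esub>)"
  "x \<oplus>\<^bsub>crossed_product G A \<alpha>\<^esub> y = (\<lambda>s\<in>carrier G. x s \<oplus>\<^bsub>A\<^esub> y s)"
  "c \<odot>\<^bsub>crossed_product G A \<alpha>\<^esub> x = (\<lambda>s\<in>carrier G. c \<odot>\<^bsub>A\<^esub> x s)"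
  "nrm (crossed_product G A \<alpha>) = enveloping_norm (l1_crossed_product G A \<alpha>)"
  by (simp_all add: crossed_product_def l1_crossed_product_def)

lemma l1_crossed_product_ops:
  "carrier (l1_crossed_product G A \<alpha>) = carrier (crossed_product G A \<alpha>)"
  "mult (l1_crossed_product G A \<alpha>) = mult (crossed_product G A \<alpha>)"
  "add (l1_crossed_product G A \<alpha>) = add (crossed_product G A \<alpha>)"
  "smult (l1_crossed_product G A \<alpha>) = smult (crossed_product G A \<alpha>)"
  "star (l1_crossed_product G A \<alpha>) = star (crossed_product G A \<alpha>)"
  "nrm (l1_crossed_product G A \<alpha>) x = (\<Sum>s\<in>carrier G. nrm A (x s))"
  by (simp_all add: crossed_product_def l1_crossed_product_def)

locale unital_action = group G for G :: "('g, 'k) monoid_scheme" (structure) +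
  fixes A :: "'a cstar" and \<alpha> :: "'g \<Rightarrow> 'a \<Rightarrow> 'a"
  assumes fin: "finite (carrier G)" and A: "unital_cstar A" and act: "cstar_action G A \<alpha>"
begin

abbreviation "C \<equiv> crossed_product G A \<alpha>"
abbreviation "\<iota> \<equiv> emb A"

lemmas em = emb_simps[OF A]
lemmas cl = unital_closed[OF A]
lemmas act_simps = cstar_actionD[OF act]

lemma act_zero: "g \<in> carrier G \<Longrightarrow> \<alpha> g \<zero>\<^bsub>A\<^esub> = \<zero>\<^bsub>A\<^esub>"
  using act_simps(4)[of g "\<zero>\<^bsub>A\<^esub>" 0] A by (simp add: unital_zero_smult act_simps cl)

lemma act_id: "x \<in> carrier A \<Longrightarrow> \<alpha> \<one> x = x"
  by (rule act_simps(2)[OF one_closed])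

lemma act_one:
  assumes g: "g \<in> carrier G"
  shows "\<alpha> g \<one>\<^bsub>A\<^esub> = \<one>\<^bsub>A\<^esub>"
proof -
  define u where "u = \<alpha> (inv g) \<one>\<^bsub>A\<^esub>"
  have u: "u \<in> carrier A" using g by (simp add: u_def act_simps cl)
  have "\<alpha> g u = \<one>\<^bsub>A\<^esub>"
    using g by (simp add: u_def cl act_simps(2) act_simps(3)[symmetric])
  moreover have "\<alpha> g (\<one>\<^bsub>A\<^esub> \<otimes>\<^bsub>A\<^esub> u) = \<alpha> g \<one>\<^bsub>A\<^esub> \<otimes>\<^bsub>A\<^esub> \<alpha> g u"
    using g u by (intro act_simps) (auto simp: cl)
  ultimately show ?thesis using g u A by (simp add: unital_simps act_simps cl)
qed

lemma act_uminus:
  assumes "g \<in> carrier G" "x \<in> carrier A"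
  shows "\<alpha> g (\<ominus>\<^bsub>A\<^esub> x) = \<ominus>\<^bsub>A\<^esub> \<alpha> g x"
  using assms by (simp add: pre_cstar_algebra.uminus_eq_smult[OF unital_pre[OF A]] act_simps)

lemma act_minus:
  assumes "g \<in> carrier G" "x \<in> carrier A" "y \<in> carrier A"
  shows "\<alpha> g (x \<ominus>\<^bsub>A\<^esub> y) = \<alpha> g x \<ominus>\<^bsub>A\<^esub> \<alpha> g y"
  using assms by (simp add: a_minus_def act_simps act_uminus cl)

text \<open>\<open>M\<^sup>2\<close> minus the square of \<open>x\<close> is again a square, and the
  automorphism preserves this identity because it fixes the unit. Monotonicity of the norm on sums
  of squares then bounds the image.\<close>

lemma act_contractive:
  assumes g: "g \<in> carrier G" and x: "x \<in> carrier A"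
  shows "nrm A (\<alpha> g x) \<le> nrm A x"
proof -
  define M where "M = nrm A x"
  have M: "0 \<le> M" using x A by (simp add: M_def unital_simps)
  define t where "t = (complex_of_real (M\<^sup>2)) \<odot>\<^bsub>A\<^esub> \<one>\<^bsub>A\<^esub>"
  have t: "t \<in> carrier A" by (simp add: t_def cl)
  obtain b where b: "b \<in> carrier A" "t \<ominus>\<^bsub>A\<^esub> star A x \<otimes>\<^bsub>A\<^esub> x = star A b \<otimes>\<^bsub>A\<^esub> b"
    using carrier_square_complement[OF A x, of M] unfolding t_def M_def by auto
  have "\<alpha> g t = t" using g by (simp add: t_def act_simps act_one cl)
  moreover have "\<alpha> g (t \<ominus>\<^bsub>A\<^esub> star A x \<otimes>\<^bsub>A\<^esub> x) = \<alpha> g (star A b \<otimes>\<^bsub>A\<^esub> b)" by (simp only: b)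
  ultimately have e: "t \<ominus>\<^bsub>A\<^esub> star A (\<alpha> g x) \<otimes>\<^bsub>A\<^esub> \<alpha> g x = star A (\<alpha> g b) \<otimes>\<^bsub>A\<^esub> \<alpha> g b"
    using g x b(1) t by (simp add: act_minus act_simps cl)
  interpret R: ring A using A by (rule unital_ring)
  define y where "y = \<alpha> g x"
  have y: "y \<in> carrier A" using g x by (simp add: y_def act_simps)
  have "star A y \<otimes>\<^bsub>A\<^esub> y \<oplus>\<^bsub>A\<^esub> star A (\<alpha> g b) \<otimes>\<^bsub>A\<^esub> \<alpha> g b = t"
    unfolding e[symmetric] y_def[symmetric] using y t
    by (simp add: a_minus_def R.a_lcomm[of _ t] R.r_neg cl)
  then have "nrm A (star A y \<otimes>\<^bsub>A\<^esub> y) \<le> nrm A t"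
    using carrier_sum_squares(2)[OF A y, of "\<alpha> g b"] g b by (simp add: act_simps)
  also have "nrm A t \<le> M\<^sup>2"
    using unital_nrm_one[OF A] A by (simp add: t_def unital_nrm cl mult_left_le norm_power)
  finally have "(nrm A y)\<^sup>2 \<le> M\<^sup>2" using A y by (simp add: unital_nrm)
  then show ?thesis using M unfolding y_def M_def by (rule power2_le_imp_le)
qed

text \<open>All coordinates outside the factor \<open>A\<close> are discarded, so even at the group
  unit this is not the identity but a compression. Hence \<open>al_one\<close> speaks of embedded
  elements.\<close>

definition al :: "'g \<Rightarrow> 'a cprod \<Rightarrow> 'a cprod" where
  "al g u = \<iota> (\<alpha> g (pcomp u A))"

lemma pcomp_in_carrier: "pcomp u A \<in> carrier A"
  using A by (rule pcomp_closed)

lemma al_emb: "x \<in> carrier A \<Longrightarrow> al g (\<iota> x) = \<iota> (\<alpha> g x)"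
  by (simp add: al_def pcomp_emb[OF A])

context
  fixes g assumes g: "g \<in> carrier G"
begin

lemma al_add: "al g (u + v) = al g u + al g v"
  using g by (simp add: al_def pcomp_add[OF A] act_simps pcomp_in_carrier em)

lemma al_zero [simp]: "al g 0 = 0"
  using g by (simp add: al_def pcomp_zero[OF A] act_zero em)

lemma al_sum: "al g (\<Sum>i\<in>I. f i) = (\<Sum>i\<in>I. al g (f i))"
  by (induction I rule: infinite_finite_induct) (auto simp: al_add)

lemma al_mult: "al g (u * v) = al g u * al g v"
  using g by (simp add: al_def pcomp_times[OF A] act_simps pcomp_in_carrier em)

lemma al_adj: "al g (adj u) = adj (al g u)"
  using g by (simp add: al_def pcomp_adj[OF A] act_simps pcomp_in_carrier em)

lemma al_comp: "h \<in> carrier G \<Longrightarrow> al g (al h u) = al (g \<otimes> h) u"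
  using g by (simp add: al_def pcomp_emb[OF A] act_simps pcomp_in_carrier)

lemma norm_al: "norm (al g u) \<le> norm u"
  using act_contractive[OF g pcomp_in_carrier, of u] nrm_pcomp_le[OF A, of u] g
  by (simp add: al_def norm_emb[OF A] act_simps pcomp_in_carrier)

end

lemma al_one: "x \<in> carrier A \<Longrightarrow> al \<one> (\<iota> x) = \<iota> x"
  by (simp add: al_emb act_id)

lemma sum_translate: "g \<in> carrier G \<Longrightarrow> (\<Sum>t\<in>carrier G. f (g \<otimes> t)) = (\<Sum>t\<in>carrier G. f t)"
  by (rule sum.reindex_bij_betw) (auto intro!: bij_betw_byWitness[where f' = "\<lambda>t. inv g \<otimes> t"] simp flip: m_assoc)

section \<open>The convolution algebra\<close>

lemma C_app: "x \<in> carrier C \<Longrightarrow> s \<in> carrier G \<Longrightarrow> x s \<in> carrier A"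
  by (auto simp: crossed_product_ops)

lemma C_eqI: "x \<in> carrier C \<Longrightarrow> y \<in> carrier C \<Longrightarrow> (\<And>s. s \<in> carrier G \<Longrightarrow> x s = y s) \<Longrightarrow> x = y"
  unfolding crossed_product_ops by (rule PiE_ext)

lemma C_closed:
  "x \<in> carrier C \<Longrightarrow> y \<in> carrier C \<Longrightarrow> x \<otimes>\<^bsub>C\<^esub> y \<in> carrier C"
  "x \<in> carrier C \<Longrightarrow> star C x \<in> carrier C"
  "x \<in> carrier C \<Longrightarrow> y \<in> carrier C \<Longrightarrow> x \<oplus>\<^bsub>C\<^esub> y \<in> carrier C"
  "x \<in> carrier C \<Longrightarrow> c \<odot>\<^bsub>C\<^esub> x \<in> carrier C"
  "\<one>\<^bsub>C\<^esub> \<in> carrier C" "\<zero>\<^bsub>C\<^esub> \<in> carrier C"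
proof -
  interpret R: ring A using A by (rule unital_ring)
  show "x \<in> carrier C \<Longrightarrow> y \<in> carrier C \<Longrightarrow> x \<otimes>\<^bsub>C\<^esub> y \<in> carrier C"
    unfolding crossed_product_simps(1,2)
    by (intro restrict_PiE_iff[THEN iffD2] ballI R.finsum_closed) (auto intro!: R.m_closed act_simps)
qed (auto simp: crossed_product_ops crossed_product_simps(3) cl act_simps
    funcset_extensional_app[where T = "carrier A"])

lemma emb_C_mult:
  assumes "x \<in> carrier C" "y \<in> carrier C" "s \<in> carrier G"
  shows "\<iota> ((x \<otimes>\<^bsub>C\<^esub> y) s) = (\<Sum>t\<in>carrier G. \<iota> (x t) * al t (\<iota> (y (inv t \<otimes> s))))"
proof -
  have "(\<lambda>t. x t \<otimes>\<^bsub>A\<^esub> \<alpha> t (y (inv t \<otimes> s))) \<in> carrier G \<rightarrow> carrier A"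
    using assms by (auto simp: crossed_product_ops intro!: cl act_simps)
  from emb_finsum[OF A this] show ?thesis
    using assms by (simp add: crossed_product_simps(2) C_app act_simps em al_emb)
qed

lemma emb_C_star:
  assumes "x \<in> carrier C" "s \<in> carrier G"
  shows "\<iota> (star C x s) = al s (adj (\<iota> (x (inv s))))"
  using assms by (simp add: crossed_product_simps(3) C_app act_simps cl al_emb flip: em)

lemma emb_C_add:
  assumes "x \<in> carrier C" "y \<in> carrier C" "s \<in> carrier G"
  shows "\<iota> ((x \<oplus>\<^bsub>C\<^esub> y) s) = \<iota> (x s) + \<iota> (y s)"
  using assms by (simp add: crossed_product_ops(4) C_app em)

lemma C_emb_eqI:
  assumes "x \<in> carrier C" "y \<in> carrier C" "\<And>s. s \<in> carrier G \<Longrightarrow> \<iota> (x s) = \<iota> (y s)"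
  shows "x = y"
  using assms by (intro C_eqI) (auto simp: emb_inject[OF A] C_app)

lemma C_assoc:
  assumes x: "x \<in> carrier C" and y: "y \<in> carrier C" and z: "z \<in> carrier C"
  shows "(x \<otimes>\<^bsub>C\<^esub> y) \<otimes>\<^bsub>C\<^esub> z = x \<otimes>\<^bsub>C\<^esub> (y \<otimes>\<^bsub>C\<^esub> z)"
proof (rule C_emb_eqI)
  fix s assume s: "s \<in> carrier G"
  have "\<iota> ((x \<otimes>\<^bsub>C\<^esub> (y \<otimes>\<^bsub>C\<^esub> z)) s) = (\<Sum>r\<in>carrier G. \<iota> (x r) *
      (\<Sum>u\<in>carrier G. al r (\<iota> (y u)) * al (r \<otimes> u) (\<iota> (z (inv u \<otimes> (inv r \<otimes> s))))))"
    using s x y z by (simp add: emb_C_mult C_closed al_sum al_mult al_comp)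
  also have "\<dots> = (\<Sum>r\<in>carrier G. \<Sum>t\<in>carrier G. \<iota> (x r) * al r (\<iota> (y (inv r \<otimes> t))) * al t (\<iota> (z (inv t \<otimes> s))))"
  proof (rule sum.cong[OF refl])
    fix r assume r: "r \<in> carrier G"
    have "(\<Sum>u\<in>carrier G. al r (\<iota> (y u)) * al (r \<otimes> u) (\<iota> (z (inv u \<otimes> (inv r \<otimes> s))))) =
        (\<Sum>u\<in>carrier G. al r (\<iota> (y (inv r \<otimes> (r \<otimes> u)))) * al (r \<otimes> u) (\<iota> (z (inv (r \<otimes> u) \<otimes> s))))"
      using r s by (intro sum.cong) (simp_all add: inv_mult_group m_assoc flip: m_assoc[of "inv r" r])
    also have "\<dots> = (\<Sum>t\<in>carrier G. al r (\<iota> (y (inv r \<otimes> t))) * al t (\<iota> (z (inv t \<otimes> s))))"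
      by (rule sum_translate[OF r])
    finally show "\<iota> (x r) * (\<Sum>u\<in>carrier G. al r (\<iota> (y u)) * al (r \<otimes> u) (\<iota> (z (inv u \<otimes> (inv r \<otimes> s))))) =
        (\<Sum>t\<in>carrier G. \<iota> (x r) * al r (\<iota> (y (inv r \<otimes> t))) * al t (\<iota> (z (inv t \<otimes> s))))"
      by (simp add: sum_distrib_left mult.assoc)
  qed
  also have "\<dots> = (\<Sum>t\<in>carrier G. (\<Sum>r\<in>carrier G. \<iota> (x r) * al r (\<iota> (y (inv r \<otimes> t)))) * al t (\<iota> (z (inv t \<otimes> s))))"
    by (subst sum.swap) (simp add: sum_distrib_right)
  also have "\<dots> = \<iota> (((x \<otimes>\<^bsub>C\<^esub> y) \<otimes>\<^bsub>C\<^esub> z) s)"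
    using s x y z by (simp add: emb_C_mult C_closed)
  finally show "\<iota> (((x \<otimes>\<^bsub>C\<^esub> y) \<otimes>\<^bsub>C\<^esub> z) s) = \<iota> ((x \<otimes>\<^bsub>C\<^esub> (y \<otimes>\<^bsub>C\<^esub> z)) s)" ..
qed (use assms in \<open>auto simp: C_closed\<close>)

lemma C_star_mult:
  assumes x: "x \<in> carrier C" and y: "y \<in> carrier C"
  shows "star C (x \<otimes>\<^bsub>C\<^esub> y) = star C y \<otimes>\<^bsub>C\<^esub> star C x"
proof (rule C_emb_eqI)
  fix s assume s: "s \<in> carrier G"
  have e: "s \<otimes> (inv (s \<otimes> t) \<otimes> s) = s \<otimes> inv t \<otimes> inv s \<otimes> s" if "t \<in> carrier G" for t
    using s that by (simp add: inv_mult_group m_assoc)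
  have "\<iota> ((star C y \<otimes>\<^bsub>C\<^esub> star C x) s) =
      (\<Sum>t\<in>carrier G. al t (adj (\<iota> (y (inv t)))) * al s (adj (\<iota> (x (inv s \<otimes> t)))))"
    unfolding emb_C_mult[OF C_closed(2)[OF y] C_closed(2)[OF x] s]
    using s x y by (intro sum.cong) (simp_all add: emb_C_star al_comp inv_mult_group flip: m_assoc)
  also have "\<dots> = (\<Sum>t\<in>carrier G. al (s \<otimes> t) (adj (\<iota> (y (inv (s \<otimes> t))))) * al s (adj (\<iota> (x (inv s \<otimes> (s \<otimes> t))))))"
    by (rule sum_translate[OF s, symmetric])
  also have "\<dots> = (\<Sum>t\<in>carrier G. al (s \<otimes> t) (adj (\<iota> (y (inv t \<otimes> inv s)))) * al s (adj (\<iota> (x t))))"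
    using s by (intro sum.cong) (simp_all add: inv_mult_group flip: m_assoc[of "inv s" s])
  also have "\<dots> = \<iota> (star C (x \<otimes>\<^bsub>C\<^esub> y) s)"
    using s x y by (simp add: emb_C_star emb_C_mult C_closed adj_sum adj_mult al_sum al_mult al_comp flip: al_adj)
  finally show "\<iota> (star C (x \<otimes>\<^bsub>C\<^esub> y) s) = \<iota> ((star C y \<otimes>\<^bsub>C\<^esub> star C x) s)" ..
qed (use assms in \<open>auto simp: C_closed\<close>)

lemma C_one_mult:
  assumes x: "x \<in> carrier C"
  shows "\<one>\<^bsub>C\<^esub> \<otimes>\<^bsub>C\<^esub> x = x" "x \<otimes>\<^bsub>C\<^esub> \<one>\<^bsub>C\<^esub> = x"
proof -
  interpret R: ring A using A by (rule unital_ring)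
  have d: "\<iota> ((if s = t then \<one>\<^bsub>A\<^esub> else \<zero>\<^bsub>A\<^esub>)) = (if s = t then \<iota> \<one>\<^bsub>A\<^esub> else 0)" for s t :: 'g
    by (simp add: em)
  show "\<one>\<^bsub>C\<^esub> \<otimes>\<^bsub>C\<^esub> x = x"
  proof (rule C_emb_eqI)
    fix s assume s: "s \<in> carrier G"
    have "\<iota> ((\<one>\<^bsub>C\<^esub> \<otimes>\<^bsub>C\<^esub> x) s) = (\<Sum>t\<in>carrier G. if t = \<one> then \<iota> (x s) else 0)"
      unfolding emb_C_mult[OF C_closed(5) x s]
      using s x by (intro sum.cong) (auto simp: crossed_product_ops(2) em al_one C_app simp flip: emb_mult[OF A])
    also have "\<dots> = \<iota> (x s)" using fin by simp
    finally show "\<iota> ((\<one>\<^bsub>C\<^esub> \<otimes>\<^bsub>C\<^esub> x) s) = \<iota> (x s)" .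
  qed (use x in \<open>auto simp: C_closed\<close>)
  show "x \<otimes>\<^bsub>C\<^esub> \<one>\<^bsub>C\<^esub> = x"
  proof (rule C_emb_eqI)
    fix s assume s: "s \<in> carrier G"
    have "inv t \<otimes> s = \<one> \<longleftrightarrow> t = s" if "t \<in> carrier G" for t
      using that s by (metis inv_closed inv_equality inv_inv l_inv)
    then have "\<iota> ((x \<otimes>\<^bsub>C\<^esub> \<one>\<^bsub>C\<^esub>) s) = (\<Sum>t\<in>carrier G. if t = s then \<iota> (x s) else 0)"
      unfolding emb_C_mult[OF x C_closed(5) s]
      using s x by (intro sum.cong)
        (auto simp: crossed_product_ops(2) em al_emb act_one act_zero C_app cl simp flip: emb_mult[OF A])
    also have "\<dots> = \<iota> (x s)" using fin s by simp
    finally show "\<iota> ((x \<otimes>\<^bsub>C\<^esub> \<one>\<^bsub>C\<^esub>) s) = \<iota> (x s)" .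
  qed (use x in \<open>auto simp: C_closed\<close>)
qed

lemma C_monoid: "Group.monoid C"
  by (rule monoidI) (auto simp: C_closed C_assoc C_one_mult)

lemma C_module: "module complex_ring C"
proof -
  interpret F: cstar_algebra "fun_cstar (carrier G) A"
    using cstar_algebra.cstar_algebra_fun[of A "carrier G"] A fin one_closed
    by (auto simp: unital_cstar_def)
  have "abelian_group (fun_cstar (carrier G) A)"
    using F.module_axioms by (rule module.axioms(2))
  then have "abelian_group C"
    unfolding abelian_group_def abelian_monoid_def abelian_group_axioms_def
    by (simp only: crossed_product_simps(4))
  then show ?thesis
    using F.smult_closed F.smult_l_distr F.smult_r_distr F.smult_assoc1 F.smult_one
    by (intro moduleI cring_complex_ring) (simp_all add: crossed_product_ops)
qed

end

lemma pcomp_sc: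
  assumes A: "unital_cstar A"
  shows "pcomp (sc c) A = c \<odot>\<^bsub>A\<^esub> \<one>\<^bsub>A\<^esub>"
proof -
  have o: "\<one>\<^bsub>A\<^esub> \<in> carrier A" using A by (rule unital_closed)
  have "pcomp (sc c) A = of_real (Re c) \<odot>\<^bsub>A\<^esub> \<one>\<^bsub>A\<^esub> \<oplus>\<^bsub>A\<^esub> of_real (Im c) \<odot>\<^bsub>A\<^esub> (\<i> \<odot>\<^bsub>A\<^esub> \<one>\<^bsub>A\<^esub>)"
    using A by (simp add: sc_def pcomp_simps pcomp_iu)
  also have "\<dots> = (of_real (Re c) + of_real (Im c) * \<i>) \<odot>\<^bsub>A\<^esub> \<one>\<^bsub>A\<^esub>"
    using A o by (simp only: module.smult_l_distr[OF unital_module, simplified]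
        module.smult_assoc1[OF unital_module, simplified])
  finally show ?thesis by (simp add: complex_eq[of c, symmetric] mult.commute)
qed

lemma pcomp_sc_mult: "unital_cstar A \<Longrightarrow> pcomp (sc c * u) A = c \<odot>\<^bsub>A\<^esub> pcomp u A"
  by (simp add: pcomp_times pcomp_sc pcomp_closed unital_simps)

lemma emb_smult: "unital_cstar A \<Longrightarrow> x \<in> carrier A \<Longrightarrow> emb A (c \<odot>\<^bsub>A\<^esub> x) = sc c * emb A x"
  by (intro cprod_eqI)
    (auto simp: pcomp_emb' pcomp_sc_mult pscal_times unital_closed unital_smult_zero)

lemma (in pre_cstar_algebra) separable_cstar_iff:
  "separable_cstar A \<longleftrightarrow> (\<exists>D. countable D \<and> D \<subseteq> carrier A \<and>
     (\<forall>x\<in>carrier A. \<forall>e>0. \<exists>d\<in>D. nrm A (x \<ominus> d) < e))"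
proof -
  interpret M: Metric_space "carrier A" "cstar_dist A" by (rule metric_space)
  have "M.mtopology closure_of D = carrier A \<longleftrightarrow> (\<forall>x\<in>carrier A. \<forall>e>0. \<exists>d\<in>D. nrm A (x \<ominus> d) < e)"
    if "D \<subseteq> carrier A" for D
  proof -
    have "d \<in> M.mball x e \<longleftrightarrow> nrm A (x \<ominus> d) < e" if "x \<in> carrier A" "d \<in> D" for x d e
      using that \<open>D \<subseteq> carrier A\<close> by (auto simp: M.in_mball cstar_dist_def)
    then have "M.mtopology closure_of D = {x \<in> carrier A. \<forall>e>0. \<exists>d\<in>D. nrm A (x \<ominus> d) < e}"
      unfolding M.metric_closure_of by (intro Collect_cong conj_cong refl all_cong imp_cong bex_cong) auto
    then show ?thesis unfolding set_eq_iff mem_Collect_eq by blast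
  qed
  then show ?thesis unfolding separable_cstar_def cstar_topology_def separable_space_def M.topspace_mtopology
    by (intro ex_cong1 conj_cong refl)
qed

context unital_action
begin

lemma al_sc_mult: "g \<in> carrier G \<Longrightarrow> al g (sc c * u) = sc c * al g u"
  by (simp add: al_def pcomp_sc_mult[OF A] act_simps pcomp_in_carrier emb_smult[OF A])

lemma emb_C_smult:
  assumes "x \<in> carrier C" "s \<in> carrier G"
  shows "\<iota> ((c \<odot>\<^bsub>C\<^esub> x) s) = sc c * \<iota> (x s)"
  using assms by (simp add: crossed_product_ops(5) C_app emb_smult[OF A])

lemma C_algebra:
  assumes x: "x \<in> carrier C" and y: "y \<in> carrier C" and z: "z \<in> carrier C"
  shows "(x \<oplus>\<^bsub>C\<^esub> y) \<otimes>\<^bsub>C\<^esub> z = x \<otimes>\<^bsub>C\<^esub> z \<oplus>\<^bsub>C\<^esub> y \<otimes>\<^bsub>C\<^esub> z"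
    and "z \<otimes>\<^bsub>C\<^esub> (x \<oplus>\<^bsub>C\<^esub> y) = z \<otimes>\<^bsub>C\<^esub> x \<oplus>\<^bsub>C\<^esub> z \<otimes>\<^bsub>C\<^esub> y"
    and "(c \<odot>\<^bsub>C\<^esub> x) \<otimes>\<^bsub>C\<^esub> y = c \<odot>\<^bsub>C\<^esub> (x \<otimes>\<^bsub>C\<^esub> y)"
    and "x \<otimes>\<^bsub>C\<^esub> (c \<odot>\<^bsub>C\<^esub> y) = c \<odot>\<^bsub>C\<^esub> (x \<otimes>\<^bsub>C\<^esub> y)"
    and "star C (star C x) = x"
    and "star C (x \<oplus>\<^bsub>C\<^esub> y) = star C x \<oplus>\<^bsub>C\<^esub> star C y"
    and "star C (c \<odot>\<^bsub>C\<^esub> x) = cnj c \<odot>\<^bsub>C\<^esub> star C x"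
proof -
  note C = x y z C_closed
  note E = emb_C_mult emb_C_add emb_C_smult emb_C_star
  show "(x \<oplus>\<^bsub>C\<^esub> y) \<otimes>\<^bsub>C\<^esub> z = x \<otimes>\<^bsub>C\<^esub> z \<oplus>\<^bsub>C\<^esub> y \<otimes>\<^bsub>C\<^esub> z"
    by (rule C_emb_eqI) (simp_all add: C E distrib_right sum.distrib)
  show "z \<otimes>\<^bsub>C\<^esub> (x \<oplus>\<^bsub>C\<^esub> y) = z \<otimes>\<^bsub>C\<^esub> x \<oplus>\<^bsub>C\<^esub> z \<otimes>\<^bsub>C\<^esub> y"
    by (rule C_emb_eqI) (simp_all add: C E distrib_left sum.distrib al_add)
  show "(c \<odot>\<^bsub>C\<^esub> x) \<otimes>\<^bsub>C\<^esub> y = c \<odot>\<^bsub>C\<^esub> (x \<otimes>\<^bsub>C\<^esub> y)"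
    by (rule C_emb_eqI) (simp_all add: C E sum_distrib_left mult.assoc)
  show "x \<otimes>\<^bsub>C\<^esub> (c \<odot>\<^bsub>C\<^esub> y) = c \<odot>\<^bsub>C\<^esub> (x \<otimes>\<^bsub>C\<^esub> y)"
  proof (rule C_emb_eqI)
    fix s assume s: "s \<in> carrier G"
    have "u * (sc c * v) = sc c * (u * v)" for u v :: "'a cprod"
      by (metis mult.assoc sc_commute)
    then show "\<iota> ((x \<otimes>\<^bsub>C\<^esub> (c \<odot>\<^bsub>C\<^esub> y)) s) = \<iota> ((c \<odot>\<^bsub>C\<^esub> (x \<otimes>\<^bsub>C\<^esub> y)) s)"
      using s by (simp add: C E sum_distrib_left al_sc_mult)
  qed (simp_all add: C)
  show "star C (star C x) = x"
    by (rule C_emb_eqI) (simp_all add: C E al_adj al_comp al_one C_app)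
  show "star C (x \<oplus>\<^bsub>C\<^esub> y) = star C x \<oplus>\<^bsub>C\<^esub> star C y"
    by (rule C_emb_eqI) (simp_all add: C E adj_add al_add)
  show "star C (c \<odot>\<^bsub>C\<^esub> x) = cnj c \<odot>\<^bsub>C\<^esub> star C x"
    by (rule C_emb_eqI) (simp_all add: C E adj_mult adj_sc al_sc_mult flip: sc_commute)
qed

text \<open>The crossed product is a Hilbert module over \<open>A\<close>. The norm of right multiplication
  is a C*-seminorm dominating the norms of the coefficients, so the enveloping norm is a
  complete norm.\<close>

definition ip :: "('g \<Rightarrow> 'a) \<Rightarrow> ('g \<Rightarrow> 'a) \<Rightarrow> 'a cprod" where
  "ip x y = (\<Sum>t\<in>carrier G. \<iota> (x t) * adj (\<iota> (y t)))"

definition ip_norm :: "('g \<Rightarrow> 'a) \<Rightarrow> real" where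
  "ip_norm x = family_norm (carrier G) (\<lambda>s. \<iota> (x s))"

text \<open>The inner product is the canonical expectation onto \<open>A\<close> of the product of
  \<open>x\<close> with the adjoint of \<open>y\<close>. This makes right multiplication
  adjointable, as \<open>ip_mult\<close> records.\<close>

lemma ip_eq:
  assumes x: "x \<in> carrier C" and y: "y \<in> carrier C"
  shows "ip x y = \<iota> ((x \<otimes>\<^bsub>C\<^esub> star C y) \<one>)"
  unfolding ip_def emb_C_mult[OF x C_closed(2)[OF y] one_closed]
proof (rule sum.cong[OF refl])
  fix t assume t: "t \<in> carrier G"
  have "al t (\<iota> (star C y (inv t \<otimes> \<one>))) = al \<one> (adj (\<iota> (y t)))"
    using t y by (simp add: emb_C_star al_comp)
  also have "\<dots> = adj (\<iota> (y t))"
    using t y by (simp add: al_one C_app cl flip: emb_star[OF A])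
  finally show "\<iota> (x t) * adj (\<iota> (y t)) = \<iota> (x t) * al t (\<iota> (star C y (inv t \<otimes> \<one>)))" by simp
qed

lemma ip_mult:
  assumes "x \<in> carrier C" "y \<in> carrier C" "z \<in> carrier C"
  shows "ip (y \<otimes>\<^bsub>C\<^esub> x) z = ip y (z \<otimes>\<^bsub>C\<^esub> star C x)"
  using assms by (simp add: ip_eq C_closed C_star_mult C_algebra C_assoc)

lemma ip_norm_square: "(ip_norm x)\<^sup>2 = norm (ip x x)"
  by (simp add: ip_norm_def ip_def family_norm_square)

lemma norm_ip_le: "norm (ip x y) \<le> ip_norm x * ip_norm y"
  unfolding ip_norm_def ip_def by (rule family_Cauchy_Schwarz[OF fin])

lemma ip_norm_nonneg: "0 \<le> ip_norm x"
  by (simp add: ip_norm_def family_norm_nonneg)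

lemma nrm_le_ip_norm: "x \<in> carrier C \<Longrightarrow> s \<in> carrier G \<Longrightarrow> nrm A (x s) \<le> ip_norm x"
  using norm_le_family_norm[OF fin, of s "\<lambda>s. \<iota> (x s)"] by (simp add: ip_norm_def norm_emb[OF A] C_app)

lemma family_norm_cong: "(\<And>i. i \<in> I \<Longrightarrow> f i = g i) \<Longrightarrow> family_norm I f = family_norm I g"
  by (simp add: family_norm_def)

lemma ip_norm_add: "x \<in> carrier C \<Longrightarrow> y \<in> carrier C \<Longrightarrow> ip_norm (x \<oplus>\<^bsub>C\<^esub> y) \<le> ip_norm x + ip_norm y"
  using family_norm_triangle[OF fin, of "\<lambda>s. \<iota> (x s)" "\<lambda>s. \<iota> (y s)"]
  by (simp add: ip_norm_def emb_C_add cong: family_norm_cong)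

lemma ip_norm_smult: "x \<in> carrier C \<Longrightarrow> ip_norm (c \<odot>\<^bsub>C\<^esub> x) = cmod c * ip_norm x"
proof -
  assume x: "x \<in> carrier C"
  have "(sc c * u) * adj (sc c * u) = ((cmod c)\<^sup>2) *\<^sub>R (u * adj u)" for u :: "'a cprod"
  proof -
    have "(sc c * u) * adj (sc c * u) = sc c * (u * adj u) * sc (cnj c)" by (simp add: adj_mult adj_sc mult.assoc)
    also have "\<dots> = sc (c * cnj c) * (u * adj u)" by (simp only: sc_commute[of "cnj c", symmetric] sc_mult mult.assoc mult.commute[of c])
    finally show ?thesis by (simp add: complex_norm_square[symmetric] flip: of_real_power)
  qed
  then have "(ip_norm (c \<odot>\<^bsub>C\<^esub> x))\<^sup>2 = (cmod c * ip_norm x)\<^sup>2"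
    using x by (simp add: ip_norm_square ip_def emb_C_smult power_mult_distrib flip: scaleR_sum_right)
  then show ?thesis using ip_norm_nonneg by (simp add: power2_eq_iff_nonneg)
qed

lemma ip_norm_mult_l1:
  assumes x: "x \<in> carrier C" and y: "y \<in> carrier C"
  shows "ip_norm (y \<otimes>\<^bsub>C\<^esub> x) \<le> (\<Sum>g\<in>carrier G. nrm A (x g)) * ip_norm y"
proof -
  \<comment> \<open>The convolution is regrouped by the coefficient \<open>x g\<close> instead of
    the position in \<open>y\<close>. Each group is a permutation of the row \<open>y\<close>,
    multiplied on the right by translates of one element.\<close>
  define f where "f g s = \<iota> (y (s \<otimes> inv g)) * al (s \<otimes> inv g) (\<iota> (x g))" for g s
  have e: "\<iota> ((y \<otimes>\<^bsub>C\<^esub> x) s) = (\<Sum>g\<in>carrier G. f g s)" if s: "s \<in> carrier G" for s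
  proof -
    have "bij_betw (\<lambda>g. s \<otimes> inv g) (carrier G) (carrier G)"
      using s by (intro bij_betw_byWitness[where f' = "\<lambda>t. inv t \<otimes> s"])
        (auto simp: inv_mult_group m_assoc, auto simp flip: m_assoc)
    from sum.reindex_bij_betw[OF this, of "\<lambda>t. \<iota> (y t) * al t (\<iota> (x (inv t \<otimes> s)))"]
    have "\<iota> ((y \<otimes>\<^bsub>C\<^esub> x) s) = (\<Sum>g\<in>carrier G. \<iota> (y (s \<otimes> inv g)) * al (s \<otimes> inv g) (\<iota> (x (inv (s \<otimes> inv g) \<otimes> s))))"
      using s x y by (simp add: emb_C_mult)
    also have "\<dots> = (\<Sum>g\<in>carrier G. f g s)"
      using s by (intro sum.cong) (auto simp: f_def inv_mult_group m_assoc)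
    finally show ?thesis .
  qed
  have "ip_norm (y \<otimes>\<^bsub>C\<^esub> x) = family_norm (carrier G) (\<lambda>s. \<Sum>g\<in>carrier G. f g s)"
    unfolding ip_norm_def by (rule family_norm_cong) (rule e)
  also have "\<dots> \<le> (\<Sum>g\<in>carrier G. family_norm (carrier G) (f g))" by (rule family_norm_sum[OF fin])
  also have "\<dots> \<le> (\<Sum>g\<in>carrier G. nrm A (x g) * ip_norm y)"
  proof (rule sum_mono)
    fix g assume g: "g \<in> carrier G"
    have "bij_betw (\<lambda>s. s \<otimes> inv g) (carrier G) (carrier G)"
      using g by (intro bij_betw_byWitness[where f' = "\<lambda>s. s \<otimes> g"]) (auto simp: m_assoc)
    then have "family_norm (carrier G) (f g) = family_norm (carrier G) (\<lambda>t. \<iota> (y t) * al t (\<iota> (x g)))"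
      unfolding f_def by (rule family_norm_reindex)
    also have "\<dots> \<le> nrm A (x g) * ip_norm y"
      unfolding ip_norm_def
    proof (rule family_norm_mult_le[OF fin])
      fix t assume "t \<in> carrier G"
      then show "norm (al t (\<iota> (x g))) \<le> nrm A (x g)"
        using norm_al[of t "\<iota> (x g)"] g x by (simp add: norm_emb[OF A] C_app)
    qed (use g x A in \<open>simp add: unital_simps C_app\<close>)
    finally show "family_norm (carrier G) (f g) \<le> nrm A (x g) * ip_norm y" .
  qed
  finally show ?thesis by (simp add: sum_distrib_right)
qed

definition regular_norm :: "('g \<Rightarrow> 'a) \<Rightarrow> real" where
  "regular_norm x = (SUP y\<in>{y \<in> carrier C. ip_norm y \<le> 1}. ip_norm (y \<otimes>\<^bsub>C\<^esub> x))"

lemma C_zero_mult: "x \<in> carrier C \<Longrightarrow> \<zero>\<^bsub>C\<^esub> \<otimes>\<^bsub>C\<^esub> x = \<zero>\<^bsub>C\<^esub>"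
  by (rule C_emb_eqI) (auto simp: C_closed emb_C_mult, simp add: crossed_product_ops(3) em)

lemma ip_norm_zero: "ip_norm \<zero>\<^bsub>C\<^esub> = 0"
  by (simp add: ip_norm_def family_norm_def crossed_product_ops(3) em)

lemma l1_nonneg: "x \<in> carrier C \<Longrightarrow> 0 \<le> (\<Sum>g\<in>carrier G. nrm A (x g))"
  using A by (intro sum_nonneg) (simp add: unital_simps C_app)

lemma regular_norm_upper:
  assumes x: "x \<in> carrier C" and y: "y \<in> carrier C" "ip_norm y \<le> 1"
  shows "ip_norm (y \<otimes>\<^bsub>C\<^esub> x) \<le> regular_norm x"
  unfolding regular_norm_def
proof (rule cSUP_upper)
  show "bdd_above ((\<lambda>y. ip_norm (y \<otimes>\<^bsub>C\<^esub> x)) ` {y \<in> carrier C. ip_norm y \<le> 1})"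
  proof (rule bdd_aboveI2)
    fix y assume "y \<in> {y \<in> carrier C. ip_norm y \<le> 1}"
    then show "ip_norm (y \<otimes>\<^bsub>C\<^esub> x) \<le> (\<Sum>g\<in>carrier G. nrm A (x g))"
      using ip_norm_mult_l1[OF x, of y] mult_left_le[OF _ l1_nonneg[OF x], of "ip_norm y"] by auto
  qed
qed (use y in auto)

lemma regular_norm_least:
  assumes "\<And>y. y \<in> carrier C \<Longrightarrow> ip_norm y \<le> 1 \<Longrightarrow> ip_norm (y \<otimes>\<^bsub>C\<^esub> x) \<le> K"
  shows "regular_norm x \<le> K"
  unfolding regular_norm_def
proof (rule cSUP_least)
  have "\<zero>\<^bsub>C\<^esub> \<in> {y \<in> carrier C. ip_norm y \<le> 1}" by (simp add: C_closed ip_norm_zero)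
  then show "{y \<in> carrier C. ip_norm y \<le> 1} \<noteq> {}" by blast
qed (use assms in auto)

lemma regular_norm_nonneg: "x \<in> carrier C \<Longrightarrow> 0 \<le> regular_norm x"
  using regular_norm_upper[of x "\<zero>\<^bsub>C\<^esub>"] ip_norm_nonneg by (simp add: C_closed ip_norm_zero C_zero_mult)

lemma regular_norm_bound:
  assumes x: "x \<in> carrier C" and y: "y \<in> carrier C"
  shows "ip_norm (y \<otimes>\<^bsub>C\<^esub> x) \<le> regular_norm x * ip_norm y"
proof (cases "ip_norm y = 0")
  case True
  have "nrm A (y s) = 0" if "s \<in> carrier G" for s
    using nrm_le_ip_norm[OF y that] True A y that by (simp add: unital_simps C_app antisym)
  then have "y = \<zero>\<^bsub>C\<^esub>"
    using A y by (intro C_eqI[OF y C_closed(6)]) (simp add: crossed_product_ops(3) C_app unital_nrm)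
  then show ?thesis using x by (simp add: C_zero_mult ip_norm_zero)
next
  case False
  then have p: "ip_norm y > 0" using ip_norm_nonneg[of y] by simp
  define r where "r = 1 / ip_norm y"
  have "ip_norm (complex_of_real r \<odot>\<^bsub>C\<^esub> y) \<le> 1" using y p by (simp add: ip_norm_smult r_def norm_divide)
  then have "ip_norm ((complex_of_real r \<odot>\<^bsub>C\<^esub> y) \<otimes>\<^bsub>C\<^esub> x) \<le> regular_norm x" using x y by (intro regular_norm_upper C_closed)
  then have "r * ip_norm (y \<otimes>\<^bsub>C\<^esub> x) \<le> regular_norm x" using x y p by (simp add: C_algebra ip_norm_smult C_closed r_def norm_divide)
  then show ?thesis using p by (simp add: r_def field_simps)
qed

lemma regular_norm_mult: "x \<in> carrier C \<Longrightarrow> y \<in> carrier C \<Longrightarrow> regular_norm (x \<otimes>\<^bsub>C\<^esub> y) \<le> regular_norm x * regular_norm y"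
proof (rule regular_norm_least)
  fix z assume x: "x \<in> carrier C" and y: "y \<in> carrier C" and z: "z \<in> carrier C" "ip_norm z \<le> 1"
  have "ip_norm (z \<otimes>\<^bsub>C\<^esub> (x \<otimes>\<^bsub>C\<^esub> y)) = ip_norm ((z \<otimes>\<^bsub>C\<^esub> x) \<otimes>\<^bsub>C\<^esub> y)" using x y z by (simp add: C_assoc)
  also have "\<dots> \<le> regular_norm y * ip_norm (z \<otimes>\<^bsub>C\<^esub> x)" using x y z by (intro regular_norm_bound C_closed)
  also have "\<dots> \<le> regular_norm y * regular_norm x" using x y z by (intro mult_left_mono regular_norm_upper regular_norm_nonneg)
  finally show "ip_norm (z \<otimes>\<^bsub>C\<^esub> (x \<otimes>\<^bsub>C\<^esub> y)) \<le> regular_norm x * regular_norm y" by (simp add: mult.commute)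
qed

text \<open>Move one factor across the inner product and apply Cauchy-Schwarz. The adjoint stands on
  the right because right multiplication reverses the order of products.\<close>

lemma regular_norm_square_le:
  assumes x: "x \<in> carrier C"
  shows "(regular_norm x)\<^sup>2 \<le> regular_norm (x \<otimes>\<^bsub>C\<^esub> star C x)"
proof -
  have "regular_norm x \<le> sqrt (regular_norm (x \<otimes>\<^bsub>C\<^esub> star C x))"
  proof (rule regular_norm_least)
    fix y assume y: "y \<in> carrier C" "ip_norm y \<le> 1"
    have "(ip_norm (y \<otimes>\<^bsub>C\<^esub> x))\<^sup>2 = norm (ip (y \<otimes>\<^bsub>C\<^esub> x) (y \<otimes>\<^bsub>C\<^esub> x))" by (rule ip_norm_square)
    also have "\<dots> = norm (ip ((y \<otimes>\<^bsub>C\<^esub> x) \<otimes>\<^bsub>C\<^esub> star C x) y)"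
      using x y by (subst ip_mult[of "star C x"]) (simp_all add: C_closed C_algebra)
    also have "\<dots> \<le> ip_norm (y \<otimes>\<^bsub>C\<^esub> (x \<otimes>\<^bsub>C\<^esub> star C x)) * ip_norm y"
      using norm_ip_le x y by (simp add: C_assoc C_closed)
    also have "\<dots> \<le> regular_norm (x \<otimes>\<^bsub>C\<^esub> star C x) * 1"
      using x y by (intro mult_mono regular_norm_upper regular_norm_nonneg ip_norm_nonneg C_closed) auto
    finally show "ip_norm (y \<otimes>\<^bsub>C\<^esub> x) \<le> sqrt (regular_norm (x \<otimes>\<^bsub>C\<^esub> star C x))" by (simp add: real_le_rsqrt)
  qed
  then have "(regular_norm x)\<^sup>2 \<le> (sqrt (regular_norm (x \<otimes>\<^bsub>C\<^esub> star C x)))\<^sup>2" using regular_norm_nonneg[OF x] by (rule power_mono)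
  then show ?thesis using regular_norm_nonneg[OF C_closed(1)[OF x C_closed(2)[OF x]]] by simp
qed

lemma regular_norm_star:
  assumes x: "x \<in> carrier C"
  shows "regular_norm (star C x) = regular_norm x"
proof -
  have le: "regular_norm x \<le> regular_norm (star C x)" if x: "x \<in> carrier C" for x
  proof (cases "regular_norm x = 0")
    case False
    have "regular_norm x * regular_norm x \<le> regular_norm x * regular_norm (star C x)"
      using regular_norm_square_le[OF x] regular_norm_mult[OF x C_closed(2)[OF x]] by (simp add: power2_eq_square)
    then show ?thesis using False regular_norm_nonneg[OF x] by simp
  qed (use regular_norm_nonneg[OF C_closed(2)[OF x]] in simp)
  show ?thesis using le[OF x] le[OF C_closed(2)[OF x]] x by (simp add: C_algebra)
qed

lemma regular_norm_le_l1: "x \<in> carrier C \<Longrightarrow> regular_norm x \<le> (\<Sum>g\<in>carrier G. nrm A (x g))"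
  using ip_norm_mult_l1[of x] mult_left_le[OF _ l1_nonneg[of x]] by (intro regular_norm_least) (meson order_trans)

lemma regular_norm_dominated: "regular_norm \<in> dominated_seminorms (l1_crossed_product G A \<alpha>)"
  unfolding dominated_seminorms_def cstar_seminorm_def l1_crossed_product_ops
proof (intro CollectI conjI ballI allI)
  fix x c assume x: "x \<in> carrier C"
  show "0 \<le> regular_norm x" using x by (rule regular_norm_nonneg)
  show "regular_norm x \<le> (\<Sum>g\<in>carrier G. nrm A (x g))" using x by (rule regular_norm_le_l1)
  have sx: "star C x \<in> carrier C" using x by (rule C_closed)
  show "regular_norm (star C x \<otimes>\<^bsub>C\<^esub> x) = (regular_norm x)\<^sup>2"
    using regular_norm_square_le[OF sx] regular_norm_mult[OF sx x] x by (simp add: C_algebra regular_norm_star power2_eq_square)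
  show "regular_norm (c \<odot>\<^bsub>C\<^esub> x) = cmod c * regular_norm x"
  proof (rule antisym)
    show "regular_norm (c \<odot>\<^bsub>C\<^esub> x) \<le> cmod c * regular_norm x"
      using x by (intro regular_norm_least) (simp add: C_algebra ip_norm_smult C_closed mult_left_mono regular_norm_upper)
    show "cmod c * regular_norm x \<le> regular_norm (c \<odot>\<^bsub>C\<^esub> x)"
    proof (cases "c = 0")
      case False
      have "regular_norm x \<le> regular_norm (c \<odot>\<^bsub>C\<^esub> x) / cmod c"
      proof (rule regular_norm_least)
        fix y assume y: "y \<in> carrier C" "ip_norm y \<le> 1"
        have "ip_norm (y \<otimes>\<^bsub>C\<^esub> (c \<odot>\<^bsub>C\<^esub> x)) \<le> regular_norm (c \<odot>\<^bsub>C\<^esub> x)" using x y by (intro regular_norm_upper C_closed)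
        then show "ip_norm (y \<otimes>\<^bsub>C\<^esub> x) \<le> regular_norm (c \<odot>\<^bsub>C\<^esub> x) / cmod c"
          using x y False by (simp add: C_algebra ip_norm_smult C_closed field_simps)
      qed
      then show ?thesis using False by (simp add: field_simps)
    qed (simp add: regular_norm_nonneg x C_closed)
  qed
  fix y assume y: "y \<in> carrier C"
  show "regular_norm (x \<otimes>\<^bsub>C\<^esub> y) \<le> regular_norm x * regular_norm y" using x y by (rule regular_norm_mult)
  show "regular_norm (x \<oplus>\<^bsub>C\<^esub> y) \<le> regular_norm x + regular_norm y"
  proof (rule regular_norm_least)
    fix z assume z: "z \<in> carrier C" "ip_norm z \<le> 1"
    have "ip_norm (z \<otimes>\<^bsub>C\<^esub> (x \<oplus>\<^bsub>C\<^esub> y)) \<le> ip_norm (z \<otimes>\<^bsub>C\<^esub> x) + ip_norm (z \<otimes>\<^bsub>C\<^esub> y)"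
      using x y z by (simp add: C_algebra ip_norm_add C_closed)
    then show "ip_norm (z \<otimes>\<^bsub>C\<^esub> (x \<oplus>\<^bsub>C\<^esub> y)) \<le> regular_norm x + regular_norm y"
      using regular_norm_upper[OF x z] regular_norm_upper[OF y z] by linarith
  qed
qed

text \<open>Let \<open>x\<close> act on the unit vector. Together with \<open>nrm_C_le_l1\<close>
  this places the enveloping norm between the largest coefficient norm and the sum of all
  coefficient norms, so completeness and separability reduce to those of \<open>A\<close>.\<close>

lemma nrm_le_nrm_C:
  assumes x: "x \<in> carrier C" and s: "s \<in> carrier G"
  shows "nrm A (x s) \<le> nrm C x"
proof -
  have "ip_norm \<one>\<^bsub>C\<^esub> \<le> 1"
  proof -
    have "ip \<one>\<^bsub>C\<^esub> \<one>\<^bsub>C\<^esub> = (\<Sum>t\<in>carrier G. if t = \<one> then \<iota> \<one>\<^bsub>A\<^esub> else 0)"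
      unfolding ip_def by (intro sum.cong)
        (auto simp: crossed_product_ops(2) em unital_star_one[OF A] cl unital_simps A simp flip: emb_star[OF A] emb_mult[OF A])
    also have "\<dots> = \<iota> \<one>\<^bsub>A\<^esub>" using fin by simp
    finally have "(ip_norm \<one>\<^bsub>C\<^esub>)\<^sup>2 \<le> 1\<^sup>2"
      using unital_nrm_one[OF A] by (simp add: ip_norm_square norm_emb[OF A] cl)
    then show ?thesis by (rule power2_le_imp_le) simp
  qed
  then have "ip_norm (\<one>\<^bsub>C\<^esub> \<otimes>\<^bsub>C\<^esub> x) \<le> regular_norm x" using x by (intro regular_norm_upper C_closed)
  then have "nrm A (x s) \<le> regular_norm x" using nrm_le_ip_norm[OF x s] x by (simp add: C_one_mult)
  also have "\<dots> \<le> nrm C x"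
    using enveloping_upper[OF regular_norm_dominated regular_norm_dominated] x
    by (simp add: crossed_product_ops(6) l1_crossed_product_ops)
  finally show ?thesis .
qed

lemma nrm_C_le_l1: "x \<in> carrier C \<Longrightarrow> nrm C x \<le> (\<Sum>g\<in>carrier G. nrm A (x g))"
  using enveloping_norm_le[OF regular_norm_dominated, of x] by (simp add: crossed_product_ops(6) l1_crossed_product_ops)

lemma C_pre_cstar: "pre_cstar_algebra C"
proof -
  have "cstar_seminorm (l1_crossed_product G A \<alpha>) (nrm C)"
    unfolding crossed_product_ops(6)
    by (rule cstar_seminorm_enveloping[OF regular_norm_dominated]) (simp_all add: l1_crossed_product_ops C_closed)
  then have N: "x \<in> carrier C \<Longrightarrow> 0 \<le> nrm C x" "x \<in> carrier C \<Longrightarrow> nrm C (star C x \<otimes>\<^bsub>C\<^esub> x) = (nrm C x)\<^sup>2"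
    "x \<in> carrier C \<Longrightarrow> nrm C (c \<odot>\<^bsub>C\<^esub> x) = cmod c * nrm C x"
    "x \<in> carrier C \<Longrightarrow> y \<in> carrier C \<Longrightarrow> nrm C (x \<oplus>\<^bsub>C\<^esub> y) \<le> nrm C x + nrm C y"
    "x \<in> carrier C \<Longrightarrow> y \<in> carrier C \<Longrightarrow> nrm C (x \<otimes>\<^bsub>C\<^esub> y) \<le> nrm C x * nrm C y" for x y c
    by (simp_all add: cstar_seminorm_def l1_crossed_product_ops)
  have N0: "nrm C x = 0 \<longleftrightarrow> x = \<zero>\<^bsub>C\<^esub>" if x: "x \<in> carrier C" for x
  proof
    assume 0: "nrm C x = 0"
    have "nrm A (x s) = 0" if "s \<in> carrier G" for s
      using nrm_le_nrm_C[OF x that] 0 A x that by (simp add: unital_simps C_app antisym)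
    then show "x = \<zero>\<^bsub>C\<^esub>"
      using A x by (intro C_eqI[OF x C_closed(6)]) (simp add: crossed_product_ops(3) C_app unital_nrm)
  next
    assume "x = \<zero>\<^bsub>C\<^esub>"
    then show "nrm C x = 0"
      using nrm_C_le_l1[OF x] N(1)[OF x] A by (simp add: crossed_product_ops(3) unital_nrm_zero)
  qed
  show ?thesis
    by (intro pre_cstar_algebra.intro pre_cstar_algebra_axioms.intro C_module)
      (simp_all add: C_closed C_assoc C_algebra C_star_mult N N0)
qed

lemma C_minus:
  assumes "x \<in> carrier C" "y \<in> carrier C" "s \<in> carrier G"
  shows "(x \<ominus>\<^bsub>C\<^esub> y) s = x s \<ominus>\<^bsub>A\<^esub> y s"
  using assms
  by (simp add: a_minus_def pre_cstar_algebra.uminus_eq_smult[OF C_pre_cstar]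
      pre_cstar_algebra.uminus_eq_smult[OF unital_pre[OF A]] crossed_product_ops(4,5) C_app)

lemma C_minus_closed: "x \<in> carrier C \<Longrightarrow> y \<in> carrier C \<Longrightarrow> x \<ominus>\<^bsub>C\<^esub> y \<in> carrier C"
  by (simp add: a_minus_def pre_cstar_algebra.uminus_eq_smult[OF C_pre_cstar] C_closed)

lemma C_cstar: "cstar_algebra C"
proof (intro cstar_algebra.intro C_pre_cstar cstar_algebra_axioms.intro)
  interpret CC: pre_cstar_algebra C by (rule C_pre_cstar)
  interpret AA: cstar_algebra A using A by (simp add: unital_cstar_def)
  show "Metric_space.mcomplete (carrier C) (cstar_dist C)"
    unfolding CC.mcomplete_iff
  proof (intro allI impI, elim conjE)
    fix \<sigma> :: "nat \<Rightarrow> 'g \<Rightarrow> 'a"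
    assume \<sigma>: "\<forall>n. \<sigma> n \<in> carrier C"
      and cau: "\<forall>\<epsilon>>0. \<exists>N. \<forall>n\<ge>N. \<forall>m\<ge>N. nrm C (\<sigma> n \<ominus>\<^bsub>C\<^esub> \<sigma> m) < \<epsilon>"
    have "\<exists>y\<in>carrier A. \<forall>\<epsilon>>0. \<exists>N. \<forall>n\<ge>N. nrm A (\<sigma> n s \<ominus>\<^bsub>A\<^esub> y) < \<epsilon>" if s: "s \<in> carrier G" for s
    proof -
      have "nrm A (\<sigma> n s \<ominus>\<^bsub>A\<^esub> \<sigma> m s) \<le> nrm C (\<sigma> n \<ominus>\<^bsub>C\<^esub> \<sigma> m)" for n m
        using nrm_le_nrm_C[OF C_minus_closed s, of "\<sigma> n" "\<sigma> m"] \<sigma> s by (simp add: C_minus)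
      then have "\<forall>\<epsilon>>0. \<exists>N. \<forall>n\<ge>N. \<forall>m\<ge>N. nrm A (\<sigma> n s \<ominus>\<^bsub>A\<^esub> \<sigma> m s) < \<epsilon>"
        using cau order_le_less_trans by meson
      moreover have "\<forall>n. \<sigma> n s \<in> carrier A" using \<sigma> s by (simp add: C_app)
      ultimately show ?thesis
        using AA.complete[unfolded AA.mcomplete_iff, THEN spec, of "\<lambda>n. \<sigma> n s"] by blast
    qed
    then obtain y where y: "\<And>s. s \<in> carrier G \<Longrightarrow> y s \<in> carrier A"
      and lim: "\<And>s \<epsilon>. s \<in> carrier G \<Longrightarrow> \<epsilon> > 0 \<Longrightarrow> \<exists>N. \<forall>n\<ge>N. nrm A (\<sigma> n s \<ominus>\<^bsub>A\<^esub> y s) < \<epsilon>"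
      by metis
    have yc: "restrict y (carrier G) \<in> carrier C" using y by (auto simp: crossed_product_ops)
    have "\<exists>N. \<forall>n\<ge>N. nrm C (\<sigma> n \<ominus>\<^bsub>C\<^esub> restrict y (carrier G)) < \<epsilon>" if e: "\<epsilon> > 0" for \<epsilon>
    proof -
      \<comment> \<open>The added 1 keeps \<open>K\<close> positive and makes the final estimate
        strict.\<close>
      define K where "K = real (card (carrier G)) + 1"
      have K: "K > 0" by (simp add: K_def)
      have "\<forall>s\<in>carrier G. \<forall>\<^sub>F n in sequentially. nrm A (\<sigma> n s \<ominus>\<^bsub>A\<^esub> y s) < \<epsilon> / K"
        using lim[of _ "\<epsilon> / K"] e K by (auto simp: eventually_sequentially)
      then have "\<forall>\<^sub>F n in sequentially. \<forall>s\<in>carrier G. nrm A (\<sigma> n s \<ominus>\<^bsub>A\<^esub> y s) < \<epsilon> / K"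
        using fin by (simp add: eventually_ball_finite)
      then obtain N where N: "\<And>n s. n \<ge> N \<Longrightarrow> s \<in> carrier G \<Longrightarrow> nrm A (\<sigma> n s \<ominus>\<^bsub>A\<^esub> y s) < \<epsilon> / K"
        by (auto simp: eventually_sequentially)
      have "nrm C (\<sigma> n \<ominus>\<^bsub>C\<^esub> restrict y (carrier G)) < \<epsilon>" if n: "n \<ge> N" for n
      proof -
        have "nrm C (\<sigma> n \<ominus>\<^bsub>C\<^esub> restrict y (carrier G)) \<le> (\<Sum>s\<in>carrier G. nrm A ((\<sigma> n \<ominus>\<^bsub>C\<^esub> restrict y (carrier G)) s))"
          using \<sigma> yc by (intro nrm_C_le_l1 C_minus_closed) auto
        also have "\<dots> \<le> (\<Sum>s\<in>carrier G. \<epsilon> / K)"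
          using \<sigma> yc N[OF n] by (intro sum_mono) (simp add: C_minus less_imp_le)
        also have "\<dots> < \<epsilon>" using e K by (simp add: K_def field_simps)
        finally show ?thesis .
      qed
      then show ?thesis by blast
    qed
    then show "\<exists>x\<in>carrier C. \<forall>\<epsilon>>0. \<exists>N. \<forall>n\<ge>N. nrm C (\<sigma> n \<ominus>\<^bsub>C\<^esub> x) < \<epsilon>" using yc by blast
  qed
qed

lemma C_unital: "unital_cstar C"
  using C_cstar C_monoid by (simp add: unital_cstar_def)

lemma C_separable:
  assumes "separable_cstar A"
  shows "separable_cstar C"
proof -
  interpret CC: pre_cstar_algebra C by (rule C_pre_cstar)
  obtain D where D': "countable D \<and> D \<subseteq> carrier A \<and> (\<forall>x\<in>carrier A. \<forall>e>0. \<exists>d\<in>D. nrm A (x \<ominus>\<^bsub>A\<^esub> d) < e)"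
    using assms unfolding pre_cstar_algebra.separable_cstar_iff[OF unital_pre[OF A]] by (rule exE)
  then have D: "countable D" "D \<subseteq> carrier A"
    and D3: "\<And>x e. x \<in> carrier A \<Longrightarrow> e > 0 \<Longrightarrow> \<exists>d\<in>D. nrm A (x \<ominus>\<^bsub>A\<^esub> d) < e"
    by simp_all
  have "countable (carrier G \<rightarrow>\<^sub>E D)" using fin D(1) by (intro countable_PiE) auto
  moreover have sub: "carrier G \<rightarrow>\<^sub>E D \<subseteq> carrier C" using D(2) by (auto simp: crossed_product_ops PiE_def Pi_def)
  moreover have "\<exists>d\<in>carrier G \<rightarrow>\<^sub>E D. nrm C (x \<ominus>\<^bsub>C\<^esub> d) < e" if x: "x \<in> carrier C" and e: "e > 0" for x e
  proof -
    define K where "K = real (card (carrier G)) + 1"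
    have K: "K > 0" by (simp add: K_def)
    have "\<forall>s\<in>carrier G. \<exists>d\<in>D. nrm A (x s \<ominus>\<^bsub>A\<^esub> d) < e / K" using e K by (intro ballI D3 C_app[OF x]) simp_all
    then obtain d where d: "\<And>s. s \<in> carrier G \<Longrightarrow> d s \<in> D \<and> nrm A (x s \<ominus>\<^bsub>A\<^esub> d s) < e / K" by metis
    define d' where "d' = restrict d (carrier G)"
    have d'D: "d' \<in> carrier G \<rightarrow>\<^sub>E D" using d by (auto simp: d'_def)
    then have dc: "d' \<in> carrier C" using sub by blast
    have "nrm C (x \<ominus>\<^bsub>C\<^esub> d') \<le> (\<Sum>s\<in>carrier G. nrm A ((x \<ominus>\<^bsub>C\<^esub> d') s))"
      using x dc by (intro nrm_C_le_l1 C_minus_closed) auto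
    also have "\<dots> \<le> (\<Sum>s\<in>carrier G. e / K)"
      using x dc d by (intro sum_mono) (simp add: C_minus less_imp_le d'_def)
    also have "\<dots> < e" using e K by (simp add: K_def field_simps)
    finally show ?thesis using d'D by blast
  qed
  ultimately show ?thesis unfolding CC.separable_cstar_iff by blast
qed

end

section \<open>Sequence algebras\<close>

lemma linf_ops:
  "carrier (linf A) = {x. (\<forall>n. x n \<in> carrier A) \<and> bdd_above (range (\<lambda>n. nrm A (x n)))}"
  "x \<otimes>\<^bsub>linf A\<^esub> y = (\<lambda>n. x n \<otimes>\<^bsub>A\<^esub> y n)" "\<one>\<^bsub>linf A\<^esub> = (\<lambda>n. \<one>\<^bsub>A\<^esub>)"
  "\<zero>\<^bsub>linf A\<^esub> = (\<lambda>n. \<zero>\<^bsub>A\<^esub>)" "x \<oplus>\<^bsub>linf A\<^esub> y = (\<lambda>n. x n \<oplus>\<^bsub>A\<^esub> y n)"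
  "c \<odot>\<^bsub>linf A\<^esub> x = (\<lambda>n. c \<odot>\<^bsub>A\<^esub> x n)" "star (linf A) x = (\<lambda>n. star A (x n))"
  "nrm (linf A) x = (SUP n. nrm A (x n))"
  by (simp_all add: linf_def)

lemma seq_alg_ops:
  "carrier (seq_alg A) = carrier (linf A Quot c0 A)"
  "mult (seq_alg A) = mult (linf A Quot c0 A)" "one (seq_alg A) = one (linf A Quot c0 A)"
  "ring.zero (seq_alg A) = ring.zero (linf A Quot c0 A)" "add (seq_alg A) = add (linf A Quot c0 A)"
  "c \<odot>\<^bsub>seq_alg A\<^esub> S = (\<Union>x\<in>S. c0 A +>\<^bsub>linf A\<^esub> (c \<odot>\<^bsub>linf A\<^esub> x))"
  "star (seq_alg A) S = (\<Union>x\<in>S. c0 A +>\<^bsub>linf A\<^esub> star (linf A) x)"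
  "nrm (seq_alg A) S = (INF x\<in>S. nrm (linf A) x)"
  by (simp_all add: seq_alg_def cstar_quotient_def module.defs ring.defs cstar.defs FactRing_def)

locale unital_algebra =
  fixes A :: "'a cstar"
  assumes A: "unital_cstar A"
begin

sublocale R: ring A using A by (rule unital_ring)

lemmas cl = unital_closed[OF A]
lemmas us = unital_simps[OF A]
lemmas un = unital_nrm[OF A]

lemma nrm_pos: "x \<in> carrier A \<Longrightarrow> 0 \<le> nrm A x"
  using A by (simp add: unital_simps)

lemma linfI: "(\<And>n. x n \<in> carrier A) \<Longrightarrow> (\<And>n. nrm A (x n) \<le> K) \<Longrightarrow> x \<in> carrier (linf A)"
  by (auto simp: linf_ops bdd_above_def)

lemma linf_app: "x \<in> carrier (linf A) \<Longrightarrow> x n \<in> carrier A"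
  by (simp add: linf_ops)

lemma linf_bound: "x \<in> carrier (linf A) \<Longrightarrow> \<exists>K>0. \<forall>n. nrm A (x n) \<le> K"
proof -
  assume "x \<in> carrier (linf A)"
  then obtain K where "\<And>n. nrm A (x n) \<le> K" by (auto simp: linf_ops bdd_above_def)
  then have "\<forall>n. nrm A (x n) \<le> max K 1" using le_max_iff_disj by blast
  then show ?thesis by (intro exI[of _ "max K 1"]) auto
qed

lemma linf_const: "a \<in> carrier A \<Longrightarrow> (\<lambda>n. a) \<in> carrier (linf A)"
  by (rule linfI[of _ "nrm A a"]) auto

lemma linf_closed_unary:
  assumes x: "x \<in> carrier (linf A)"
  shows "(\<lambda>n. \<ominus>\<^bsub>A\<^esub> x n) \<in> carrier (linf A)" "(\<lambda>n. c \<odot>\<^bsub>A\<^esub> x n) \<in> carrier (linf A)"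
    "(\<lambda>n. star A (x n)) \<in> carrier (linf A)"
proof -
  note in_x = linf_app[OF x]
  obtain K where K: "K > 0" "\<And>n. nrm A (x n) \<le> K" using linf_bound[OF x] by auto
  show "(\<lambda>n. \<ominus>\<^bsub>A\<^esub> x n) \<in> carrier (linf A)"
    by (rule linfI[of _ K]) (auto intro!: cl simp: in_x un(6) K)
  show "(\<lambda>n. c \<odot>\<^bsub>A\<^esub> x n) \<in> carrier (linf A)"
    by (rule linfI[of _ "cmod c * K"]) (auto simp: cl in_x un(3) K mult_left_mono)
  show "(\<lambda>n. star A (x n)) \<in> carrier (linf A)"
    by (rule linfI[of _ K]) (auto simp: cl in_x unital_nrm_star[OF A] K)
qed

lemma linf_closed_binary:
  assumes x: "x \<in> carrier (linf A)" and y: "y \<in> carrier (linf A)"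
  shows "(\<lambda>n. x n \<oplus>\<^bsub>A\<^esub> y n) \<in> carrier (linf A)" "(\<lambda>n. x n \<otimes>\<^bsub>A\<^esub> y n) \<in> carrier (linf A)"
    "(\<lambda>n. x n \<ominus>\<^bsub>A\<^esub> y n) \<in> carrier (linf A)"
proof -
  note in_x = linf_app[OF x] and in_y = linf_app[OF y]
  obtain K L where K: "K > 0" "\<And>n. nrm A (x n) \<le> K" and L: "L > 0" "\<And>n. nrm A (y n) \<le> L"
    using linf_bound[OF x] linf_bound[OF y] by auto
  have 1: "(\<lambda>n. x n \<oplus>\<^bsub>A\<^esub> u n) \<in> carrier (linf A)" if u: "u \<in> carrier (linf A)" for u
  proof -
    obtain L where L: "\<And>n. nrm A (u n) \<le> L" using linf_bound[OF u] by auto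
    show ?thesis
      by (rule linfI[of _ "K + L"])
        (auto intro!: cl in_x linf_app[OF u] order_trans[OF un(2) add_mono] K L)
  qed
  show "(\<lambda>n. x n \<oplus>\<^bsub>A\<^esub> y n) \<in> carrier (linf A)" using 1[OF y] .
  show "(\<lambda>n. x n \<otimes>\<^bsub>A\<^esub> y n) \<in> carrier (linf A)"
    by (rule linfI[of _ "K * L"])
      (auto intro!: cl in_x in_y order_trans[OF un(4) mult_mono] K L nrm_pos less_imp_le[OF K(1)])
  show "(\<lambda>n. x n \<ominus>\<^bsub>A\<^esub> y n) \<in> carrier (linf A)"
    unfolding a_minus_def using 1[OF linf_closed_unary(1)[OF y]] .
qed

lemmas linf_closed = linf_closed_unary linf_closed_binary

lemma linf_ring: "ring (linf A)"
proof (rule ringI)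
  show "abelian_group (linf A)"
  proof (rule abelian_groupI)
    fix x assume x: "x \<in> carrier (linf A)"
    show "\<exists>y\<in>carrier (linf A). y \<oplus>\<^bsub>linf A\<^esub> x = \<zero>\<^bsub>linf A\<^esub>"
      using x by (intro bexI[of _ "\<lambda>n. \<ominus>\<^bsub>A\<^esub> x n"] linf_closed) (auto simp: linf_ops(4,5) linf_app R.l_neg)
  next
    show "\<zero>\<^bsub>linf A\<^esub> \<in> carrier (linf A)" by (simp add: linf_ops(4) linf_const)
  qed (auto simp: linf_ops(4,5) linf_app linf_closed R.a_ac)
  show "Group.monoid (linf A)"
    by (rule monoidI) (auto simp: linf_ops(2,3) linf_app linf_closed linf_const R.m_assoc)
qed (auto simp: linf_ops(2,5) linf_app linf_closed R.l_distr R.r_distr)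

sublocale L: ring "linf A" by (rule linf_ring)

lemma linf_uminus: "x \<in> carrier (linf A) \<Longrightarrow> \<ominus>\<^bsub>linf A\<^esub> x = (\<lambda>n. \<ominus>\<^bsub>A\<^esub> x n)"
  by (rule L.minus_equality) (auto simp: linf_ops(4,5) linf_closed linf_app R.l_neg)

lemma linf_minus: "x \<in> carrier (linf A) \<Longrightarrow> y \<in> carrier (linf A) \<Longrightarrow> x \<ominus>\<^bsub>linf A\<^esub> y = (\<lambda>n. x n \<ominus>\<^bsub>A\<^esub> y n)"
  by (simp add: a_minus_def linf_uminus linf_ops(5))

lemma c0_sub: "c0 A \<subseteq> carrier (linf A)"
proof
  fix x assume x: "x \<in> c0 A"
  then have "Bseq (\<lambda>n. nrm A (x n))" by (auto simp: c0_def intro: convergent_imp_Bseq convergentI)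
  then obtain K where "\<And>n. norm (nrm A (x n)) \<le> K" by (auto simp: Bseq_def)
  then have "\<And>n. nrm A (x n) \<le> K" by (simp add: abs_le_iff)
  then show "x \<in> carrier (linf A)" using x by (intro linfI) (auto simp: c0_def)
qed

lemma c0_mult:
  assumes x: "x \<in> c0 A" and y: "y \<in> carrier (linf A)"
  shows "(\<lambda>n. x n \<otimes>\<^bsub>A\<^esub> y n) \<in> c0 A" "(\<lambda>n. y n \<otimes>\<^bsub>A\<^esub> x n) \<in> c0 A"
proof -
  have xc: "x n \<in> carrier A" for n using x by (simp add: c0_def)
  have lim: "(\<lambda>n. nrm A (x n)) \<longlonglongrightarrow> 0" using x by (simp add: c0_def)
  obtain K where K: "K > 0" "\<And>n. nrm A (y n) \<le> K" using linf_bound[OF y] by auto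
  have b: "nrm A (x n \<otimes>\<^bsub>A\<^esub> y n) \<le> nrm A (x n) * K" "nrm A (y n \<otimes>\<^bsub>A\<^esub> x n) \<le> nrm A (x n) * K" for n
    using un(4)[OF xc linf_app[OF y], of n n] un(4)[OF linf_app[OF y] xc, of n n] mult_left_mono[OF K(2) nrm_pos[OF xc], of n n]
    by (simp_all add: mult.commute)
  have l: "(\<lambda>n. nrm A (x n) * K) \<longlonglongrightarrow> 0" using tendsto_mult_right[OF lim, of K] by simp
  have "(\<lambda>n. nrm A (x n \<otimes>\<^bsub>A\<^esub> y n)) \<longlonglongrightarrow> 0" "(\<lambda>n. nrm A (y n \<otimes>\<^bsub>A\<^esub> x n)) \<longlonglongrightarrow> 0"
    by (rule tendsto_sandwich[OF _ _ tendsto_const l]; simp add: b nrm_pos cl xc linf_app[OF y])+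
  then show "(\<lambda>n. x n \<otimes>\<^bsub>A\<^esub> y n) \<in> c0 A" "(\<lambda>n. y n \<otimes>\<^bsub>A\<^esub> x n) \<in> c0 A"
    by (simp_all add: c0_def cl xc linf_app[OF y])
qed

lemma c0_add:
  assumes x: "x \<in> c0 A" and y: "y \<in> c0 A"
  shows "(\<lambda>n. x n \<oplus>\<^bsub>A\<^esub> y n) \<in> c0 A"
proof -
  have xc: "x n \<in> carrier A" "y n \<in> carrier A" for n using x y by (auto simp: c0_def)
  have l: "(\<lambda>n. nrm A (x n) + nrm A (y n)) \<longlonglongrightarrow> 0"
    using tendsto_add[of "\<lambda>n. nrm A (x n)" 0 sequentially "\<lambda>n. nrm A (y n)" 0] x y by (auto simp: c0_def)
  have "(\<lambda>n. nrm A (x n \<oplus>\<^bsub>A\<^esub> y n)) \<longlonglongrightarrow> 0"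
    by (rule tendsto_sandwich[OF _ _ tendsto_const l]) (simp_all add: un(2) nrm_pos cl xc)
  then show ?thesis by (simp add: c0_def cl xc)
qed

lemma c0_subgroup: "subgroup (c0 A) (add_monoid (linf A))"
  proof (rule L.add.subgroupI)
    show "c0 A \<subseteq> carrier (linf A)" by (rule c0_sub)
    have "(\<lambda>n. \<zero>\<^bsub>A\<^esub>) \<in> c0 A" using A by (simp add: c0_def unital_nrm_zero)
    then show "c0 A \<noteq> {}" by blast
    fix x y assume x: "x \<in> c0 A" and y: "y \<in> c0 A"
    show "x \<oplus>\<^bsub>linf A\<^esub> y \<in> c0 A" using x y by (simp add: linf_ops c0_add)
    show "\<ominus>\<^bsub>linf A\<^esub> x \<in> c0 A" using x c0_sub by (auto simp: linf_uminus c0_def un(6))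
  qed

lemma c0_ideal: "ideal (c0 A) (linf A)"
proof (rule idealI[OF linf_ring c0_subgroup])
  fix a x assume "a \<in> c0 A" "x \<in> carrier (linf A)"
  then show "x \<otimes>\<^bsub>linf A\<^esub> a \<in> c0 A" "a \<otimes>\<^bsub>linf A\<^esub> x \<in> c0 A" by (simp_all add: linf_ops(2) c0_mult)
qed

sublocale I: ideal "c0 A" "linf A" by (rule c0_ideal)

section \<open>Classes modulo null sequences\<close>

lemma seq_class_eq_iff:
  assumes x: "x \<in> carrier (linf A)" and y: "y \<in> carrier (linf A)"
  shows "seq_class A x = seq_class A y \<longleftrightarrow> (\<lambda>n. nrm A (x n \<ominus>\<^bsub>A\<^esub> y n)) \<longlonglongrightarrow> 0"
proof -
  have "x \<ominus>\<^bsub>linf A\<^esub> y \<in> c0 A \<longleftrightarrow> (\<lambda>n. nrm A (x n \<ominus>\<^bsub>A\<^esub> y n)) \<longlonglongrightarrow> 0"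
    unfolding linf_minus[OF x y] by (simp add: c0_def cl linf_app[OF x] linf_app[OF y])
  then show ?thesis
    unfolding L.quotient_eq_iff_same_a_r_cos[OF c0_ideal x y] seq_class_def by simp
qed

lemma seq_class_mem: "z \<in> seq_class A x \<longleftrightarrow> z \<in> carrier (linf A) \<and> seq_class A z = seq_class A x"
  if x: "x \<in> carrier (linf A)"
proof -
  have "z \<in> seq_class A x \<Longrightarrow> z \<in> carrier (linf A)"
    using L.a_r_coset_subset_G[OF c0_sub x] by (auto simp: seq_class_def)
  then show ?thesis
    using L.a_repr_independence[OF _ x c0_subgroup, of z] I.a_rcos_self[of z]
    by (auto simp: seq_class_def)
qed

lemma seq_class_closed: "x \<in> carrier (linf A) \<Longrightarrow> seq_class A x \<in> carrier (seq_alg A)"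
  by (auto simp: seq_alg_ops FactRing_def seq_class_def A_RCOSETS_def')

lemma seq_alg_cases:
  assumes "S \<in> carrier (seq_alg A)"
  obtains x where "x \<in> carrier (linf A)" "S = seq_class A x"
  using assms by (auto simp: seq_alg_ops FactRing_def seq_class_def A_RCOSETS_def')

lemma seq_class_ops:
  assumes x: "x \<in> carrier (linf A)" and y: "y \<in> carrier (linf A)"
  shows "seq_class A x \<otimes>\<^bsub>seq_alg A\<^esub> seq_class A y = seq_class A (\<lambda>n. x n \<otimes>\<^bsub>A\<^esub> y n)"
    and "seq_class A x \<oplus>\<^bsub>seq_alg A\<^esub> seq_class A y = seq_class A (\<lambda>n. x n \<oplus>\<^bsub>A\<^esub> y n)"
    and "c \<odot>\<^bsub>seq_alg A\<^esub> seq_class A x = seq_class A (\<lambda>n. c \<odot>\<^bsub>A\<^esub> x n)"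
    and "star (seq_alg A) (seq_class A x) = seq_class A (\<lambda>n. star A (x n))"
proof -
  show "seq_class A x \<otimes>\<^bsub>seq_alg A\<^esub> seq_class A y = seq_class A (\<lambda>n. x n \<otimes>\<^bsub>A\<^esub> y n)"
    using I.rcoset_mult_add[OF x y] by (simp add: seq_class_def seq_alg_ops FactRing_def linf_ops(2))
  show "seq_class A x \<oplus>\<^bsub>seq_alg A\<^esub> seq_class A y = seq_class A (\<lambda>n. x n \<oplus>\<^bsub>A\<^esub> y n)"
    using I.a_rcos_sum[OF x y] by (simp add: seq_class_def seq_alg_ops FactRing_def linf_ops(5))
  have ne: "seq_class A x \<noteq> {}" using seq_class_mem[OF x, of x] x by blast
  have sm: "seq_class A (\<lambda>n. c \<odot>\<^bsub>A\<^esub> z n) = seq_class A (\<lambda>n. c \<odot>\<^bsub>A\<^esub> x n)" if "z \<in> seq_class A x" for z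
  proof -
    have z: "z \<in> carrier (linf A)" "(\<lambda>n. nrm A (z n \<ominus>\<^bsub>A\<^esub> x n)) \<longlonglongrightarrow> 0"
      using that seq_class_mem[OF x] seq_class_eq_iff[OF _ x] by auto
    have "c \<odot>\<^bsub>A\<^esub> z n \<ominus>\<^bsub>A\<^esub> c \<odot>\<^bsub>A\<^esub> x n = c \<odot>\<^bsub>A\<^esub> (z n \<ominus>\<^bsub>A\<^esub> x n)" for n
      using linf_app[OF z(1)] linf_app[OF x] A
      by (simp add: a_minus_def cl us pre_cstar_algebra.uminus_eq_smult[OF unital_pre[OF A]]
          mult.commute flip: module.smult_assoc1[OF unital_module[OF A], simplified])
    then have "(\<lambda>n. nrm A (c \<odot>\<^bsub>A\<^esub> z n \<ominus>\<^bsub>A\<^esub> c \<odot>\<^bsub>A\<^esub> x n)) \<longlonglongrightarrow> 0"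
      using linf_app[OF z(1)] linf_app[OF x] tendsto_mult_left[OF z(2), of "cmod c"] by (simp add: un(3) cl)
    then show ?thesis using z x by (subst seq_class_eq_iff) (auto intro: linf_closed)
  qed
  show "c \<odot>\<^bsub>seq_alg A\<^esub> seq_class A x = seq_class A (\<lambda>n. c \<odot>\<^bsub>A\<^esub> x n)"
    unfolding seq_alg_ops(6) linf_ops(6) seq_class_def[symmetric]
    using ne by (simp add: sm)
  have st: "seq_class A (\<lambda>n. star A (z n)) = seq_class A (\<lambda>n. star A (x n))" if "z \<in> seq_class A x" for z
  proof -
    have z: "z \<in> carrier (linf A)" "(\<lambda>n. nrm A (z n \<ominus>\<^bsub>A\<^esub> x n)) \<longlonglongrightarrow> 0"
      using that seq_class_mem[OF x] seq_class_eq_iff[OF _ x] by auto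
    have "star A (z n) \<ominus>\<^bsub>A\<^esub> star A (x n) = star A (z n \<ominus>\<^bsub>A\<^esub> x n)" for n
      using linf_app[OF z(1), of n] linf_app[OF x, of n]
      by (simp add: a_minus_def cl us pre_cstar_algebra.uminus_eq_smult[OF unital_pre[OF A]])
    then have "(\<lambda>n. nrm A (star A (z n) \<ominus>\<^bsub>A\<^esub> star A (x n))) \<longlonglongrightarrow> 0"
      using linf_app[OF z(1)] linf_app[OF x] z(2) by (simp add: unital_nrm_star[OF A] cl)
    then show ?thesis using z x by (subst seq_class_eq_iff) (auto intro: linf_closed)
  qed
  show "star (seq_alg A) (seq_class A x) = seq_class A (\<lambda>n. star A (x n))"
    unfolding seq_alg_ops(7) linf_ops(7) seq_class_def[symmetric]
    using ne by (simp add: st)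
qed

lemma seq_alg_one: "\<one>\<^bsub>seq_alg A\<^esub> = seq_class A (\<lambda>n. \<one>\<^bsub>A\<^esub>)"
  by (simp add: seq_alg_ops FactRing_def seq_class_def linf_ops(3))

lemma seq_alg_zero: "\<zero>\<^bsub>seq_alg A\<^esub> = seq_class A (\<lambda>n. \<zero>\<^bsub>A\<^esub>)"
  using L.a_coset_add_zero[OF c0_sub] by (simp add: seq_alg_ops FactRing_def seq_class_def linf_ops(4))

lemma seq_alg_add_group: "abelian_group (seq_alg A)"
proof -
  have "abelian_group (linf A Quot c0 A)"
    using I.quotient_is_ring unfolding ring_def by blast
  then interpret Q: abelian_group "linf A Quot c0 A" .
  show ?thesis
  proof (rule abelian_groupI)
    fix S assume "S \<in> carrier (seq_alg A)"
    then show "\<exists>T\<in>carrier (seq_alg A). T \<oplus>\<^bsub>seq_alg A\<^esub> S = \<zero>\<^bsub>seq_alg A\<^esub>"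
      unfolding seq_alg_ops by (intro bexI[of _ "\<ominus>\<^bsub>linf A Quot c0 A\<^esub> S"] Q.l_neg Q.a_inv_closed)
  qed (simp_all add: seq_alg_ops Q.a_ac)
qed

lemma seq_class_minus:
  assumes x: "x \<in> carrier (linf A)" and y: "y \<in> carrier (linf A)"
  shows "seq_class A x \<ominus>\<^bsub>seq_alg A\<^esub> seq_class A y = seq_class A (\<lambda>n. x n \<ominus>\<^bsub>A\<^esub> y n)"
proof -
  interpret Q: abelian_group "seq_alg A" by (rule seq_alg_add_group)
  have ny: "(\<lambda>n. \<ominus>\<^bsub>A\<^esub> y n) \<in> carrier (linf A)" using y by (rule linf_closed)
  have "\<ominus>\<^bsub>seq_alg A\<^esub> seq_class A y = seq_class A (\<lambda>n. \<ominus>\<^bsub>A\<^esub> y n)"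
    using linf_app[OF y] y ny
    by (intro Q.minus_equality seq_class_closed) (simp_all add: seq_class_ops seq_alg_zero R.l_neg)
  then show ?thesis using x ny by (simp add: a_minus_def seq_class_ops)
qed

section \<open>The quotient norm and its metric\<close>

lemma linf_nrm_upper: "x \<in> carrier (linf A) \<Longrightarrow> nrm A (x n) \<le> nrm (linf A) x"
  unfolding linf_ops(8) by (rule cSUP_upper) (auto simp: linf_ops)

lemma linf_nrm_least: "(\<And>n. nrm A (x n) \<le> K) \<Longrightarrow> nrm (linf A) x \<le> K"
  unfolding linf_ops(8) by (rule cSUP_least) auto

lemma linf_nrm_nonneg: "x \<in> carrier (linf A) \<Longrightarrow> 0 \<le> nrm (linf A) x"
  using linf_nrm_upper[of x 0] nrm_pos[OF linf_app] order_trans by blast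

lemma quot_nrm_lower:
  assumes "x \<in> carrier (linf A)" "z \<in> carrier (linf A)" "seq_class A z = seq_class A x"
  shows "nrm (seq_alg A) (seq_class A x) \<le> nrm (linf A) z"
  unfolding seq_alg_ops(8)
  by (rule cINF_lower) (use assms linf_nrm_nonneg in \<open>auto simp: seq_class_mem bdd_below_def intro!: exI[of _ 0]\<close>)

lemma quot_nrm_nonneg: "x \<in> carrier (linf A) \<Longrightarrow> 0 \<le> nrm (seq_alg A) (seq_class A x)"
  unfolding seq_alg_ops(8)
proof (rule cINF_greatest)
  assume x: "x \<in> carrier (linf A)"
  then show "seq_class A x \<noteq> {}" using seq_class_mem[OF x, of x] by blast
  show "0 \<le> nrm (linf A) z" if "z \<in> seq_class A x" for z
    using that linf_nrm_nonneg by (simp add: seq_class_mem[OF x])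
qed

lemma quot_nrm_approx:
  assumes x: "x \<in> carrier (linf A)" and e: "e > 0"
  shows "\<exists>z\<in>carrier (linf A). seq_class A z = seq_class A x \<and>
    nrm (linf A) z < nrm (seq_alg A) (seq_class A x) + e"
proof -
  have "\<exists>z\<in>seq_class A x. nrm (linf A) z < nrm (seq_alg A) (seq_class A x) + e"
  proof (rule ccontr)
    assume "\<not> ?thesis"
    then have "nrm (seq_alg A) (seq_class A x) + e \<le> (INF z\<in>seq_class A x. nrm (linf A) z)"
      using seq_class_mem[OF x, of x] x by (intro cINF_greatest) (auto simp: not_less)
    then show False using e by (simp add: seq_alg_ops(8))
  qed
  then show ?thesis using seq_class_mem[OF x] by blast
qed

lemma quot_nrm_zero:
  assumes x: "x \<in> carrier (linf A)"
  shows "nrm (seq_alg A) (seq_class A x) = 0 \<longleftrightarrow> seq_class A x = \<zero>\<^bsub>seq_alg A\<^esub>"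
proof
  assume 0: "nrm (seq_alg A) (seq_class A x) = 0"
  have "(\<lambda>n. nrm A (x n)) \<longlonglongrightarrow> 0"
  proof (rule LIMSEQ_I)
    fix e :: real assume e: "e > 0"
    obtain z where z: "z \<in> carrier (linf A)" "seq_class A z = seq_class A x" "nrm (linf A) z < e/2"
      using quot_nrm_approx[OF x, of "e/2"] e 0 by auto
    have "(\<lambda>n. nrm A (x n \<ominus>\<^bsub>A\<^esub> z n)) \<longlonglongrightarrow> 0"
      using seq_class_eq_iff[OF x z(1)] z(2) by simp
    then obtain N where N: "\<And>n. n \<ge> N \<Longrightarrow> norm (nrm A (x n \<ominus>\<^bsub>A\<^esub> z n)) < e/2"
      using LIMSEQ_D[of "\<lambda>n. nrm A (x n \<ominus>\<^bsub>A\<^esub> z n)" 0 "e/2"] e by auto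
    have "norm (nrm A (x n) - 0) < e" if n: "n \<ge> N" for n
    proof -
      have "x n = (x n \<ominus>\<^bsub>A\<^esub> z n) \<oplus>\<^bsub>A\<^esub> z n"
        using linf_app[OF x, of n] linf_app[OF z(1), of n] by (simp add: a_minus_def R.a_assoc R.l_neg)
      then have "nrm A (x n) \<le> nrm A (x n \<ominus>\<^bsub>A\<^esub> z n) + nrm A (z n)"
        using un(2)[of "x n \<ominus>\<^bsub>A\<^esub> z n" "z n"] linf_app[OF x, of n] linf_app[OF z(1), of n] by (simp add: cl)
      then show ?thesis using N[OF n] linf_nrm_upper[OF z(1), of n] z(3) nrm_pos[OF linf_app[OF x]] by simp
    qed
    then show "\<exists>N. \<forall>n\<ge>N. norm (nrm A (x n) - 0) < e" by blast
  qed
  moreover have "x n \<ominus>\<^bsub>A\<^esub> \<zero>\<^bsub>A\<^esub> = x n" for n using linf_app[OF x, of n] by (simp add: a_minus_def)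
  ultimately show "seq_class A x = \<zero>\<^bsub>seq_alg A\<^esub>"
    unfolding seq_alg_zero by (subst seq_class_eq_iff) (simp_all add: x linf_const)
next
  assume "seq_class A x = \<zero>\<^bsub>seq_alg A\<^esub>"
  then have "nrm (seq_alg A) (seq_class A x) \<le> nrm (linf A) (\<lambda>n. \<zero>\<^bsub>A\<^esub>)"
    unfolding seq_alg_zero by (intro quot_nrm_lower x linf_const) auto
  also have "\<dots> = 0" using A by (simp add: linf_ops unital_nrm_zero)
  finally show "nrm (seq_alg A) (seq_class A x) = 0" using quot_nrm_nonneg[OF x] by simp
qed

lemma quot_nrm_add:
  assumes x: "x \<in> carrier (linf A)" and y: "y \<in> carrier (linf A)"
  shows "nrm (seq_alg A) (seq_class A x \<oplus>\<^bsub>seq_alg A\<^esub> seq_class A y) \<le>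
    nrm (seq_alg A) (seq_class A x) + nrm (seq_alg A) (seq_class A y)"
proof (rule field_le_epsilon)
  fix e :: real assume e: "e > 0"
  obtain u where u: "u \<in> carrier (linf A)" "seq_class A u = seq_class A x"
      "nrm (linf A) u < nrm (seq_alg A) (seq_class A x) + e/2"
    using quot_nrm_approx[OF x, of "e/2"] e by auto
  obtain v where v: "v \<in> carrier (linf A)" "seq_class A v = seq_class A y"
      "nrm (linf A) v < nrm (seq_alg A) (seq_class A y) + e/2"
    using quot_nrm_approx[OF y, of "e/2"] e by auto
  have "nrm (seq_alg A) (seq_class A u \<oplus>\<^bsub>seq_alg A\<^esub> seq_class A v) \<le> nrm (linf A) (\<lambda>n. u n \<oplus>\<^bsub>A\<^esub> v n)"
    unfolding seq_class_ops(2)[OF u(1) v(1)] using u v by (intro quot_nrm_lower linf_closed) auto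
  also have "\<dots> \<le> nrm (linf A) u + nrm (linf A) v"
    by (rule linf_nrm_least)
      (rule order_trans[OF un(2) add_mono], auto simp: u v linf_app linf_nrm_upper)
  finally show "nrm (seq_alg A) (seq_class A x \<oplus>\<^bsub>seq_alg A\<^esub> seq_class A y) \<le>
    nrm (seq_alg A) (seq_class A x) + nrm (seq_alg A) (seq_class A y) + e"
    using u v by simp
qed

lemma quot_nrm_minus:
  assumes x: "x \<in> carrier (linf A)"
  shows "nrm (seq_alg A) (seq_class A (\<lambda>n. \<ominus>\<^bsub>A\<^esub> x n)) \<le> nrm (seq_alg A) (seq_class A x)"
proof (rule field_le_epsilon)
  fix e :: real assume e: "e > 0"
  obtain u where u: "u \<in> carrier (linf A)" "seq_class A u = seq_class A x"
      "nrm (linf A) u < nrm (seq_alg A) (seq_class A x) + e"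
    using quot_nrm_approx[OF x e] by auto
  have c: "(-1) \<odot>\<^bsub>seq_alg A\<^esub> seq_class A u = seq_class A (\<lambda>n. \<ominus>\<^bsub>A\<^esub> u n)"
     "(-1) \<odot>\<^bsub>seq_alg A\<^esub> seq_class A x = seq_class A (\<lambda>n. \<ominus>\<^bsub>A\<^esub> x n)"
    by (simp_all only: seq_class_ops(3)[OF u(1) u(1)] seq_class_ops(3)[OF x x]
        pre_cstar_algebra.uminus_eq_smult[OF unital_pre[OF A] linf_app[OF u(1)]]
        pre_cstar_algebra.uminus_eq_smult[OF unital_pre[OF A] linf_app[OF x]])
  then have "seq_class A (\<lambda>n. \<ominus>\<^bsub>A\<^esub> u n) = seq_class A (\<lambda>n. \<ominus>\<^bsub>A\<^esub> x n)" using u(2) by metis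
  then have "nrm (seq_alg A) (seq_class A (\<lambda>n. \<ominus>\<^bsub>A\<^esub> x n)) \<le> nrm (linf A) (\<lambda>n. \<ominus>\<^bsub>A\<^esub> u n)"
    using u x by (intro quot_nrm_lower linf_closed)
  also have "\<dots> = nrm (linf A) u" using u by (simp add: linf_ops(8) un(6) linf_app)
  finally show "nrm (seq_alg A) (seq_class A (\<lambda>n. \<ominus>\<^bsub>A\<^esub> x n)) \<le> nrm (seq_alg A) (seq_class A x) + e"
    using u by simp
qed

text \<open>Needed to handle the closure in \<open>hereditary_subalgebra\<close>: the topology of
  the sequence algebra is a \<open>Metric_space.mtopology\<close>, which can be worked with once the
  distance is known to be a metric.\<close>

lemma seq_alg_metric: "Metric_space (carrier (seq_alg A)) (cstar_dist (seq_alg A))"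
proof
  interpret Q: abelian_group "seq_alg A" by (rule seq_alg_add_group)
  have nn: "0 \<le> nrm (seq_alg A) S" if "S \<in> carrier (seq_alg A)" for S
    using that by (elim seq_alg_cases) (simp add: quot_nrm_nonneg)
  have tri: "nrm (seq_alg A) (S \<oplus>\<^bsub>seq_alg A\<^esub> T) \<le> nrm (seq_alg A) S + nrm (seq_alg A) T"
    if "S \<in> carrier (seq_alg A)" "T \<in> carrier (seq_alg A)" for S T
    using that by (elim seq_alg_cases) (simp add: quot_nrm_add)
  have z: "nrm (seq_alg A) S = 0 \<longleftrightarrow> S = \<zero>\<^bsub>seq_alg A\<^esub>" if "S \<in> carrier (seq_alg A)" for S
    using that by (elim seq_alg_cases) (simp add: quot_nrm_zero)
  have c: "nrm (seq_alg A) (S \<ominus>\<^bsub>seq_alg A\<^esub> T) \<le> nrm (seq_alg A) (T \<ominus>\<^bsub>seq_alg A\<^esub> S)"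
    if "S \<in> carrier (seq_alg A)" "T \<in> carrier (seq_alg A)" for S T
    using that
  proof (elim seq_alg_cases)
    fix x y assume xy: "x \<in> carrier (linf A)" "S = seq_class A x" "y \<in> carrier (linf A)" "T = seq_class A y"
    have "(\<lambda>n. x n \<ominus>\<^bsub>A\<^esub> y n) = (\<lambda>n. \<ominus>\<^bsub>A\<^esub> (y n \<ominus>\<^bsub>A\<^esub> x n))"
      using xy by (simp add: linf_app a_minus_def R.minus_add R.a_comm)
    then show ?thesis
      using quot_nrm_minus[OF linf_closed(6)[OF xy(3,1)]] xy by (simp add: seq_class_minus)
  qed
  fix S T U assume S: "S \<in> carrier (seq_alg A)" "T \<in> carrier (seq_alg A)" "U \<in> carrier (seq_alg A)"
  have "S \<ominus>\<^bsub>seq_alg A\<^esub> U = (S \<ominus>\<^bsub>seq_alg A\<^esub> T) \<oplus>\<^bsub>seq_alg A\<^esub> (T \<ominus>\<^bsub>seq_alg A\<^esub> U)"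
    using S by (simp add: a_minus_def Q.a_assoc Q.r_neg1)
  then show "cstar_dist (seq_alg A) S U \<le> cstar_dist (seq_alg A) S T + cstar_dist (seq_alg A) T U"
    using S tri[of "S \<ominus>\<^bsub>seq_alg A\<^esub> T" "T \<ominus>\<^bsub>seq_alg A\<^esub> U"] by (simp add: cstar_dist_def)
next
  interpret Q: abelian_group "seq_alg A" by (rule seq_alg_add_group)
  fix S T
  show "0 \<le> cstar_dist (seq_alg A) S T"
    unfolding cstar_dist_def
    by (auto elim!: seq_alg_cases simp: seq_class_minus quot_nrm_nonneg linf_closed)
  have c: "nrm (seq_alg A) (S \<ominus>\<^bsub>seq_alg A\<^esub> T) \<le> nrm (seq_alg A) (T \<ominus>\<^bsub>seq_alg A\<^esub> S)"
    if "S \<in> carrier (seq_alg A)" "T \<in> carrier (seq_alg A)" for S T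
    using that
  proof (elim seq_alg_cases)
    fix x y assume xy: "x \<in> carrier (linf A)" "S = seq_class A x" "y \<in> carrier (linf A)" "T = seq_class A y"
    have "(\<lambda>n. x n \<ominus>\<^bsub>A\<^esub> y n) = (\<lambda>n. \<ominus>\<^bsub>A\<^esub> (y n \<ominus>\<^bsub>A\<^esub> x n))"
      using xy by (simp add: linf_app a_minus_def R.minus_add R.a_comm)
    then show ?thesis
      using quot_nrm_minus[OF linf_closed(6)[OF xy(3,1)]] xy by (simp add: seq_class_minus)
  qed
  then show "cstar_dist (seq_alg A) S T = cstar_dist (seq_alg A) T S"
    by (auto simp: cstar_dist_def intro: antisym)
  assume S: "S \<in> carrier (seq_alg A)" "T \<in> carrier (seq_alg A)"
  have "nrm (seq_alg A) (S \<ominus>\<^bsub>seq_alg A\<^esub> T) = 0 \<longleftrightarrow> S \<ominus>\<^bsub>seq_alg A\<^esub> T = \<zero>\<^bsub>seq_alg A\<^esub>"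
    using S by (elim seq_alg_cases) (simp add: seq_class_minus quot_nrm_zero linf_closed)
  also have "\<dots> \<longleftrightarrow> S = T"
    using S by (metis Q.add.inv_solve_right Q.l_zero Q.zero_closed a_minus_def)
  finally show "cstar_dist (seq_alg A) S T = 0 \<longleftrightarrow> S = T" using S by (simp add: cstar_dist_def)
qed

lemma seq_alg_hereditaryI:
  assumes "z \<in> carrier (linf A)" "b \<in> carrier (linf A)"
  shows "seq_class A (\<lambda>n. z n \<otimes>\<^bsub>A\<^esub> b n \<otimes>\<^bsub>A\<^esub> z n) \<in> hereditary_subalgebra (seq_alg A) (seq_class A z)"
proof -
  interpret M: Metric_space "carrier (seq_alg A)" "cstar_dist (seq_alg A)" by (rule seq_alg_metric)
  let ?H = "{seq_class A z \<otimes>\<^bsub>seq_alg A\<^esub> a \<otimes>\<^bsub>seq_alg A\<^esub> seq_class A z | a. a \<in> carrier (seq_alg A)}"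
  have "seq_class A (\<lambda>n. z n \<otimes>\<^bsub>A\<^esub> b n \<otimes>\<^bsub>A\<^esub> z n) =
      seq_class A z \<otimes>\<^bsub>seq_alg A\<^esub> seq_class A b \<otimes>\<^bsub>seq_alg A\<^esub> seq_class A z"
    using assms by (simp add: seq_class_ops linf_closed)
  then have "seq_class A (\<lambda>n. z n \<otimes>\<^bsub>A\<^esub> b n \<otimes>\<^bsub>A\<^esub> z n) \<in> ?H" using assms seq_class_closed by blast
  moreover have "?H \<subseteq> topspace M.mtopology"
    using assms by (auto simp: seq_class_ops linf_closed intro!: seq_class_closed elim!: seq_alg_cases)
  ultimately show ?thesis
    unfolding hereditary_subalgebra_def cstar_topology_def using closure_of_subset by blast
qed

text \<open>Representatives differ by a null sequence, so they share their null subsequences. The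
  representative by squares therefore inherits the condition imposed on \<open>x\<close>, and norms
  without a null subsequence are eventually bounded below.\<close>

lemma seq_alg_pp_bounded_below:
  assumes "z \<in> seq_alg_pp A"
  shows "\<exists>w\<in>carrier (linf A). \<exists>\<delta>>0. \<exists>N. z = seq_class A (\<lambda>n. star A (w n) \<otimes>\<^bsub>A\<^esub> w n) \<and>
    (\<forall>n\<ge>N. \<delta> < nrm A (star A (w n) \<otimes>\<^bsub>A\<^esub> w n))"
proof -
  obtain b x where b: "b \<in> carrier (seq_alg A)" "z = star (seq_alg A) b \<otimes>\<^bsub>seq_alg A\<^esub> b"
    and x: "x \<in> carrier (linf A)" "z = seq_class A x"
      "\<not> (\<exists>k. strict_mono k \<and> (\<lambda>n. nrm A (x (k n))) \<longlonglongrightarrow> 0)"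
    using assms by (auto simp: seq_alg_pp_def positive_cone_def)
  obtain w where w: "w \<in> carrier (linf A)" "b = seq_class A w" using b(1) by (rule seq_alg_cases)
  define v where "v = (\<lambda>n. star A (w n) \<otimes>\<^bsub>A\<^esub> w n)"
  have v: "v \<in> carrier (linf A)" using w by (simp add: v_def linf_closed)
  have zv: "z = seq_class A v" using b w by (simp add: seq_class_ops linf_closed v_def)
  have lim: "(\<lambda>n. nrm A (x n \<ominus>\<^bsub>A\<^esub> v n)) \<longlonglongrightarrow> 0"
    using seq_class_eq_iff[OF x(1) v] zv x(2) by simp
  have "\<exists>\<delta>>0. \<exists>N. \<forall>n\<ge>N. \<delta> < nrm A (v n)"
  proof (rule ccontr)
    assume neg: "\<not> ?thesis"
    have ex: "\<exists>m>N. nrm A (v m) \<le> 1 / real (Suc n)" for n N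
    proof -
      have "\<exists>m\<ge>Suc N. \<not> 1 / real (Suc n) < nrm A (v m)"
        using neg zero_less_divide_1_iff[of "real (Suc n)"] by (metis of_nat_0_less_iff zero_less_Suc)
      then show ?thesis by (auto simp: not_less Suc_le_eq)
    qed
    \<comment> \<open>Indices are chosen recursively, so that they increase strictly while the norms
      fall below \<open>1 / (n + 1)\<close>.\<close>
    obtain k where k: "\<And>n. nrm A (v (k n)) \<le> 1 / real (Suc n)" "\<And>n. k n < k (Suc n)"
      using dependent_nat_choice[of "\<lambda>n m. nrm A (v m) \<le> 1 / real (Suc n)" "\<lambda>n m m'. m < m'"] ex by metis
    have sm: "strict_mono k" using k(2) by (simp add: strict_mono_Suc_iff)
    have l1: "(\<lambda>n. nrm A (x (k n) \<ominus>\<^bsub>A\<^esub> v (k n))) \<longlonglongrightarrow> 0"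
      using LIMSEQ_subseq_LIMSEQ[OF lim sm] by (simp add: o_def)
    have l: "(\<lambda>n. nrm A (x (k n) \<ominus>\<^bsub>A\<^esub> v (k n)) + 1 / real (Suc n)) \<longlonglongrightarrow> 0"
      using tendsto_add[OF l1 LIMSEQ_inverse_real_of_nat] by (simp add: inverse_eq_divide)
    have le: "nrm A (x m) \<le> nrm A (x m \<ominus>\<^bsub>A\<^esub> v m) + nrm A (v m)" for m
    proof -
      have "x m = (x m \<ominus>\<^bsub>A\<^esub> v m) \<oplus>\<^bsub>A\<^esub> v m"
        using linf_app[OF x(1), of m] linf_app[OF v, of m] by (simp add: a_minus_def R.a_assoc R.l_neg)
      then show ?thesis
        using un(2)[of "x m \<ominus>\<^bsub>A\<^esub> v m" "v m"] linf_app[OF x(1), of m] linf_app[OF v, of m] by (simp add: cl)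
    qed
    have "(\<lambda>n. nrm A (x (k n))) \<longlonglongrightarrow> 0"
    proof (rule tendsto_sandwich[OF _ _ tendsto_const l])
      show "\<forall>\<^sub>F n in sequentially. nrm A (x (k n)) \<le> nrm A (x (k n) \<ominus>\<^bsub>A\<^esub> v (k n)) + 1 / real (Suc n)"
        using order_trans[OF le add_left_mono[OF k(1)]] by (intro always_eventually allI)
    qed (simp add: nrm_pos linf_app[OF x(1)])
    then show False using x(3) sm by blast
  qed
  then show ?thesis using w(1) zv unfolding v_def by blast
qed

end

section \<open>Projections in simple algebras\<close>

text \<open>The C*-identity applied to \<open>v * p - v\<close>, whose square expands to 0.\<close>

lemma partial_isometry:
  fixes v :: "'a::cstar_alg"
  assumes "adj v * v = p" "p * p = p"
  shows "v * p = v" "v * adj v * v = v"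
proof -
  have "adj (adj v * v) = adj v * v" by (simp add: adj_mult)
  then have pa: "adj p = p" by (simp add: assms)
  define w where "w = v * p - v"
  have vp: "adj v * (v * t) = p * t" for t by (simp add: assms flip: mult.assoc)
  have "adj w * w = 0"
    by (simp add: w_def adj_diff adj_mult pa algebra_simps vp assms)
  then have "(norm w)\<^sup>2 = 0" by (metis norm_adj_mult norm_zero)
  then show "v * p = v" by (simp add: w_def)
  then show "v * adj v * v = v" by (simp add: mult.assoc assms)
qed

context unital_algebra
begin

abbreviation "\<iota> \<equiv> emb A"

lemmas em = emb_simps[OF A]

lemma eqI: "x \<in> carrier A \<Longrightarrow> y \<in> carrier A \<Longrightarrow> \<iota> x = \<iota> y \<Longrightarrow> x = y"
  by (simp add: emb_inject[OF A])

lemma emb_unit: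
  "x \<in> carrier A \<Longrightarrow> \<iota> \<one>\<^bsub>A\<^esub> * \<iota> x = \<iota> x" "x \<in> carrier A \<Longrightarrow> \<iota> x * \<iota> \<one>\<^bsub>A\<^esub> = \<iota> x"
  by (simp_all add: cl flip: em(3))

lemma emb_unit': "\<iota> \<one>\<^bsub>A\<^esub> * \<iota> \<one>\<^bsub>A\<^esub> = \<iota> \<one>\<^bsub>A\<^esub>" "adj (\<iota> \<one>\<^bsub>A\<^esub>) = \<iota> \<one>\<^bsub>A\<^esub>"
  by (simp_all add: cl unital_star_one[OF A] flip: em)

lemma projectionsD:
  assumes "p \<in> projections A"
  shows "p \<in> carrier A" "p \<otimes>\<^bsub>A\<^esub> p = p" "star A p = p" "\<iota> p * \<iota> p = \<iota> p" "adj (\<iota> p) = \<iota> p" "norm (\<iota> p) \<le> 1"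
proof -
  show 1: "p \<in> carrier A" "p \<otimes>\<^bsub>A\<^esub> p = p" "star A p = p" using assms by (auto simp: projections_def)
  then show 2: "\<iota> p * \<iota> p = \<iota> p" "adj (\<iota> p) = \<iota> p" by (simp_all flip: em)
  then show "norm (\<iota> p) \<le> 1" by (rule norm_projection_le)
qed

lemma projectionsI:
  assumes "p \<in> carrier A" "\<iota> p * \<iota> p = \<iota> p" "adj (\<iota> p) = \<iota> p"
  shows "p \<in> projections A"
  unfolding projections_def using assms by (auto intro!: eqI simp: cl em)

lemma one_minus_projection:
  assumes "p \<in> projections A"
  shows "\<one>\<^bsub>A\<^esub> \<ominus>\<^bsub>A\<^esub> p \<in> projections A"
  using projectionsD[OF assms]
  by (intro projectionsI) (simp_all add: em cl adj_diff algebra_simps emb_unit emb_unit')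

lemma hereditary_approx:
  assumes q: "q \<in> hereditary_subalgebra A x" and x: "x \<in> carrier A"
  shows "q \<in> carrier A" "e > 0 \<Longrightarrow> \<exists>a\<in>carrier A. norm (\<iota> q - \<iota> x * \<iota> a * \<iota> x) < e"
proof -
  interpret P: pre_cstar_algebra A using A by (rule unital_pre)
  interpret M: Metric_space "carrier A" "cstar_dist A" by (rule P.metric_space)
  have q': "q \<in> {q \<in> carrier A. \<forall>e>0. \<exists>y\<in>{x \<otimes>\<^bsub>A\<^esub> a \<otimes>\<^bsub>A\<^esub> x | a. a \<in> carrier A}. y \<in> M.mball q e}"
    using q unfolding hereditary_subalgebra_def cstar_topology_def M.metric_closure_of .
  then show qc: "q \<in> carrier A" by simp
  assume "e > 0"
  then obtain a where a: "a \<in> carrier A" "x \<otimes>\<^bsub>A\<^esub> a \<otimes>\<^bsub>A\<^esub> x \<in> M.mball q e" using q' by blast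
  then have "nrm A (q \<ominus>\<^bsub>A\<^esub> x \<otimes>\<^bsub>A\<^esub> a \<otimes>\<^bsub>A\<^esub> x) < e" by (auto simp: M.in_mball cstar_dist_def)
  then have "norm (\<iota> q - \<iota> x * \<iota> a * \<iota> x) < e"
    using qc a x norm_emb[OF A, of "q \<ominus>\<^bsub>A\<^esub> x \<otimes>\<^bsub>A\<^esub> a \<otimes>\<^bsub>A\<^esub> x"] by (simp only: em cl)
  then show "\<exists>a\<in>carrier A. norm (\<iota> q - \<iota> x * \<iota> a * \<iota> x) < e" using a by blast
qed

text \<open>Annihilation passes from \<open>x\<close> to every \<open>x a x\<close> and by
  continuity to their closure. With \<open>u = p - 1\<close> it shows that a projection
  \<open>q\<close> in the hereditary subalgebra lies under \<open>p\<close>.\<close>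

lemma hereditary_annihilate:
  assumes q: "q \<in> hereditary_subalgebra A x" and x: "x \<in> carrier A"
  shows "u * \<iota> x = 0 \<Longrightarrow> u * \<iota> q = 0" "\<iota> x * u = 0 \<Longrightarrow> \<iota> q * u = 0"
proof -
  have small: "t = 0" if "\<And>e. e > 0 \<Longrightarrow> norm t \<le> norm u * e" for t :: "'a cprod"
  proof (rule ccontr)
    assume t: "t \<noteq> 0"
    define e where "e = norm t / (2 * (norm u + 1))"
    have "e > 0" using t by (simp add: e_def add_nonneg_pos)
    then have "norm t \<le> norm u * e" by (rule that)
    also have "\<dots> \<le> (norm u + 1) * e" using \<open>e > 0\<close> by (intro mult_right_mono) auto
    also have "\<dots> = norm t / 2" unfolding e_def by (simp add: field_simps add_nonneg_eq_0_iff)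
    finally show False using t by simp
  qed
  assume ux: "u * \<iota> x = 0"
  show "u * \<iota> q = 0"
  proof (rule small)
    fix e :: real assume "e > 0"
    then obtain a where lt: "norm (\<iota> q - \<iota> x * \<iota> a * \<iota> x) < e" using hereditary_approx[OF q x] by blast
    moreover have "u * \<iota> q = u * (\<iota> q - \<iota> x * \<iota> a * \<iota> x)"
      by (simp add: right_diff_distrib mult.assoc) (simp add: ux flip: mult.assoc)
    ultimately show "norm (u * \<iota> q) \<le> norm u * e"
      using order_trans[OF norm_mult_ineq mult_left_mono[OF less_imp_le[OF lt] norm_ge_zero]] by simp
  qed
next
  have small: "t = 0" if "\<And>e. e > 0 \<Longrightarrow> norm t \<le> e * norm u" for t :: "'a cprod"
  proof (rule ccontr)
    assume t: "t \<noteq> 0"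
    define e where "e = norm t / (2 * (norm u + 1))"
    have "e > 0" using t by (simp add: e_def add_nonneg_pos)
    then have "norm t \<le> e * norm u" by (rule that)
    also have "\<dots> \<le> e * (norm u + 1)" using \<open>e > 0\<close> by (intro mult_left_mono) auto
    also have "\<dots> = norm t / 2" unfolding e_def by (simp add: field_simps add_nonneg_eq_0_iff)
    finally show False using t by simp
  qed
  assume ux: "\<iota> x * u = 0"
  show "\<iota> q * u = 0"
  proof (rule small)
    fix e :: real assume "e > 0"
    then obtain a where lt: "norm (\<iota> q - \<iota> x * \<iota> a * \<iota> x) < e" using hereditary_approx[OF q x] by blast
    moreover have "\<iota> q * u = (\<iota> q - \<iota> x * \<iota> a * \<iota> x) * u"
      by (simp add: left_diff_distrib mult.assoc ux)
    ultimately show "norm (\<iota> q * u) \<le> e * norm u"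
      using order_trans[OF norm_mult_ineq mult_right_mono[OF less_imp_le[OF lt] norm_ge_zero]] by simp
  qed
qed

text \<open>Completing \<open>u\<close> by the complement of \<open>p\<close> gives an isometry.
  Finiteness makes its range projection the unit, so the range projection of \<open>u\<close> is all
  of \<open>p\<close>, although it lies under \<open>x\<close>.\<close>

lemma finite_subprojection:
  assumes fin: "finite_cstar A" and p: "p \<in> projections A" and x: "x \<in> projections A"
    and px: "\<iota> p * \<iota> x = \<iota> x" and u: "u \<in> carrier A" "adj (\<iota> u) * \<iota> u = \<iota> p" "\<iota> x * \<iota> u = \<iota> u"
  shows "x = p"
proof -
  note P = projectionsD[OF p] and XX = projectionsD[OF x]
  let ?o = "\<iota> \<one>\<^bsub>A\<^esub>"
  define t where "t = u \<oplus>\<^bsub>A\<^esub> (\<one>\<^bsub>A\<^esub> \<ominus>\<^bsub>A\<^esub> p)"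
  have t: "t \<in> carrier A" using u P by (simp add: t_def cl)
  have et: "\<iota> t = \<iota> u + (?o - \<iota> p)" using u P by (simp add: t_def em cl)
  have up: "\<iota> u * \<iota> p = \<iota> u" using partial_isometry(1)[OF u(2) P(4)] .
  have pu: "\<iota> p * \<iota> u = \<iota> u" using px u(3) by (metis mult.assoc)
  have pu': "adj (\<iota> u) * \<iota> p = adj (\<iota> u)" using pu P(5) by (metis adj_mult)
  have up': "\<iota> p * adj (\<iota> u) = adj (\<iota> u)" using up P(5) by (metis adj_mult)
  have o: "?o * \<iota> u = \<iota> u" "\<iota> u * ?o = \<iota> u" "?o * \<iota> p = \<iota> p" "\<iota> p * ?o = \<iota> p"
    using u P by (simp_all add: emb_unit)
  have o': "adj (\<iota> u) * ?o = adj (\<iota> u)" "?o * adj (\<iota> u) = adj (\<iota> u)"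
    using o emb_unit' by (metis adj_mult)+
  have at: "adj (\<iota> t) = adj (\<iota> u) + (?o - \<iota> p)" by (simp add: et adj_add adj_diff emb_unit' P)
  have tt: "adj (\<iota> t) * \<iota> t = ?o"
    unfolding at unfolding et by (simp add: algebra_simps u o o' pu pu' emb_unit' P)
  have tt': "\<iota> t * adj (\<iota> t) = \<iota> u * adj (\<iota> u) + (?o - \<iota> p)"
    unfolding at unfolding et by (simp add: algebra_simps o o' up up' emb_unit' P)
  define q where "q = t \<otimes>\<^bsub>A\<^esub> star A t"
  have eq: "\<iota> q = \<iota> t * adj (\<iota> t)" using t by (simp add: q_def em cl)
  have "q \<in> projections A"
  proof (rule projectionsI)
    show "q \<in> carrier A" using t by (simp add: q_def cl)
    have "\<iota> q * \<iota> q = \<iota> t * (adj (\<iota> t) * \<iota> t) * adj (\<iota> t)" by (simp add: eq mult.assoc)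
    also have "\<dots> = \<iota> q" using t by (simp add: tt eq emb_unit)
    finally show "\<iota> q * \<iota> q = \<iota> q" .
    show "adj (\<iota> q) = \<iota> q" by (simp add: eq adj_mult)
  qed
  moreover have "star A t \<otimes>\<^bsub>A\<^esub> t = \<one>\<^bsub>A\<^esub>" using t tt by (intro eqI) (simp_all add: em cl)
  ultimately have "q = \<one>\<^bsub>A\<^esub>" using fin t unfolding finite_cstar_def mvn_equivalent_def q_def by blast
  then have uu: "\<iota> u * adj (\<iota> u) = \<iota> p" using eq tt' by simp
  have "\<iota> x * \<iota> p = \<iota> p" using u(3) by (simp flip: uu mult.assoc)
  moreover have "\<iota> x * \<iota> p = \<iota> x" using px XX(5) P(5) by (metis adj_mult)
  ultimately show "x = p" using P XX by (intro eqI) auto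
qed

section \<open>Linear spans and algebraic ideals\<close>

inductive_set span_of :: "'a set \<Rightarrow> 'a set" for F where
  zero: "\<zero>\<^bsub>A\<^esub> \<in> span_of F"
| step: "x \<in> span_of F \<Longrightarrow> f \<in> F \<Longrightarrow> x \<oplus>\<^bsub>A\<^esub> c \<odot>\<^bsub>A\<^esub> f \<in> span_of F"

lemma span_of_closed: "x \<in> span_of F \<Longrightarrow> F \<subseteq> carrier A \<Longrightarrow> x \<in> carrier A"
  by (induction rule: span_of.induct) (auto simp: cl)

lemma span_of_mono: "x \<in> span_of F \<Longrightarrow> F \<subseteq> H \<Longrightarrow> x \<in> span_of H"
  by (induction rule: span_of.induct) (auto intro: span_of.intros)

lemma span_of_add:
  assumes "y \<in> span_of F" "x \<in> span_of F" "F \<subseteq> carrier A"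
  shows "x \<oplus>\<^bsub>A\<^esub> y \<in> span_of F"
  using assms
proof (induction rule: span_of.induct)
  case zero
  then show ?case by (simp add: span_of_closed)
next
  case (step y f c)
  then have "x \<oplus>\<^bsub>A\<^esub> (y \<oplus>\<^bsub>A\<^esub> c \<odot>\<^bsub>A\<^esub> f) = (x \<oplus>\<^bsub>A\<^esub> y) \<oplus>\<^bsub>A\<^esub> c \<odot>\<^bsub>A\<^esub> f"
    by (subst R.a_assoc) (auto simp: cl span_of_closed)
  then show ?case using step by (simp add: span_of.step)
qed

lemma span_of_mult:
  assumes "x \<in> span_of F" "F \<subseteq> carrier A" "a \<in> carrier A"
  shows "a \<otimes>\<^bsub>A\<^esub> x \<in> span_of ((\<otimes>\<^bsub>A\<^esub>) a ` F)"
  using assms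
proof (induction rule: span_of.induct)
  case zero
  then show ?case by (simp add: span_of.zero)
next
  case (step x f c)
  have f: "f \<in> carrier A" and x: "x \<in> carrier A" using step span_of_closed by auto
  have "a \<otimes>\<^bsub>A\<^esub> (x \<oplus>\<^bsub>A\<^esub> c \<odot>\<^bsub>A\<^esub> f) = a \<otimes>\<^bsub>A\<^esub> x \<oplus>\<^bsub>A\<^esub> c \<odot>\<^bsub>A\<^esub> (a \<otimes>\<^bsub>A\<^esub> f)"
    using f x step(5) by (simp add: R.r_distr cl pre_cstar_algebra.smult_mult_right[OF unital_pre[OF A]])
  then show ?case using step by (simp add: span_of.step)
qed

text \<open>Combinations built term by term pass easily through sums and products. Here repeated
  occurrences of a generator are collected into one coefficient, the form in which
  \<open>infinite_dimensional_cstar\<close> is stated.\<close>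

lemma span_of_finsum:
  assumes "x \<in> span_of F" "F \<subseteq> carrier A" "finite F"
  shows "\<exists>c. x = (\<Oplus>\<^bsub>A\<^esub>f\<in>F. c f \<odot>\<^bsub>A\<^esub> f)"
  using assms
proof (induction rule: span_of.induct)
  case zero
  have "(\<Oplus>\<^bsub>A\<^esub>f\<in>F. 0 \<odot>\<^bsub>A\<^esub> f) = (\<Oplus>\<^bsub>A\<^esub>f\<in>F. \<zero>\<^bsub>A\<^esub>)"
    using zero by (intro R.finsum_cong') (auto simp: unital_zero_smult[OF A])
  then show ?case by (intro exI[of _ "\<lambda>f. 0"]) simp
next
  case (step x g d)
  then obtain c where c: "x = (\<Oplus>\<^bsub>A\<^esub>f\<in>F. c f \<odot>\<^bsub>A\<^esub> f)" by blast
  have fcl: "(\<lambda>f. b f \<odot>\<^bsub>A\<^esub> f) \<in> F \<rightarrow> carrier A" for b using step by (auto simp: cl)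
  have "\<iota> (x \<oplus>\<^bsub>A\<^esub> d \<odot>\<^bsub>A\<^esub> g) = (\<Sum>f\<in>F. sc (c f) * \<iota> f) + sc d * \<iota> g"
    using step emb_finsum[OF A fcl, of c] span_of_closed[OF step(1)]
    by (simp add: em cl emb_smult[OF A] subset_iff flip: c cong: sum.cong)
  also have "\<dots> = (\<Sum>f\<in>F. sc ((c(g := c g + d)) f) * \<iota> f)"
  proof -
    have "(\<Sum>f\<in>F. sc ((c(g := c g + d)) f) * \<iota> f) = sc (c g + d) * \<iota> g + (\<Sum>f\<in>F - {g}. sc (c f) * \<iota> f)"
      using step by (subst sum.remove[of F g]) (auto intro!: sum.cong)
    moreover have "(\<Sum>f\<in>F. sc (c f) * \<iota> f) = sc (c g) * \<iota> g + (\<Sum>f\<in>F - {g}. sc (c f) * \<iota> f)"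
      using step by (subst sum.remove[of F g]) auto
    moreover have "sc (c g + d) = sc (c g) + (sc d :: 'a cprod)" by (simp add: sc_def algebra_simps)
    ultimately show ?thesis by (simp add: algebra_simps)
  qed
  also have "\<dots> = \<iota> (\<Oplus>\<^bsub>A\<^esub>f\<in>F. (c(g := c g + d)) f \<odot>\<^bsub>A\<^esub> f)"
    using step emb_finsum[OF A fcl, of "c(g := c g + d)"]
    by (simp add: emb_smult[OF A] subset_iff cong: sum.cong)
  finally have "x \<oplus>\<^bsub>A\<^esub> d \<odot>\<^bsub>A\<^esub> g = (\<Oplus>\<^bsub>A\<^esub>f\<in>F. (c(g := c g + d)) f \<odot>\<^bsub>A\<^esub> f)"
    using step span_of_closed[OF step(1)] by (intro eqI R.finsum_closed fcl cl) auto
  then show ?case by blast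
qed

text \<open>No closure is taken: that the unit is a finite sum of terms \<open>a p b\<close> is what
  later bounds the dimension.\<close>

inductive_set ideal_of :: "'a \<Rightarrow> 'a set" for p where
  zero: "\<zero>\<^bsub>A\<^esub> \<in> ideal_of p"
| step: "x \<in> ideal_of p \<Longrightarrow> a \<in> carrier A \<Longrightarrow> b \<in> carrier A \<Longrightarrow> x \<oplus>\<^bsub>A\<^esub> a \<otimes>\<^bsub>A\<^esub> p \<otimes>\<^bsub>A\<^esub> b \<in> ideal_of p"

context
  fixes p assumes p: "p \<in> carrier A"
begin

lemma ideal_of_closed: "x \<in> ideal_of p \<Longrightarrow> x \<in> carrier A"
  by (induction rule: ideal_of.induct) (auto simp: cl p)

lemma ideal_of_add: "y \<in> ideal_of p \<Longrightarrow> x \<in> ideal_of p \<Longrightarrow> x \<oplus>\<^bsub>A\<^esub> y \<in> ideal_of p"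
proof (induction rule: ideal_of.induct)
  case zero
  then show ?case by (simp add: ideal_of_closed)
next
  case (step y a b)
  then have "x \<oplus>\<^bsub>A\<^esub> (y \<oplus>\<^bsub>A\<^esub> a \<otimes>\<^bsub>A\<^esub> p \<otimes>\<^bsub>A\<^esub> b) = (x \<oplus>\<^bsub>A\<^esub> y) \<oplus>\<^bsub>A\<^esub> a \<otimes>\<^bsub>A\<^esub> p \<otimes>\<^bsub>A\<^esub> b"
    by (subst R.a_assoc) (auto simp: cl ideal_of_closed p)
  then show ?case using step by (simp add: ideal_of.step)
qed

lemma ideal_of_mult:
  assumes "x \<in> ideal_of p" "c \<in> carrier A"
  shows "c \<otimes>\<^bsub>A\<^esub> x \<in> ideal_of p" "x \<otimes>\<^bsub>A\<^esub> c \<in> ideal_of p"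
  using assms
proof (induction rule: ideal_of.induct)
  case zero
  { case 1 then show ?case by (simp add: ideal_of.zero) next case 2 then show ?case by (simp add: ideal_of.zero) }
next
  case (step x a b)
  { case 1
    have "c \<otimes>\<^bsub>A\<^esub> (x \<oplus>\<^bsub>A\<^esub> a \<otimes>\<^bsub>A\<^esub> p \<otimes>\<^bsub>A\<^esub> b) = c \<otimes>\<^bsub>A\<^esub> x \<oplus>\<^bsub>A\<^esub> (c \<otimes>\<^bsub>A\<^esub> a) \<otimes>\<^bsub>A\<^esub> p \<otimes>\<^bsub>A\<^esub> b"
      using step 1 by (simp add: R.r_distr R.m_assoc cl p ideal_of_closed)
    then show ?case using step 1 by (simp add: ideal_of.step cl)
  next
    case 2
    have "(x \<oplus>\<^bsub>A\<^esub> a \<otimes>\<^bsub>A\<^esub> p \<otimes>\<^bsub>A\<^esub> b) \<otimes>\<^bsub>A\<^esub> c = x \<otimes>\<^bsub>A\<^esub> c \<oplus>\<^bsub>A\<^esub> a \<otimes>\<^bsub>A\<^esub> p \<otimes>\<^bsub>A\<^esub> (b \<otimes>\<^bsub>A\<^esub> c)"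
      using step 2 by (simp add: R.l_distr R.m_assoc cl p ideal_of_closed)
    then show ?case using step 2 by (simp add: ideal_of.step cl)
  }
qed

lemma ideal_of_self: "p \<in> ideal_of p"
  using ideal_of.step[OF ideal_of.zero, of "\<one>\<^bsub>A\<^esub>" "\<one>\<^bsub>A\<^esub>" p] p by (simp add: cl)

text \<open>An element of a dense ideal at distance less than 1 from the unit is invertible.\<close>

lemma one_in_ideal_of:
  assumes simple: "simple_cstar A" and p0: "p \<noteq> \<zero>\<^bsub>A\<^esub>"
  shows "\<one>\<^bsub>A\<^esub> \<in> ideal_of p"
proof -
  interpret P: pre_cstar_algebra A using A by (rule unital_pre)
  interpret M: Metric_space "carrier A" "cstar_dist A" by (rule P.metric_space)
  define I where "I = M.mtopology closure_of (ideal_of p)"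
  have memI: "x \<in> I \<longleftrightarrow> x \<in> carrier A \<and> (\<forall>e>0. \<exists>y\<in>ideal_of p. nrm A (x \<ominus>\<^bsub>A\<^esub> y) < e)" for x
    unfolding I_def M.metric_closure_of
    by (auto simp: M.in_mball cstar_dist_def ideal_of_closed)
  have emI: "x \<in> I" if "x \<in> carrier A" "\<And>e. e > 0 \<Longrightarrow> \<exists>y\<in>ideal_of p. norm (\<iota> x - \<iota> y) < e" for x
    using that unfolding memI by (simp add: norm_emb[OF A] cl ideal_of_closed flip: em(5))
  have Iem: "x \<in> carrier A" "e > 0 \<Longrightarrow> \<exists>y\<in>ideal_of p. norm (\<iota> x - \<iota> y) < e" if xI: "x \<in> I" for x e
  proof -
    show x: "x \<in> carrier A" using xI by (simp add: memI)
    assume "e > 0"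
    then obtain y where y: "y \<in> ideal_of p" "nrm A (x \<ominus>\<^bsub>A\<^esub> y) < e" using xI unfolding memI by blast
    then have "norm (\<iota> x - \<iota> y) < e"
      using x ideal_of_closed[OF y(1)] norm_emb[OF A, of "x \<ominus>\<^bsub>A\<^esub> y"] by (simp add: em(5) R.minus_closed)
    then show "\<exists>y\<in>ideal_of p. norm (\<iota> x - \<iota> y) < e" using y(1) by blast
  qed
  have add: "x \<oplus>\<^bsub>A\<^esub> y \<in> I" if x: "x \<in> I" and y: "y \<in> I" for x y
  proof (rule emI)
    fix e :: real assume "e > 0"
    then obtain x' y' where x': "x' \<in> ideal_of p" "norm (\<iota> x - \<iota> x') < e/2" and y': "y' \<in> ideal_of p" "norm (\<iota> y - \<iota> y') < e/2"
      using Iem[OF x] Iem[OF y] by (meson half_gt_zero)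
    have "\<iota> (x \<oplus>\<^bsub>A\<^esub> y) - \<iota> (x' \<oplus>\<^bsub>A\<^esub> y') = (\<iota> x - \<iota> x') + (\<iota> y - \<iota> y')"
      using Iem x y x' y' by (simp add: em(2) ideal_of_closed)
    then have "norm (\<iota> (x \<oplus>\<^bsub>A\<^esub> y) - \<iota> (x' \<oplus>\<^bsub>A\<^esub> y')) < e"
      using norm_triangle_ineq[of "\<iota> x - \<iota> x'" "\<iota> y - \<iota> y'"] x' y' by simp
    then show "\<exists>z\<in>ideal_of p. norm (\<iota> (x \<oplus>\<^bsub>A\<^esub> y) - \<iota> z) < e" using ideal_of_add x' y' by blast
  qed (use Iem x y in \<open>simp add: cl\<close>)
  have mult: "c \<otimes>\<^bsub>A\<^esub> x \<in> I \<and> x \<otimes>\<^bsub>A\<^esub> c \<in> I" if x: "x \<in> I" and c: "c \<in> carrier A" for x c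
  proof (intro conjI; rule emI)
    fix e :: real assume e: "e > 0"
    define d where "d = e / (norm (\<iota> c) + 1)"
    have K: "norm (\<iota> c) + 1 > 0" by (simp add: add_nonneg_pos)
    then have d1: "d > 0" using e by (simp add: d_def)
    have "norm (\<iota> c) * d < (norm (\<iota> c) + 1) * d" using d1 by (simp add: distrib_right)
    also have "\<dots> = e" using K by (simp add: d_def)
    finally have d: "d > 0" "norm (\<iota> c) * d < e" using d1 by simp_all
    obtain y where y: "y \<in> ideal_of p" "norm (\<iota> x - \<iota> y) < d" using Iem[OF x] d by blast
    have "norm (\<iota> c * (\<iota> x - \<iota> y)) < e" "norm ((\<iota> x - \<iota> y) * \<iota> c) < e"
      using norm_mult_ineq[of "\<iota> c" "\<iota> x - \<iota> y"] norm_mult_ineq[of "\<iota> x - \<iota> y" "\<iota> c"]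
        mult_left_mono[OF less_imp_le[OF y(2)], of "norm (\<iota> c)"] d by (simp_all add: mult.commute)
    then have "norm (\<iota> (c \<otimes>\<^bsub>A\<^esub> x) - \<iota> (c \<otimes>\<^bsub>A\<^esub> y)) < e" "norm (\<iota> (x \<otimes>\<^bsub>A\<^esub> c) - \<iota> (y \<otimes>\<^bsub>A\<^esub> c)) < e"
      using Iem(1)[OF x] ideal_of_closed[OF y(1)] c by (simp_all add: em(3) algebra_simps)
    then show "\<exists>z\<in>ideal_of p. norm (\<iota> (c \<otimes>\<^bsub>A\<^esub> x) - \<iota> z) < e" "\<exists>z\<in>ideal_of p. norm (\<iota> (x \<otimes>\<^bsub>A\<^esub> c) - \<iota> z) < e"
      using ideal_of_mult[OF y(1) c] by blast+
  qed (use Iem x c in \<open>simp_all add: cl\<close>)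
  have J: "x \<in> I" if "x \<in> ideal_of p" for x
    using that ideal_of_closed[OF that] by (intro emI) (auto intro!: bexI[of _ x])
  have sm: "c \<odot>\<^bsub>A\<^esub> x \<in> I" if "x \<in> I" for c x
  proof -
    have "c \<odot>\<^bsub>A\<^esub> x = (c \<odot>\<^bsub>A\<^esub> \<one>\<^bsub>A\<^esub>) \<otimes>\<^bsub>A\<^esub> x" using Iem[OF that] by (simp add: P.smult_mult_left cl)
    then show ?thesis using mult[OF that, of "c \<odot>\<^bsub>A\<^esub> \<one>\<^bsub>A\<^esub>"] by (simp add: cl)
  qed
  have "closed_two_sided_ideal I A"
    unfolding closed_two_sided_ideal_def
  proof (intro conjI ballI)
    show "submodule I complex_ring A"
    proof (rule submodule.intro)
      show "subgroup I (add_monoid A)"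
      proof (rule R.add.subgroupI)
        show "I \<subseteq> carrier A" using Iem by blast
        show "I \<noteq> {}" using J[OF ideal_of.zero] by blast
        show "x \<oplus>\<^bsub>A\<^esub> y \<in> I" if "x \<in> I" "y \<in> I" for x y using add that .
        show "\<ominus>\<^bsub>A\<^esub> x \<in> I" if "x \<in> I" for x using sm[OF that, of "-1"] Iem[OF that] by (simp add: P.uminus_eq_smult)
      qed
      show "submodule_axioms I complex_ring A" by (rule submodule_axioms.intro) (rule sm)
    qed
    show "closedin (cstar_topology A) I" unfolding cstar_topology_def I_def by (rule closedin_closure_of)
  qed (use mult in auto)
  moreover have "I \<noteq> {\<zero>\<^bsub>A\<^esub>}" using J[OF ideal_of_self] p0 by blast
  ultimately have "I = carrier A" using simple unfolding simple_cstar_def by blast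
  then have "\<one>\<^bsub>A\<^esub> \<in> I" by simp
  then obtain s where s: "s \<in> ideal_of p" "norm (\<iota> \<one>\<^bsub>A\<^esub> - \<iota> s) < 1" using Iem(2)[of "\<one>\<^bsub>A\<^esub>" 1] by auto
  note sc = ideal_of_closed[OF s(1)]
  obtain y where y: "(1 - (\<iota> \<one>\<^bsub>A\<^esub> - \<iota> s)) * y = 1" using one_minus_inverse[OF s(2)] by blast
  have "pcomp ((1 - (\<iota> \<one>\<^bsub>A\<^esub> - \<iota> s)) * y) A = \<one>\<^bsub>A\<^esub>" by (simp add: y pcomp_one[OF A])
  then have "(\<one>\<^bsub>A\<^esub> \<ominus>\<^bsub>A\<^esub> (\<one>\<^bsub>A\<^esub> \<ominus>\<^bsub>A\<^esub> s)) \<otimes>\<^bsub>A\<^esub> pcomp y A = \<one>\<^bsub>A\<^esub>"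
    using sc by (simp add: pcomp_simps A pcomp_emb cl)
  moreover have "\<one>\<^bsub>A\<^esub> \<ominus>\<^bsub>A\<^esub> (\<one>\<^bsub>A\<^esub> \<ominus>\<^bsub>A\<^esub> s) = s" using sc by (intro eqI) (simp_all add: em cl)
  ultimately have "s \<otimes>\<^bsub>A\<^esub> pcomp y A = \<one>\<^bsub>A\<^esub>" by simp
  then show ?thesis using ideal_of_mult(2)[OF s(1) pcomp_closed[OF A, of y]] by simp
qed

text \<open>Write the unit as a finite sum of terms \<open>a p b\<close>. Since every
  \<open>p (x a) p\<close> is a multiple of \<open>p\<close>, the space \<open>p A\<close> is
  spanned by the finitely many \<open>p b\<close>, and \<open>A\<close> is the sum of the finitely
  many spaces \<open>a p A\<close>.\<close>

lemma finite_dimensional_if_corner_scalar: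
  assumes one: "\<one>\<^bsub>A\<^esub> \<in> ideal_of p" and sca: "\<And>b. b \<in> carrier A \<Longrightarrow> \<exists>c. p \<otimes>\<^bsub>A\<^esub> b \<otimes>\<^bsub>A\<^esub> p = c \<odot>\<^bsub>A\<^esub> p"
  shows "\<not> infinite_dimensional_cstar A"
proof -
  have 1: "\<exists>F. finite F \<and> F \<subseteq> carrier A \<and> (\<forall>x\<in>carrier A. p \<otimes>\<^bsub>A\<^esub> x \<otimes>\<^bsub>A\<^esub> k \<in> span_of F)" if "k \<in> ideal_of p" for k
    using that
  proof (induction rule: ideal_of.induct)
    case zero
    then show ?case by (intro exI[of _ "{}"]) (auto simp: p cl intro: span_of.zero)
  next
    case (step k a b)
    then obtain F where F: "finite F" "F \<subseteq> carrier A" "\<And>x. x \<in> carrier A \<Longrightarrow> p \<otimes>\<^bsub>A\<^esub> x \<otimes>\<^bsub>A\<^esub> k \<in> span_of F" by blast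
    show ?case
    proof (intro exI[of _ "insert (p \<otimes>\<^bsub>A\<^esub> b) F"] conjI ballI)
      fix x assume x: "x \<in> carrier A"
      obtain c where c: "p \<otimes>\<^bsub>A\<^esub> (x \<otimes>\<^bsub>A\<^esub> a) \<otimes>\<^bsub>A\<^esub> p = c \<odot>\<^bsub>A\<^esub> p" using sca[of "x \<otimes>\<^bsub>A\<^esub> a"] x step by (auto simp: cl)
      have "p \<otimes>\<^bsub>A\<^esub> x \<otimes>\<^bsub>A\<^esub> (k \<oplus>\<^bsub>A\<^esub> a \<otimes>\<^bsub>A\<^esub> p \<otimes>\<^bsub>A\<^esub> b) =
          p \<otimes>\<^bsub>A\<^esub> x \<otimes>\<^bsub>A\<^esub> k \<oplus>\<^bsub>A\<^esub> (p \<otimes>\<^bsub>A\<^esub> (x \<otimes>\<^bsub>A\<^esub> a) \<otimes>\<^bsub>A\<^esub> p) \<otimes>\<^bsub>A\<^esub> b"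
        using x step p ideal_of_closed by (simp add: R.r_distr R.m_assoc cl)
      also have "\<dots> = p \<otimes>\<^bsub>A\<^esub> x \<otimes>\<^bsub>A\<^esub> k \<oplus>\<^bsub>A\<^esub> c \<odot>\<^bsub>A\<^esub> (p \<otimes>\<^bsub>A\<^esub> b)"
        using p step by (simp add: c pre_cstar_algebra.smult_mult_left[OF unital_pre[OF A]])
      finally show "p \<otimes>\<^bsub>A\<^esub> x \<otimes>\<^bsub>A\<^esub> (k \<oplus>\<^bsub>A\<^esub> a \<otimes>\<^bsub>A\<^esub> p \<otimes>\<^bsub>A\<^esub> b) \<in> span_of (insert (p \<otimes>\<^bsub>A\<^esub> b) F)"
        using span_of_mono[OF F(3)[OF x], of "insert (p \<otimes>\<^bsub>A\<^esub> b) F"] by (auto intro: span_of.step)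
    qed (use F p step in \<open>auto simp: cl\<close>)
  qed
  obtain F where F: "finite F" "F \<subseteq> carrier A" and F3: "\<And>x. x \<in> carrier A \<Longrightarrow> p \<otimes>\<^bsub>A\<^esub> x \<otimes>\<^bsub>A\<^esub> \<one>\<^bsub>A\<^esub> \<in> span_of F"
    using 1[OF one] by blast
  have F3: "p \<otimes>\<^bsub>A\<^esub> x \<in> span_of F" if "x \<in> carrier A" for x using F3[OF that] that p by (simp add: cl)
  have 2: "\<exists>H. finite H \<and> H \<subseteq> carrier A \<and> (\<forall>x\<in>carrier A. k \<otimes>\<^bsub>A\<^esub> x \<in> span_of H)" if "k \<in> ideal_of p" for k
    using that
  proof (induction rule: ideal_of.induct)
    case zero
    then show ?case by (intro exI[of _ "{}"]) (auto intro: span_of.zero)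
  next
    case (step k a b)
    then obtain H where H: "finite H" "H \<subseteq> carrier A" "\<And>x. x \<in> carrier A \<Longrightarrow> k \<otimes>\<^bsub>A\<^esub> x \<in> span_of H" by blast
    let ?H = "H \<union> (\<otimes>\<^bsub>A\<^esub>) a ` F"
    have sub: "?H \<subseteq> carrier A" using H F step by (auto simp: cl)
    show ?case
    proof (intro exI[of _ ?H] conjI ballI sub)
      fix x assume x: "x \<in> carrier A"
      have "(k \<oplus>\<^bsub>A\<^esub> a \<otimes>\<^bsub>A\<^esub> p \<otimes>\<^bsub>A\<^esub> b) \<otimes>\<^bsub>A\<^esub> x = k \<otimes>\<^bsub>A\<^esub> x \<oplus>\<^bsub>A\<^esub> a \<otimes>\<^bsub>A\<^esub> (p \<otimes>\<^bsub>A\<^esub> (b \<otimes>\<^bsub>A\<^esub> x))"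
        using x step p ideal_of_closed by (simp add: R.l_distr R.m_assoc cl)
      moreover have "k \<otimes>\<^bsub>A\<^esub> x \<in> span_of ?H" using H(3)[OF x] by (rule span_of_mono) auto
      moreover have "a \<otimes>\<^bsub>A\<^esub> (p \<otimes>\<^bsub>A\<^esub> (b \<otimes>\<^bsub>A\<^esub> x)) \<in> span_of ?H"
      proof (rule span_of_mono)
        show "a \<otimes>\<^bsub>A\<^esub> (p \<otimes>\<^bsub>A\<^esub> (b \<otimes>\<^bsub>A\<^esub> x)) \<in> span_of ((\<otimes>\<^bsub>A\<^esub>) a ` F)"
          by (rule span_of_mult[OF F3 F(2)]) (simp_all add: cl x step)
      qed auto
      ultimately show "(k \<oplus>\<^bsub>A\<^esub> a \<otimes>\<^bsub>A\<^esub> p \<otimes>\<^bsub>A\<^esub> b) \<otimes>\<^bsub>A\<^esub> x \<in> span_of ?H"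
        using span_of_add[OF _ _ sub] by simp
    qed (use H F in auto)
  qed
  obtain H where H: "finite H" "H \<subseteq> carrier A" and H3: "\<And>x. x \<in> carrier A \<Longrightarrow> \<one>\<^bsub>A\<^esub> \<otimes>\<^bsub>A\<^esub> x \<in> span_of H"
    using 2[OF one] by blast
  have "\<exists>c. x = (\<Oplus>\<^bsub>A\<^esub>f\<in>H. c f \<odot>\<^bsub>A\<^esub> f)" if "x \<in> carrier A" for x
    using span_of_finsum[OF H3[OF that] H(2,1)] that by simp
  then show ?thesis unfolding infinite_dimensional_cstar_def using H by blast
qed

end

text \<open>A scalar corner would make the algebra finite dimensional. A non-scalar self-adjoint
  element of the corner splits into \<open>x\<close> and \<open>y\<close> with product 0; a nonzero
  projection in the hereditary subalgebra of the square of \<open>x\<close> lies under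
  \<open>p\<close> and annihilates \<open>y\<close>, which \<open>p\<close> does not.\<close>

lemma exists_strict_subprojection:
  assumes simple: "simple_cstar A" and inf: "infinite_dimensional_cstar A"
    and sp: "\<And>x. x \<in> positive_cone A \<Longrightarrow> x \<noteq> \<zero>\<^bsub>A\<^esub> \<Longrightarrow>
      \<exists>q\<in>projections A \<inter> hereditary_subalgebra A x. q \<noteq> \<zero>\<^bsub>A\<^esub>"
    and p: "p \<in> projections A" "p \<noteq> \<zero>\<^bsub>A\<^esub>"
  shows "\<exists>q\<in>projections A. q \<noteq> \<zero>\<^bsub>A\<^esub> \<and> q \<noteq> p \<and> \<iota> p * \<iota> q = \<iota> q"
proof -
  note P = projectionsD[OF p(1)]
  have "\<exists>h\<in>carrier A. star A h = h \<and> p \<otimes>\<^bsub>A\<^esub> h = h \<and> h \<otimes>\<^bsub>A\<^esub> p = h \<and> (\<forall>l::real. h \<noteq> of_real l \<odot>\<^bsub>A\<^esub> p)"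
  proof (rule ccontr)
    assume neg: "\<not> ?thesis"
    have pp: "\<iota> p * (\<iota> p * t) = \<iota> p * t" for t by (simp add: P flip: mult.assoc)
    have sa: "\<exists>l::real. \<iota> p * \<iota> b * \<iota> p = l *\<^sub>R \<iota> p" if b: "b \<in> carrier A" "adj (\<iota> b) = \<iota> b" for b
    proof -
      define h where "h = p \<otimes>\<^bsub>A\<^esub> b \<otimes>\<^bsub>A\<^esub> p"
      have h: "h \<in> carrier A" "\<iota> h = \<iota> p * \<iota> b * \<iota> p" using b P by (simp_all add: h_def em cl)
      have "star A h = h" "p \<otimes>\<^bsub>A\<^esub> h = h" "h \<otimes>\<^bsub>A\<^esub> p = h"
        using P h b by (auto intro!: eqI simp: em cl adj_mult mult.assoc pp)
      then obtain l :: real where "h = of_real l \<odot>\<^bsub>A\<^esub> p" using neg h by blast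
      then have "\<iota> h = l *\<^sub>R \<iota> p" using P by (simp add: em)
      then show ?thesis using h by auto
    qed
    have "\<exists>c. p \<otimes>\<^bsub>A\<^esub> b \<otimes>\<^bsub>A\<^esub> p = c \<odot>\<^bsub>A\<^esub> p" if b: "b \<in> carrier A" for b
    proof -
      \<comment> \<open>\<open>neg\<close> speaks of self-adjoint elements, so \<open>b\<close> is
        decomposed into real and imaginary parts, both doubled, and its complex scalar is
        reassembled from two real ones.\<close>
      define b1 where "b1 = b \<oplus>\<^bsub>A\<^esub> star A b"
      define b2 where "b2 = \<i> \<odot>\<^bsub>A\<^esub> (star A b \<ominus>\<^bsub>A\<^esub> b)"
      have b1: "b1 \<in> carrier A" "\<iota> b1 = \<iota> b + adj (\<iota> b)" using b by (simp_all add: b1_def em cl)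
      have b2: "b2 \<in> carrier A" "\<iota> b2 = sc \<i> * (adj (\<iota> b) - \<iota> b)"
        using b by (simp_all add: b2_def em cl emb_smult[OF A])
      have sci: "sc \<i> = (iu :: 'a cprod)" by (simp add: sc_def)
      obtain l1 :: real where l1: "\<iota> p * \<iota> b1 * \<iota> p = l1 *\<^sub>R \<iota> p"
        using sa[OF b1(1)] by (auto simp: b1 adj_add add.commute)
      obtain l2 :: real where l2: "\<iota> p * \<iota> b2 * \<iota> p = l2 *\<^sub>R \<iota> p"
        using sa[OF b2(1)] by (auto simp: b2 sci adj_mult adj_diff adj_iu iu_commute algebra_simps)
      have "\<iota> p * (iu * t) = iu * (\<iota> p * t)" for t by (simp only: iu_commute[of "\<iota> p", symmetric] flip: mult.assoc)
      then have "iu * (\<iota> p * \<iota> b2 * \<iota> p) = (iu * iu) * (\<iota> p * (adj (\<iota> b) - \<iota> b) * \<iota> p)"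
        unfolding b2 sci by (simp only: mult.assoc)
      then have "\<iota> p * \<iota> b1 * \<iota> p + iu * (\<iota> p * \<iota> b2 * \<iota> p) = 2 *\<^sub>R (\<iota> p * \<iota> b * \<iota> p)"
        by (simp add: iu_square b1 algebra_simps scaleR_2)
      then have "\<iota> p * \<iota> b * \<iota> p = (1/2) *\<^sub>R (l1 *\<^sub>R \<iota> p + l2 *\<^sub>R (iu * \<iota> p))"
        by (simp add: l1 l2)
      also have "\<dots> = sc (Complex (l1/2) (l2/2)) * \<iota> p" by (simp add: sc_def algebra_simps)
      finally have "p \<otimes>\<^bsub>A\<^esub> b \<otimes>\<^bsub>A\<^esub> p = Complex (l1/2) (l2/2) \<odot>\<^bsub>A\<^esub> p"
        using P b by (intro eqI) (simp_all add: em cl emb_smult[OF A])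
      then show ?thesis by blast
    qed
    then show False
      using finite_dimensional_if_corner_scalar[OF P(1) one_in_ideal_of[OF P(1) simple p(2)]] inf by blast
  qed
  then obtain h where h: "h \<in> carrier A" "star A h = h" "p \<otimes>\<^bsub>A\<^esub> h = h" "h \<otimes>\<^bsub>A\<^esub> p = h"
    "\<And>l::real. h \<noteq> of_real l \<odot>\<^bsub>A\<^esub> p" by blast
  obtain x y where x: "x \<in> carrier A" "star A x = x" "x \<noteq> \<zero>\<^bsub>A\<^esub>" "x \<otimes>\<^bsub>A\<^esub> p = x"
      and y: "y \<in> carrier A" "y \<noteq> \<zero>\<^bsub>A\<^esub>" "p \<otimes>\<^bsub>A\<^esub> y = y" "x \<otimes>\<^bsub>A\<^esub> y = \<zero>\<^bsub>A\<^esub>"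
    using carrier_corner_scalar_or_split[OF A p(1) h] by blast
  have xa: "adj (\<iota> x) = \<iota> x" using x by (simp flip: em(7))
  define z where "z = star A x \<otimes>\<^bsub>A\<^esub> x"
  have z: "z \<in> carrier A" "\<iota> z = \<iota> x * \<iota> x" using x xa by (simp_all add: z_def em cl)
  have "z \<in> positive_cone A" unfolding z_def positive_cone_def using x(1) by blast
  moreover have "z \<noteq> \<zero>\<^bsub>A\<^esub>"
  proof
    assume "z = \<zero>\<^bsub>A\<^esub>"
    then have "\<iota> x * \<iota> x = 0" using z em(1) by simp
    then have "\<iota> x = 0" using norm_square_sa[OF xa] by simp
    then show False using x em(1) emb_inject[OF A x(1), of "\<zero>\<^bsub>A\<^esub>"] by simp
  qed
  ultimately obtain q where q: "q \<in> projections A" "q \<in> hereditary_subalgebra A z" "q \<noteq> \<zero>\<^bsub>A\<^esub>" using sp by blast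
  have xp: "\<iota> x * \<iota> p = \<iota> x" using x P by (simp flip: em(3))
  have px: "\<iota> p * \<iota> x = \<iota> x" using xp xa P(5) by (metis adj_mult)
  have "(\<iota> p - 1) * \<iota> z = 0" using px by (simp add: z left_diff_distrib flip: mult.assoc)
  then have "(\<iota> p - 1) * \<iota> q = 0" by (rule hereditary_annihilate(1)[OF q(2) z(1)])
  then have pq: "\<iota> p * \<iota> q = \<iota> q" by (simp add: left_diff_distrib)
  have xy: "\<iota> x * \<iota> y = 0" using x y em(1) by (simp flip: em(3))
  have "\<iota> z * \<iota> y = 0" by (simp add: z mult.assoc xy)
  then have qy: "\<iota> q * \<iota> y = 0" by (rule hereditary_annihilate(2)[OF q(2) z(1)])
  have "q \<noteq> p"
  proof
    assume "q = p"
    then have "\<iota> p * \<iota> y = 0" using qy by simp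
    then have "\<iota> y = \<iota> \<zero>\<^bsub>A\<^esub>" using y P em(1) by (simp flip: em(3))
    then show False using y emb_inject[OF A y(1), of "\<zero>\<^bsub>A\<^esub>"] by simp
  qed
  then show ?thesis using q pq by blast
qed

end

section \<open>Rokhlin towers\<close>

context unital_action
begin

sublocale UA: unital_algebra A by unfold_locales (rule A)
sublocale UC: unital_algebra C by unfold_locales (rule C_unital)

abbreviation "\<kappa> \<equiv> emb C"

section \<open>The coefficient algebra inside the crossed product\<close>

definition base_incl :: "'a \<Rightarrow> 'g \<Rightarrow> 'a" where
  "base_incl a = (\<lambda>s\<in>carrier G. if s = \<one> then a else \<zero>\<^bsub>A\<^esub>)"

lemma base_incl_closed: "a \<in> carrier A \<Longrightarrow> base_incl a \<in> carrier C"
  by (auto simp: base_incl_def crossed_product_ops cl)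

lemma base_incl_app: "s \<in> carrier G \<Longrightarrow> base_incl a s = (if s = \<one> then a else \<zero>\<^bsub>A\<^esub>)"
  by (simp add: base_incl_def)

lemma base_incl_left:
  assumes a: "a \<in> carrier A" and x: "x \<in> carrier C" and s: "s \<in> carrier G"
  shows "(base_incl a \<otimes>\<^bsub>C\<^esub> x) s = a \<otimes>\<^bsub>A\<^esub> x s"
proof (rule UA.eqI)
  have "\<iota> ((base_incl a \<otimes>\<^bsub>C\<^esub> x) s) = (\<Sum>t\<in>carrier G. if t = \<one> then \<iota> a * \<iota> (x s) else 0)"
    unfolding emb_C_mult[OF base_incl_closed[OF a] x s]
    using s x by (intro sum.cong) (auto simp: base_incl_app em al_one C_app)
  then show "\<iota> ((base_incl a \<otimes>\<^bsub>C\<^esub> x) s) = \<iota> (a \<otimes>\<^bsub>A\<^esub> x s)" using fin a x s by (simp add: em C_app)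
qed (use assms in \<open>simp_all add: C_app C_closed base_incl_closed cl\<close>)

lemma base_incl_right:
  assumes a: "a \<in> carrier A" and x: "x \<in> carrier C" and s: "s \<in> carrier G"
  shows "(x \<otimes>\<^bsub>C\<^esub> base_incl a) s = x s \<otimes>\<^bsub>A\<^esub> \<alpha> s a"
proof (rule UA.eqI)
  have "inv t \<otimes> s = \<one> \<longleftrightarrow> t = s" if "t \<in> carrier G" for t
    using that s by (metis inv_closed inv_equality inv_inv l_inv)
  then have "\<iota> ((x \<otimes>\<^bsub>C\<^esub> base_incl a) s) = (\<Sum>t\<in>carrier G. if t = s then \<iota> (x s) * \<iota> (\<alpha> s a) else 0)"
    unfolding emb_C_mult[OF x base_incl_closed[OF a] s]
    using s a by (intro sum.cong) (auto simp: base_incl_app em al_emb act_zero cl)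
  then show "\<iota> ((x \<otimes>\<^bsub>C\<^esub> base_incl a) s) = \<iota> (x s \<otimes>\<^bsub>A\<^esub> \<alpha> s a)"
    using fin a x s by (simp add: em C_app act_simps)
qed (use assms in \<open>simp_all add: C_app C_closed base_incl_closed cl act_simps\<close>)

lemma base_incl_ops:
  assumes "a \<in> carrier A" "b \<in> carrier A"
  shows "base_incl a \<otimes>\<^bsub>C\<^esub> base_incl b = base_incl (a \<otimes>\<^bsub>A\<^esub> b)" "star C (base_incl a) = base_incl (star A a)"
    "base_incl a \<ominus>\<^bsub>C\<^esub> base_incl b = base_incl (a \<ominus>\<^bsub>A\<^esub> b)"
proof -
  have z: "a \<ominus>\<^bsub>A\<^esub> a = \<zero>\<^bsub>A\<^esub>" if "a \<in> carrier A" for a using that by (simp add: a_minus_def UA.R.r_neg)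
  show "base_incl a \<otimes>\<^bsub>C\<^esub> base_incl b = base_incl (a \<otimes>\<^bsub>A\<^esub> b)"
    using assms by (intro C_eqI) (auto simp: base_incl_left base_incl_app base_incl_closed C_closed cl)
  show "star C (base_incl a) = base_incl (star A a)"
  proof (rule C_emb_eqI)
    fix s assume s: "s \<in> carrier G"
    have "inv s = \<one> \<longleftrightarrow> s = \<one>" using s inv_eq_1_iff by blast
    then show "\<iota> (star C (base_incl a) s) = \<iota> (base_incl (star A a) s)"
      using assms s by (auto simp: emb_C_star base_incl_closed base_incl_app em cl al_one unital_star_zero[OF A] simp flip: em(7))
  qed (use assms in \<open>simp_all add: C_closed base_incl_closed cl\<close>)
  show "base_incl a \<ominus>\<^bsub>C\<^esub> base_incl b = base_incl (a \<ominus>\<^bsub>A\<^esub> b)"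
    using assms by (intro C_eqI) (auto simp: C_minus base_incl_closed base_incl_app C_minus_closed cl z)
qed

lemma base_incl_one: "base_incl \<one>\<^bsub>A\<^esub> = \<one>\<^bsub>C\<^esub>" and base_incl_zero: "base_incl \<zero>\<^bsub>A\<^esub> = \<zero>\<^bsub>C\<^esub>"
  by (auto simp: base_incl_def crossed_product_ops)

lemma base_incl_projection: "r \<in> projections A \<Longrightarrow> base_incl r \<in> projections C"
  by (auto simp: projections_def base_incl_ops base_incl_closed)

lemma base_incl_eq_zero: "a \<in> carrier A \<Longrightarrow> base_incl a = \<zero>\<^bsub>C\<^esub> \<longleftrightarrow> a = \<zero>\<^bsub>A\<^esub>"
  by (metis base_incl_app base_incl_zero one_closed)

section \<open>Approximately equivariant and central towers\<close>

definition tower_sum :: "('g \<Rightarrow> 'a) \<Rightarrow> 'a" where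
  "tower_sum e = (\<Oplus>\<^bsub>A\<^esub>g\<in>carrier G. e g)"

text \<open>The tracial Rokhlin property without its smallness clause, which is kept apart because
  complements are compared with different elements.\<close>

definition tower :: "'a set \<Rightarrow> real \<Rightarrow> ('g \<Rightarrow> 'a) \<Rightarrow> bool" where
  "tower F \<epsilon> e \<longleftrightarrow> (\<forall>g\<in>carrier G. e g \<in> projections A) \<and>
     (\<forall>g\<in>carrier G. \<forall>h\<in>carrier G. g \<noteq> h \<longrightarrow> e g \<otimes>\<^bsub>A\<^esub> e h = \<zero>\<^bsub>A\<^esub>) \<and>
     (\<forall>g\<in>carrier G. \<forall>h\<in>carrier G. nrm A (\<alpha> g (e h) \<ominus>\<^bsub>A\<^esub> e (g \<otimes> h)) \<le> \<epsilon>) \<and>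
     (\<forall>g\<in>carrier G. \<forall>a\<in>F. nrm A (e g \<otimes>\<^bsub>A\<^esub> a \<ominus>\<^bsub>A\<^esub> a \<otimes>\<^bsub>A\<^esub> e g) \<le> \<epsilon>)"

context
  fixes F \<epsilon> e
  assumes tow: "tower F \<epsilon> e" and F: "F \<subseteq> carrier A"
begin

lemma tower_proj: "g \<in> carrier G \<Longrightarrow> e g \<in> projections A"
  using tow by (simp add: tower_def)

lemmas tp = UA.projectionsD[OF tower_proj]

lemma tower_orth: "g \<in> carrier G \<Longrightarrow> h \<in> carrier G \<Longrightarrow> \<iota> (e g) * \<iota> (e h) = (if g = h then \<iota> (e g) else 0)"
  using tow tp by (auto simp: tower_def em simp flip: em(3))

lemma tower_act: "g \<in> carrier G \<Longrightarrow> h \<in> carrier G \<Longrightarrow> norm (al g (\<iota> (e h)) - \<iota> (e (g \<otimes> h))) \<le> \<epsilon>"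
  using tow tp norm_emb[OF A, of "\<alpha> g (e h) \<ominus>\<^bsub>A\<^esub> e (g \<otimes> h)"]
  by (simp add: tower_def em(5) al_emb act_simps UA.R.minus_closed)

lemma tower_comm:
  assumes "g \<in> carrier G" "a \<in> F"
  shows "norm (\<iota> (e g) * \<iota> a - \<iota> a * \<iota> (e g)) \<le> \<epsilon>"
proof -
  have a: "a \<in> carrier A" using assms F by blast
  have "norm (\<iota> (e g \<otimes>\<^bsub>A\<^esub> a \<ominus>\<^bsub>A\<^esub> a \<otimes>\<^bsub>A\<^esub> e g)) \<le> \<epsilon>"
    using tow assms a tp(1)[OF assms(1)]
    by (subst norm_emb[OF A]) (auto simp: tower_def cl)
  then show ?thesis using a tp(1)[OF assms(1)] by (simp add: em(5,3) cl)
qed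

lemma tower_sum_closed: "tower_sum e \<in> carrier A" and emb_tower_sum: "\<iota> (tower_sum e) = (\<Sum>g\<in>carrier G. \<iota> (e g))"
proof -
  have c: "e \<in> carrier G \<rightarrow> carrier A" using tp(1) by blast
  then show "tower_sum e \<in> carrier A" unfolding tower_sum_def by (rule UA.R.finsum_closed)
  show "\<iota> (tower_sum e) = (\<Sum>g\<in>carrier G. \<iota> (e g))" unfolding tower_sum_def by (rule emb_finsum[OF A c])
qed

lemma tower_sum_projection: "tower_sum e \<in> projections A"
proof (rule UA.projectionsI[OF tower_sum_closed])
  show "\<iota> (tower_sum e) * \<iota> (tower_sum e) = \<iota> (tower_sum e)"
    by (simp add: emb_tower_sum sum_product tower_orth fin cong: sum.cong)
  show "adj (\<iota> (tower_sum e)) = \<iota> (tower_sum e)" by (simp add: emb_tower_sum adj_sum tp)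
qed

text \<open>Compressing by one projection of a tower annihilates all coefficients off the unit
  approximately, because \<open>e\<^sub>h\<close> and \<open>e\<^sub>s\<^sub>h\<close> are orthogonal.\<close>

lemma tower_compress:
  assumes h: "h \<in> carrier G" and x: "x \<in> carrier C" and xF: "\<And>s. s \<in> carrier G \<Longrightarrow> x s \<in> F"
    and p: "p \<in> carrier A" "norm (\<iota> (x \<one>) - \<iota> p) \<le> \<eta>"
    and r: "r \<in> carrier A" "norm (\<iota> r - \<iota> (e h) * \<iota> p * \<iota> (e h)) \<le> \<delta>" and \<epsilon>: "0 \<le> \<epsilon>"
  shows "nrm C (base_incl r \<ominus>\<^bsub>C\<^esub> base_incl (e h) \<otimes>\<^bsub>C\<^esub> x \<otimes>\<^bsub>C\<^esub> base_incl (e h)) \<le>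
    \<delta> + \<eta> + \<epsilon> * (\<Sum>s\<in>carrier G. 1 + nrm A (x s))"
proof -
  note eh = tp[OF h]
  define T where "T = base_incl (e h) \<otimes>\<^bsub>C\<^esub> x \<otimes>\<^bsub>C\<^esub> base_incl (e h)"
  have T: "T \<in> carrier C" using eh x by (simp add: T_def C_closed base_incl_closed)
  have Ts: "\<iota> (T s) = \<iota> (e h) * \<iota> (x s) * al s (\<iota> (e h))" if s: "s \<in> carrier G" for s
    using eh x s by (simp add: T_def base_incl_left base_incl_right C_closed base_incl_closed em cl C_app act_simps al_emb)
  have n1: "norm (a * b) \<le> norm b" if "norm a \<le> 1" for a b :: "'a cprod"
    using order_trans[OF norm_mult_ineq mult_right_mono[OF that norm_ge_zero]] by simp
  have n2: "norm (b * a) \<le> norm b" if "norm a \<le> 1" for a b :: "'a cprod"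
    using order_trans[OF norm_mult_ineq mult_left_mono[OF that norm_ge_zero]] by simp
  have off: "norm (\<iota> (T s)) \<le> \<epsilon> * (1 + nrm A (x s))" if s: "s \<in> carrier G" "s \<noteq> \<one>" for s
  proof -
    have sh: "s \<otimes> h \<in> carrier G" "s \<otimes> h \<noteq> h" using s h by auto
    define u where "u = \<iota> (e h)"
    define f where "f = \<iota> (e (s \<otimes> h))"
    define b where "b = \<iota> (x s)"
    have uf: "u * f = 0" using tower_orth[OF h sh(1)] sh(2) by (simp add: u_def f_def)
    \<comment> \<open>Since \<open>u * f = 0\<close>, the coefficient splits into an equivariance
      error, where the translate of \<open>u\<close> is replaced by \<open>f\<close>, and a
      commutator of \<open>u\<close> with \<open>b\<close>. Each is controlled by
      \<open>\<epsilon>\<close>.\<close>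
    have "\<iota> (T s) = u * (b * (al s u - f)) + (u * b - b * u) * f"
      by (simp add: Ts[OF s(1)] u_def[symmetric] b_def[symmetric] algebra_simps uf)
    then have "norm (\<iota> (T s)) \<le> norm (u * (b * (al s u - f))) + norm ((u * b - b * u) * f)"
      by (simp add: norm_triangle_ineq)
    also have "norm (u * (b * (al s u - f))) \<le> norm b * \<epsilon>"
      using n1[of u "b * (al s u - f)"] eh norm_mult_ineq[of b "al s u - f"]
        mult_left_mono[OF tower_act[OF s(1) h], of "norm b"] by (simp add: u_def f_def)
    also have "norm ((u * b - b * u) * f) \<le> \<epsilon>"
      using n2[of f "u * b - b * u"] tp(6)[OF sh(1)] tower_comm[OF h xF[OF s(1)]] by (simp add: u_def f_def b_def)
    finally show ?thesis using x s by (simp add: b_def norm_emb[OF A] C_app algebra_simps)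
  qed
  have on: "norm (\<iota> r - \<iota> (T \<one>)) \<le> \<delta> + \<eta>"
  proof -
    have "al \<one> (\<iota> (e h)) = \<iota> (e h)" using eh by (simp add: al_one)
    then have eq: "\<iota> r - \<iota> (T \<one>) = (\<iota> r - \<iota> (e h) * \<iota> p * \<iota> (e h)) - \<iota> (e h) * ((\<iota> (x \<one>) - \<iota> p) * \<iota> (e h))"
      by (simp add: Ts algebra_simps)
    have "norm (\<iota> r - \<iota> (T \<one>)) \<le> norm (\<iota> r - \<iota> (e h) * \<iota> p * \<iota> (e h)) + norm (\<iota> (e h) * ((\<iota> (x \<one>) - \<iota> p) * \<iota> (e h)))"
      unfolding eq by (rule norm_triangle_ineq4)
    also have "norm (\<iota> (e h) * ((\<iota> (x \<one>) - \<iota> p) * \<iota> (e h))) \<le> norm (\<iota> (x \<one>) - \<iota> p)"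
      using n1[OF eh(6)] n2[OF eh(6)] order_trans by blast
    finally show ?thesis using p r by simp
  qed
  have d: "base_incl r \<ominus>\<^bsub>C\<^esub> T \<in> carrier C" using r T by (simp add: C_minus_closed base_incl_closed)
  have "nrm C (base_incl r \<ominus>\<^bsub>C\<^esub> T) \<le> (\<Sum>s\<in>carrier G. nrm A ((base_incl r \<ominus>\<^bsub>C\<^esub> T) s))" using d by (rule nrm_C_le_l1)
  also have "\<dots> = nrm A ((base_incl r \<ominus>\<^bsub>C\<^esub> T) \<one>) + (\<Sum>s\<in>carrier G - {\<one>}. nrm A ((base_incl r \<ominus>\<^bsub>C\<^esub> T) s))"
    using fin by (subst sum.remove[of _ \<one>]) auto
  also have "nrm A ((base_incl r \<ominus>\<^bsub>C\<^esub> T) \<one>) = norm (\<iota> r - \<iota> (T \<one>))"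
    using r T d by (simp add: norm_emb[OF A, symmetric] C_app C_minus base_incl_closed base_incl_app em(5))
  also have "(\<Sum>s\<in>carrier G - {\<one>}. nrm A ((base_incl r \<ominus>\<^bsub>C\<^esub> T) s)) \<le> (\<Sum>s\<in>carrier G - {\<one>}. \<epsilon> * (1 + nrm A (x s)))"
  proof (rule sum_mono)
    fix s assume s: "s \<in> carrier G - {\<one>}"
    have "nrm A ((base_incl r \<ominus>\<^bsub>C\<^esub> T) s) = norm (\<iota> (T s))"
      using r T d s norm_emb[OF A C_app[OF d], of s] by (simp add: C_minus base_incl_closed base_incl_app em(1,5) C_app cl)
    then show "nrm A ((base_incl r \<ominus>\<^bsub>C\<^esub> T) s) \<le> \<epsilon> * (1 + nrm A (x s))" using off s by simp
  qed
  also have "\<dots> \<le> (\<Sum>s\<in>carrier G. \<epsilon> * (1 + nrm A (x s)))"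
    using fin \<epsilon> x by (intro sum_mono2) (auto simp: UA.nrm_pos C_app add_nonneg_nonneg)
  finally show ?thesis using on by (simp add: T_def sum_distrib_left)
qed

end

end

locale tracial_action = unital_action G A \<alpha>
  for G :: "('g, 'k) monoid_scheme" (structure) and A :: "'a cstar" and \<alpha> :: "'g \<Rightarrow> 'a \<Rightarrow> 'a" +
  assumes simple: "simple_cstar A" and inf: "infinite_dimensional_cstar A"
    and unit_finite: "finite_cstar A" and trp: "tracial_rokhlin_property G A \<alpha>"
begin

lemma trpD:
  assumes "finite F" "F \<subseteq> carrier A" "\<epsilon> > 0" "x \<in> positive_cone A" "x \<noteq> \<zero>\<^bsub>A\<^esub>"
  shows "\<exists>e. tower F \<epsilon> e \<and> (\<exists>q\<in>projections A \<inter> hereditary_subalgebra A x. \<exists>w\<in>carrier A.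
    star A w \<otimes>\<^bsub>A\<^esub> w = \<one>\<^bsub>A\<^esub> \<ominus>\<^bsub>A\<^esub> tower_sum e \<and> w \<otimes>\<^bsub>A\<^esub> star A w = q)"
proof -
  have "finite F \<and> F \<subseteq> carrier A \<and> \<epsilon> > 0 \<and> x \<in> positive_cone A \<and> x \<noteq> \<zero>\<^bsub>A\<^esub>" using assms by simp
  from trp[unfolded tracial_rokhlin_property_def mvn_equivalent_def, THEN spec, THEN spec, THEN spec, THEN mp, OF this]
  show ?thesis unfolding tower_def tower_sum_def
    by (rule ex_forward) (elim conjE, intro conjI; assumption)
qed

lemma one_neq_zero: "\<one>\<^bsub>A\<^esub> \<noteq> \<zero>\<^bsub>A\<^esub>"
proof
  assume 0: "\<one>\<^bsub>A\<^esub> = \<zero>\<^bsub>A\<^esub>"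
  have "x = \<zero>\<^bsub>A\<^esub>" if "x \<in> carrier A" for x using UA.R.l_one[OF that] that by (simp add: 0)
  then have "carrier A = {\<zero>\<^bsub>A\<^esub>}" by auto
  then show False using simple by (simp add: simple_cstar_def)
qed

text \<open>The range projection has the exact form \<open>y c y\<close> instead of lying in a
  closure, so that the cut-down equations can later replace \<open>y\<close> by a representative of
  \<open>z\<close>. The sum is nonzero because \<open>g\<close> has to be.\<close>

definition good_tower :: "('g \<Rightarrow> 'a) \<Rightarrow> 'a set \<Rightarrow> real \<Rightarrow> ('g \<Rightarrow> 'a) \<Rightarrow> bool" where
  "good_tower y F \<epsilon> e \<longleftrightarrow> tower F \<epsilon> e \<and> tower_sum e \<noteq> \<zero>\<^bsub>A\<^esub> \<and>
     (\<exists>v\<in>carrier C. \<exists>c\<in>carrier C. star C v \<otimes>\<^bsub>C\<^esub> v = base_incl (\<one>\<^bsub>A\<^esub> \<ominus>\<^bsub>A\<^esub> tower_sum e) \<and>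
       v \<otimes>\<^bsub>C\<^esub> star C v = y \<otimes>\<^bsub>C\<^esub> c \<otimes>\<^bsub>C\<^esub> y)"

lemma good_tower_exact:
  assumes "tower F \<epsilon> e" "tower_sum e = \<one>\<^bsub>A\<^esub>" "y \<in> carrier C"
  shows "good_tower y F \<epsilon> e"
proof -
  have z: "\<one>\<^bsub>A\<^esub> \<ominus>\<^bsub>A\<^esub> \<one>\<^bsub>A\<^esub> = \<zero>\<^bsub>A\<^esub>" by (simp add: a_minus_def UA.R.r_neg cl)
  show ?thesis
    unfolding good_tower_def using assms one_neq_zero
    by (intro conjI bexI[of _ "\<zero>\<^bsub>C\<^esub>"])
      (simp_all add: z base_incl_zero C_closed unital_star_zero[OF C_unital] UC.R.l_null UC.R.r_null)
qed

section \<open>Towers when every nonzero hereditary subalgebra contains a nonzero projection\<close>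

context
  assumes sp: "\<And>x. x \<in> positive_cone A \<Longrightarrow> x \<noteq> \<zero>\<^bsub>A\<^esub> \<Longrightarrow>
      \<exists>q\<in>projections A \<inter> hereditary_subalgebra A x. q \<noteq> \<zero>\<^bsub>A\<^esub>"
begin

lemma strict_subprojection_exists:
  assumes "p \<in> projections A" "p \<noteq> \<zero>\<^bsub>A\<^esub>"
  obtains q where "q \<in> projections A" "q \<noteq> \<zero>\<^bsub>A\<^esub>" "q \<noteq> p" "\<iota> p * \<iota> q = \<iota> q"
  using UA.exists_strict_subprojection[OF simple inf sp assms] by blast

lemma projection_positive: "p \<in> projections A \<Longrightarrow> p \<in> positive_cone A"
  unfolding positive_cone_def projections_def by force

text \<open>The range projection of \<open>w\<close> lies in the hereditary subalgebra of
  \<open>x\<close>, hence under \<open>x\<close>. In this form \<open>w\<close> can be composed with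
  other partial isometries.\<close>

lemma trp_projection:
  assumes "finite F" "F \<subseteq> carrier A" "\<epsilon> > 0" and x: "x \<in> projections A" "x \<noteq> \<zero>\<^bsub>A\<^esub>"
  obtains e w where "tower F \<epsilon> e" "w \<in> carrier A" "adj (\<iota> w) * \<iota> w = \<iota> \<one>\<^bsub>A\<^esub> - \<iota> (tower_sum e)" "\<iota> x * \<iota> w = \<iota> w"
proof -
  obtain e q w where e: "tower F \<epsilon> e" and q: "q \<in> hereditary_subalgebra A x" and w: "w \<in> carrier A"
    "star A w \<otimes>\<^bsub>A\<^esub> w = \<one>\<^bsub>A\<^esub> \<ominus>\<^bsub>A\<^esub> tower_sum e" "w \<otimes>\<^bsub>A\<^esub> star A w = q"
    using trpD[OF assms(1-3) projection_positive[OF x(1)] x(2)] by blast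
  note X = UA.projectionsD[OF x(1)]
  note E = UA.projectionsD[OF tower_sum_projection[OF e assms(2)]]
  note P = UA.projectionsD[OF UA.one_minus_projection[OF tower_sum_projection[OF e assms(2)]]]
  have ww: "adj (\<iota> w) * \<iota> w = \<iota> (\<one>\<^bsub>A\<^esub> \<ominus>\<^bsub>A\<^esub> tower_sum e)" using w(1) by (simp add: cl em(3,7) flip: w(2))
  have "\<iota> w * adj (\<iota> w) = \<iota> q" using w(1) by (simp add: cl em(3,7) flip: w(3))
  then have qw: "\<iota> q * \<iota> w = \<iota> w" using partial_isometry(2)[OF ww P(4)] by simp
  have "(\<iota> x - 1) * \<iota> x = 0" by (simp add: left_diff_distrib X)
  then have "(\<iota> x - 1) * \<iota> q = 0" by (rule UA.hereditary_annihilate(1)[OF q X(1)])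
  then have "\<iota> x * \<iota> q = \<iota> q" by (simp add: left_diff_distrib)
  then have "\<iota> x * \<iota> w = \<iota> w" using qw by (metis mult.assoc)
  then show ?thesis using that e w(1) ww E by (simp add: em(5) cl)
qed

text \<open>Compose \<open>v\<close> with a partial isometry \<open>w\<close> that carries the
  complement of a second tower under a proper subprojection \<open>x\<close> of \<open>r\<close>.
  Taking \<open>x\<close> proper excludes a tower with sum 0: finiteness would give
  \<open>x = \<one>\<close>, and then \<open>r = x\<close>.\<close>

lemma good_tower_if_projection:
  assumes F: "finite F" "F \<subseteq> carrier A" "\<epsilon> > 0"
    and r: "r \<in> projections A" "r \<noteq> \<zero>\<^bsub>A\<^esub>" and y: "y \<in> carrier C"
    and v: "v \<in> carrier C" "c \<in> carrier C" "star C v \<otimes>\<^bsub>C\<^esub> v = base_incl r" "v \<otimes>\<^bsub>C\<^esub> star C v = y \<otimes>\<^bsub>C\<^esub> c \<otimes>\<^bsub>C\<^esub> y"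
    and ya: "star C y = y"
  shows "\<exists>e. good_tower y F \<epsilon> e"
proof -
  obtain x where x: "x \<in> projections A" "x \<noteq> \<zero>\<^bsub>A\<^esub>" "x \<noteq> r" "\<iota> r * \<iota> x = \<iota> x" using strict_subprojection_exists[OF r] .
  obtain e w where e: "tower F \<epsilon> e" and w: "w \<in> carrier A" "adj (\<iota> w) * \<iota> w = \<iota> \<one>\<^bsub>A\<^esub> - \<iota> (tower_sum e)" "\<iota> x * \<iota> w = \<iota> w"
    using trp_projection[OF F x(1,2)] .
  note R = UA.projectionsD[OF r(1)] and XX = UA.projectionsD[OF x(1)]
  note E = UA.projectionsD[OF tower_sum_projection[OF e F(2)]]
  have ne: "tower_sum e \<noteq> \<zero>\<^bsub>A\<^esub>"
  proof
    assume "tower_sum e = \<zero>\<^bsub>A\<^esub>"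
    then have ww: "adj (\<iota> w) * \<iota> w = \<iota> \<one>\<^bsub>A\<^esub>" using w by (simp add: em)
    have one: "\<one>\<^bsub>A\<^esub> \<in> projections A" by (rule UA.projectionsI) (simp_all add: cl UA.emb_unit')
    have "x = \<one>\<^bsub>A\<^esub>"
      by (rule UA.finite_subprojection[OF unit_finite one x(1) _ w(1) ww w(3)]) (simp add: UA.emb_unit XX)
    then have "\<iota> r = \<iota> x" using x(4) R by (simp add: UA.emb_unit)
    then show False using x(3) R XX UA.eqI by metis
  qed
  define V where "V = v \<otimes>\<^bsub>C\<^esub> base_incl w"
  have rw: "r \<otimes>\<^bsub>A\<^esub> w = w"
    using R w x XX by (intro UA.eqI) (simp_all add: cl em, metis mult.assoc)
  have Vc: "V \<in> carrier C" using v w by (simp add: V_def C_closed base_incl_closed)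
  have sV: "star C V = base_incl (star A w) \<otimes>\<^bsub>C\<^esub> star C v" using v w by (simp add: V_def C_star_mult base_incl_ops base_incl_closed)
  have "star C V \<otimes>\<^bsub>C\<^esub> V = base_incl (star A w) \<otimes>\<^bsub>C\<^esub> (star C v \<otimes>\<^bsub>C\<^esub> v) \<otimes>\<^bsub>C\<^esub> base_incl w"
    unfolding sV unfolding V_def using v(1,2) w(1) by (simp add: C_assoc C_closed base_incl_closed cl)
  also have "\<dots> = base_incl (star A w \<otimes>\<^bsub>A\<^esub> w)" using w R by (simp add: v base_incl_ops cl UA.R.m_assoc rw)
  also have "star A w \<otimes>\<^bsub>A\<^esub> w = \<one>\<^bsub>A\<^esub> \<ominus>\<^bsub>A\<^esub> tower_sum e" using w E by (intro UA.eqI) (simp_all add: cl em(3,5,7))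
  finally have 1: "star C V \<otimes>\<^bsub>C\<^esub> V = base_incl (\<one>\<^bsub>A\<^esub> \<ominus>\<^bsub>A\<^esub> tower_sum e)" .
  have vv: "y \<otimes>\<^bsub>C\<^esub> c \<otimes>\<^bsub>C\<^esub> y \<otimes>\<^bsub>C\<^esub> v = v"
  proof (rule UC.eqI)
    have "adj (\<kappa> v) * \<kappa> v = \<kappa> (base_incl r)" using v by (simp add: UC.em(3,7) C_closed flip: v(3))
    moreover have "\<kappa> (base_incl r) * \<kappa> (base_incl r) = \<kappa> (base_incl r)" using UC.projectionsD[OF base_incl_projection[OF r(1)]] by simp
    ultimately have "\<kappa> v * adj (\<kappa> v) * \<kappa> v = \<kappa> v" by (rule partial_isometry(2))
    then have "\<kappa> (v \<otimes>\<^bsub>C\<^esub> star C v \<otimes>\<^bsub>C\<^esub> v) = \<kappa> v" using v(1) by (simp add: UC.em(3,7) C_closed)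
    then show "\<kappa> (y \<otimes>\<^bsub>C\<^esub> c \<otimes>\<^bsub>C\<^esub> y \<otimes>\<^bsub>C\<^esub> v) = \<kappa> v" by (simp add: v(4))
  qed (use v y in \<open>simp_all add: C_closed\<close>)
  \<comment> \<open>\<open>v\<close> absorbs its range projection \<open>y c y\<close>, so
    \<open>V\<close> factors as \<open>y\<close> times \<open>Y\<close>, and the range projection of
    \<open>V\<close> again has \<open>y\<close> on both sides.\<close>
  define Y where "Y = c \<otimes>\<^bsub>C\<^esub> y \<otimes>\<^bsub>C\<^esub> V"
  have Y: "Y \<in> carrier C" using v y Vc by (simp add: Y_def C_closed)
  have VY: "V = y \<otimes>\<^bsub>C\<^esub> Y"
  proof -
    have "y \<otimes>\<^bsub>C\<^esub> Y = (y \<otimes>\<^bsub>C\<^esub> c \<otimes>\<^bsub>C\<^esub> y \<otimes>\<^bsub>C\<^esub> v) \<otimes>\<^bsub>C\<^esub> base_incl w"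
      using v y w by (simp add: Y_def V_def C_assoc C_closed base_incl_closed)
    then show ?thesis by (simp add: vv V_def)
  qed
  have "V \<otimes>\<^bsub>C\<^esub> star C V = (y \<otimes>\<^bsub>C\<^esub> Y) \<otimes>\<^bsub>C\<^esub> (star C Y \<otimes>\<^bsub>C\<^esub> y)"
    using Y y by (subst (1 2) VY) (simp add: C_star_mult ya)
  also have "\<dots> = y \<otimes>\<^bsub>C\<^esub> (Y \<otimes>\<^bsub>C\<^esub> star C Y) \<otimes>\<^bsub>C\<^esub> y"
    using Y y by (simp add: C_assoc C_closed)
  finally have 2: "V \<otimes>\<^bsub>C\<^esub> star C V = y \<otimes>\<^bsub>C\<^esub> (Y \<otimes>\<^bsub>C\<^esub> star C Y) \<otimes>\<^bsub>C\<^esub> y" .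
  have "Y \<otimes>\<^bsub>C\<^esub> star C Y \<in> carrier C" using Y by (simp add: C_closed)
  then show ?thesis unfolding good_tower_def using e ne 1 2 Vc by blast
qed

text \<open>The unit coefficient is the inner product of \<open>y\<close> with itself, a sum of
  squares that vanishes only for \<open>y = 0\<close>. Its square root is taken in the product type
  and read off in the coordinate \<open>A\<close>.\<close>

lemma square_expectation:
  assumes y: "y \<in> carrier C" "star C y = y" "y \<noteq> \<zero>\<^bsub>C\<^esub>"
  shows "\<exists>s\<in>carrier A. star A s = s \<and> s \<otimes>\<^bsub>A\<^esub> s = (y \<otimes>\<^bsub>C\<^esub> y) \<one> \<and> s \<otimes>\<^bsub>A\<^esub> s \<noteq> \<zero>\<^bsub>A\<^esub>"
proof -
  define a where "a = (y \<otimes>\<^bsub>C\<^esub> y) \<one>"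
  have a: "a \<in> carrier A" using y by (simp add: a_def C_app C_closed)
  have ea: "\<iota> a = ip y y" using ip_eq[OF y(1) y(1)] y by (simp add: a_def)
  have "psd (\<iota> a)" unfolding ea ip_def by (intro psd_sum psd_mult_adj)
  then obtain t where t: "psd t" "t * t = \<iota> a" using psd_sqrt by blast
  have "pcomp (adj t) A = pcomp t A" "pcomp (t * t) A = a" using t a by (simp_all add: psd_sa pcomp_emb[OF A])
  then have s: "star A (pcomp t A) = pcomp t A" "pcomp t A \<otimes>\<^bsub>A\<^esub> pcomp t A = a" by (simp_all add: pcomp_simps A)
  have "a \<noteq> \<zero>\<^bsub>A\<^esub>"
  proof
    assume "a = \<zero>\<^bsub>A\<^esub>"
    then have "(ip_norm y)\<^sup>2 = 0" by (simp add: ip_norm_square em flip: ea)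
    then have "nrm A (y s) = 0" if "s \<in> carrier G" for s
      using nrm_le_ip_norm[OF y(1) that] UA.nrm_pos[OF C_app[OF y(1) that]] by simp
    then have "y = \<zero>\<^bsub>C\<^esub>"
      using y by (intro C_eqI[OF y(1) C_closed(6)]) (simp add: crossed_product_ops(3) C_app UA.un)
    then show False using y by simp
  qed
  then show ?thesis using s pcomp_in_carrier[of t] by (auto simp: a_def)
qed

text \<open>Choose a projection \<open>p\<close> below the expectation of \<open>y\<^sup>2\<close>, up to a conjugation, and a fine tower
  whose complement is small compared with \<open>p\<close>. If some \<open>e\<^sub>h p e\<^sub>h\<close> is near a nonzero projection,
  then the latter is equivalent to a projection in \<open>y C y\<close>. Otherwise \<open>p\<close> is equivalent to a
  subprojection of the complement, hence to a proper subprojection of itself.\<close>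

lemma good_tower_exists_if_projections:
  assumes F: "finite F" "F \<subseteq> carrier A" "\<epsilon> > 0" and y: "y \<in> carrier C" "star C y = y" "y \<noteq> \<zero>\<^bsub>C\<^esub>"
  shows "\<exists>e. good_tower y F \<epsilon> e"
proof -
  obtain s where s: "s \<in> carrier A" "star A s = s" "s \<otimes>\<^bsub>A\<^esub> s = (y \<otimes>\<^bsub>C\<^esub> y) \<one>" "s \<otimes>\<^bsub>A\<^esub> s \<noteq> \<zero>\<^bsub>A\<^esub>"
    using square_expectation[OF y] by blast
  define a where "a = s \<otimes>\<^bsub>A\<^esub> s"
  have a: "a \<in> carrier A" "\<iota> a = \<iota> s * \<iota> s" using s(1) by (simp_all add: a_def em cl)
  have sa: "adj (\<iota> s) = \<iota> s" using s by (simp flip: em(7))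
  have "a = star A s \<otimes>\<^bsub>A\<^esub> s" using s by (simp add: a_def)
  then have "a \<in> positive_cone A" unfolding positive_cone_def using s(1) by blast
  then obtain p where p: "p \<in> projections A" "p \<in> hereditary_subalgebra A a" "p \<noteq> \<zero>\<^bsub>A\<^esub>"
    using sp[of a] s(4) by (auto simp: a_def)
  note P = UA.projectionsD[OF p(1)]
  \<comment> \<open>With this tolerance \<open>k * adj k\<close> is within 1/16 + 2/16 of
    \<open>p\<close>, below the 1/4 allowed afterwards.\<close>
  obtain c where c: "c \<in> carrier A" "norm (\<iota> p - \<iota> a * \<iota> c * \<iota> a) < 1/16"
    using UA.hereditary_approx(2)[OF p(2) a(1), of "1/16"] by auto
  \<comment> \<open>Since \<open>a\<close> is the square of \<open>s\<close>, conjugating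
    \<open>a\<close> by \<open>d\<close> gives \<open>k * adj k\<close> with
    \<open>k = a c a\<close>. Hence conjugating \<open>y \<otimes> y\<close> by \<open>d\<close>
    brings its unit coefficient close to \<open>p\<close>.\<close>
  define d where "d = a \<otimes>\<^bsub>A\<^esub> c \<otimes>\<^bsub>A\<^esub> s"
  have d: "d \<in> carrier A" "\<iota> d = \<iota> a * \<iota> c * \<iota> s" using a c s by (simp_all add: d_def em cl)
  define k where "k = \<iota> a * \<iota> c * \<iota> a"
  have k: "norm (\<iota> p - k) < 1/16" using c by (simp add: k_def)
  have dd: "\<iota> d * \<iota> a * adj (\<iota> d) = k * adj k"
    by (simp add: d k_def a adj_mult sa mult.assoc)
  have near: "norm (k * adj k - \<iota> p) \<le> 1/4"
  proof -
    have "adj (\<iota> p - k) = \<iota> p - adj k" by (simp add: adj_diff P)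
    then have k': "norm (\<iota> p - adj k) < 1/16" using k norm_adj by metis
    have "norm k \<le> norm (\<iota> p) + norm (\<iota> p - k)" using norm_triangle_ineq4[of "\<iota> p" "\<iota> p - k"] by simp
    then have nk: "norm k \<le> 2" using k P by simp
    have "\<iota> p - k * adj k = (\<iota> p - k) * \<iota> p + k * (\<iota> p - adj k)" by (simp add: algebra_simps P)
    then have "norm (\<iota> p - k * adj k) \<le> norm ((\<iota> p - k) * \<iota> p) + norm (k * (\<iota> p - adj k))"
      by (simp add: norm_triangle_ineq)
    also have "norm ((\<iota> p - k) * \<iota> p) \<le> (1/16) * 1"
      using k P by (intro order_trans[OF norm_mult_ineq mult_mono]) auto
    also have "norm (k * (\<iota> p - adj k)) \<le> 2 * (1/16)"
      using k' nk by (intro order_trans[OF norm_mult_ineq mult_mono]) auto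
    finally show ?thesis by (simp add: norm_minus_commute)
  qed
  define x where "x = base_incl d \<otimes>\<^bsub>C\<^esub> (y \<otimes>\<^bsub>C\<^esub> y) \<otimes>\<^bsub>C\<^esub> base_incl (star A d)"
  have x: "x \<in> carrier C" using d y by (simp add: x_def C_closed base_incl_closed cl)
  have "\<iota> (x \<one>) = \<iota> d * \<iota> a * adj (\<iota> d)"
    using d y s(3) by (simp add: x_def base_incl_left base_incl_right C_closed base_incl_closed cl C_app act_id em a_def)
  then have x1: "norm (\<iota> (x \<one>) - \<iota> p) \<le> 1/4" using dd near by simp
  define M where "M = (\<Sum>s\<in>carrier G. 1 + nrm A (x s)) + 1"
  define N where "N = real (card (carrier G)) + 1"
  have M: "M \<ge> 1" unfolding M_def using x by (simp add: sum_nonneg UA.nrm_pos C_app add_nonneg_nonneg)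
  have N: "N \<ge> 1" by (simp add: N_def)
  \<comment> \<open>\<open>\<delta> * M\<close> bounds the contribution of the coefficients off the
    unit and \<open>4 * \<delta>\<close> the distance to a projection; together with 1/4 they stay
    below 1. The last estimate makes the norms of all \<open>p e(h)\<close> sum to less than 1 when
    no nonzero projection is near any \<open>e(h) p e(h)\<close>.\<close>
  define \<delta> where "\<delta> = 1 / (64 * N\<^sup>2 * M)"
  have N2: "N\<^sup>2 \<ge> 1" using N by simp
  have \<delta>: "0 < \<delta>" "\<delta> * M \<le> 1/64" "\<delta> \<le> 1/64" "4 * \<delta> \<le> (1 / (4 * N))\<^sup>2"
  proof -
    have NM: "N\<^sup>2 * M \<ge> 1" "N\<^sup>2 * M \<ge> M" "N\<^sup>2 * M \<ge> N\<^sup>2"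
      using mult_mono[OF N2 M] mult_right_mono[OF N2, of M] mult_left_mono[OF M, of "N\<^sup>2"] M by auto
    show "0 < \<delta>" using NM(1) by (simp add: \<delta>_def mult.assoc)
    show "\<delta> * M \<le> 1/64" using NM M by (simp add: \<delta>_def divide_simps mult.assoc)
    show "\<delta> \<le> 1/64" using NM by (simp add: \<delta>_def divide_simps mult.assoc)
    show "4 * \<delta> \<le> (1 / (4 * N))\<^sup>2" using NM N by (simp add: \<delta>_def power_mult_distrib power_divide divide_simps mult.assoc)
  qed
  obtain x0 where x0: "x0 \<in> projections A" "x0 \<noteq> \<zero>\<^bsub>A\<^esub>" "x0 \<noteq> p" "\<iota> p * \<iota> x0 = \<iota> x0"
    using strict_subprojection_exists[OF p(1,3)] .
  define F' where "F' = insert p (x ` carrier G)"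
  have F': "finite F'" "F' \<subseteq> carrier A" using fin x P by (auto simp: F'_def C_app)
  obtain e w where e: "tower F' \<delta> e" and w: "w \<in> carrier A" "adj (\<iota> w) * \<iota> w = \<iota> \<one>\<^bsub>A\<^esub> - \<iota> (tower_sum e)" "\<iota> x0 * \<iota> w = \<iota> w"
    using trp_projection[OF F' \<delta>(1) x0(1,2)] .
  note ep = tp[OF e F'(2)]
  have ex: "\<exists>r\<in>projections A. norm (\<iota> r - \<iota> (e h) * \<iota> p * \<iota> (e h)) \<le> 4 * \<delta>" if h: "h \<in> carrier G" for h
  proof -
    define b where "b = e h \<otimes>\<^bsub>A\<^esub> p \<otimes>\<^bsub>A\<^esub> e h"
    have b: "b \<in> carrier A" "\<iota> b = \<iota> (e h) * \<iota> p * \<iota> (e h)" using ep[OF h] P by (simp_all add: b_def em cl)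
    have ee: "\<iota> (e h) * (\<iota> (e h) * t) = \<iota> (e h) * t" for t using ep[OF h] by (simp flip: mult.assoc)
    have pp: "\<iota> p * (\<iota> p * t) = \<iota> p * t" for t using P by (simp flip: mult.assoc)
    have bs: "star A b = b" using b ep[OF h] P by (intro UA.eqI) (simp_all add: em cl adj_mult mult.assoc)
    have "\<iota> b * \<iota> b - \<iota> b = \<iota> (e h) * \<iota> p * ((\<iota> (e h) * \<iota> p - \<iota> p * \<iota> (e h)) * \<iota> (e h))"
      using ep[OF h] by (simp add: b algebra_simps ee pp)
    then have "norm (\<iota> b * \<iota> b - \<iota> b) \<le> norm (\<iota> (e h) * \<iota> p) * norm ((\<iota> (e h) * \<iota> p - \<iota> p * \<iota> (e h)) * \<iota> (e h))"
      using norm_mult_ineq by metis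
    also have "\<dots> \<le> (1 * 1) * (\<delta> * 1)"
      using ep[OF h] P tower_comm[OF e F'(2) h, of p] less_imp_le[OF \<delta>(1)]
      by (intro mult_mono order_trans[OF norm_mult_ineq mult_mono]) (auto simp: F'_def)
    finally have "nrm A (b \<otimes>\<^bsub>A\<^esub> b \<ominus>\<^bsub>A\<^esub> b) \<le> \<delta>"
      using b norm_emb[OF A, of "b \<otimes>\<^bsub>A\<^esub> b \<ominus>\<^bsub>A\<^esub> b"] by (simp add: em(3,5) cl)
    then obtain r where r: "r \<in> projections A" "nrm A (r \<ominus>\<^bsub>A\<^esub> b) \<le> 4 * \<delta>"
      using carrier_projection_near_almost_projection[OF A b(1) bs] \<delta> by force
    then have "norm (\<iota> r - \<iota> b) \<le> 4 * \<delta>"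
      using b UA.projectionsD[OF r(1)] norm_emb[OF A, of "r \<ominus>\<^bsub>A\<^esub> b"] by (simp add: em(5) UA.R.minus_closed)
    then show ?thesis using r b by auto
  qed
  show ?thesis
  proof (cases "\<exists>h\<in>carrier G. \<exists>r\<in>projections A. r \<noteq> \<zero>\<^bsub>A\<^esub> \<and> norm (\<iota> r - \<iota> (e h) * \<iota> p * \<iota> (e h)) \<le> 4 * \<delta>")
    case True
    then obtain h r where h: "h \<in> carrier G" and r: "r \<in> projections A" "r \<noteq> \<zero>\<^bsub>A\<^esub>"
      "norm (\<iota> r - \<iota> (e h) * \<iota> p * \<iota> (e h)) \<le> 4 * \<delta>" by blast
    note R = UA.projectionsD[OF r(1)] and MR = UC.projectionsD[OF base_incl_projection[OF r(1)]]
    define T where "T = base_incl (e h) \<otimes>\<^bsub>C\<^esub> x \<otimes>\<^bsub>C\<^esub> base_incl (e h)"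
    have T: "T \<in> carrier C" using ep[OF h] x by (simp add: T_def C_closed base_incl_closed)
    have "nrm C (base_incl r \<ominus>\<^bsub>C\<^esub> T) \<le> 4 * \<delta> + 1/4 + \<delta> * (\<Sum>s\<in>carrier G. 1 + nrm A (x s))"
      unfolding T_def using \<delta> by (intro tower_compress[OF e F'(2) h x _ P(1) x1 R(1) r(3)]) (auto simp: F'_def)
    also have "\<delta> * (\<Sum>s\<in>carrier G. 1 + nrm A (x s)) \<le> \<delta> * M" using \<delta> by (intro mult_left_mono) (auto simp: M_def)
    finally have nT: "nrm C (base_incl r \<ominus>\<^bsub>C\<^esub> T) < 1" using \<delta> by linarith
    define q where "q = base_incl r \<otimes>\<^bsub>C\<^esub> (base_incl (e h) \<otimes>\<^bsub>C\<^esub> base_incl d)"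
    have q: "q \<in> carrier C" using R ep[OF h] d by (simp add: q_def C_closed base_incl_closed)
    have "\<kappa> (q \<otimes>\<^bsub>C\<^esub> y \<otimes>\<^bsub>C\<^esub> y \<otimes>\<^bsub>C\<^esub> star C q) = \<kappa> (base_incl r) * \<kappa> T * \<kappa> (base_incl r)"
    proof -
      have "star C (base_incl (e h)) = base_incl (e h)" "star C (base_incl r) = base_incl r" "star C (base_incl d) = base_incl (star A d)"
        using ep[OF h] R d by (simp_all add: base_incl_ops)
      then have "q \<otimes>\<^bsub>C\<^esub> y \<otimes>\<^bsub>C\<^esub> y \<otimes>\<^bsub>C\<^esub> star C q = base_incl r \<otimes>\<^bsub>C\<^esub> T \<otimes>\<^bsub>C\<^esub> base_incl r"
        using R ep[OF h] d y
        by (simp add: q_def T_def x_def C_star_mult C_assoc C_closed base_incl_closed cl)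
      then show ?thesis using R T by (simp add: UC.em C_closed base_incl_closed)
    qed
    then have "\<kappa> (base_incl r \<ominus>\<^bsub>C\<^esub> q \<otimes>\<^bsub>C\<^esub> y \<otimes>\<^bsub>C\<^esub> y \<otimes>\<^bsub>C\<^esub> star C q) = \<kappa> (base_incl r) * (\<kappa> (base_incl r \<ominus>\<^bsub>C\<^esub> T) * \<kappa> (base_incl r))"
      using R T q y MR by (simp add: UC.em(5) C_closed base_incl_closed algebra_simps)
    then have "nrm C (base_incl r \<ominus>\<^bsub>C\<^esub> q \<otimes>\<^bsub>C\<^esub> y \<otimes>\<^bsub>C\<^esub> y \<otimes>\<^bsub>C\<^esub> star C q) = norm (\<kappa> (base_incl r) * (\<kappa> (base_incl r \<ominus>\<^bsub>C\<^esub> T) * \<kappa> (base_incl r)))"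
      using R q y by (simp add: norm_emb[OF C_unital, symmetric] C_minus_closed C_closed base_incl_closed)
    also have "\<dots> \<le> 1 * (nrm C (base_incl r \<ominus>\<^bsub>C\<^esub> T) * 1)"
      using MR R T by (intro order_trans[OF norm_mult_ineq mult_mono])
        (auto simp: norm_emb[OF C_unital] C_minus_closed base_incl_closed UC.nrm_pos)
    also have "\<dots> < 1" using nT by simp
    finally have lt: "nrm C (base_incl r \<ominus>\<^bsub>C\<^esub> q \<otimes>\<^bsub>C\<^esub> y \<otimes>\<^bsub>C\<^esub> y \<otimes>\<^bsub>C\<^esub> star C q) < 1" .
    have rq: "base_incl r \<otimes>\<^bsub>C\<^esub> q = q"
    proof -
      have "base_incl r \<otimes>\<^bsub>C\<^esub> q = (base_incl r \<otimes>\<^bsub>C\<^esub> base_incl r) \<otimes>\<^bsub>C\<^esub> (base_incl (e h) \<otimes>\<^bsub>C\<^esub> base_incl d)"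
        unfolding q_def using R(1) ep(1)[OF h] d(1) by (intro C_assoc[symmetric] C_closed base_incl_closed)
      then show ?thesis by (simp add: MR(2) q_def)
    qed
    obtain v c' where "v \<in> carrier C" "c' \<in> carrier C" "star C v \<otimes>\<^bsub>C\<^esub> v = base_incl r" "v \<otimes>\<^bsub>C\<^esub> star C v = y \<otimes>\<^bsub>C\<^esub> c' \<otimes>\<^bsub>C\<^esub> y"
      using carrier_projection_near_conjugate[OF C_unital MR(1) q y(1) MR(2,3) y(2) rq lt] by blast
    then show ?thesis using good_tower_if_projection[OF F r(1,2) y(1)] y(2) by blast
  next
    case False
    \<comment> \<open>Here the projection near \<open>e(h) p e(h)\<close> can only be 0, so the
      C*-identity makes \<open>p e(h)\<close> small. Summing over the group, \<open>p\<close> is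
      almost orthogonal to the whole tower.\<close>
    have small: "norm (\<iota> p * \<iota> (e h)) \<le> 1 / (4 * N)" if h: "h \<in> carrier G" for h
    proof -
      obtain r where r: "r \<in> projections A" "norm (\<iota> r - \<iota> (e h) * \<iota> p * \<iota> (e h)) \<le> 4 * \<delta>" using ex[OF h] by blast
      then have "r = \<zero>\<^bsub>A\<^esub>" using False h by blast
      then have 1: "norm (\<iota> (e h) * \<iota> p * \<iota> (e h)) \<le> 4 * \<delta>" using r by (simp add: em)
      have "adj (\<iota> p * \<iota> (e h)) * (\<iota> p * \<iota> (e h)) = \<iota> (e h) * (\<iota> p * \<iota> p) * \<iota> (e h)"
        using ep(5)[OF h] P(5) by (simp add: adj_mult mult.assoc)
      then have "(norm (\<iota> p * \<iota> (e h)))\<^sup>2 \<le> 4 * \<delta>" using 1 P norm_adj_mult[of "\<iota> p * \<iota> (e h)"] by simp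
      also have "\<dots> \<le> (1 / (4 * N))\<^sup>2" by (rule \<delta>)
      finally show ?thesis by (rule power2_le_imp_le) (use N in simp)
    qed
    have "norm (\<iota> p * \<iota> (tower_sum e)) \<le> (\<Sum>h\<in>carrier G. norm (\<iota> p * \<iota> (e h)))"
      by (simp add: emb_tower_sum[OF e F'(2)] sum_distrib_left norm_sum)
    also have "\<dots> \<le> (\<Sum>h\<in>carrier G. 1 / (4 * N))" by (rule sum_mono) (rule small)
    also have "\<dots> < 1" using N by (simp add: N_def divide_simps)
    finally have pe: "norm (\<iota> p * \<iota> (tower_sum e)) < 1" .
    define f where "f = \<one>\<^bsub>A\<^esub> \<ominus>\<^bsub>A\<^esub> tower_sum e"
    have fp: "f \<in> projections A" unfolding f_def by (rule UA.one_minus_projection[OF tower_sum_projection[OF e F'(2)]])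
    note FP = UA.projectionsD[OF fp] and EP = UA.projectionsD[OF tower_sum_projection[OF e F'(2)]]
    have ef: "\<iota> f = \<iota> \<one>\<^bsub>A\<^esub> - \<iota> (tower_sum e)" using EP by (simp add: f_def em(5) cl)
    define m where "m = p \<otimes>\<^bsub>A\<^esub> f \<otimes>\<^bsub>A\<^esub> f \<otimes>\<^bsub>A\<^esub> star A p"
    have mc: "m \<in> carrier A" unfolding m_def using P FP by (simp add: cl)
    have "\<iota> m = \<iota> p * (\<iota> f * \<iota> f) * \<iota> p"
      unfolding m_def using P FP by (simp add: em(3) cl mult.assoc)
    also have "\<dots> = \<iota> p * \<iota> f * \<iota> p" by (simp only: FP(4))
    also have "\<dots> = \<iota> p - \<iota> p * \<iota> (tower_sum e) * \<iota> p"
      using P(1,4) unfolding ef by (simp add: right_diff_distrib left_diff_distrib UA.emb_unit)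
    finally have "\<iota> (p \<ominus>\<^bsub>A\<^esub> m) = (\<iota> p * \<iota> (tower_sum e)) * \<iota> p"
      using P(1) mc by (simp add: em(5))
    then have "nrm A (p \<ominus>\<^bsub>A\<^esub> m) = norm ((\<iota> p * \<iota> (tower_sum e)) * \<iota> p)"
      using P(1) mc by (simp add: norm_emb[OF A, symmetric] cl)
    also have "\<dots> \<le> norm (\<iota> p * \<iota> (tower_sum e)) * 1"
      using P by (intro order_trans[OF norm_mult_ineq mult_mono]) auto
    also have "\<dots> < 1" using pe by simp
    finally have pm: "nrm A (p \<ominus>\<^bsub>A\<^esub> m) < 1" .
    obtain v b where v: "v \<in> carrier A" "b \<in> carrier A" "star A v \<otimes>\<^bsub>A\<^esub> v = p" "v \<otimes>\<^bsub>A\<^esub> star A v = f \<otimes>\<^bsub>A\<^esub> b \<otimes>\<^bsub>A\<^esub> f"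
      using carrier_projection_near_conjugate[OF A P(1) P(1) FP(1) P(2,3) FP(3) P(2) pm[unfolded m_def]] by blast
    have vv: "adj (\<iota> v) * \<iota> v = \<iota> p" using v by (simp add: em(3,7) cl flip: v(3))
    have "\<iota> v * adj (\<iota> v) = \<iota> f * \<iota> b * \<iota> f" using v(1,2) FP(1) v(4)[THEN arg_cong[of _ _ \<iota>]] by (simp add: em(3,7) cl)
    then have "\<iota> f * (\<iota> v * adj (\<iota> v)) = \<iota> v * adj (\<iota> v)" using FP(4) by (metis mult.assoc)
    then have fv: "\<iota> f * \<iota> v = \<iota> v" using partial_isometry(2)[OF vv P(4)] by (metis mult.assoc)
    \<comment> \<open>\<open>v\<close> carries \<open>p\<close> under the complement
      \<open>f\<close>, and \<open>w\<close> carries \<open>f\<close> under \<open>x0\<close>. The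
      composition carries \<open>p\<close> into its own proper subprojection.\<close>
    define u where "u = w \<otimes>\<^bsub>A\<^esub> v"
    have u: "u \<in> carrier A" "\<iota> u = \<iota> w * \<iota> v" using v w by (simp_all add: u_def em cl)
    have "adj (\<iota> u) * \<iota> u = adj (\<iota> v) * ((adj (\<iota> w) * \<iota> w) * \<iota> v)" by (simp add: u adj_mult mult.assoc)
    also have "\<dots> = \<iota> p" by (simp add: w(2) fv vv flip: ef)
    finally have "adj (\<iota> u) * \<iota> u = \<iota> p" .
    moreover have "\<iota> x0 * \<iota> u = \<iota> u" using w(3) by (simp add: u flip: mult.assoc)
    ultimately have "x0 = p" using UA.finite_subprojection[OF unit_finite p(1) x0(1,4) u(1)] by blast
    then show ?thesis using x0 by simp
  qed
qed

end

text \<open>If some towers cannot be completed to the unit, then the tracial Rokhlin property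
  itself produces nonzero projections in all hereditary subalgebras.\<close>

lemma good_tower_exists:
  assumes F: "finite F" "F \<subseteq> carrier A" "\<epsilon> > 0" and y: "y \<in> carrier C" "star C y = y" "y \<noteq> \<zero>\<^bsub>C\<^esub>"
  shows "\<exists>e. good_tower y F \<epsilon> e"
proof (cases "\<forall>H \<delta>. finite H \<and> H \<subseteq> carrier A \<and> \<delta> > 0 \<longrightarrow> (\<exists>e. tower H \<delta> e \<and> tower_sum e = \<one>\<^bsub>A\<^esub>)")
  case True
  then obtain e where "tower F \<epsilon> e \<and> tower_sum e = \<one>\<^bsub>A\<^esub>"
    using conjI[OF F(1) conjI[OF F(2,3)]] by (elim allE impE exE)
  then have "tower F \<epsilon> e" "tower_sum e = \<one>\<^bsub>A\<^esub>" by simp_all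
  then have "good_tower y F \<epsilon> e" using y(1) by (rule good_tower_exact)
  then show ?thesis by blast
next
  case False
  then obtain H \<delta> where H: "finite H" "H \<subseteq> carrier A" "\<delta> > 0" "\<And>e. tower H \<delta> e \<Longrightarrow> tower_sum e \<noteq> \<one>\<^bsub>A\<^esub>" by blast
  have "\<exists>q\<in>projections A \<inter> hereditary_subalgebra A x. q \<noteq> \<zero>\<^bsub>A\<^esub>" if x: "x \<in> positive_cone A" "x \<noteq> \<zero>\<^bsub>A\<^esub>" for x
  proof -
    obtain e q w where e: "tower H \<delta> e" and q: "q \<in> projections A \<inter> hereditary_subalgebra A x" and w: "w \<in> carrier A"
      "star A w \<otimes>\<^bsub>A\<^esub> w = \<one>\<^bsub>A\<^esub> \<ominus>\<^bsub>A\<^esub> tower_sum e" "w \<otimes>\<^bsub>A\<^esub> star A w = q"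
      using trpD[OF H(1-3) x] by blast
    have "q \<noteq> \<zero>\<^bsub>A\<^esub>"
    proof
      assume "q = \<zero>\<^bsub>A\<^esub>"
      then have "\<iota> w * adj (\<iota> w) = 0" using w(1) w(3)[THEN arg_cong[of _ _ \<iota>]] by (simp add: em(1,3,7) cl)
      then have "\<iota> w = 0" using norm_mult_adj[of "\<iota> w"] by simp
      then have "\<iota> (\<one>\<^bsub>A\<^esub> \<ominus>\<^bsub>A\<^esub> tower_sum e) = 0" using w(1) by (simp add: em(3,7) cl flip: w(2))
      then have "\<iota> (tower_sum e) = \<iota> \<one>\<^bsub>A\<^esub>" using tower_sum_closed[OF e H(2)] by (simp add: em(5) cl)
      then have "tower_sum e = \<one>\<^bsub>A\<^esub>" using tower_sum_closed[OF e H(2)] by (intro UA.eqI) (simp_all add: cl)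
      then show False using H(4)[OF e] by simp
    qed
    then show ?thesis using q by blast
  qed
  then show ?thesis using good_tower_exists_if_projections[OF _ F y] by blast
qed

end

section \<open>The splitting homomorphism\<close>

lemma null_sandwich:
  fixes u :: "nat \<Rightarrow> 'b::real_normed_algebra"
  assumes "u \<longlonglongrightarrow> 0" "\<And>n. norm (a n) \<le> K"
  shows "(\<lambda>n. a n * u n * b) \<longlonglongrightarrow> 0"
proof (rule Lim_null_comparison)
  have "norm (a n * u n * b) \<le> K * norm (u n) * norm b" for n
    using assms(2)[of n]
    by (intro order_trans[OF norm_mult_ineq mult_right_mono] order_trans[OF norm_mult_ineq mult_right_mono]) auto
  then show "\<forall>\<^sub>F n in sequentially. norm (a n * u n * b) \<le> K * norm (u n) * norm b" by simp
  have "(\<lambda>n. norm (u n)) \<longlonglongrightarrow> 0" using assms(1) by (rule tendsto_norm_zero)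
  then show "(\<lambda>n. K * norm (u n) * norm b) \<longlonglongrightarrow> 0"
    by (intro tendsto_mult_left_zero tendsto_mult_right_zero)
qed

context unital_action
begin

lemma tensor_unital: "unital_cstar (CG_tensor G A)"
proof -
  have "cstar_algebra (CG_tensor G A)"
    unfolding CG_tensor_def using A fin one_closed
    by (intro cstar_algebra.cstar_algebra_fun) (auto simp: unital_cstar_def)
  moreover have "Group.monoid (CG_tensor G A)"
    by (rule monoidI)
      (auto simp: CG_tensor_def cl UA.us funcset_extensional_app[where T = "carrier A"] intro!: restrict_ext)
  ultimately show ?thesis by (simp add: unital_cstar_def)
qed

lemma tensor_unital_action: "unital_action G (CG_tensor G A) (tensor_action G A \<alpha>)"
  using A act cstar_action_tensor_action[of A \<alpha>]
  by (intro unital_action.intro unital_action_axioms.intro is_group fin tensor_unital) (simp add: unital_cstar_def)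

lemma tensor_separable:
  assumes "separable_cstar A"
  shows "separable_cstar (CG_tensor G A)"
proof -
  interpret T: unital_algebra "CG_tensor G A" by unfold_locales (rule tensor_unital)
  interpret TP: pre_cstar_algebra "CG_tensor G A" by (rule unital_pre[OF tensor_unital])
  obtain D where D': "countable D \<and> D \<subseteq> carrier A \<and> (\<forall>x\<in>carrier A. \<forall>e>0. \<exists>d\<in>D. nrm A (x \<ominus>\<^bsub>A\<^esub> d) < e)"
    using assms unfolding pre_cstar_algebra.separable_cstar_iff[OF unital_pre[OF A]] by (rule exE)
  then have D: "countable D" "D \<subseteq> carrier A"
    and D3: "\<And>x e. x \<in> carrier A \<Longrightarrow> e > 0 \<Longrightarrow> \<exists>d\<in>D. nrm A (x \<ominus>\<^bsub>A\<^esub> d) < e"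
    by simp_all
  have ct: "countable (carrier G \<rightarrow>\<^sub>E D)" using fin D(1) by (intro countable_PiE) auto
  have sub: "carrier G \<rightarrow>\<^sub>E D \<subseteq> carrier (CG_tensor G A)" using D(2) by (auto simp: CG_tensor_def PiE_def Pi_def)
  have "\<exists>d\<in>carrier G \<rightarrow>\<^sub>E D. nrm (CG_tensor G A) (x \<ominus>\<^bsub>CG_tensor G A\<^esub> d) < e"
    if x: "x \<in> carrier (CG_tensor G A)" and e: "e > 0" for x e
  proof -
    have xs: "x s \<in> carrier A" if "s \<in> carrier G" for s using x that by (auto simp: CG_tensor_def)
    have "\<forall>s\<in>carrier G. \<exists>d\<in>D. nrm A (x s \<ominus>\<^bsub>A\<^esub> d) < e" using e by (intro ballI D3 xs)
    then obtain d where d: "\<And>s. s \<in> carrier G \<Longrightarrow> d s \<in> D \<and> nrm A (x s \<ominus>\<^bsub>A\<^esub> d s) < e" by metis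
    define d' where "d' = restrict d (carrier G)"
    have d'D: "d' \<in> carrier G \<rightarrow>\<^sub>E D" using d by (auto simp: d'_def)
    then have dc: "d' \<in> carrier (CG_tensor G A)" using sub by blast
    have "(x \<ominus>\<^bsub>CG_tensor G A\<^esub> d') s = x s \<ominus>\<^bsub>A\<^esub> d s" if s: "s \<in> carrier G" for s
    proof -
      have "x \<ominus>\<^bsub>CG_tensor G A\<^esub> d' = x \<oplus>\<^bsub>CG_tensor G A\<^esub> ((-1) \<odot>\<^bsub>CG_tensor G A\<^esub> d')"
        by (simp only: a_minus_def TP.uminus_eq_smult[OF dc])
      then show ?thesis using s d[OF s] D(2)
        by (auto simp: CG_tensor_def d'_def a_minus_def pre_cstar_algebra.uminus_eq_smult[OF unital_pre[OF A]])
    qed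
    then have "nrm (CG_tensor G A) (x \<ominus>\<^bsub>CG_tensor G A\<^esub> d') < e"
      using d one_closed fin SUP_finite_less_iff[of "carrier G" "\<lambda>s. nrm A ((x \<ominus>\<^bsub>CG_tensor G A\<^esub> d') s)" e]
      unfolding CG_tensor_def fun_cstar_simps(8) by fastforce
    then show ?thesis using d'D by blast
  qed
  then show ?thesis
    unfolding TP.separable_cstar_iff using ct sub by (intro exI[of _ "carrier G \<rightarrow>\<^sub>E D"] conjI ballI allI impI)
qed

text \<open>Elements are read as \<open>F s h\<close>, where \<open>s\<close> indexes the
  implementing unitary and \<open>h\<close> is the point at which the function coefficient is
  evaluated.\<close>

abbreviation "D \<equiv> crossed_product G (CG_tensor G A) (tensor_action G A \<alpha>)"

lemma D_app_closed: "F \<in> carrier D \<Longrightarrow> s \<in> carrier G \<Longrightarrow> h \<in> carrier G \<Longrightarrow> F s h \<in> carrier A"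
  by (auto simp: crossed_product_ops CG_tensor_def PiE_def Pi_def)

lemma unit_tensor_eq: "a \<in> carrier A \<Longrightarrow> unit_tensor G A a = (\<lambda>h\<in>carrier G. a)"
  by (auto simp: unit_tensor_def elem_tensor_def CG_def complex_cstar_def UA.us intro!: restrict_ext)

text \<open>Both arguments of \<open>H\<close> are shifted, the first by the convolution and the
  second by translation of functions. The second shift is what an equivariant tower
  reproduces.\<close>

lemma D_mult_app:
  assumes F: "F \<in> carrier D" and H: "H \<in> carrier D" and s: "s \<in> carrier G" and h: "h \<in> carrier G"
  shows "\<iota> ((F \<otimes>\<^bsub>D\<^esub> H) s h) = (\<Sum>t\<in>carrier G. \<iota> (F t h) * al t (\<iota> (H (inv t \<otimes> s) (inv t \<otimes> h))))"
proof -
  interpret AA: cstar_algebra A using A by (simp add: unital_cstar_def)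
  interpret TT: unital_action G "CG_tensor G A" "tensor_action G A \<alpha>" by (rule tensor_unital_action)
  have FT: "F t \<in> carrier (CG_tensor G A)" "H t \<in> carrier (CG_tensor G A)" if "t \<in> carrier G" for t
    using TT.C_app that F H by blast+
  have c: "(\<lambda>t. F t \<otimes>\<^bsub>CG_tensor G A\<^esub> tensor_action G A \<alpha> t (H (inv t \<otimes> s))) \<in> carrier G \<rightarrow> carrier (fun_cstar (carrier G) A)"
    using s FT TT.act_simps(1) TT.cl(5) by (auto simp: CG_tensor_def[symmetric] simp del: fun_cstar_simps)
  have app: "(F t \<otimes>\<^bsub>CG_tensor G A\<^esub> tensor_action G A \<alpha> t (H (inv t \<otimes> s))) h = F t h \<otimes>\<^bsub>A\<^esub> \<alpha> t (H (inv t \<otimes> s) (inv t \<otimes> h))"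
    if t: "t \<in> carrier G" for t
    using t s h FT(2)[of "inv t \<otimes> s"] by (auto simp: CG_tensor_def tensor_action_def)
  have "(F \<otimes>\<^bsub>D\<^esub> H) s h = (\<Oplus>\<^bsub>A\<^esub>t\<in>carrier G. (F t \<otimes>\<^bsub>CG_tensor G A\<^esub> tensor_action G A \<alpha> t (H (inv t \<otimes> s))) h)"
    using AA.finsum_fun_cstar_app[OF fin h c] s by (simp add: crossed_product_simps(2) CG_tensor_def)
  then have "\<iota> ((F \<otimes>\<^bsub>D\<^esub> H) s h) = (\<Sum>t\<in>carrier G. \<iota> ((F t \<otimes>\<^bsub>CG_tensor G A\<^esub> tensor_action G A \<alpha> t (H (inv t \<otimes> s))) h))"
    using F H s h by (simp add: emb_finsum[OF A] Pi_iff app cl D_app_closed act_simps)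
  also have "\<dots> = (\<Sum>t\<in>carrier G. \<iota> (F t h) * al t (\<iota> (H (inv t \<otimes> s) (inv t \<otimes> h))))"
    using F H s h by (intro sum.cong) (simp_all add: app em D_app_closed act_simps al_emb)
  finally show ?thesis .
qed

lemma D_star_app:
  assumes F: "F \<in> carrier D" and s: "s \<in> carrier G" and h: "h \<in> carrier G"
  shows "\<iota> (star D F s h) = al s (adj (\<iota> (F (inv s) (inv s \<otimes> h))))"
proof -
  have "F (inv s) \<in> carrier (CG_tensor G A)" using F s by (auto simp: crossed_product_ops)
  moreover have "F (inv s) x \<in> carrier A" if "x \<in> carrier G" for x using D_app_closed[OF F _ that] s by simp
  ultimately have "star D F s h = \<alpha> s (star A (F (inv s) (inv s \<otimes> h)))"
    using s h by (auto simp: crossed_product_simps(3) CG_tensor_def tensor_action_def cl)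
  then show ?thesis using F s h by (simp add: D_app_closed act_simps cl al_emb flip: em)
qed

lemma D_add_smult_app:
  assumes "F \<in> carrier D" "s \<in> carrier G" "h \<in> carrier G"
  shows "H \<in> carrier D \<Longrightarrow> \<iota> ((F \<oplus>\<^bsub>D\<^esub> H) s h) = \<iota> (F s h) + \<iota> (H s h)" "\<iota> ((c \<odot>\<^bsub>D\<^esub> F) s h) = sc c * \<iota> (F s h)"
  using assms by (simp_all add: crossed_product_ops CG_tensor_def em emb_smult[OF A] D_app_closed[unfolded crossed_product_ops CG_tensor_def])

lemma D_eqI:
  assumes "F \<in> carrier D" "H \<in> carrier D" "\<And>s h. s \<in> carrier G \<Longrightarrow> h \<in> carrier G \<Longrightarrow> \<iota> (F s h) = \<iota> (H s h)"
  shows "F = H"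
proof -
  interpret TT: unital_action G "CG_tensor G A" "tensor_action G A \<alpha>" by (rule tensor_unital_action)
  show ?thesis
  proof (rule TT.C_eqI[OF assms(1,2)])
    fix s assume s: "s \<in> carrier G"
    have "F s \<in> carrier G \<rightarrow>\<^sub>E carrier A" "H s \<in> carrier G \<rightarrow>\<^sub>E carrier A"
      using TT.C_app[OF assms(1) s] TT.C_app[OF assms(2) s] by (simp_all add: CG_tensor_def)
    then show "F s = H s"
    proof (rule PiE_ext)
      fix h assume h: "h \<in> carrier G"
      then show "F s h = H s h" using assms s by (intro UA.eqI D_app_closed) auto
    qed
  qed
qed

section \<open>The map induced by constant functions\<close>

lemma crossed_hom_app:
  assumes "x \<in> carrier C" "s \<in> carrier G" "h \<in> carrier G"
  shows "crossed_hom G (unit_tensor G A) x s h = x s"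
  using assms by (simp add: crossed_hom_def unit_tensor_eq C_app)

lemma crossed_hom_closed: "x \<in> carrier C \<Longrightarrow> crossed_hom G (unit_tensor G A) x \<in> carrier D"
  by (auto simp: crossed_product_ops(1) crossed_hom_def CG_tensor_def unit_tensor_eq C_app)

lemma crossed_hom_star_hom: "crossed_hom G (unit_tensor G A) \<in> star_hom C D"
proof -
  interpret TT: unital_action G "CG_tensor G A" "tensor_action G A \<alpha>" by (rule tensor_unital_action)
  note c = crossed_hom_closed crossed_hom_app C_closed TT.C_closed
  show ?thesis
    unfolding star_hom_def
  proof (intro CollectI conjI allI ballI)
    show "crossed_hom G (unit_tensor G A) \<in> hom C D"
    proof (rule homI)
      fix x y assume xy: "x \<in> carrier C" "y \<in> carrier C"
      show "crossed_hom G (unit_tensor G A) (x \<otimes>\<^bsub>C\<^esub> y) =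
          crossed_hom G (unit_tensor G A) x \<otimes>\<^bsub>D\<^esub> crossed_hom G (unit_tensor G A) y"
        using xy by (intro D_eqI) (simp_all add: c D_mult_app emb_C_mult)
    qed (rule crossed_hom_closed)
    show "crossed_hom G (unit_tensor G A) \<in> hom (add_monoid C) (add_monoid D)"
    proof (rule homI)
      fix x y assume "x \<in> carrier (add_monoid C)" "y \<in> carrier (add_monoid C)"
      then have xy: "x \<in> carrier C" "y \<in> carrier C" by simp_all
      show "crossed_hom G (unit_tensor G A) (x \<otimes>\<^bsub>add_monoid C\<^esub> y) =
          crossed_hom G (unit_tensor G A) x \<otimes>\<^bsub>add_monoid D\<^esub> crossed_hom G (unit_tensor G A) y"
        using xy by (intro D_eqI) (simp_all add: c D_add_smult_app emb_C_add)
    qed (simp add: crossed_hom_closed)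
    fix x assume x: "x \<in> carrier C"
    show "crossed_hom G (unit_tensor G A) (c \<odot>\<^bsub>C\<^esub> x) = c \<odot>\<^bsub>D\<^esub> crossed_hom G (unit_tensor G A) x" for c
      using x by (intro D_eqI) (simp_all add: c D_add_smult_app emb_C_smult)
    show "crossed_hom G (unit_tensor G A) (star C x) = star D (crossed_hom G (unit_tensor G A) x)"
      using x by (intro D_eqI) (simp_all add: c D_star_app emb_C_star)
  qed
qed

text \<open>The norm of \<open>C\<close> is dominated by the l1-norm over a finite group, so
  convergence may be checked coefficient by coefficient.\<close>

lemma seq_class_C_eqI:
  assumes x: "x \<in> carrier (linf C)" and y: "y \<in> carrier (linf C)"
    and lim: "\<And>s. s \<in> carrier G \<Longrightarrow> (\<lambda>n. \<iota> (x n s) - \<iota> (y n s)) \<longlonglongrightarrow> 0"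
  shows "seq_class C x = seq_class C y"
  unfolding UC.seq_class_eq_iff[OF x y]
proof (rule tendsto_sandwich[OF _ _ tendsto_const])
  note xc = UC.linf_app[OF x] and yc = UC.linf_app[OF y]
  show "\<forall>\<^sub>F n in sequentially. 0 \<le> nrm C (x n \<ominus>\<^bsub>C\<^esub> y n)"
    by (intro always_eventually allI UC.nrm_pos C_minus_closed xc yc)
  have "nrm C (x n \<ominus>\<^bsub>C\<^esub> y n) \<le> (\<Sum>s\<in>carrier G. norm (\<iota> (x n s) - \<iota> (y n s)))" for n
  proof -
    have "nrm C (x n \<ominus>\<^bsub>C\<^esub> y n) \<le> (\<Sum>s\<in>carrier G. nrm A ((x n \<ominus>\<^bsub>C\<^esub> y n) s))"
      by (intro nrm_C_le_l1 C_minus_closed xc yc)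
    also have "\<dots> = (\<Sum>s\<in>carrier G. norm (\<iota> (x n s) - \<iota> (y n s)))"
      using xc yc by (intro sum.cong) (simp_all add: C_minus C_app UA.R.minus_closed norm_emb[OF A, symmetric] em(5))
    finally show ?thesis .
  qed
  then show "\<forall>\<^sub>F n in sequentially. nrm C (x n \<ominus>\<^bsub>C\<^esub> y n) \<le> (\<Sum>s\<in>carrier G. norm (\<iota> (x n s) - \<iota> (y n s)))" by simp
  show "(\<lambda>n. \<Sum>s\<in>carrier G. norm (\<iota> (x n s) - \<iota> (y n s))) \<longlonglongrightarrow> 0"
    using lim by (intro tendsto_null_sum tendsto_norm_zero)
qed

end

section \<open>Sequences of towers and the homomorphism they induce\<close>

locale tower_sequence = unital_action G A \<alpha>
  for G :: "('g, 'k) monoid_scheme" (structure) and A :: "'a cstar" and \<alpha> :: "'g \<Rightarrow> 'a \<Rightarrow> 'a" +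
  fixes e :: "nat \<Rightarrow> 'g \<Rightarrow> 'a"
  assumes proj: "\<And>n g. g \<in> carrier G \<Longrightarrow> e n g \<in> projections A"
    and orth: "\<And>n g h. g \<in> carrier G \<Longrightarrow> h \<in> carrier G \<Longrightarrow> g \<noteq> h \<Longrightarrow> emb A (e n g) * emb A (e n h) = 0"
    and shift: "\<And>g h. g \<in> carrier G \<Longrightarrow> h \<in> carrier G \<Longrightarrow> (\<lambda>n. al g (emb A (e n h)) - emb A (e n (g \<otimes> h))) \<longlonglongrightarrow> 0"
    and comm: "\<And>g a. g \<in> carrier G \<Longrightarrow> a \<in> carrier A \<Longrightarrow> (\<lambda>n. emb A (e n g) * emb A a - emb A a * emb A (e n g)) \<longlonglongrightarrow> 0"
begin

lemmas ep = UA.projectionsD[OF proj]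

text \<open>Equivariance and centrality combined: asymptotically a tower projection may be moved to
  the other side of a fixed element and replaced there by a translate. This is how tower sums pass
  the implementing unitaries.\<close>

lemma shift_comm:
  assumes s: "s \<in> carrier G" and h: "h \<in> carrier G" and a: "a \<in> carrier A"
  shows "(\<lambda>n. \<iota> (e n (s \<otimes> h)) * \<iota> a - \<iota> a * al s (\<iota> (e n h))) \<longlonglongrightarrow> 0"
proof -
  have "(\<lambda>n. \<iota> a * (al s (\<iota> (e n h)) - \<iota> (e n (s \<otimes> h))) * 1) \<longlonglongrightarrow> 0"
    by (rule null_sandwich[OF shift[OF s h]]) (rule order_refl)
  from tendsto_diff[OF comm[OF m_closed[OF s h] a] this] show ?thesis by (simp add: algebra_simps)
qed

definition \<Psi> :: "nat \<Rightarrow> ('g \<Rightarrow> 'g \<Rightarrow> 'a) \<Rightarrow> 'g \<Rightarrow> 'a" where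
  "\<Psi> n F = (\<lambda>s\<in>carrier G. \<Oplus>\<^bsub>A\<^esub>h\<in>carrier G. e n h \<otimes>\<^bsub>A\<^esub> F s h)"

definition \<psi> :: "('g \<Rightarrow> 'g \<Rightarrow> 'a) \<Rightarrow> (nat \<Rightarrow> 'g \<Rightarrow> 'a) set" where
  "\<psi> F = seq_class C (\<lambda>n. \<Psi> n F)"

lemma \<Psi>_app:
  assumes F: "F \<in> carrier D"
  shows "\<Psi> n F \<in> carrier C" "s \<in> carrier G \<Longrightarrow> \<iota> (\<Psi> n F s) = (\<Sum>h\<in>carrier G. \<iota> (e n h) * \<iota> (F s h))"
proof -
  have c: "(\<lambda>h. e n h \<otimes>\<^bsub>A\<^esub> F s h) \<in> carrier G \<rightarrow> carrier A" if "s \<in> carrier G" for s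
    using F that ep(1) by (auto simp: cl D_app_closed)
  show "\<Psi> n F \<in> carrier C"
    unfolding \<Psi>_def crossed_product_ops(1) by (intro restrict_PiE_iff[THEN iffD2] ballI UA.R.finsum_closed c)
  assume s: "s \<in> carrier G"
  have "\<iota> (\<Psi> n F s) = (\<Sum>h\<in>carrier G. \<iota> (e n h \<otimes>\<^bsub>A\<^esub> F s h))"
    using s emb_finsum[OF A c[OF s]] by (simp add: \<Psi>_def)
  then show "\<iota> (\<Psi> n F s) = (\<Sum>h\<in>carrier G. \<iota> (e n h) * \<iota> (F s h))"
    using F s ep(1) by (simp add: em(3) D_app_closed)
qed

lemma \<Psi>_linf:
  assumes F: "F \<in> carrier D"
  shows "(\<lambda>n. \<Psi> n F) \<in> carrier (linf C)"
proof (rule UC.linfI)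
  fix n
  show "\<Psi> n F \<in> carrier C" by (rule \<Psi>_app(1)[OF F])
  have "nrm C (\<Psi> n F) \<le> (\<Sum>s\<in>carrier G. nrm A (\<Psi> n F s))" by (rule nrm_C_le_l1[OF \<Psi>_app(1)[OF F]])
  also have "\<dots> \<le> (\<Sum>s\<in>carrier G. \<Sum>h\<in>carrier G. norm (\<iota> (F s h)))"
  proof (rule sum_mono)
    fix s assume s: "s \<in> carrier G"
    have "nrm A (\<Psi> n F s) = norm (\<Sum>h\<in>carrier G. \<iota> (e n h) * \<iota> (F s h))"
      using s norm_emb[OF A C_app[OF \<Psi>_app(1)[OF F] s], of n] by (simp add: \<Psi>_app(2)[OF F])
    also have "\<dots> \<le> (\<Sum>h\<in>carrier G. norm (\<iota> (e n h) * \<iota> (F s h)))" by (rule norm_sum)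
    also have "\<dots> \<le> (\<Sum>h\<in>carrier G. norm (\<iota> (F s h)))"
    proof (rule sum_mono)
      fix h assume h: "h \<in> carrier G"
      show "norm (\<iota> (e n h) * \<iota> (F s h)) \<le> norm (\<iota> (F s h))"
        using order_trans[OF norm_mult_ineq mult_right_mono[OF ep(6)[OF h] norm_ge_zero]] by simp
    qed
    finally show "nrm A (\<Psi> n F s) \<le> (\<Sum>h\<in>carrier G. norm (\<iota> (F s h)))" .
  qed
  finally show "nrm C (\<Psi> n F) \<le> (\<Sum>s\<in>carrier G. \<Sum>h\<in>carrier G. norm (\<iota> (F s h)))" .
qed

text \<open>The product of two images is a triple sum with two tower projections in each term.
  Equivariance turns the translated projection into \<open>e n k\<close>, centrality moves it next
  to \<open>e n h\<close>, and orthogonality leaves the diagonal \<open>h = k\<close>, which is the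
  image of the product.\<close>

lemma \<psi>_mult:
  assumes F: "F \<in> carrier D" and H: "H \<in> carrier D"
  shows "\<psi> (F \<otimes>\<^bsub>D\<^esub> H) = \<psi> F \<otimes>\<^bsub>seq_alg C\<^esub> \<psi> H"
proof -
  interpret TT: unital_action G "CG_tensor G A" "tensor_action G A \<alpha>" by (rule tensor_unital_action)
  have FH: "F \<otimes>\<^bsub>D\<^esub> H \<in> carrier D" using F H by (rule TT.C_closed)
  have "seq_class C (\<lambda>n. \<Psi> n (F \<otimes>\<^bsub>D\<^esub> H)) = seq_class C (\<lambda>n. \<Psi> n F \<otimes>\<^bsub>C\<^esub> \<Psi> n H)"
  proof (rule seq_class_C_eqI)
    fix s assume s: "s \<in> carrier G"
    define b where "b t k = al t (\<iota> (H (inv t \<otimes> s) (inv t \<otimes> k)))" for t k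
    define u where "u n t h k = \<iota> (e n h) * \<iota> (F t h) * al t (\<iota> (e n (inv t \<otimes> k))) * b t k" for n t h k
    have l: "\<iota> ((\<Psi> n F \<otimes>\<^bsub>C\<^esub> \<Psi> n H) s) = (\<Sum>t\<in>carrier G. \<Sum>h\<in>carrier G. \<Sum>k\<in>carrier G. u n t h k)" for n
    proof -
      have "al t (\<iota> (\<Psi> n H (inv t \<otimes> s))) = (\<Sum>k\<in>carrier G. al t (\<iota> (e n (inv t \<otimes> k))) * b t k)"
        if t: "t \<in> carrier G" for t
      proof -
        have "al t (\<iota> (\<Psi> n H (inv t \<otimes> s))) = al t (\<Sum>k\<in>carrier G. \<iota> (e n (inv t \<otimes> k)) * \<iota> (H (inv t \<otimes> s) (inv t \<otimes> k)))"
          using s t sum_translate[of "inv t" "\<lambda>k. \<iota> (e n k) * \<iota> (H (inv t \<otimes> s) k)"] by (simp add: \<Psi>_app(2)[OF H])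
        then show ?thesis using t by (simp add: al_sum al_mult b_def)
      qed
      then show ?thesis
        using s by (simp add: emb_C_mult \<Psi>_app F H sum_product u_def mult.assoc)
    qed
    have r: "\<iota> (\<Psi> n (F \<otimes>\<^bsub>D\<^esub> H) s) =
        (\<Sum>t\<in>carrier G. \<Sum>h\<in>carrier G. \<Sum>k\<in>carrier G. if h = k then \<iota> (e n h) * \<iota> (F t h) * b t k else 0)" for n
    proof -
      have "\<iota> (\<Psi> n (F \<otimes>\<^bsub>D\<^esub> H) s) = (\<Sum>h\<in>carrier G. \<Sum>t\<in>carrier G. \<iota> (e n h) * \<iota> (F t h) * b t h)"
        using s F H by (simp add: \<Psi>_app(2)[OF FH] D_mult_app b_def sum_distrib_left mult.assoc)
      also have "\<dots> = (\<Sum>t\<in>carrier G. \<Sum>h\<in>carrier G. \<iota> (e n h) * \<iota> (F t h) * b t h)" by (rule sum.swap)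
      finally show ?thesis using fin by simp
    qed
    have "(\<lambda>n. (if h = k then \<iota> (e n h) * \<iota> (F t h) * b t k else 0) - u n t h k) \<longlonglongrightarrow> 0"
      if t: "t \<in> carrier G" and h: "h \<in> carrier G" and k: "k \<in> carrier G" for t h k
    proof -
      define f where "f = \<iota> (F t h)"
      have tk: "inv t \<otimes> k \<in> carrier G" "t \<otimes> (inv t \<otimes> k) = k" using t k by (simp_all flip: m_assoc)
      have n1: "norm (\<iota> (e n h) * f) \<le> norm f" for n
        using order_trans[OF norm_mult_ineq mult_right_mono[OF ep(6)[OF h] norm_ge_zero]] by simp
      have 1: "(\<lambda>n. (\<iota> (e n h) * f) * (al t (\<iota> (e n (inv t \<otimes> k))) - \<iota> (e n k)) * b t k) \<longlonglongrightarrow> 0"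
        using null_sandwich[OF shift[OF t tk(1)] n1] by (simp add: tk(2))
      have 2: "(\<lambda>n. \<iota> (e n h) * (\<iota> (e n k) * f - f * \<iota> (e n k)) * b t k) \<longlonglongrightarrow> 0"
        unfolding f_def using F t h by (intro null_sandwich[OF comm[OF k] ep(6)[OF h]] D_app_closed)
      have "\<iota> (e n h) * \<iota> (e n k) = (if h = k then \<iota> (e n h) else 0)" for n
        using orth[OF h k] ep(4)[OF h] by auto
      \<comment> \<open>By orthogonality the diagonal term is \<open>e(h) e(k) f b\<close>.
        Subtracting \<open>u\<close> leaves a commutator term and an equivariance term, the null
        sequences \<open>2\<close> and \<open>1\<close>.\<close>
      then have E: "(if h = k then \<iota> (e n h) * f * b t k else 0) - u n t h k =
          \<iota> (e n h) * (\<iota> (e n k) * f - f * \<iota> (e n k)) * b t k -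
          (\<iota> (e n h) * f) * (al t (\<iota> (e n (inv t \<otimes> k))) - \<iota> (e n k)) * b t k" for n
        by (auto simp: u_def f_def[symmetric] algebra_simps simp flip: mult.assoc)
      show ?thesis using tendsto_diff[OF 2 1] by (simp only: E diff_zero f_def[symmetric])
    qed
    then have "(\<lambda>n. \<Sum>t\<in>carrier G. \<Sum>h\<in>carrier G. \<Sum>k\<in>carrier G.
        (if h = k then \<iota> (e n h) * \<iota> (F t h) * b t k else 0) - u n t h k) \<longlonglongrightarrow> 0"
      by (intro tendsto_null_sum)
    then show "(\<lambda>n. \<iota> (\<Psi> n (F \<otimes>\<^bsub>D\<^esub> H) s) - \<iota> ((\<Psi> n F \<otimes>\<^bsub>C\<^esub> \<Psi> n H) s)) \<longlonglongrightarrow> 0"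
      unfolding l r by (simp only: sum_subtractf)
  qed (intro \<Psi>_linf UC.linf_closed F H FH)+
  then show ?thesis by (simp add: \<psi>_def UC.seq_class_ops(1)[OF \<Psi>_linf[OF F] \<Psi>_linf[OF H]])
qed

text \<open>After the substitution of \<open>s \<otimes> h\<close> for \<open>h\<close>, the two
  sides differ by the exchange in \<open>shift_comm\<close>.\<close>

lemma \<psi>_star:
  assumes F: "F \<in> carrier D"
  shows "\<psi> (star D F) = star (seq_alg C) (\<psi> F)"
proof -
  interpret TT: unital_action G "CG_tensor G A" "tensor_action G A \<alpha>" by (rule tensor_unital_action)
  have FS: "star D F \<in> carrier D" using F by (rule TT.C_closed)
  have "seq_class C (\<lambda>n. \<Psi> n (star D F)) = seq_class C (\<lambda>n. star C (\<Psi> n F))"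
  proof (rule seq_class_C_eqI)
    fix s assume s: "s \<in> carrier G"
    define a where "a h = \<alpha> s (star A (F (inv s) h))" for h
    have a: "a h \<in> carrier A" "\<iota> (a h) = al s (adj (\<iota> (F (inv s) h)))" if "h \<in> carrier G" for h
      using s F that by (simp_all add: a_def act_simps cl D_app_closed al_emb flip: em(7))
    have "\<iota> (\<Psi> n (star D F) s) = (\<Sum>h\<in>carrier G. \<iota> (e n h) * \<iota> (a (inv s \<otimes> h)))" for n
      using s by (simp add: \<Psi>_app(2)[OF FS] D_star_app[OF F] a)
    also have "\<And>n. \<dots> n = (\<Sum>h\<in>carrier G. \<iota> (e n (s \<otimes> h)) * \<iota> (a h))"
      using s sum_translate[OF s, symmetric, of "\<lambda>h. \<iota> (e _ h) * \<iota> (a (inv s \<otimes> h))"] by (simp flip: m_assoc)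
    finally have 1: "\<iota> (\<Psi> n (star D F) s) = (\<Sum>h\<in>carrier G. \<iota> (e n (s \<otimes> h)) * \<iota> (a h))" for n .
    have 2: "\<iota> (star C (\<Psi> n F) s) = (\<Sum>h\<in>carrier G. \<iota> (a h) * al s (\<iota> (e n h)))" for n
      using s by (simp add: emb_C_star \<Psi>_app[OF F] adj_sum adj_mult al_sum al_mult ep a)
    show "(\<lambda>n. \<iota> (\<Psi> n (star D F) s) - \<iota> (star C (\<Psi> n F) s)) \<longlonglongrightarrow> 0"
      unfolding 1 2 sum_subtractf[symmetric] using s a by (intro tendsto_null_sum shift_comm)
  qed (intro \<Psi>_linf UC.linf_closed F FS)+
  then show ?thesis by (simp add: \<psi>_def UC.seq_class_ops(4)[OF \<Psi>_linf[OF F] \<Psi>_linf[OF F]])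
qed

lemma \<psi>_star_hom: "\<psi> \<in> star_hom D (seq_alg C)"
proof -
  interpret TT: unital_action G "CG_tensor G A" "tensor_action G A \<alpha>" by (rule tensor_unital_action)
  have closed: "\<psi> F \<in> carrier (seq_alg C)" if "F \<in> carrier D" for F
    unfolding \<psi>_def by (rule UC.seq_class_closed[OF \<Psi>_linf[OF that]])
  show ?thesis
    unfolding star_hom_def
  proof (intro CollectI conjI allI ballI)
    show "\<psi> \<in> hom D (seq_alg C)" by (rule homI) (auto simp: closed \<psi>_mult)
    show "\<psi> \<in> hom (add_monoid D) (add_monoid (seq_alg C))"
    proof (rule homI)
      fix F H assume "F \<in> carrier (add_monoid D)" "H \<in> carrier (add_monoid D)"
      then have FH: "F \<in> carrier D" "H \<in> carrier D" by simp_all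
      have "\<Psi> n (F \<oplus>\<^bsub>D\<^esub> H) = \<Psi> n F \<oplus>\<^bsub>C\<^esub> \<Psi> n H" for n
        using FH by (intro C_emb_eqI)
          (simp_all add: \<Psi>_app TT.C_closed C_closed emb_C_add D_add_smult_app distrib_left sum.distrib)
      then show "\<psi> (F \<otimes>\<^bsub>add_monoid D\<^esub> H) = \<psi> F \<otimes>\<^bsub>add_monoid (seq_alg C)\<^esub> \<psi> H"
        by (simp add: \<psi>_def UC.seq_class_ops(2)[OF \<Psi>_linf[OF FH(1)] \<Psi>_linf[OF FH(2)]])
    qed (simp add: closed)
    fix F assume F: "F \<in> carrier D"
    show "\<psi> (c \<odot>\<^bsub>D\<^esub> F) = c \<odot>\<^bsub>seq_alg C\<^esub> \<psi> F" for c
    proof -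
      have z: "u * (sc c * v) = sc c * (u * v)" for u v :: "'a cprod" by (metis mult.assoc sc_commute)
      have "\<Psi> n (c \<odot>\<^bsub>D\<^esub> F) = c \<odot>\<^bsub>C\<^esub> \<Psi> n F" for n
        using F by (intro C_emb_eqI)
          (simp_all add: \<Psi>_app TT.C_closed C_closed emb_C_smult D_add_smult_app sum_distrib_left z)
      then show ?thesis by (simp add: \<psi>_def UC.seq_class_ops(3)[OF \<Psi>_linf[OF F] \<Psi>_linf[OF F]])
    qed
    show "\<psi> (star D F) = star (seq_alg C) (\<psi> F)" by (rule \<psi>_star[OF F])
  qed
qed

definition gproj :: "(nat \<Rightarrow> 'g \<Rightarrow> 'a) set" where
  "gproj = seq_class C (\<lambda>n. base_incl (tower_sum (e n)))"

lemma tower_sum_facts: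
  shows "tower_sum (e n) \<in> projections A" "\<iota> (tower_sum (e n)) = (\<Sum>g\<in>carrier G. \<iota> (e n g))"
proof -
  have c: "e n \<in> carrier G \<rightarrow> carrier A" using ep(1) by blast
  show s: "\<iota> (tower_sum (e n)) = (\<Sum>g\<in>carrier G. \<iota> (e n g))" unfolding tower_sum_def by (rule emb_finsum[OF A c])
  have o: "\<iota> (e n g) * \<iota> (e n h) = (if g = h then \<iota> (e n g) else 0)" if "g \<in> carrier G" "h \<in> carrier G" for g h
    using orth that ep(4) by auto
  show "tower_sum (e n) \<in> projections A"
  proof (rule UA.projectionsI)
    show "tower_sum (e n) \<in> carrier A" unfolding tower_sum_def using c by (rule UA.R.finsum_closed)
  qed (simp_all add: s sum_product o fin adj_sum ep cong: sum.cong)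
qed

lemmas es = UA.projectionsD[OF tower_sum_facts(1)]

lemma base_incl_linf: "(\<lambda>n. base_incl (tower_sum (e n))) \<in> carrier (linf C)"
proof (rule UC.linfI)
  fix n
  show "base_incl (tower_sum (e n)) \<in> carrier C" using es by (simp add: base_incl_closed)
  show "nrm C (base_incl (tower_sum (e n))) \<le> 1"
    using UC.projectionsD(1,6)[OF base_incl_projection[OF tower_sum_facts(1)], of n] by (simp add: norm_emb[OF C_unital])
qed

lemma gproj_projection: "gproj \<in> projections (seq_alg C)"
proof -
  note M = UC.projectionsD[OF base_incl_projection[OF tower_sum_facts(1)]]
  show ?thesis
    unfolding gproj_def projections_def
    by (simp add: UC.seq_class_ops(1,4)[OF base_incl_linf base_incl_linf] UC.seq_class_closed[OF base_incl_linf] M(2,3))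
qed

text \<open>Multiplying by the tower sums from the left reproduces the image exactly; from the right
  it does so only asymptotically, because the sums have to pass the implementing unitaries. That
  both products have the same class is the centrality of \<open>gproj\<close>.\<close>

lemma gproj_const:
  assumes x: "x \<in> carrier C"
  shows "const_embed C x \<otimes>\<^bsub>seq_alg C\<^esub> gproj = \<psi> (crossed_hom G (unit_tensor G A) x)"
    and "gproj \<otimes>\<^bsub>seq_alg C\<^esub> const_embed C x = \<psi> (crossed_hom G (unit_tensor G A) x)"
proof -
  note P = \<Psi>_app[OF crossed_hom_closed[OF x]]
  have l: "(\<lambda>n. x \<otimes>\<^bsub>C\<^esub> base_incl (tower_sum (e n))) \<in> carrier (linf C)" "(\<lambda>n. base_incl (tower_sum (e n)) \<otimes>\<^bsub>C\<^esub> x) \<in> carrier (linf C)"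
    using UC.linf_closed(5)[OF UC.linf_const[OF x] base_incl_linf] UC.linf_closed(5)[OF base_incl_linf UC.linf_const[OF x]] .
  have p: "\<iota> (\<Psi> n (crossed_hom G (unit_tensor G A) x) s) = (\<Sum>h\<in>carrier G. \<iota> (e n h) * \<iota> (x s))" if "s \<in> carrier G" for n s
    using that x by (simp add: P crossed_hom_app)
  have "seq_class C (\<lambda>n. \<Psi> n (crossed_hom G (unit_tensor G A) x)) = seq_class C (\<lambda>n. x \<otimes>\<^bsub>C\<^esub> base_incl (tower_sum (e n)))"
  proof (rule seq_class_C_eqI[OF \<Psi>_linf[OF crossed_hom_closed[OF x]] l(1)])
    fix s assume s: "s \<in> carrier G"
    have 1: "\<iota> (\<Psi> n (crossed_hom G (unit_tensor G A) x) s) = (\<Sum>h\<in>carrier G. \<iota> (e n (s \<otimes> h)) * \<iota> (x s))" for n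
      using p[OF s, of n] sum_translate[OF s, of "\<lambda>h. \<iota> (e n h) * \<iota> (x s)"] by simp
    have 2: "\<iota> ((x \<otimes>\<^bsub>C\<^esub> base_incl (tower_sum (e n))) s) = (\<Sum>h\<in>carrier G. \<iota> (x s) * al s (\<iota> (e n h)))" for n
    proof -
      have "\<iota> ((x \<otimes>\<^bsub>C\<^esub> base_incl (tower_sum (e n))) s) = \<iota> (x s) * al s (\<iota> (tower_sum (e n)))"
        using s x es(1) by (simp add: base_incl_right em(3) C_app act_simps al_emb)
      then show ?thesis using s by (simp add: tower_sum_facts(2) al_sum sum_distrib_left)
    qed
    show "(\<lambda>n. \<iota> (\<Psi> n (crossed_hom G (unit_tensor G A) x) s) - \<iota> ((x \<otimes>\<^bsub>C\<^esub> base_incl (tower_sum (e n))) s)) \<longlonglongrightarrow> 0"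
      unfolding 1 2 sum_subtractf[symmetric] using s x by (intro tendsto_null_sum shift_comm C_app)
  qed
  then show "const_embed C x \<otimes>\<^bsub>seq_alg C\<^esub> gproj = \<psi> (crossed_hom G (unit_tensor G A) x)"
    by (simp add: const_embed_def gproj_def \<psi>_def UC.seq_class_ops(1)[OF UC.linf_const[OF x] base_incl_linf])
  have "\<Psi> n (crossed_hom G (unit_tensor G A) x) = base_incl (tower_sum (e n)) \<otimes>\<^bsub>C\<^esub> x" for n
    using x es(1) by (intro C_emb_eqI P(1))
      (simp_all add: p base_incl_left em(3) C_app C_closed base_incl_closed tower_sum_facts(2) sum_distrib_right)
  then show "gproj \<otimes>\<^bsub>seq_alg C\<^esub> const_embed C x = \<psi> (crossed_hom G (unit_tensor G A) x)"
    by (simp add: const_embed_def gproj_def \<psi>_def UC.seq_class_ops(1)[OF base_incl_linf UC.linf_const[OF x]])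
qed

lemma gproj_central: "gproj \<in> central_seq_alg C"
  using gproj_const gproj_projection by (simp add: central_seq_alg_def projections_def)

text \<open>Nonzero projections have norm 1, so the sequence of tower sums cannot be null.\<close>

lemma gproj_nonzero:
  assumes "\<And>n. tower_sum (e n) \<noteq> \<zero>\<^bsub>A\<^esub>"
  shows "gproj \<noteq> \<zero>\<^bsub>seq_alg C\<^esub>"
proof
  assume "gproj = \<zero>\<^bsub>seq_alg C\<^esub>"
  then have "(\<lambda>n. nrm C (base_incl (tower_sum (e n)) \<ominus>\<^bsub>C\<^esub> \<zero>\<^bsub>C\<^esub>)) \<longlonglongrightarrow> 0"
    unfolding gproj_def UC.seq_alg_zero by (subst (asm) UC.seq_class_eq_iff) (auto intro: base_incl_linf UC.linf_const C_closed)
  moreover have "nrm C (base_incl (tower_sum (e n)) \<ominus>\<^bsub>C\<^esub> \<zero>\<^bsub>C\<^esub>) = 1" for n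
  proof -
    note M = UC.projectionsD[OF base_incl_projection[OF tower_sum_facts(1)], of n]
    have "(norm (\<kappa> (base_incl (tower_sum (e n)))))\<^sup>2 = norm (\<kappa> (base_incl (tower_sum (e n))))"
      using norm_square_sa[OF M(5)] M(4) by simp
    moreover have "norm (\<kappa> (base_incl (tower_sum (e n)))) \<noteq> 0"
      using assms[of n] base_incl_eq_zero[OF es(1)] M(1) by (simp add: norm_emb[OF C_unital] UC.un)
    ultimately have "nrm C (base_incl (tower_sum (e n))) = 1"
      using M(1) by (simp add: power2_eq_square norm_emb[OF C_unital])
    moreover have "base_incl (tower_sum (e n)) \<ominus>\<^bsub>C\<^esub> \<zero>\<^bsub>C\<^esub> = base_incl (tower_sum (e n))" using M(1) by (simp add: a_minus_def)
    ultimately show ?thesis by simp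
  qed
  ultimately show False by (simp add: LIMSEQ_const_iff)
qed

end

section \<open>From single towers to the splitting\<close>

context unital_action
begin

text \<open>The tower with index \<open>n\<close> is tested against the first \<open>n + 1\<close>
  members of a dense sequence with tolerance \<open>1 / (n + 1)\<close>. A general element is within
  \<open>r / 3\<close> of some \<open>d m\<close>, and as the tower projections are contractions,
  the replacement costs \<open>r / 3\<close> on each side of the commutator.\<close>

lemma tower_sequenceI:
  assumes dense: "range d \<subseteq> carrier A" "\<And>a r. a \<in> carrier A \<Longrightarrow> r > 0 \<Longrightarrow> \<exists>m. nrm A (a \<ominus>\<^bsub>A\<^esub> d m) < r"
    and tow: "\<And>n. tower (d ` {..n}) (inverse (real (Suc n))) (e n)"
  shows "tower_sequence G A \<alpha> e"
proof -
  have sub: "d ` {..n} \<subseteq> carrier A" for n using dense(1) by blast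
  have null: "u \<longlonglongrightarrow> 0" if "\<And>n. norm (u n) \<le> inverse (real (Suc n))" for u :: "nat \<Rightarrow> 'a cprod"
    by (rule Lim_null_comparison[OF _ LIMSEQ_inverse_real_of_nat]) (use that in simp)
  note ep = tp[OF tow sub]
  have comm: "(\<lambda>n. \<iota> (e n g) * \<iota> a - \<iota> a * \<iota> (e n g)) \<longlonglongrightarrow> 0" if g: "g \<in> carrier G" and a: "a \<in> carrier A" for g a
  proof (rule LIMSEQ_I)
    fix r :: real assume r: "r > 0"
    then obtain m where m: "nrm A (a \<ominus>\<^bsub>A\<^esub> d m) < r / 3" using dense(2)[OF a, of "r / 3"] by auto
    obtain k where k: "inverse (real (Suc k)) < r / 3" using r reals_Archimedean[of "r / 3"] by auto
    have dm: "d m \<in> carrier A" using dense(1) by blast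
    have ad: "norm (\<iota> a - \<iota> (d m)) < r / 3"
      using m a dm norm_emb[OF A, of "a \<ominus>\<^bsub>A\<^esub> d m"] by (simp add: em(5) UA.R.minus_closed)
    have "norm (\<iota> (e n g) * \<iota> a - \<iota> a * \<iota> (e n g)) < r" if n: "n \<ge> max m k" for n
    proof -
      define u x y where "u = \<iota> (e n g)" and "x = \<iota> a" and "y = \<iota> (d m)"
      have u: "norm u \<le> 1" using ep(6)[OF g] by (simp add: u_def)
      have tri: "norm (a + b - c) \<le> norm a + norm b + norm c" for a b c :: "'a cprod"
        using norm_triangle_ineq4[of "a + b" c] norm_triangle_ineq[of a b] by linarith
      have eq: "u * x - x * u = (u * y - y * u) + u * (x - y) - (x - y) * u" by (simp add: algebra_simps)
      have "norm (u * x - x * u) \<le> norm (u * y - y * u) + norm (u * (x - y)) + norm ((x - y) * u)"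
        unfolding eq by (rule tri)
      moreover have "norm (u * y - y * u) \<le> inverse (real (Suc n))"
        unfolding u_def y_def using n by (intro tower_comm[OF tow sub g]) auto
      moreover have "inverse (real (Suc n)) \<le> inverse (real (Suc k))" using n by (intro le_imp_inverse_le) auto
      moreover have "norm (u * (x - y)) \<le> norm (x - y)" "norm ((x - y) * u) \<le> norm (x - y)"
        using order_trans[OF norm_mult_ineq mult_right_mono[OF u norm_ge_zero], of "x - y"]
          order_trans[OF norm_mult_ineq mult_left_mono[OF u norm_ge_zero], of "x - y"] by simp_all
      ultimately have "norm (u * x - x * u) < r"
        using ad[folded x_def y_def] k by linarith
      then show ?thesis by (simp add: u_def x_def)
    qed
    then show "\<exists>no. \<forall>n\<ge>no. norm (\<iota> (e n g) * \<iota> a - \<iota> a * \<iota> (e n g) - 0) < r" by (intro exI[of _ "max m k"]) simp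
  qed
  show ?thesis
  proof (intro tower_sequence.intro tower_sequence_axioms.intro unital_action_axioms)
    show "e n g \<in> projections A" if "g \<in> carrier G" for n g by (rule tower_proj[OF tow sub that])
    show "\<iota> (e n g) * \<iota> (e n h) = 0" if "g \<in> carrier G" "h \<in> carrier G" "g \<noteq> h" for n g h
      using tower_orth[OF tow sub that(1,2)] that(3) by simp
    show "(\<lambda>n. al g (\<iota> (e n h)) - \<iota> (e n (g \<otimes> h))) \<longlonglongrightarrow> 0" if "g \<in> carrier G" "h \<in> carrier G" for g h
      by (rule null[OF tower_act[OF tow sub that]])
  qed (rule comm)
qed

end

context tracial_action
begin

lemma C_one_neq_zero: "\<one>\<^bsub>C\<^esub> \<noteq> \<zero>\<^bsub>C\<^esub>"
  using base_incl_eq_zero[of "\<one>\<^bsub>A\<^esub>"] one_neq_zero by (simp add: base_incl_one cl)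

lemma spectral_cutdown_sequence:
  assumes z: "z \<in> seq_alg_pp C"
  obtains x f y where "x \<in> carrier (linf C)" "z = seq_class C x" "f \<in> carrier (linf C)"
    "\<forall>n. y n \<in> carrier C \<and> star C (y n) = y n \<and> y n \<noteq> \<zero>\<^bsub>C\<^esub>"
    "\<forall>\<^sub>F n in sequentially. y n \<otimes>\<^bsub>C\<^esub> (f n \<otimes>\<^bsub>C\<^esub> x n) = y n \<and> x n \<otimes>\<^bsub>C\<^esub> (f n \<otimes>\<^bsub>C\<^esub> y n) = y n"
proof -
  obtain w \<delta> N where w: "w \<in> carrier (linf C)" and \<delta>: "\<delta> > 0"
    and zw: "z = seq_class C (\<lambda>n. star C (w n) \<otimes>\<^bsub>C\<^esub> w n)"
    and lower: "\<And>n. n \<ge> N \<Longrightarrow> \<delta> < nrm C (star C (w n) \<otimes>\<^bsub>C\<^esub> w n)"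
    using UC.seq_alg_pp_bounded_below[OF z] by blast
  define x where "x = (\<lambda>n. star C (w n) \<otimes>\<^bsub>C\<^esub> w n)"
  have x: "x \<in> carrier (linf C)" unfolding x_def using w by (intro UC.linf_closed)
  have "\<exists>y f. y \<in> carrier C \<and> f \<in> carrier C \<and> star C y = y \<and> y \<noteq> \<zero>\<^bsub>C\<^esub> \<and> nrm C f \<le> 2 / \<delta> \<and>
      (n \<ge> N \<longrightarrow> y \<otimes>\<^bsub>C\<^esub> (f \<otimes>\<^bsub>C\<^esub> x n) = y \<and> x n \<otimes>\<^bsub>C\<^esub> (f \<otimes>\<^bsub>C\<^esub> y) = y)" for n
  proof (cases "n \<ge> N")
    case True
    obtain y f where "y \<in> carrier C" "f \<in> carrier C" "star C y = y" "y \<noteq> \<zero>\<^bsub>C\<^esub>" "nrm C f \<le> 2 / \<delta>"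
      "y \<otimes>\<^bsub>C\<^esub> (f \<otimes>\<^bsub>C\<^esub> x n) = y" "x n \<otimes>\<^bsub>C\<^esub> (f \<otimes>\<^bsub>C\<^esub> y) = y"
      using carrier_spectral_cutdown[OF C_unital UC.linf_app[OF w] refl \<delta> lower[OF True]] unfolding x_def by blast
    then show ?thesis by blast
  next
    case False
    \<comment> \<open>Below \<open>N\<close> no lower bound is available, but \<open>y n\<close>
      must be self-adjoint and nonzero for every \<open>n\<close>. The unit serves as default, with
      \<open>f n\<close> zero, and the cut-down equations are claimed only from \<open>N\<close>
      on.\<close>
    have "star C \<one>\<^bsub>C\<^esub> = \<one>\<^bsub>C\<^esub>" by (rule unital_star_one[OF C_unital])
    moreover have "nrm C \<zero>\<^bsub>C\<^esub> = 0" by (simp add: UC.un)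
    ultimately show ?thesis using False \<delta> C_one_neq_zero by (intro exI[of _ "\<one>\<^bsub>C\<^esub>"] exI[of _ "\<zero>\<^bsub>C\<^esub>"]) (simp add: UC.us)
  qed
  then obtain y f where yf: "\<And>n. y n \<in> carrier C \<and> f n \<in> carrier C \<and> star C (y n) = y n \<and> y n \<noteq> \<zero>\<^bsub>C\<^esub> \<and>
      nrm C (f n) \<le> 2 / \<delta> \<and> (n \<ge> N \<longrightarrow> y n \<otimes>\<^bsub>C\<^esub> (f n \<otimes>\<^bsub>C\<^esub> x n) = y n \<and> x n \<otimes>\<^bsub>C\<^esub> (f n \<otimes>\<^bsub>C\<^esub> y n) = y n)"
    by metis
  have "f \<in> carrier (linf C)" by (rule UC.linfI[of _ "2 / \<delta>"]) (use yf in auto)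
  moreover have "\<forall>\<^sub>F n in sequentially. y n \<otimes>\<^bsub>C\<^esub> (f n \<otimes>\<^bsub>C\<^esub> x n) = y n \<and> x n \<otimes>\<^bsub>C\<^esub> (f n \<otimes>\<^bsub>C\<^esub> y n) = y n"
    using yf by (intro eventually_sequentiallyI[of N]) blast
  ultimately show ?thesis using yf x zw[folded x_def] by (intro that[of x f y]) blast+
qed

lemma tracial_splitting:
  assumes sep: "separable_cstar A" and z: "z \<in> seq_alg_pp C"
  shows "\<exists>\<psi>\<in>star_hom D (seq_alg C). \<exists>g\<in>projections (seq_alg C) \<inter> central_seq_alg C. g \<noteq> \<zero>\<^bsub>seq_alg C\<^esub> \<and>
    (\<forall>a\<in>carrier C. \<psi> (crossed_hom G (unit_tensor G A) a) = const_embed C a \<otimes>\<^bsub>seq_alg C\<^esub> g) \<and>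
    (\<exists>q\<in>projections (seq_alg C) \<inter> hereditary_subalgebra (seq_alg C) z.
      mvn_equivalent (seq_alg C) (\<one>\<^bsub>seq_alg C\<^esub> \<ominus>\<^bsub>seq_alg C\<^esub> g) q)"
proof -
  obtain x f y where x: "x \<in> carrier (linf C)" "z = seq_class C x" and f: "f \<in> carrier (linf C)"
    and y': "\<forall>n. y n \<in> carrier C \<and> star C (y n) = y n \<and> y n \<noteq> \<zero>\<^bsub>C\<^esub>"
    and cut: "\<forall>\<^sub>F n in sequentially. y n \<otimes>\<^bsub>C\<^esub> (f n \<otimes>\<^bsub>C\<^esub> x n) = y n \<and> x n \<otimes>\<^bsub>C\<^esub> (f n \<otimes>\<^bsub>C\<^esub> y n) = y n"
    using spectral_cutdown_sequence[OF z] .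
  have y: "y n \<in> carrier C" "star C (y n) = y n" "y n \<noteq> \<zero>\<^bsub>C\<^esub>" for n using y' by blast+
  obtain S where S: "countable S \<and> S \<subseteq> carrier A \<and> (\<forall>x\<in>carrier A. \<forall>e>0. \<exists>d\<in>S. nrm A (x \<ominus>\<^bsub>A\<^esub> d) < e)"
    using sep unfolding pre_cstar_algebra.separable_cstar_iff[OF unital_pre[OF A]] by (rule exE)
  then have "S \<noteq> {}" using UA.R.one_closed zero_less_one[where 'a = real] by blast
  then have rS: "range (from_nat_into S) = S" using S by (intro range_from_nat_into) auto
  define d where "d = from_nat_into S"
  have d: "range d \<subseteq> carrier A" "\<exists>m. nrm A (a \<ominus>\<^bsub>A\<^esub> d m) < r" if "a \<in> carrier A" "r > 0" for a r
  proof -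
    show "range d \<subseteq> carrier A" using rS S by (simp add: d_def)
    obtain s where "s \<in> S" "nrm A (a \<ominus>\<^bsub>A\<^esub> s) < r" using S \<open>a \<in> carrier A\<close> \<open>r > 0\<close> by blast
    then show "\<exists>m. nrm A (a \<ominus>\<^bsub>A\<^esub> d m) < r" using rS unfolding d_def by (metis rangeE)
  qed
  have dc: "range d \<subseteq> carrier A" using d(1)[OF UA.R.one_closed zero_less_one] .
  have "\<exists>e. good_tower (y n) (d ` {..n}) (inverse (real (Suc n))) e" for n
    using dc by (intro good_tower_exists y) auto
  then obtain e where e: "\<And>n. good_tower (y n) (d ` {..n}) (inverse (real (Suc n))) (e n)" by metis
  interpret E: tower_sequence G A \<alpha> e
    by (rule tower_sequenceI[OF dc d(2)]) (use e in \<open>simp_all add: good_tower_def\<close>)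
  have "\<exists>v c. v \<in> carrier C \<and> c \<in> carrier C \<and> star C v \<otimes>\<^bsub>C\<^esub> v = base_incl (\<one>\<^bsub>A\<^esub> \<ominus>\<^bsub>A\<^esub> tower_sum (e n)) \<and>
      v \<otimes>\<^bsub>C\<^esub> star C v = y n \<otimes>\<^bsub>C\<^esub> c \<otimes>\<^bsub>C\<^esub> y n" for n
    using e[of n] unfolding good_tower_def by blast
  then obtain v c where vc: "\<And>n. v n \<in> carrier C \<and> c n \<in> carrier C \<and> star C (v n) \<otimes>\<^bsub>C\<^esub> v n = base_incl (\<one>\<^bsub>A\<^esub> \<ominus>\<^bsub>A\<^esub> tower_sum (e n)) \<and>
      v n \<otimes>\<^bsub>C\<^esub> star C (v n) = y n \<otimes>\<^bsub>C\<^esub> c n \<otimes>\<^bsub>C\<^esub> y n" by metis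
  have v: "v n \<in> carrier C" "c n \<in> carrier C" "star C (v n) \<otimes>\<^bsub>C\<^esub> v n = base_incl (\<one>\<^bsub>A\<^esub> \<ominus>\<^bsub>A\<^esub> tower_sum (e n))"
    "v n \<otimes>\<^bsub>C\<^esub> star C (v n) = y n \<otimes>\<^bsub>C\<^esub> c n \<otimes>\<^bsub>C\<^esub> y n" for n using vc by blast+
  have P: "base_incl (\<one>\<^bsub>A\<^esub> \<ominus>\<^bsub>A\<^esub> tower_sum (e n)) \<in> projections C" for n
    by (rule base_incl_projection[OF UA.one_minus_projection[OF E.tower_sum_facts(1)]])
  note P = UC.projectionsD[OF P]
  have vv: "adj (\<kappa> (v n)) * \<kappa> (v n) = \<kappa> (base_incl (\<one>\<^bsub>A\<^esub> \<ominus>\<^bsub>A\<^esub> tower_sum (e n)))" for n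
    using v(1)[of n] by (simp add: UC.em(3,7) C_closed flip: v(3))
  have vl: "v \<in> carrier (linf C)"
  proof (rule UC.linfI[of _ 1])
    fix n
    have "(norm (\<kappa> (v n)))\<^sup>2 \<le> 1\<^sup>2" using vv[of n] P(6)[of n] norm_adj_mult[of "\<kappa> (v n)"] by simp
    then have "norm (\<kappa> (v n)) \<le> 1" by (rule power2_le_imp_le) simp
    then show "nrm C (v n) \<le> 1" using v(1) by (simp add: norm_emb[OF C_unital])
  qed (rule v)
  have sl: "(\<lambda>n. star C (v n)) \<in> carrier (linf C)" using vl by (rule UC.linf_closed)
  define s where "s = (\<lambda>n. v n \<otimes>\<^bsub>C\<^esub> star C (v n))"
  have sC: "s \<in> carrier (linf C)" unfolding s_def using vl sl by (rule UC.linf_closed)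
  define q where "q = seq_class C s"
  have "s n \<otimes>\<^bsub>C\<^esub> s n = s n" "star C (s n) = s n" for n
  proof -
    have "\<kappa> (v n) * adj (\<kappa> (v n)) * \<kappa> (v n) = \<kappa> (v n)" by (rule partial_isometry(2)[OF vv P(4)])
    then show "s n \<otimes>\<^bsub>C\<^esub> s n = s n"
      using v(1)[of n] by (intro UC.eqI) (simp_all add: s_def C_closed UC.em(3,7) flip: mult.assoc)
    show "star C (s n) = s n" using v(1)[of n] by (simp add: s_def C_star_mult C_closed UC.us)
  qed
  then have qp: "q \<in> projections (seq_alg C)"
    unfolding q_def projections_def by (simp add: UC.seq_class_ops(1,4)[OF sC sC] UC.seq_class_closed[OF sC])
  \<comment> \<open>No bound on \<open>c n\<close> is known, so the middle factor is built from the
    projection \<open>s n\<close> and the bounded sequence \<open>f\<close>. Wherever the cut-down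
    equations hold, \<open>x n\<close> times \<open>b n\<close> times \<open>x n\<close> collapses
    to \<open>s n\<close>.\<close>
  define b where "b = (\<lambda>n. f n \<otimes>\<^bsub>C\<^esub> s n \<otimes>\<^bsub>C\<^esub> f n)"
  have b: "b \<in> carrier (linf C)" unfolding b_def using f sC by (intro UC.linf_closed)
  have xbx: "(\<lambda>n. x n \<otimes>\<^bsub>C\<^esub> b n \<otimes>\<^bsub>C\<^esub> x n) \<in> carrier (linf C)" using x b by (intro UC.linf_closed)
  have "q = seq_class C (\<lambda>n. x n \<otimes>\<^bsub>C\<^esub> b n \<otimes>\<^bsub>C\<^esub> x n)"
    unfolding q_def UC.seq_class_eq_iff[OF sC xbx]
  proof (rule tendsto_eventually, rule eventually_mono[OF cut])
    fix n assume n: "y n \<otimes>\<^bsub>C\<^esub> (f n \<otimes>\<^bsub>C\<^esub> x n) = y n \<and> x n \<otimes>\<^bsub>C\<^esub> (f n \<otimes>\<^bsub>C\<^esub> y n) = y n"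
    note cc = UC.linf_app[OF x(1), of n] UC.linf_app[OF f, of n] y(1)[of n] v(2)[of n]
    have "x n \<otimes>\<^bsub>C\<^esub> b n \<otimes>\<^bsub>C\<^esub> x n = (x n \<otimes>\<^bsub>C\<^esub> (f n \<otimes>\<^bsub>C\<^esub> y n)) \<otimes>\<^bsub>C\<^esub> c n \<otimes>\<^bsub>C\<^esub> (y n \<otimes>\<^bsub>C\<^esub> (f n \<otimes>\<^bsub>C\<^esub> x n))"
      using cc by (simp add: b_def s_def v(4) C_assoc C_closed)
    then have "x n \<otimes>\<^bsub>C\<^esub> b n \<otimes>\<^bsub>C\<^esub> x n = s n" using n by (simp add: s_def v(4))
    then show "nrm C (s n \<ominus>\<^bsub>C\<^esub> x n \<otimes>\<^bsub>C\<^esub> b n \<otimes>\<^bsub>C\<^esub> x n) = 0"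
      using UC.linf_app[OF sC, of n] by (simp add: a_minus_def UC.R.r_neg UC.un)
  qed
  then have qh: "q \<in> hereditary_subalgebra (seq_alg C) z"
    using UC.seq_alg_hereditaryI[OF x(1) b] by (simp add: x(2))
  have "star (seq_alg C) (seq_class C v) \<otimes>\<^bsub>seq_alg C\<^esub> seq_class C v = seq_class C (\<lambda>n. \<one>\<^bsub>C\<^esub> \<ominus>\<^bsub>C\<^esub> base_incl (tower_sum (e n)))"
    using E.es(1) by (simp add: UC.seq_class_ops(4)[OF vl vl] UC.seq_class_ops(1)[OF sl vl] v(3) base_incl_ops(3) cl flip: base_incl_one)
  also have "\<dots> = \<one>\<^bsub>seq_alg C\<^esub> \<ominus>\<^bsub>seq_alg C\<^esub> E.gproj"
    unfolding E.gproj_def UC.seq_alg_one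
    by (rule UC.seq_class_minus[OF UC.linf_const E.base_incl_linf, symmetric]) (rule C_closed)
  finally have "mvn_equivalent (seq_alg C) (\<one>\<^bsub>seq_alg C\<^esub> \<ominus>\<^bsub>seq_alg C\<^esub> E.gproj) q"
    unfolding mvn_equivalent_def q_def s_def
    by (intro bexI[of _ "seq_class C v"] UC.seq_class_closed[OF vl])
      (simp add: UC.seq_class_ops(4)[OF vl vl] UC.seq_class_ops(1)[OF vl sl])
  moreover have "E.gproj \<noteq> \<zero>\<^bsub>seq_alg C\<^esub>"
    by (rule E.gproj_nonzero) (use e in \<open>simp add: good_tower_def\<close>)
  ultimately show ?thesis
    using E.gproj_projection E.gproj_central E.gproj_const(1) qp qh
    by (intro bexI[OF _ E.\<psi>_star_hom] bexI[of _ E.gproj] conjI bexI[of _ q] ballI) simp_all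
qed

end

theorem theorem3p7:
  fixes G :: "('g, 'k) monoid_scheme"
    and A :: "'a cstar"
    and \<alpha> :: "'g \<Rightarrow> 'a \<Rightarrow> 'a"
  assumes "group G" and "finite (carrier G)"
    and "cstar_algebra A" and "Group.monoid A"
    and "separable_cstar A" and "infinite_dimensional_cstar A"
    and "simple_cstar A" and "finite_cstar A"
    and "cstar_action G A \<alpha>"
    and "tracial_rokhlin_property G A \<alpha>"
  shows "tracially_sequentially_split
    (crossed_product G A \<alpha>)
    (crossed_product G (CG_tensor G A) (tensor_action G A \<alpha>))
    (crossed_hom G (unit_tensor G A))"
proof -
  interpret tracial_action G A \<alpha>
    using assms
    by (intro tracial_action.intro unital_action.intro tracial_action_axioms.intro unital_action_axioms.intro)
      (simp_all add: unital_cstar_def)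
  interpret TT: unital_action G "CG_tensor G A" "tensor_action G A \<alpha>" by (rule tensor_unital_action)
  have "Group.monoid C" using C_unital by (simp add: unital_cstar_def)
  then show ?thesis
    unfolding tracially_sequentially_split_def
    using C_cstar C_separable[OF assms(5)] TT.C_cstar TT.C_separable[OF tensor_separable[OF assms(5)]]
      crossed_hom_star_hom tracial_splitting[OF assms(5)]
    by (intro conjI ballI impI) assumption+
qed

end
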